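(* Let $T\in\mathcal{K}(V)$ be bisectorial of angle $\omega\in(0,\frac{\pi}{2})$, let $\theta\in(\omega,\frac{\pi}{2})$, $g\in\mathcal{N}^{\mathrm{reg}}(D_\theta)$ and $f\in\mathcal{SH}_L^{\mathrm{reg}}(D_\theta)$. Then, with the $H^\infty$-functional calculus of $T$, the product rule $$(gf)(T)\supseteq g(T)f(T)$$ holds, and the domains of both sides are connected by $$\operatorname{dom}(g(T)f(T))=\operatorname{dom}((gf)(T))\cap\operatorname{dom}(f(T)).$$
   Context: Clifford setting. Fix an integer $n\geq 1$. $\mathbb{R}_n$ is the real Clifford algebra generated by $e_1,\dots,e_n$ with $e_i^2=-1$, $e_ie_j=-e_je_i$ ($i\neq j$), with basis $e_A=e_{i_1}\cdots e_{i_r}$ for $A=(i_1<\dots<i_r)$, $e_\emptyset=1$, and $|s|^2=\sum_As_A^2$ for $s=\sum_As_Ae_A$. Paravectors: $\mathbb{R}^{n+1}=\{s_0+s_1e_1+\dots+s_ne_n\}\subseteq\mathbb{R}_n$ with $\overline{s}=s_0-s_1e_1-\dots-s_ne_n$. $\mathbb{S}=\{s\in\mathbb{R}^{n+1}: s_0=0,|s|=1\}$ and $\mathbb{C}_J=\{x+Jy: x,y\in\mathbb{R}\}$ for $J\in\mathbb{S}$. $U\subseteq\mathbb{R}^{n+1}$ is axially symmetric if $x+Jy\in U$ ($x,y\in\mathbb{R}$, $J\in\mathbb{S}$) implies $x+Iy\in U$ for all $I\in\mathbb{S}$. Slice hyperholomorphic functions. For $U$ open and axially symmetric, $f:U\to\mathbb{R}_n$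 is left slice hyperholomorphic ($f\in\mathcal{SH}_L(U)$) if there are continuously differentiable $f_0,f_1:\{(x,y)\in\mathbb{R}^2: x+\mathbb{S}y\subseteq U\}\to\mathbb{R}_n$ with $f(x+Jy)=f_0(x,y)+Jf_1(x,y)$ for all $J\in\mathbb{S}$, $f_0(x,-y)=f_0(x,y)$, $f_1(x,-y)=-f_1(x,y)$, $\partial_xf_0=\partial_yf_1$, $\partial_yf_0=-\partial_xf_1$. If $f_0,f_1$ are real valued, $f$ is called intrinsic ($f\in\mathcal{N}(U)$). Operators. $V_\mathbb{R}$ is a real Banach space, $V=\{\sum_Av_A\otimes e_A: v_A\in V_\mathbb{R}\}$ the corresponding Clifford module with norm $\|v\|^2=\sum_A\|v_A\|^2$ and the natural left and right multiplications by $\mathbb{R}_n$. $\mathcal{B}(V)$: bounded everywhere defined right-linear operators; $\mathcal{K}(V)$: closed right-linear operators $T:\operatorname{dom}(T)\to V$ with right-linear domain $\operatorname{dom}(T)\subseteq V$. A Clifford number $a$ is identified with the operator $v\mapsto av$, so $(aT)v=a(Tv)$, $(Ta)v=T(av)$. For operators, $A\subseteq B$ means $\operatorname{dom}(A)\subseteq\operatorname{dom}(B)$ and $Av=Bv$ for $v\in\operatorname{dom}(A)$; products have their natural domains. For $s\in\mathbb{R}^{n+1}$, $Q_s[T]=T^2-2s_0T+|s|^2$ on $\operatorname{dom}(T^2)$; $\rho_S(T)=\{s\in\mathbb{R}^{n+1}: Q_s[T]^{-1}\in\mathcal{B}(V)\}$, $\sigma_S(T)=\mathbb{R}^{n+1}\setminus\rho_S(T)$,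 and $S_L^{-1}(s,T)=Q_s[T]^{-1}\overline{s}-TQ_s[T]^{-1}$ for $s\in\rho_S(T)$. Bisectorial operators. For $\omega\in(0,\frac{\pi}{2})$, $I_\omega=(-\omega,\omega)\cup(\pi-\omega,\pi+\omega)$ and $D_\omega=\{re^{J\phi}: r>0,\,J\in\mathbb{S},\,\phi\in I_\omega\}\subseteq\mathbb{R}^{n+1}$. $T\in\mathcal{K}(V)$ is bisectorial of angle $\omega$ if $\sigma_S(T)\subseteq\overline{D_\omega}$ and for every $\varphi\in(\omega,\frac{\pi}{2})$ there is $C_\varphi\geq 0$ with $\|S_L^{-1}(s,T)\|\leq\frac{C_\varphi}{|s|}$ for all $s\in\mathbb{R}^{n+1}\setminus(D_\varphi\cup\{0\})$. $\omega$-functional calculus. $\mathcal{SH}_L^0(D_\theta)$ is the set of bounded $f\in\mathcal{SH}_L(D_\theta)$ with $\int_0^\infty|f(te^{J\phi})|\frac{dt}{t}<\infty$ for all $J\in\mathbb{S}$, $\phi\in I_\theta$; $\mathcal{N}^0(D_\theta)$ is the set of intrinsic such functions. For $T$ bisectorial of angle $\omega$, $\theta\in(\omega,\frac{\pi}{2})$ and $f\in\mathcal{SH}_L^0(D_\theta)$, $$f(T)=\frac{1}{2\pi}\int_{\partial D_\varphi\cap\mathbb{C}_J}S_L^{-1}(s,T)ds_Jf(s):=\frac{1}{2\pi}\sum_\pm\int_\mathbb{R}S_L^{-1}(\gamma_\pm(t),T)\frac{\gamma_\pm'(t)}{J}f(\gamma_\pm(t))dt\in\mathcal{B}(V),$$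 with $\gamma_\pm(t)=\pm|t|e^{-\operatorname{sgn}(t)J\varphi}$; it does not depend on the choice of $\varphi\in(\omega,\theta)$ and $J\in\mathbb{S}$. Extended $\omega$-functional calculus. $\mathcal{SH}_L^{\mathrm{bnd}}(D_\theta)$ is the set of functions $f(s)=f_\infty+\frac{1}{1+s^2}(f_0-f_\infty)+\widetilde{f}(s)$ on $D_\theta$ with $f_0,f_\infty\in\mathbb{R}_n$, $\widetilde{f}\in\mathcal{SH}_L^0(D_\theta)$ (unique components); $\mathcal{N}^{\mathrm{bnd}}(D_\theta)$ is the analogous set with $f_0,f_\infty\in\mathbb{R}$, $\widetilde{f}\in\mathcal{N}^0(D_\theta)$. For such $f$, $f(T):=f_\infty+(1+T^2)^{-1}(f_0-f_\infty)+\widetilde{f}(T)\in\mathcal{B}(V)$; here $1+T^2$ is boundedly invertible since $\mathbb{S}\subseteq\rho_S(T)$. $H^\infty$-functional calculus. $\mathcal{SH}_L^{\mathrm{reg}}(D_\theta)$ is the set of $f\in\mathcal{SH}_L(D_\theta)$ for which there exists $e\in\mathcal{N}^{\mathrm{bnd}}(D_\theta)$ (a regularizer of $f$) such that $ef\in\mathcal{SH}_L^{\mathrm{bnd}}(D_\theta)$ and $e(T)$ is injective; $\mathcal{N}^{\mathrm{reg}}(D_\theta)$ is the set of $g\in\mathcal{N}(D_\theta)$ for which there exists $e\in\mathcal{N}^{\mathrm{bnd}}(D_\theta)$ with $eg\in\mathcal{N}^{\mathrm{bnd}}(D_\theta)$ and $e(T)$ injective. For such $f$, $f(T):=e(T)^{-1}(ef)(T)$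 with its natural domain $\operatorname{dom}(f(T))=\{v\in V: (ef)(T)v\in\operatorname{ran}(e(T))\}$; this is independent of the regularizer $e$. $(gf)(T)$ denotes the $H^\infty$-functional calculus applied to the pointwise product $gf$, which is again in $\mathcal{SH}_L^{\mathrm{reg}}(D_\theta)$. *)

theory Defs
  imports "HOL-Analysis.Analysis"
begin

section \<open>The Clifford algebra and Clifford modules\<close>

text \<open>
  The generators of the Clifford algebra are indexed by a nonempty finite linearly ordered
  type \<^typ>\<open>'n\<close>, so that n is the cardinality of that type and the basis elements \<open>e\<^sub>A\<close> are indexed
  by \<^typ>\<open>'n set\<close>. The vector space structure and the norm are those of the library type
  of finite vectors (Euclidean norm of the coefficients).
  The componentwise operations \<open>*\<close> and \<open>1\<close> of that type are \<^emph>\<open>not\<close> those of the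
  Clifford algebra and are never used below.

  Likewise, for a real Banach space \<^typ>\<open>'v\<close>, the family \<open>(v\<^sub>A)\<^sub>A\<close> stands for the sum of the
  \<open>v\<^sub>A \<otimes> e\<^sub>A\<close>; the library norm is again the square root of the sum of the squares of the norms
  of the \<open>v\<^sub>A\<close>.
\<close>

type_synonym 'n clifford = "(real, 'n set) vec"
type_synonym ('v, 'n) cmodule = "('v, 'n set) vec"

definition cl_basis :: "'n::{finite,linorder} set \<Rightarrow> 'n clifford" where
  "cl_basis A = axis A 1"

definition cl_of_real :: "real \<Rightarrow> 'n::{finite,linorder} clifford" where
  "cl_of_real x = x *\<^sub>R cl_basis {}"

text \<open>
  The sign in \<open>e\<^sub>A e\<^sub>B = \<plusminus> e\<^bsub>sym_diff A B\<^esub>\<close>: one factor -1 for every transposition of \<open>e\<^sub>i\<close> and \<open>e\<^sub>j\<close>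
  with \<open>j < i\<close>, and one for every square \<open>e\<^sub>i e\<^sub>i = -1\<close>.
\<close>

definition cl_sign :: "'n::{finite,linorder} set \<Rightarrow> 'n set \<Rightarrow> real" where
  "cl_sign A B = (\<Prod>i\<in>A. \<Prod>j\<in>B. if j \<le> i then -1 else 1)"

text \<open>
  Left and right multiplication of a module element by a Clifford number. The Clifford product
  is the special case where the module is the algebra itself, that is, \<^typ>\<open>'v\<close> is \<^typ>\<open>real\<close>.
\<close>

definition cl_mult ::
    "'n::{finite,linorder} clifford \<Rightarrow> ('v::real_vector, 'n) cmodule \<Rightarrow> ('v, 'n) cmodule"
    (infixl "\<odot>" 70) where
  "a \<odot> v = (\<Sum>A\<in>UNIV. \<Sum>B\<in>UNIV. axis (sym_diff A B) ((cl_sign A B * a $ A) *\<^sub>R v $ B))"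

definition cl_rmult ::
    "('v::real_vector, 'n::{finite,linorder}) cmodule \<Rightarrow> 'n clifford \<Rightarrow> ('v, 'n) cmodule"
    (infixl "\<odot>\<^sub>r" 70) where
  "v \<odot>\<^sub>r a = (\<Sum>A\<in>UNIV. \<Sum>B\<in>UNIV. axis (sym_diff A B) ((cl_sign A B * a $ B) *\<^sub>R v $ A))"

text \<open>
  The following facts confirm that this is the Clifford algebra with \<open>e\<^sub>i\<^sup>2 = -1\<close> and
  \<open>e\<^sub>i e\<^sub>j = - e\<^sub>j e\<^sub>i\<close>, that \<^const>\<open>cl_basis\<close> \<open>A\<close> is the ordered product of the generators in \<open>A\<close>, and that
  the module is a bimodule.
\<close>

lemma prod_sym_diff:
  fixes f :: "'a \<Rightarrow> real"
  assumes "finite A" "finite B" "\<And>x. f x * f x = 1"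
  shows "prod f (sym_diff A B) = prod f A * prod f B"
proof -
  have A: "prod f A = prod f (A - B) * prod f (A \<inter> B)"
    using prod.Int_Diff[OF assms(1), of f B] by (simp add: mult.commute)
  have B: "prod f B = prod f (B - A) * prod f (A \<inter> B)"
    using prod.Int_Diff[OF assms(2), of f A] by (simp add: mult.commute Int_commute)
  have "prod f (A \<inter> B) * prod f (A \<inter> B) = 1"
    using assms(3) by (simp add: prod.distrib[symmetric])
  then have "prod f A * prod f B = prod f (A - B) * prod f (B - A)"
    unfolding A B by (simp add: algebra_simps)
  also have "\<dots> = prod f (sym_diff A B)"
    by (rule prod.union_disjoint[symmetric]) (use assms in auto)
  finally show ?thesis by simp
qed

lemma cl_sign_sym_diff:
  fixes A B C :: "'n::{finite,linorder} set"
  shows "cl_sign (sym_diff A B) C = cl_sign A C * cl_sign B C"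
    and "cl_sign C (sym_diff A B) = cl_sign C A * cl_sign C B"
proof -
  show "cl_sign (sym_diff A B) C = cl_sign A C * cl_sign B C"
    unfolding cl_sign_def
    by (rule prod_sym_diff) (auto simp: prod.distrib[symmetric] intro!: prod.neutral)
  show "cl_sign C (sym_diff A B) = cl_sign C A * cl_sign C B"
    unfolding cl_sign_def prod.distrib[symmetric]
    by (rule prod.cong[OF refl], rule prod_sym_diff) auto
qed

lemma cl_mult_nth:
  fixes a :: "'n::{finite,linorder} clifford"
  shows "(a \<odot> v) $ C = (\<Sum>A\<in>UNIV. (cl_sign A (sym_diff A C) * a $ A) *\<^sub>R v $ sym_diff A C)"
proof -
  have eq: "C = sym_diff A B \<longleftrightarrow> B = sym_diff A C" for A B :: "'n set"
    by auto
  show ?thesis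
    unfolding cl_mult_def by (simp add: axis_def eq)
qed

lemma cl_rmult_nth:
  fixes a :: "'n::{finite,linorder} clifford"
  shows "(v \<odot>\<^sub>r a) $ C = (\<Sum>B\<in>UNIV. (cl_sign (sym_diff B C) B * a $ B) *\<^sub>R v $ sym_diff B C)"
proof -
  have eq: "C = sym_diff A B \<longleftrightarrow> A = sym_diff B C" for A B :: "'n set"
    by auto
  show ?thesis
    unfolding cl_rmult_def by (subst sum.swap) (simp add: axis_def eq)
qed

lemma cl_rmult_eq_cl_mult: "(a \<odot>\<^sub>r b :: 'n::{finite,linorder} clifford) = a \<odot> b"
  unfolding cl_rmult_def cl_mult_def by (simp add: mult_ac)

lemma cl_mult_one:
  fixes v :: "('v::real_vector, 'n::{finite,linorder}) cmodule"
  shows "cl_of_real x \<odot> v = x *\<^sub>R v"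
proof -
  have "(cl_of_real x \<odot> v) $ C = (x *\<^sub>R v) $ C" for C
  proof -
    have "(cl_of_real x \<odot> v) $ C
        = (\<Sum>A\<in>(UNIV :: 'n set set). if A = {} then x *\<^sub>R v $ C else 0)"
      unfolding cl_mult_nth
      by (rule sum.cong[OF refl], rename_tac A, case_tac "A = {}")
        (simp_all add: cl_of_real_def cl_basis_def axis_def cl_sign_def)
    then show ?thesis by simp
  qed
  then show ?thesis by (simp add: vec_eq_iff)
qed

lemma cl_rmult_one:
  fixes v :: "('v::real_vector, 'n::{finite,linorder}) cmodule"
  shows "v \<odot>\<^sub>r cl_of_real x = x *\<^sub>R v"
proof -
  have "(v \<odot>\<^sub>r cl_of_real x) $ C = (x *\<^sub>R v) $ C" for C
  proof -
    have "(v \<odot>\<^sub>r cl_of_real x) $ C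
        = (\<Sum>A\<in>(UNIV :: 'n set set). if A = {} then x *\<^sub>R v $ C else 0)"
      unfolding cl_rmult_nth
      by (rule sum.cong[OF refl], rename_tac A, case_tac "A = {}")
        (simp_all add: cl_of_real_def cl_basis_def axis_def cl_sign_def)
    then show ?thesis by simp
  qed
  then show ?thesis by (simp add: vec_eq_iff)
qed

lemma bij_sym_diff: "bij (sym_diff A)"
  by (rule o_bij[of "sym_diff A"]) (auto simp: fun_eq_iff)

lemma cl_mult_assoc:
  fixes a b :: "'n::{finite,linorder} clifford"
  shows "(a \<odot> b) \<odot> v = a \<odot> (b \<odot> v)"
proof -
  have "((a \<odot> b) \<odot> v) $ D = (a \<odot> (b \<odot> v)) $ D" for D
  proof -
    let ?t = "\<lambda>A B. (cl_sign A B * cl_sign A (sym_diff (sym_diff A B) D)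
        * cl_sign B (sym_diff (sym_diff A B) D) * a $ A * b $ B) *\<^sub>R v $ sym_diff (sym_diff A B) D"
    have sd: "sym_diff A (sym_diff A C) = C" for A C :: "'n set" by auto
    have sd2: "sym_diff B (sym_diff A D) = sym_diff (sym_diff A B) D" for A B :: "'n set" by auto
    have sd3: "sym_diff A D = sym_diff B (sym_diff (sym_diff A B) D)" for A B :: "'n set" by auto
    have sgn: "cl_sign A (sym_diff A D) = cl_sign A B * cl_sign A (sym_diff (sym_diff A B) D)"
      for A B :: "'n set"
      using cl_sign_sym_diff(2)[of A B "sym_diff (sym_diff A B) D"]
      by (simp only: sd3[of A B, symmetric])
    have "((a \<odot> b) \<odot> v) $ D = (\<Sum>C\<in>UNIV. \<Sum>A\<in>UNIV. ?t A (sym_diff A C))"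
      unfolding cl_mult_nth[of "a \<odot> b" v]
      unfolding sd
      apply (rule sum.cong[OF refl])
      unfolding cl_mult_nth
      apply (simp only: sum_distrib_left scaleR_sum_left)
      apply (rule sum.cong[OF refl])
      subgoal for C A
        using cl_sign_sym_diff(1)[of A "sym_diff A C" "sym_diff C D"]
        unfolding sd by (simp add: mult_ac)
      done
    also have "\<dots> = (\<Sum>A\<in>UNIV. \<Sum>C\<in>UNIV. ?t A (sym_diff A C))"
      by (rule sum.swap)
    also have "\<dots> = (\<Sum>A\<in>UNIV. \<Sum>B\<in>UNIV. ?t A B)"
      by (rule sum.cong[OF refl])
        (rule sum.reindex_bij_betw[where g = "\<lambda>B. (cl_sign A B * cl_sign A (sym_diff (sym_diff A B) D)
        * cl_sign B (sym_diff (sym_diff A B) D) * a $ A * b $ B) *\<^sub>R v $ sym_diff (sym_diff A B) D" for A,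
          OF bij_sym_diff])
    also have "\<dots> = (a \<odot> (b \<odot> v)) $ D"
      unfolding cl_mult_nth[of a "b \<odot> v"] unfolding cl_mult_nth scaleR_sum_right
      apply (rule sum.cong[OF refl])
      apply (rule sum.cong[OF refl])
      subgoal for A B
        unfolding sd2 by (simp only: sgn[of A B] scaleR_scaleR mult_ac)
      done
    finally show ?thesis .
  qed
  then show ?thesis by (simp add: vec_eq_iff)
qed

lemma cl_basis_mult: "cl_basis A \<odot> cl_basis B = cl_sign A B *\<^sub>R cl_basis (sym_diff A B)"
proof -
  have "(cl_basis A \<odot> cl_basis B) $ C = (cl_sign A B *\<^sub>R cl_basis (sym_diff A B)) $ C" for C
  proof -
    have "(cl_basis A \<odot> cl_basis B) $ C
      = (\<Sum>A'\<in>UNIV. if A' = A then cl_sign A (sym_diff A C) * cl_basis B $ sym_diff A C else 0)"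
      unfolding cl_mult_nth
      by (rule sum.cong) (auto simp: cl_basis_def axis_def)
    also have "\<dots> = cl_sign A (sym_diff A C) * cl_basis B $ sym_diff A C" by simp
    also have "\<dots> = (cl_sign A B *\<^sub>R cl_basis (sym_diff A B)) $ C"
    proof (cases "C = sym_diff A B")
      case True
      then have "sym_diff A C = B" by auto
      with True show ?thesis by (simp add: cl_basis_def)
    next
      case False
      then have "sym_diff A C \<noteq> B" by auto
      with False show ?thesis by (auto simp: cl_basis_def axis_def)
    qed
    finally show ?thesis .
  qed
  then show ?thesis by (simp add: vec_eq_iff)
qed

lemma cl_generator_square: "cl_basis {i} \<odot> cl_basis {i} = cl_of_real (-1)"
  by (simp add: cl_basis_mult cl_sign_def cl_of_real_def)

lemma cl_generators_anticommute:
  "i \<noteq> j \<Longrightarrow> cl_basis {i} \<odot> cl_basis {j} = - (cl_basis {j} \<odot> cl_basis {i})"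
  by (auto simp: cl_basis_mult cl_sign_def Un_commute)

lemma cl_basis_ordered_product:
  assumes "\<forall>j\<in>A. i < j"
  shows "cl_basis (insert i A) = cl_basis {i} \<odot> cl_basis A"
proof -
  have "i \<notin> A" using assms by auto
  then have "sym_diff {i} A = insert i A" by auto
  moreover have "cl_sign {i} A = 1"
    unfolding cl_sign_def using assms by (auto intro!: prod.neutral)
  ultimately show ?thesis unfolding cl_basis_mult by simp
qed

text \<open>The paravectors and the sphere of imaginary units. Conjugation and inversion are only used
  for paravectors.\<close>

definition paravectors :: "'n::{finite,linorder} clifford set" where
  "paravectors = {s. \<forall>A. card A \<ge> 2 \<longrightarrow> s $ A = 0}"

definition para_conj :: "'n::{finite,linorder} clifford \<Rightarrow> 'n clifford" where
  "para_conj s = (\<chi> A. if A = {} then s $ A else - s $ A)"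

definition para_inverse :: "'n::{finite,linorder} clifford \<Rightarrow> 'n clifford" where
  "para_inverse s = (1 / (norm s)\<^sup>2) *\<^sub>R para_conj s"

definition imag_units :: "'n::{finite,linorder} clifford set" where
  "imag_units = {s \<in> paravectors. s $ {} = 0 \<and> norm s = 1}"

definition slice_point :: "'n::{finite,linorder} clifford \<Rightarrow> real \<Rightarrow> real \<Rightarrow> 'n clifford" where
  "slice_point J x y = cl_of_real x + y *\<^sub>R J"

definition slice_exp :: "'n::{finite,linorder} clifford \<Rightarrow> real \<Rightarrow> 'n clifford" where
  "slice_exp J \<phi> = slice_point J (cos \<phi>) (sin \<phi>)"


section \<open>Slice hyperholomorphic functions\<close>

text \<open>Functions on a set of paravectors are represented by total functions whose values outside
  the set are irrelevant.\<close>

definition slice_domain :: "'n::{finite,linorder} clifford set \<Rightarrow> (real \<times> real) set" where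
  "slice_domain U = {(x, y). \<forall>J\<in>imag_units. slice_point J x y \<in> U}"

definition has_continuous_partials ::
    "(real \<times> real \<Rightarrow> 'b::real_normed_vector) \<Rightarrow> (real \<times> real \<Rightarrow> 'b) \<Rightarrow> (real \<times> real \<Rightarrow> 'b)
      \<Rightarrow> (real \<times> real) set \<Rightarrow> bool" where
  "has_continuous_partials F Fx Fy \<Omega> \<longleftrightarrow>
     continuous_on \<Omega> Fx \<and> continuous_on \<Omega> Fy \<and>
     (\<forall>p\<in>\<Omega>. (F has_derivative (\<lambda>(h, k). h *\<^sub>R Fx p + k *\<^sub>R Fy p)) (at p))"

definition slice_components ::
    "'n::{finite,linorder} clifford set \<Rightarrow> ('n clifford \<Rightarrow> 'n clifford)
      \<Rightarrow> (real \<times> real \<Rightarrow> 'n clifford) \<Rightarrow> (real \<times> real \<Rightarrow> 'n clifford) \<Rightarrow> bool" where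
  "slice_components U f f\<^sub>0 f\<^sub>1 \<longleftrightarrow>
     (\<forall>(x, y)\<in>slice_domain U. \<forall>J\<in>imag_units. f (slice_point J x y) = f\<^sub>0 (x, y) + J \<odot> f\<^sub>1 (x, y)) \<and>
     (\<forall>(x, y)\<in>slice_domain U. f\<^sub>0 (x, -y) = f\<^sub>0 (x, y) \<and> f\<^sub>1 (x, -y) = - f\<^sub>1 (x, y)) \<and>
     (\<exists>f\<^sub>0x f\<^sub>0y f\<^sub>1x f\<^sub>1y.
        has_continuous_partials f\<^sub>0 f\<^sub>0x f\<^sub>0y (slice_domain U) \<and>
        has_continuous_partials f\<^sub>1 f\<^sub>1x f\<^sub>1y (slice_domain U) \<and>
        (\<forall>p\<in>slice_domain U. f\<^sub>0x p = f\<^sub>1y p \<and> f\<^sub>0y p = - f\<^sub>1x p))"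

definition SH_L :: "'n::{finite,linorder} clifford set \<Rightarrow> ('n clifford \<Rightarrow> 'n clifford) set" where
  "SH_L U = {f. \<exists>f\<^sub>0 f\<^sub>1. slice_components U f f\<^sub>0 f\<^sub>1}"

definition intrinsic :: "'n::{finite,linorder} clifford set \<Rightarrow> ('n clifford \<Rightarrow> 'n clifford) set" where
  "intrinsic U = {f. \<exists>f\<^sub>0 f\<^sub>1. slice_components U f f\<^sub>0 f\<^sub>1 \<and>
     (\<forall>p\<in>slice_domain U. f\<^sub>0 p \<in> range cl_of_real \<and> f\<^sub>1 p \<in> range cl_of_real)}"


section \<open>Operators\<close>

text \<open>
  An operator is a partial map of the module, with the library's \<^const>\<open>dom\<close>. The product with its
  natural domain is \<open>A \<circ>\<^sub>m B\<close>, and the inclusion of operators is \<open>A \<subseteq>\<^sub>m B\<close>.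
\<close>

type_synonym ('v, 'n) oper = "('v, 'n) cmodule \<rightharpoonup> ('v, 'n) cmodule"

definition op_of :: "'n::{finite,linorder} clifford \<Rightarrow> ('v::real_vector, 'n) oper" where
  "op_of a = (\<lambda>v. Some (a \<odot> v))"

definition op_add :: "('v::real_vector, 'n::finite) oper \<Rightarrow> ('v, 'n) oper \<Rightarrow> ('v, 'n) oper"
    (infixl "\<oplus>" 65) where
  "A \<oplus> B = (\<lambda>v. if v \<in> dom A \<inter> dom B then Some (the (A v) + the (B v)) else None)"

definition op_injective :: "('v, 'n::finite) oper \<Rightarrow> bool" where
  "op_injective A \<longleftrightarrow> inj_on A (dom A)"

text \<open>Only meaningful for injective operators.\<close>

definition op_inverse :: "('v, 'n::finite) oper \<Rightarrow> ('v, 'n) oper" where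
  "op_inverse A = (\<lambda>w. if w \<in> ran A then Some (THE v. A v = Some w) else None)"

definition right_linear :: "('v::real_vector, 'n::{finite,linorder}) oper \<Rightarrow> bool" where
  "right_linear T \<longleftrightarrow> 0 \<in> dom T \<and>
     (\<forall>v\<in>dom T. \<forall>w\<in>dom T. v + w \<in> dom T \<and> the (T (v + w)) = the (T v) + the (T w)) \<and>
     (\<forall>v\<in>dom T. \<forall>a. v \<odot>\<^sub>r a \<in> dom T \<and> the (T (v \<odot>\<^sub>r a)) = the (T v) \<odot>\<^sub>r a)"

definition bounded_ops :: "('v::banach, 'n::{finite,linorder}) oper set" where
  "bounded_ops = {A. right_linear A \<and> dom A = UNIV \<and> (\<exists>C. \<forall>v. norm (the (A v)) \<le> C * norm v)}"

definition closed_ops :: "('v::banach, 'n::{finite,linorder}) oper set" where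
  "closed_ops = {T. right_linear T \<and> closed (Map.graph T)}"

definition Q_op ::
    "'n::{finite,linorder} clifford \<Rightarrow> ('v::banach, 'n) oper \<Rightarrow> ('v, 'n) oper" where
  "Q_op s T = (T \<circ>\<^sub>m T) \<oplus> (op_of (cl_of_real (- 2 * s $ {})) \<circ>\<^sub>m T) \<oplus> op_of (cl_of_real ((norm s)\<^sup>2))"

definition S_resolvent_set :: "('v::banach, 'n::{finite,linorder}) oper \<Rightarrow> 'n clifford set" where
  "S_resolvent_set T =
     {s \<in> paravectors. op_injective (Q_op s T) \<and> op_inverse (Q_op s T) \<in> bounded_ops}"

definition S_spectrum :: "('v::banach, 'n::{finite,linorder}) oper \<Rightarrow> 'n clifford set" where
  "S_spectrum T = paravectors - S_resolvent_set T"

definition S_resolvent ::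
    "'n::{finite,linorder} clifford \<Rightarrow> ('v::banach, 'n) oper \<Rightarrow> ('v, 'n) oper" where
  "S_resolvent s T = (op_inverse (Q_op s T) \<circ>\<^sub>m op_of (para_conj s))
     \<oplus> (op_of (cl_of_real (-1)) \<circ>\<^sub>m (T \<circ>\<^sub>m op_inverse (Q_op s T)))"

definition angles :: "real \<Rightarrow> real set" where
  "angles \<omega> = {-\<omega><..<\<omega>} \<union> {pi - \<omega><..<pi + \<omega>}"

definition double_sector :: "real \<Rightarrow> 'n::{finite,linorder} clifford set" where
  "double_sector \<omega> = {r *\<^sub>R slice_exp J \<phi> | r J \<phi>. r > 0 \<and> J \<in> imag_units \<and> \<phi> \<in> angles \<omega>}"

text \<open>The norm estimate is spelled out for the vectors; the S-resolvent is everywhere defined at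
  the points in question, as they lie in the S-resolvent set.\<close>

definition bisectorial :: "real \<Rightarrow> ('v::banach, 'n::{finite,linorder}) oper \<Rightarrow> bool" where
  "bisectorial \<omega> T \<longleftrightarrow> T \<in> closed_ops \<and>
     S_spectrum T \<subseteq> closure (double_sector \<omega>) \<and>
     (\<forall>\<phi>\<in>{\<omega><..<pi/2}. \<exists>C\<ge>0. \<forall>s\<in>paravectors - (double_sector \<phi> \<union> {0}). \<forall>v.
        norm (the (S_resolvent s T v)) \<le> C / norm s * norm v)"


section \<open>The functional calculi\<close>

subsection \<open>The \<open>\<omega>\<close>-functional calculus\<close>

definition SH0 :: "real \<Rightarrow> ('n::{finite,linorder} clifford \<Rightarrow> 'n clifford) set" where
  "SH0 \<theta> = {f \<in> SH_L (double_sector \<theta>). bounded (f ` double_sector \<theta>) \<and>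
     (\<forall>J\<in>imag_units. \<forall>\<phi>\<in>angles \<theta>.
        (\<integral>\<^sup>+t\<in>{0<..}. ennreal (norm (f (t *\<^sub>R slice_exp J \<phi>)) / t) \<partial>lborel) < \<infinity>)}"

definition N0 :: "real \<Rightarrow> ('n::{finite,linorder} clifford \<Rightarrow> 'n clifford) set" where
  "N0 \<theta> = SH0 \<theta> \<inter> intrinsic (double_sector \<theta>)"

text \<open>The parameter \<open>\<epsilon>\<close> is the sign \<open>\<plusminus>\<close> of the path.\<close>

definition sector_path ::
    "real \<Rightarrow> real \<Rightarrow> 'n::{finite,linorder} clifford \<Rightarrow> real \<Rightarrow> 'n clifford" where
  "sector_path \<epsilon> \<phi> J t = (\<epsilon> * \<bar>t\<bar>) *\<^sub>R slice_exp J (- sgn t * \<phi>)"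

definition op_to_blinfun ::
    "('v::banach, 'n::{finite,linorder}) oper \<Rightarrow> ('v, 'n) cmodule \<Rightarrow>\<^sub>L ('v, 'n) cmodule" where
  "op_to_blinfun A = Blinfun (\<lambda>v. the (A v))"

text \<open>
  The integral is taken in the Banach space of bounded operators. It is the Henstock-Kurzweil
  integral, since the Bochner integral of the library is restricted to separable spaces. The
  integrand is only specified for \<open>t \<noteq> 0\<close>.
\<close>

definition sector_integral ::
    "real \<Rightarrow> 'n::{finite,linorder} clifford \<Rightarrow> ('v::banach, 'n) oper
      \<Rightarrow> ('n clifford \<Rightarrow> 'n clifford) \<Rightarrow> ('v, 'n) cmodule \<Rightarrow>\<^sub>L ('v, 'n) cmodule" where
  "sector_integral \<phi> J T f = (1 / (2 * pi)) *\<^sub>R (\<Sum>\<epsilon>\<in>{1, -1}.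
     integral UNIV (\<lambda>t. op_to_blinfun (S_resolvent (sector_path \<epsilon> \<phi> J t) T \<circ>\<^sub>m
       op_of (vector_derivative (sector_path \<epsilon> \<phi> J) (at t) \<odot> para_inverse J \<odot> f (sector_path \<epsilon> \<phi> J t)))))"

text \<open>The integral does not depend on \<open>\<phi>\<close> and \<open>J\<close>; some admissible pair is chosen.\<close>

definition omega_calculus ::
    "real \<Rightarrow> real \<Rightarrow> ('v::banach, 'n::{finite,linorder}) oper
      \<Rightarrow> ('n clifford \<Rightarrow> 'n clifford) \<Rightarrow> ('v, 'n) oper" where
  "omega_calculus \<omega> \<theta> T f =
     (let (\<phi>, J) = (SOME (\<phi>, J). \<phi> \<in> {\<omega><..<\<theta>} \<and> J \<in> imag_units)
      in (\<lambda>v. Some (blinfun_apply (sector_integral \<phi> J T f) v)))"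


subsection \<open>The extended \<open>\<omega>\<close>-functional calculus\<close>

definition bnd_decomposition ::
    "real \<Rightarrow> ('n::{finite,linorder} clifford \<Rightarrow> 'n clifford)
      \<Rightarrow> 'n clifford \<Rightarrow> 'n clifford \<Rightarrow> ('n clifford \<Rightarrow> 'n clifford) \<Rightarrow> bool" where
  "bnd_decomposition \<theta> f f\<^sub>0 f_inf h \<longleftrightarrow> (\<forall>s\<in>double_sector \<theta>.
     f s = f_inf + para_inverse (cl_of_real 1 + s \<odot> s) \<odot> (f\<^sub>0 - f_inf) + h s)"

definition SH_bnd :: "real \<Rightarrow> ('n::{finite,linorder} clifford \<Rightarrow> 'n clifford) set" where
  "SH_bnd \<theta> = {f. \<exists>f\<^sub>0 f_inf. \<exists>h\<in>SH0 \<theta>. bnd_decomposition \<theta> f f\<^sub>0 f_inf h}"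

definition N_bnd :: "real \<Rightarrow> ('n::{finite,linorder} clifford \<Rightarrow> 'n clifford) set" where
  "N_bnd \<theta> = {f. \<exists>f\<^sub>0\<in>range cl_of_real. \<exists>f_inf\<in>range cl_of_real. \<exists>h\<in>N0 \<theta>.
     bnd_decomposition \<theta> f f\<^sub>0 f_inf h}"

text \<open>The components are unique, the last one up to its values outside the double sector.\<close>

definition bnd_calculus ::
    "real \<Rightarrow> real \<Rightarrow> ('v::banach, 'n::{finite,linorder}) oper
      \<Rightarrow> ('n clifford \<Rightarrow> 'n clifford) \<Rightarrow> ('v, 'n) oper" where
  "bnd_calculus \<omega> \<theta> T f =
     (let (f\<^sub>0, f_inf, h) = (SOME (f\<^sub>0, f_inf, h). h \<in> SH0 \<theta> \<and> bnd_decomposition \<theta> f f\<^sub>0 f_inf h)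
      in op_of f_inf \<oplus> (op_inverse (op_of (cl_of_real 1) \<oplus> (T \<circ>\<^sub>m T)) \<circ>\<^sub>m op_of (f\<^sub>0 - f_inf))
           \<oplus> omega_calculus \<omega> \<theta> T h)"


subsection \<open>The \<open>H\<^sup>\<infinity>\<close>-functional calculus\<close>

definition regularizer ::
    "real \<Rightarrow> real \<Rightarrow> ('v::banach, 'n::{finite,linorder}) oper
      \<Rightarrow> ('n clifford \<Rightarrow> 'n clifford) \<Rightarrow> ('n clifford \<Rightarrow> 'n clifford) \<Rightarrow> bool" where
  "regularizer \<omega> \<theta> T e f \<longleftrightarrow>
     e \<in> N_bnd \<theta> \<and> (\<lambda>s. e s \<odot> f s) \<in> SH_bnd \<theta> \<and> op_injective (bnd_calculus \<omega> \<theta> T e)"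

definition SH_reg ::
    "real \<Rightarrow> real \<Rightarrow> ('v::banach, 'n::{finite,linorder}) oper \<Rightarrow> ('n clifford \<Rightarrow> 'n clifford) set" where
  "SH_reg \<omega> \<theta> T = {f \<in> SH_L (double_sector \<theta>). \<exists>e. regularizer \<omega> \<theta> T e f}"

definition N_reg ::
    "real \<Rightarrow> real \<Rightarrow> ('v::banach, 'n::{finite,linorder}) oper \<Rightarrow> ('n clifford \<Rightarrow> 'n clifford) set" where
  "N_reg \<omega> \<theta> T = {g \<in> intrinsic (double_sector \<theta>).
     \<exists>e\<in>N_bnd \<theta>. (\<lambda>s. e s \<odot> g s) \<in> N_bnd \<theta> \<and> op_injective (bnd_calculus \<omega> \<theta> T e)}"

text \<open>The result does not depend on the regularizer.\<close>

definition H_calculus ::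
    "real \<Rightarrow> real \<Rightarrow> ('v::banach, 'n::{finite,linorder}) oper
      \<Rightarrow> ('n clifford \<Rightarrow> 'n clifford) \<Rightarrow> ('v, 'n) oper" where
  "H_calculus \<omega> \<theta> T f =
     (let e = (SOME e. regularizer \<omega> \<theta> T e f)
      in op_inverse (bnd_calculus \<omega> \<theta> T e) \<circ>\<^sub>m bnd_calculus \<omega> \<theta> T (\<lambda>s. e s \<odot> f s))"

end

(*
Right multiplication by a generator J commutes with every right linear operator and makes the
module a complex Banach space. On it the S-resolvents of T combine to
  R(z) v = Q_z[T]^{-1} (v conj(z)) - T Q_z[T]^{-1} v,
which satisfies the classical resolvent identity outside the double sector. Writing a slice
hyperholomorphic function as f = sum_A f_A e_A with intrinsic f_A, and f_A as a holomorphic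
function F_A of one complex variable with F_A(conj z) = conj F_A(z), one gets
  f(T) v = sum_A Phi(F_A) (e_A v),   Phi(F) = 1/(2 pi i) int F(z) R(z) dz.
So Phi is a classical Riesz-Dunford calculus, and the resolvent identity, Fubini and Cauchy's
formula give Phi(F G) = Phi(F) Phi(G). With Phi(z/(1+z^2)) = T(1+T^2)^{-1} this extends to
(e f)(T) = e(T) f(T) for e in N^bnd and f in SH_L^bnd. If d and e regularize g and f, then d e
regularizes g f, since the values of intrinsic functions commute; for v in dom f(T) and
w = f(T) v this gives (d e g f)(T) v = e(T) (d g)(T) w and (d e)(T) y = e(T) d(T) y, and the
injectivity of e(T) shows that (g f)(T) v = y if and only if g(T) w = y.
*)

theory Submission
  imports Defs "HOL-Complex_Analysis.Complex_Analysis"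
begin


text \<open>Two obstacles shape the proof. Left multiplication by Clifford numbers does not commute
  with T, so the integral that defines f(T) is not a complex one: its integrand acts from the left
  by elements of C_J, whereas Phi uses a right multiplication. The two agree only after pairing z
  with cnj z. The operators Q_z[T]^{-1} and T Q_z[T]^{-1} are the same at both points and the
  coefficients are conjugate, so only twice their real parts survive, and real numbers act alike on
  both sides. Moreover, decay means integrability of |F| / |z| along each single ray, without
  uniformity in the angle and without prescribed limits at 0 and infinity. Arcs are therefore not
  estimated one by one; suitable radii are found by averaging over intervals [a, 2a] with respect to
  dr / r. The link between Phi and (1+T^2)^{-1} is z q, through q^2 = q - (z q)^2; this identity
  also closes the extended class under products.\<close>

section \<open>Henstock-Kurzweil integrals over the half line with values in a Banach space\<close>

text \<open>Riemann sums of \<open>f\<close> and \<open>F n\<close> differ by at most the Riemann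
  sum of \<open>G n\<close>, which is close to a small integral. So the Cauchy criterion passes from
  \<open>F n\<close> to \<open>f\<close>. Only norms of Riemann sums enter, which is why any Banach
  space is allowed.\<close>

lemma integrable_approx:
  fixes f :: "real \<Rightarrow> 'a::banach" and F :: "nat \<Rightarrow> real \<Rightarrow> 'a" and G :: "nat \<Rightarrow> real \<Rightarrow> real"
  assumes F: "\<And>n. F n integrable_on UNIV" and G: "\<And>n. G n integrable_on UNIV"
    and le: "\<And>n x. norm (f x - F n x) \<le> G n x"
    and lim: "(\<lambda>n. integral UNIV (G n)) \<longlonglongrightarrow> 0"
  shows "f integrable_on UNIV" and "(\<lambda>n. integral UNIV (F n)) \<longlonglongrightarrow> integral UNIV f"
proof -
  have G0: "0 \<le> G n x" for n x using le[of x n] norm_ge_zero order_trans by blast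
  have small: "\<exists>n. integral UNIV (G n) < e" if "e > 0" for e
    using order_tendstoD(2)[OF lim that] by (auto simp: eventually_sequentially)
  have Fb: "F n integrable_on cbox a b" and Gb: "G n integrable_on cbox a b" for n a b
    using F G integrable_on_subcbox by blast+
  have Gle: "integral (cbox a b) (G n) \<le> integral UNIV (G n)" for n a b
    by (rule integral_subset_le) (use Gb G G0 in auto)
  have box: "f integrable_on cbox a b" for a b
    unfolding integrable_Cauchy
  proof (intro allI impI)
    fix e :: real assume "e > 0"
    \<comment> \<open>The bound \<open>e / 6\<close> is spent three times: on the integral of
      \<open>G n\<close>, on its Riemann sum and on that of \<open>F n\<close>. Together they bring
      every fine Riemann sum of \<open>f\<close> within \<open>e / 2\<close> of the integral of
      \<open>F n\<close>, hence two of them within \<open>e\<close> of each other.\<close>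
    then obtain n where n: "integral UNIV (G n) < e / 6" using small[of "e/6"] by auto
    obtain \<gamma>1 where g1: "gauge \<gamma>1" and p1: "\<And>p. p tagged_division_of cbox a b \<Longrightarrow> \<gamma>1 fine p \<Longrightarrow>
        norm ((\<Sum>(x, k)\<in>p. measure lborel k *\<^sub>R F n x) - integral (cbox a b) (F n)) < e / 6"
      using integrable_integral[OF Fb[of n a b]] \<open>e > 0\<close> unfolding has_integral
      by (meson divide_pos_pos zero_less_numeral)
    obtain \<gamma>2 where g2: "gauge \<gamma>2" and p2: "\<And>p. p tagged_division_of cbox a b \<Longrightarrow> \<gamma>2 fine p \<Longrightarrow>
        norm ((\<Sum>(x, k)\<in>p. measure lborel k *\<^sub>R G n x) - integral (cbox a b) (G n)) < e / 6"
      using integrable_integral[OF Gb[of n a b]] \<open>e > 0\<close> unfolding has_integral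
      by (meson divide_pos_pos zero_less_numeral)
    define \<gamma> where "\<gamma> x = \<gamma>1 x \<inter> \<gamma>2 x" for x
    have "gauge \<gamma>" unfolding \<gamma>_def using g1 g2 by (rule gauge_Int)
    moreover have near: "norm ((\<Sum>(x, k)\<in>p. measure lborel k *\<^sub>R f x) - integral (cbox a b) (F n)) < e / 2"
      if p: "p tagged_division_of cbox a b" "\<gamma> fine p" for p
    proof -
      have f12: "\<gamma>1 fine p" "\<gamma>2 fine p" using p(2) unfolding \<gamma>_def fine_def by auto
      have "norm ((\<Sum>(x, k)\<in>p. measure lborel k *\<^sub>R f x) - (\<Sum>(x, k)\<in>p. measure lborel k *\<^sub>R F n x))
          = norm (\<Sum>(x, k)\<in>p. measure lborel k *\<^sub>R (f x - F n x))"
        by (simp add: sum_subtractf[symmetric] scaleR_diff_right case_prod_beta)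
      also have "\<dots> \<le> (\<Sum>(x, k)\<in>p. measure lborel k *\<^sub>R G n x)"
        by (rule sum_norm_le) (auto simp: le mult_left_mono)
      also have "\<dots> < e / 6 + integral (cbox a b) (G n)"
        using p2[OF p(1) f12(2)] unfolding real_norm_def abs_less_iff by linarith
      also have "\<dots> \<le> e / 6 + e / 6" using Gle[of a b n] n by simp
      finally show ?thesis
        using p1[OF p(1) f12(1)] norm_triangle_lt[of "(\<Sum>(x, k)\<in>p. measure lborel k *\<^sub>R f x) - (\<Sum>(x, k)\<in>p. measure lborel k *\<^sub>R F n x)" "(\<Sum>(x, k)\<in>p. measure lborel k *\<^sub>R F n x) - integral (cbox a b) (F n)" "e/2"]
        by simp
    qed
    ultimately show "\<exists>\<gamma>. gauge \<gamma> \<and> (\<forall>\<D>1 \<D>2. \<D>1 tagged_division_of cbox a b \<and> \<gamma> fine \<D>1 \<and>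
        \<D>2 tagged_division_of cbox a b \<and> \<gamma> fine \<D>2 \<longrightarrow>
        norm ((\<Sum>(x, K)\<in>\<D>1. measure lborel K *\<^sub>R f x) - (\<Sum>(x, K)\<in>\<D>2. measure lborel K *\<^sub>R f x)) < e)"
      
      by (intro exI[of _ \<gamma>] conjI allI impI; (elim conjE)?) (assumption, rule norm_triangle_half_l, auto)
  qed
  have close: "norm (integral (cbox a b) f - integral (cbox a b) (F n)) \<le> integral UNIV (G n)" for a b n
  proof -
    have "norm (integral (cbox a b) (\<lambda>x. f x - F n x)) \<le> integral (cbox a b) (G n)"
      by (rule Henstock_Kurzweil_Integration.integral_norm_bound_integral)
        (use box Fb Gb le in \<open>auto intro!: integrable_diff\<close>)
    then show ?thesis using Gle[of a b n] integral_diff[OF box[of a b] Fb[of n a b]] by simp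
  qed
  show int: "f integrable_on UNIV"
    unfolding integrable_alt[of f UNIV]
  proof (intro conjI allI impI)
    fix e :: real assume "e > 0"
    then obtain n where n: "integral UNIV (G n) < e / 3" using small[of "e/3"] by auto
    obtain B where B: "B > 0" "\<And>a b c d. ball 0 B \<subseteq> cbox a b \<Longrightarrow> ball 0 B \<subseteq> cbox c d \<Longrightarrow>
       norm (integral (cbox a b) (F n) - integral (cbox c d) (F n)) < e / 3"
      using integrable_altD(2)[OF F[of n], of "e / 3"] \<open>e > 0\<close> by auto
    have "norm (integral (cbox a b) f - integral (cbox c d) f) < e"
      if "ball 0 B \<subseteq> cbox a b" "ball 0 B \<subseteq> cbox c d" for a b c d
    proof -
      have "norm (x - y) \<le> norm (x - x') + norm (x' - y') + norm (y - y')" for x y x' y' :: 'a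
        using norm_triangle_ineq4[of "x - x' + (x' - y')" "y - y'"] norm_triangle_ineq[of "x - x'" "x' - y'"]
        by (simp add: algebra_simps)
      from this[of "integral (cbox a b) f" "integral (cbox c d) f" "integral (cbox a b) (F n)" "integral (cbox c d) (F n)"]
      show ?thesis using B(2)[OF that] close[of a b n] close[of c d n] n by linarith
    qed
    then show "\<exists>B>0. \<forall>a b c d. ball 0 B \<subseteq> cbox a b \<and> ball 0 B \<subseteq> cbox c d \<longrightarrow>
        norm (integral (cbox a b) (\<lambda>x. if x \<in> UNIV then f x else 0)
          - integral (cbox c d) (\<lambda>x. if x \<in> UNIV then f x else 0)) < e"
      using B(1) by auto
  qed (use box in simp)
  have "norm (integral UNIV f - integral UNIV (F n)) \<le> integral UNIV (G n)" for n
  proof -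
    have "norm (integral UNIV (\<lambda>x. f x - F n x)) \<le> integral UNIV (G n)"
      by (rule Henstock_Kurzweil_Integration.integral_norm_bound_integral)
        (use int F G le in \<open>auto intro!: integrable_diff\<close>)
    then show ?thesis by (simp add: integral_diff int F)
  qed
  then have "(\<lambda>n. integral UNIV f - integral UNIV (F n)) \<longlonglongrightarrow> 0"
    using tendsto_norm_zero_cancel[OF tendsto_sandwich[OF _ _ tendsto_const lim]] 
    by (simp add: Lim_null_comparison[OF _ lim])
  then show "(\<lambda>n. integral UNIV (F n)) \<longlonglongrightarrow> integral UNIV f"
    using tendsto_diff[OF tendsto_const[of "integral UNIV f"]] by fastforce
qed

text \<open>Compact pieces of the open half line: the integrals along rays are improper at 0 as well
  as at infinity.\<close>

definition exhaust :: "nat \<Rightarrow> real set" where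
  "exhaust n = {1 / real (Suc n)..real (Suc n)}"

lemma exhaust_subset: "exhaust n \<subseteq> {0<..}"
  by (auto simp: exhaust_def intro: less_le_trans[of 0 "1 / real (Suc n)"])

lemma eventually_in_exhaust:
  assumes "x > 0" shows "\<forall>\<^sub>F n in sequentially. x \<in> exhaust n"
proof -
  have "\<forall>\<^sub>F n in sequentially. x \<le> real (Suc n)" "\<forall>\<^sub>F n in sequentially. 1 / x \<le> real (Suc n)"
    by real_asymp+
  then show ?thesis
  proof eventually_elim
    case (elim n)
    then show ?case using assms by (simp add: exhaust_def field_simps)
  qed
qed

text \<open>These tails are the majorants \<open>G n\<close> with which
  \<open>integrable_approx\<close> is used.\<close>

lemma exhaust_tail:
  fixes g :: "real \<Rightarrow> real"
  assumes g: "g integrable_on {0<..}" and g0: "\<And>x. x > 0 \<Longrightarrow> 0 \<le> g x"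
  shows "(\<lambda>x. if x \<in> exhaust n then g x else 0) integrable_on {0<..}"
    and "(\<lambda>n. integral {0<..} (\<lambda>x. g x - (if x \<in> exhaust n then g x else 0))) \<longlonglongrightarrow> 0"
proof -
  have sub: "g integrable_on exhaust n" for n
    using g exhaust_subset[of n] unfolding exhaust_def by (rule integrable_on_subinterval)
  show i: "(\<lambda>x. if x \<in> exhaust n then g x else 0) integrable_on {0<..}" for n
    using sub[of n] exhaust_subset[of n]
    by (subst integrable_restrict_Int[of "exhaust n"]) (simp add: Int_absorb1 Int_absorb2)
  have d: "(\<lambda>x. g x - (if x \<in> exhaust n then g x else 0)) integrable_on {0<..}" for n
    by (intro integrable_diff g i)
  have l: "(\<lambda>n. g x - (if x \<in> exhaust n then g x else 0)) \<longlonglongrightarrow> 0" if "x \<in> {0<..}" for x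
    using that by (intro tendsto_eventually eventually_mono[OF eventually_in_exhaust[of x]]) auto
  have "norm (g x - (if x \<in> exhaust n then g x else 0)) \<le> g x" if "x \<in> {0<..}" for n x
    using that g0 by auto
  then have "(\<lambda>n. integral {0<..} (\<lambda>x. g x - (if x \<in> exhaust n then g x else 0))) \<longlonglongrightarrow> integral {0<..} (\<lambda>x. 0 :: real)"
    using dominated_convergence(2)[OF d g _ l] by simp
  then show "(\<lambda>n. integral {0<..} (\<lambda>x. g x - (if x \<in> exhaust n then g x else 0))) \<longlonglongrightarrow> 0"
    by simp
qed

lemma integrable_approx_exhaust:
  fixes f :: "real \<Rightarrow> 'a::banach" and F :: "nat \<Rightarrow> real \<Rightarrow> 'a" and G :: "nat \<Rightarrow> real \<Rightarrow> real"
  assumes F: "\<And>n. F n integrable_on exhaust n" and G: "\<And>n. G n integrable_on {0<..}"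
    and le: "\<And>n x. x > 0 \<Longrightarrow> norm (f x - (if x \<in> exhaust n then F n x else 0)) \<le> G n x"
    and lim: "(\<lambda>n. integral {0<..} (G n)) \<longlonglongrightarrow> 0"
  shows "f integrable_on {0<..}" and "(\<lambda>n. integral (exhaust n) (F n)) \<longlonglongrightarrow> integral {0<..} f"
proof -
  let ?f = "\<lambda>x. if x \<in> {0<..} then f x else 0"
  let ?F = "\<lambda>n x. if x \<in> exhaust n then F n x else 0"
  let ?G = "\<lambda>n x. if x \<in> {0<..} then G n x else 0"
  have 1: "?F n integrable_on UNIV" for n using F integrable_restrict_UNIV by blast
  have 2: "?G n integrable_on UNIV" for n using G integrable_restrict_UNIV by blast
  have 3: "norm (?f x - ?F n x) \<le> ?G n x" for n x
    using le[of x n] exhaust_subset[of n] by auto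
  have 4: "(\<lambda>n. integral UNIV (?G n)) \<longlonglongrightarrow> 0"
    using lim by (simp only: Henstock_Kurzweil_Integration.integral_restrict_UNIV)
  from integrable_approx[where f = ?f and F = ?F and G = ?G, OF 1 2 3 4]
  show "f integrable_on {0<..}" "(\<lambda>n. integral (exhaust n) (F n)) \<longlonglongrightarrow> integral {0<..} f"
    by (simp_all only: integrable_restrict_UNIV Henstock_Kurzweil_Integration.integral_restrict_UNIV)
qed

text \<open>Continuity gives integrability on each compact piece, and the tail of \<open>g\<close>
  controls the rest.\<close>

lemma dominated_integrable_Ioi:
  fixes f :: "real \<Rightarrow> 'a::banach"
  assumes f: "continuous_on {0<..} f" and g: "g integrable_on {0<..}"
    and le: "\<And>x. x > 0 \<Longrightarrow> norm (f x) \<le> g x"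
  shows "f integrable_on {0<..}" and "(\<lambda>n. integral (exhaust n) f) \<longlonglongrightarrow> integral {0<..} f"
proof -
  have g0: "0 \<le> g x" if "x > 0" for x using le[OF that] norm_ge_zero order_trans by blast
  have F: "f integrable_on exhaust n" for n
    unfolding exhaust_def
    by (rule integrable_continuous_interval, rule continuous_on_subset[OF f])
      (use exhaust_subset[of n] in \<open>simp add: exhaust_def\<close>)
  have G: "(\<lambda>x. g x - (if x \<in> exhaust n then g x else 0)) integrable_on {0<..}" for n
    by (intro integrable_diff g exhaust_tail(1) g0)
  have "norm (f x - (if x \<in> exhaust n then f x else 0)) \<le> g x - (if x \<in> exhaust n then g x else 0)"
    if "x > 0" for x n
    using le that by auto
  from integrable_approx_exhaust[where F = "\<lambda>_. f", OF F G this exhaust_tail(2)[OF g g0]]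
  show "f integrable_on {0<..}" "(\<lambda>n. integral (exhaust n) f) \<longlonglongrightarrow> integral {0<..} f"
    by auto
qed

lemma norm_integral_le_Ioi:
  fixes f :: "real \<Rightarrow> 'a::banach"
  assumes f: "continuous_on {0<..} f" and g: "g integrable_on {0<..}"
    and le: "\<And>x. x > 0 \<Longrightarrow> norm (f x) \<le> g x"
  shows "norm (integral {0<..} f) \<le> integral {0<..} g"
  by (rule Henstock_Kurzweil_Integration.integral_norm_bound_integral)
    (use dominated_integrable_Ioi(1)[OF f g le] g le in auto)

text \<open>Reduces an improper iterated integral to squares \<open>exhaust n\<close> times
  \<open>exhaust n\<close>, where the order of integration may be exchanged for a continuous
  integrand. The product majorant keeps the truncation errors in the two variables apart.\<close>

lemma iterated_integral_Ioi:
  fixes f :: "real \<Rightarrow> real \<Rightarrow> 'a::banach"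
  assumes f: "continuous_on ({0<..} \<times> {0<..}) (\<lambda>(r, s). f r s)"
    and a: "a integrable_on {0<..}" and b: "b integrable_on {0<..}"
    and a0: "\<And>r. r > 0 \<Longrightarrow> 0 \<le> a r" and b0: "\<And>r. r > 0 \<Longrightarrow> 0 \<le> b r"
    and le: "\<And>r s. r > 0 \<Longrightarrow> s > 0 \<Longrightarrow> norm (f r s) \<le> a r * b s"
  shows "(\<lambda>r. integral {0<..} (f r)) integrable_on {0<..}"
    and "(\<lambda>n. integral (exhaust n) (\<lambda>r. integral (exhaust n) (f r))) \<longlonglongrightarrow> integral {0<..} (\<lambda>r. integral {0<..} (f r))"
proof -
  have fr: "continuous_on {0<..} (f r)" if "r > 0" for r
  proof -
    have "continuous_on {0<..} (\<lambda>s. (r, s))" by (intro continuous_intros)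
    from continuous_on_compose2[OF f this] that show ?thesis by auto
  qed
  let ?b = "\<lambda>n x. b x - (if x \<in> exhaust n then b x else 0)"
  define B where "B = integral {0<..} b"
  define \<beta> where "\<beta> n = integral {0<..} (?b n)" for n
  have bi: "?b n integrable_on {0<..}" for n
    by (intro integrable_diff b exhaust_tail(1) b0)
  have B0: "0 \<le> B" unfolding B_def by (rule integral_nonneg[OF b]) (use b0 in auto)
  have \<beta>0: "0 \<le> \<beta> n" for n unfolding \<beta>_def by (rule integral_nonneg[OF bi]) (use b0 in auto)
  have \<beta>: "\<beta> \<longlonglongrightarrow> 0" unfolding \<beta>_def by (rule exhaust_tail(2)[OF b b0])
  have frint: "f r integrable_on {0<..}" if "r > 0" for r
    by (rule dominated_integrable_Ioi(1)[OF fr[OF that] integrable_on_cmult_left[OF b, of "a r"]])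
      (use le that in auto)
  have bound: "norm (integral {0<..} (f r)) \<le> a r * B" if "r > 0" for r
    unfolding B_def
    using norm_integral_le_Ioi[OF fr[OF that] integrable_on_cmult_left[OF b, of "a r"]] le that
    by simp
  have diff: "norm (integral {0<..} (f r) - integral (exhaust n) (f r)) \<le> a r * \<beta> n" if "r > 0" for r n
  proof -
    have i: "f r integrable_on exhaust n"
      using frint[OF that] exhaust_subset[of n] unfolding exhaust_def by (rule integrable_on_subinterval)
    have j: "(\<lambda>s. if s \<in> exhaust n then f r s else 0) integrable_on {0<..}"
      using i exhaust_subset[of n]
      by (subst integrable_restrict_Int[of "exhaust n"]) (simp add: Int_absorb1 Int_absorb2)
    have e: "integral (exhaust n) (f r) = integral {0<..} (\<lambda>s. if s \<in> exhaust n then f r s else 0)"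
      using exhaust_subset[of n]
      by (subst integral_restrict_Int[of _ "exhaust n"]) (simp add: Int_absorb1 Int_absorb2)
    have "norm (integral {0<..} (\<lambda>s. f r s - (if s \<in> exhaust n then f r s else 0)))
        \<le> integral {0<..} (\<lambda>s. a r * ?b n s)"
      by (rule Henstock_Kurzweil_Integration.integral_norm_bound_integral)
        (use integrable_diff[OF frint[OF that] j] integrable_on_cmult_left[OF bi, of "a r"] le that in auto)
    then show ?thesis
      unfolding e \<beta>_def by (simp add: integral_diff frint[OF that] j)
  qed
  have cont: "continuous_on (exhaust n) (\<lambda>r. integral (exhaust n) (f r))" for n
    unfolding exhaust_def box_real(2)[symmetric]
    apply (rule integral_continuous_on_param)
    apply (rule continuous_on_subset[OF f])
    using exhaust_subset[of n] by (auto simp: exhaust_def)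
  have F: "(\<lambda>r. integral (exhaust n) (f r)) integrable_on exhaust n" for n
    using cont[of n] unfolding exhaust_def by (rule integrable_continuous_interval)
  \<comment> \<open>The first summand takes care of \<open>r\<close> outside
    \<open>exhaust n\<close>, where the inner integral is at most \<open>a r * B\<close>. The second
    is the cost of truncating the inner integral when \<open>r\<close> is inside.\<close>
  let ?G = "\<lambda>n r. (a r - (if r \<in> exhaust n then a r else 0)) * B + a r * \<beta> n"
  have G: "?G n integrable_on {0<..}" for n
    by (intro integrable_add integrable_on_mult_left integrable_diff a exhaust_tail(1) a0)
  have "integral {0<..} (?G n) = integral {0<..} (\<lambda>r. a r - (if r \<in> exhaust n then a r else 0)) * B
      + integral {0<..} a * \<beta> n" for n
    by (subst integral_add)
     (auto intro!: integrable_on_mult_left integrable_diff a exhaust_tail(1) a0)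
  then have lim: "(\<lambda>n. integral {0<..} (?G n)) \<longlonglongrightarrow> 0"
    using tendsto_add[OF tendsto_mult_left_zero[OF exhaust_tail(2)[OF a a0], of B]
       tendsto_mult_right_zero[OF \<beta>, of "integral {0<..} a"]] by simp
  have le': "norm (integral {0<..} (f r) - (if r \<in> exhaust n then integral (exhaust n) (f r) else 0)) \<le> ?G n r"
    if "r > 0" for r n
    using diff[OF that, of n] bound[OF that] a0[OF that] \<beta>0[of n] by (auto intro: add_increasing2)
  from integrable_approx_exhaust[where F = "\<lambda>n r. integral (exhaust n) (f r)", OF F G le' lim]
  show "(\<lambda>r. integral {0<..} (f r)) integrable_on {0<..}"
    and "(\<lambda>n. integral (exhaust n) (\<lambda>r. integral (exhaust n) (f r))) \<longlonglongrightarrow> integral {0<..} (\<lambda>r. integral {0<..} (f r))"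
    by auto
qed

lemma integral_swap_Ioi:
  fixes f :: "real \<Rightarrow> real \<Rightarrow> 'a::banach"
  assumes f: "continuous_on ({0<..} \<times> {0<..}) (\<lambda>(r, s). f r s)"
    and a: "a integrable_on {0<..}" and b: "b integrable_on {0<..}"
    and a0: "\<And>r. r > 0 \<Longrightarrow> 0 \<le> a r" and b0: "\<And>r. r > 0 \<Longrightarrow> 0 \<le> b r"
    and le: "\<And>r s. r > 0 \<Longrightarrow> s > 0 \<Longrightarrow> norm (f r s) \<le> a r * b s"
  shows "integral {0<..} (\<lambda>r. integral {0<..} (f r)) = integral {0<..} (\<lambda>s. integral {0<..} (\<lambda>r. f r s))"
proof -
  have f': "continuous_on ({0<..} \<times> {0<..}) (\<lambda>(s, r). f r s)"
  proof -
    have c: "continuous_on ({0<..} \<times> {0<..}) (\<lambda>x. (snd x, fst x) :: real \<times> real)"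
      by (intro continuous_intros)
    have "(\<lambda>x. (snd x, fst x)) ` ({0<..} \<times> {0<..}) \<subseteq> {0<..} \<times> {0 :: real <..}"
      by auto
    from continuous_on_compose2[OF f c this] show ?thesis by (simp add: case_prod_beta)
  qed
  have le': "norm (f r s) \<le> b s * a r" if "s > 0" "r > 0" for r s
    using le[OF that(2,1)] by (simp add: mult.commute)
  have eq: "integral (exhaust n) (\<lambda>r. integral (exhaust n) (f r))
      = integral (exhaust n) (\<lambda>s. integral (exhaust n) (\<lambda>r. f r s))" for n
    unfolding exhaust_def box_real(2)[symmetric]
    apply (rule integral_swap_continuous)
    apply (rule continuous_on_subset[OF f])
    using exhaust_subset[of n] by (auto simp: exhaust_def)
  show ?thesis
    using LIMSEQ_unique[OF iterated_integral_Ioi(2)[OF f a b a0 b0 le, unfolded eq]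
      iterated_integral_Ioi(2)[OF f' b a b0 a0 le']] .
qed


section \<open>Complex structures on Banach spaces and the rotation of integration rays\<close>

text \<open>Up to their endpoints both intervals lie outside \<open>exhaust n\<close>, so the tails
  of the convergent integral bound them. Their length with respect to \<open>dr / r\<close> is
  always \<open>ln 2\<close>, which makes averages over them useful.\<close>

lemma dyadic_tendsto_0:
  fixes g :: "real \<Rightarrow> real"
  assumes g: "g integrable_on {0<..}" and g0: "\<And>x. x > 0 \<Longrightarrow> 0 \<le> g x"
  shows "(\<lambda>n. integral {real (Suc n)..2 * real (Suc n)} g) \<longlonglongrightarrow> 0"
    and "(\<lambda>n. integral {1 / (2 * real (Suc n))..1 / real (Suc n)} g) \<longlonglongrightarrow> 0"
proof -
  let ?t = "\<lambda>n x. g x - (if x \<in> exhaust n then g x else 0)"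
  have ti: "?t n integrable_on {0<..}" for n by (intro integrable_diff g exhaust_tail(1) g0)
  have t0: "0 \<le> ?t n x" if "x > 0" for n x using g0[OF that] by auto
  have le: "0 \<le> integral {a..b} g \<and> integral {a..b} g \<le> integral {0<..} (?t n)"
    if ab: "0 < a" "{a<..<b} \<inter> exhaust n = {}" for a b n
  proof -
    have i: "g integrable_on {a..b}" "?t n integrable_on {a..b}"
      using ab(1) by (auto intro: integrable_on_subinterval[OF g] integrable_on_subinterval[OF ti])
    have "integral {a..b} g = integral {a..b} (?t n)"
      by (rule integral_spike[of "{a, b}"]) (use ab in \<open>auto simp: disjoint_iff\<close>)
    also have "\<dots> \<le> integral {0<..} (?t n)"
      by (rule integral_subset_le) (use i ti t0 ab in auto)
    finally show ?thesis using integral_nonneg[OF i(1)] g0 ab(1) by auto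
  qed
  have d1: "{real (Suc n)<..<2 * real (Suc n)} \<inter> exhaust n = {}"
    and d2: "{1 / (2 * real (Suc n))<..<1 / real (Suc n)} \<inter> exhaust n = {}" for n
    by (auto simp: exhaust_def)
  show "(\<lambda>n. integral {real (Suc n)..2 * real (Suc n)} g) \<longlonglongrightarrow> 0"
    by (rule tendsto_sandwich[OF _ _ tendsto_const exhaust_tail(2)[OF g g0]])
      (use le[OF _ d1] in \<open>auto simp del: of_nat_Suc\<close>)
  show "(\<lambda>n. integral {1 / (2 * real (Suc n))..1 / real (Suc n)} g) \<longlonglongrightarrow> 0"
    by (rule tendsto_sandwich[OF _ _ tendsto_const exhaust_tail(2)[OF g g0]])
      (use le[OF _ d2] in \<open>auto simp del: of_nat_Suc\<close>)
qed

lemma integral_inverse_dyadic: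
  fixes a :: real assumes "a > 0"
  shows "((\<lambda>r. 1 / r) has_integral ln 2) {a..2 * a}"
proof -
  have "((\<lambda>r. 1 / r) has_integral (ln (2 * a) - ln a)) {a..2 * a}"
    by (rule fundamental_theorem_of_calculus)
      (use assms in \<open>auto intro!: derivative_eq_intros simp: has_real_derivative_iff_has_vector_derivative[symmetric]\<close>)
  then show ?thesis using assms by (simp add: ln_mult)
qed

text \<open>The complex scalars act through an explicit operation, so that the theory covers both
  the complex numbers and a Clifford module with right multiplication by a generator. The norm is
  homogeneous for real scalars only; for complex ones it is merely bounded, hence the constants
  \<open>K\<close> in the estimates.\<close>

locale complex_action =
  fixes cs :: "complex \<Rightarrow> 'a::banach \<Rightarrow> 'a" (infixr "\<cdot>" 75)
  assumes bilinear: "bounded_bilinear cs"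
    and cs_assoc: "(a * b) \<cdot> v = a \<cdot> b \<cdot> v"
    and cs_one [simp]: "1 \<cdot> v = v"
begin

sublocale bounded_bilinear cs by (rule bilinear)

lemma cs_of_real [simp]: "complex_of_real x \<cdot> v = x *\<^sub>R v"
  using scaleR_left[of x 1 v] by (simp add: scaleR_conv_of_real)

lemma cs_commute: "a \<cdot> b \<cdot> v = b \<cdot> a \<cdot> v"
  by (metis cs_assoc mult.commute)

lemma norm_cs: "\<exists>K>0. \<forall>c v. norm (c \<cdot> v) \<le> norm c * norm v * K"
  using pos_bounded by blast

text \<open>Contour integral over the half line from 0 in direction \<open>d\<close>; the outer
  factor \<open>d\<close> is dz/dr.\<close>

definition ray :: "complex \<Rightarrow> (complex \<Rightarrow> 'a) \<Rightarrow> 'a" where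
  "ray d G = d \<cdot> integral {0<..} (\<lambda>r. G (of_real r * d))"

definition wedge :: "real \<Rightarrow> real \<Rightarrow> complex set" where
  "wedge \<alpha> \<beta> = {of_real r * cis t | r t. r > 0 \<and> t \<in> {\<alpha>..\<beta>}}"

text \<open>Cauchy's theorem for an unbounded sector. In polar coordinates the form G dz is closed,
  so the difference of the two truncated ray integrals is the difference of two arc integrals.
  Boundedness of \<open>norm z * norm (G z)\<close> only keeps the arc integrals bounded; the radii
  along which they vanish have to be selected.\<close>

theorem ray_rotate:
  assumes "\<alpha> \<le> \<beta>"
    and der: "\<And>z. z \<in> wedge \<alpha> \<beta> \<Longrightarrow> (G has_derivative (\<lambda>h. h \<cdot> G' z)) (at z)"
    and cont: "continuous_on (wedge \<alpha> \<beta>) G'"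
    and int: "\<And>t. t \<in> {\<alpha>..\<beta>} \<Longrightarrow> (\<lambda>r. norm (G (of_real r * cis t))) integrable_on {0<..}"
    and bdd: "\<And>z. z \<in> wedge \<alpha> \<beta> \<Longrightarrow> norm z * norm (G z) \<le> M"
  shows "ray (cis \<alpha>) G = ray (cis \<beta>) G"
proof -
  obtain K where K: "K > 0" "\<And>c v. norm (c \<cdot> v) \<le> norm c * norm v * K" using norm_cs by blast
  have inW [simp, intro]: "of_real r * cis t \<in> wedge \<alpha> \<beta>" if "r > 0" "t \<in> {\<alpha>..\<beta>}" for r t
    using that unfolding wedge_def by blast
  have contG: "continuous_on (wedge \<alpha> \<beta>) G"
    using der has_derivative_continuous_on by (meson has_derivative_at_withinI)
  have cpol: "continuous_on ({0<..} \<times> {\<alpha>..\<beta>}) (\<lambda>p. H (of_real (fst p) * cis (snd p)))"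
    if "continuous_on (wedge \<alpha> \<beta>) H" for H :: "complex \<Rightarrow> 'a"
    by (rule continuous_on_compose2[OF that]) (auto intro!: continuous_intros)
  \<comment> \<open>\<open>N\<close> is the common value of the derivative of
    \<open>cis t \<cdot> G\<close> in \<open>t\<close> and of
    \<open>(\<i> r cis t) \<cdot> G\<close> in \<open>r\<close>. That both equal \<open>N\<close>,
    as shown in \<open>dt\<close> and \<open>dG\<close>, is the closedness of G dz.\<close>
  define N where "N r t = (\<i> * cis t) \<cdot> G (of_real r * cis t) + (\<i> * of_real r * cis t * cis t) \<cdot> G' (of_real r * cis t)" for r t
  have Ncont: "continuous_on ({0<..} \<times> {\<alpha>..\<beta>}) (\<lambda>p. N (fst p) (snd p))"
    unfolding N_def
    by (intro continuous_on_add continuous_on cpol contG cont continuous_intros)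
  \<comment> \<open>The contour integral over the arc of radius \<open>r\<close>, with dz = i r cis
    t dt.\<close>
  define S where "S r = integral {\<alpha>..\<beta>} (\<lambda>t. (\<i> * of_real r * cis t) \<cdot> G (of_real r * cis t))" for r
  have dG: "((\<lambda>r. (\<i> * of_real r * cis t) \<cdot> G (of_real r * cis t)) has_vector_derivative N r t) (at r)"
    if "r > 0" "t \<in> {\<alpha>..\<beta>}" for r t
  proof -
    have "((\<lambda>r. of_real r * cis t) has_derivative (\<lambda>h. of_real h * cis t)) (at r)"
      by (auto intro!: derivative_eq_intros)
    from has_derivative_compose[OF this der[OF inW[OF that]]]
    have 1: "((\<lambda>r. G (of_real r * cis t)) has_derivative (\<lambda>h. (of_real h * cis t) \<cdot> G' (of_real r * cis t))) (at r)" .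
    have 2: "((\<lambda>r. \<i> * of_real r * cis t) has_derivative (\<lambda>h. \<i> * of_real h * cis t)) (at r)"
      by (auto intro!: derivative_eq_intros)
    have "(\<lambda>h. (\<i> * of_real r * cis t) \<cdot> (of_real h * cis t) \<cdot> G' (of_real r * cis t)
        + (\<i> * of_real h * cis t) \<cdot> G (of_real r * cis t)) = (\<lambda>h. h *\<^sub>R N r t)"
      by (simp add: fun_eq_iff N_def scaleR_add_right cs_assoc[symmetric] scaleR_left[symmetric] scaleR_conv_of_real mult_ac)
    then show ?thesis
      using FDERIV[OF 2 1] unfolding has_vector_derivative_def by simp
  qed
  have dt: "((\<lambda>t. cis t \<cdot> G (of_real r * cis t)) has_vector_derivative N r t) (at t)"
    if "r > 0" "t \<in> {\<alpha>..\<beta>}" for r t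
  proof -
    have c: "(cis has_derivative (\<lambda>h. of_real h * (\<i> * cis t))) (at t)"
      by (auto intro!: derivative_eq_intros simp: fun_eq_iff scaleR_conv_of_real)
    have "((\<lambda>t. of_real r * cis t) has_derivative (\<lambda>h. of_real r * (of_real h * (\<i> * cis t)))) (at t)"
      by (rule has_derivative_mult_right[OF c])
    from has_derivative_compose[OF this der[OF inW[OF that]]]
    have 1: "((\<lambda>t. G (of_real r * cis t)) has_derivative
       (\<lambda>h. (of_real r * (of_real h * (\<i> * cis t))) \<cdot> G' (of_real r * cis t))) (at t)" .
    have "(\<lambda>h. cis t \<cdot> (of_real r * (of_real h * (\<i> * cis t))) \<cdot> G' (of_real r * cis t)
        + (of_real h * (\<i> * cis t)) \<cdot> G (of_real r * cis t)) = (\<lambda>h. h *\<^sub>R N r t)"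
      by (simp add: fun_eq_iff N_def scaleR_add_right cs_assoc[symmetric] scaleR_left[symmetric] scaleR_conv_of_real mult_ac)
    then show ?thesis
      using FDERIV[OF c 1] unfolding has_vector_derivative_def by simp
  qed
  have green: "integral {a..b} (\<lambda>r. cis \<beta> \<cdot> G (of_real r * cis \<beta>)) - integral {a..b} (\<lambda>r. cis \<alpha> \<cdot> G (of_real r * cis \<alpha>)) = S b - S a"
    if ab: "0 < a" "a \<le> b" for a b
  proof -
    have cr: "continuous_on {a..b} (\<lambda>r. cis t \<cdot> G (of_real r * cis t))" if "t \<in> {\<alpha>..\<beta>}" for t
      using that ab(1) by (intro continuous_on continuous_intros continuous_on_compose2[OF contG]) auto
    have ct: "continuous_on {\<alpha>..\<beta>} (\<lambda>t. (\<i> * of_real r * cis t) \<cdot> G (of_real r * cis t))" if "r > 0" for r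
      using that by (intro continuous_on continuous_intros continuous_on_compose2[OF contG]) auto
    have "integral {a..b} (\<lambda>r. cis \<beta> \<cdot> G (of_real r * cis \<beta>)) - integral {a..b} (\<lambda>r. cis \<alpha> \<cdot> G (of_real r * cis \<alpha>))
        = integral {a..b} (\<lambda>r. cis \<beta> \<cdot> G (of_real r * cis \<beta>) - cis \<alpha> \<cdot> G (of_real r * cis \<alpha>))"
      by (rule integral_diff[symmetric]) (use assms(1) in \<open>auto intro!: integrable_continuous_interval cr\<close>)
    also have "\<dots> = integral {a..b} (\<lambda>r. integral {\<alpha>..\<beta>} (N r))"
    proof (rule integral_cong)
      fix r assume "r \<in> {a..b}"
      then show "cis \<beta> \<cdot> G (of_real r * cis \<beta>) - cis \<alpha> \<cdot> G (of_real r * cis \<alpha>) = integral {\<alpha>..\<beta>} (N r)"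
        using ab(1) assms(1)
        by (intro integral_unique[symmetric] fundamental_theorem_of_calculus[OF assms(1)]
              has_vector_derivative_at_within[OF dt]) auto
    qed
    also have "\<dots> = integral {\<alpha>..\<beta>} (\<lambda>t. integral {a..b} (\<lambda>r. N r t))"
    proof -
      have "continuous_on (cbox (a, \<alpha>) (b, \<beta>)) (\<lambda>(r, t). N r t)"
        unfolding case_prod_beta
        by (rule continuous_on_subset[OF Ncont]) (use ab(1) in \<open>auto simp: cbox_Pair_eq\<close>)
      from integral_swap_continuous[OF this] show ?thesis by simp
    qed
    also have "\<dots> = integral {\<alpha>..\<beta>} (\<lambda>t. (\<i> * of_real b * cis t) \<cdot> G (of_real b * cis t) - (\<i> * of_real a * cis t) \<cdot> G (of_real a * cis t))"
      using ab by (intro integral_cong integral_unique fundamental_theorem_of_calculus[OF ab(2)]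
              has_vector_derivative_at_within[OF dG]) auto
    also have "\<dots> = S b - S a"
      unfolding S_def using ab
      by (intro integral_diff integrable_continuous_interval ct) auto
    finally show ?thesis .
  qed
  have Sbound: "norm (S r) \<le> K * integral {\<alpha>..\<beta>} (\<lambda>t. r * norm (G (of_real r * cis t)))" if "r > 0" for r
  proof -
    have c: "continuous_on {\<alpha>..\<beta>} (\<lambda>t. G (of_real r * cis t))"
      using that by (intro continuous_intros continuous_on_compose2[OF contG]) auto
    have "norm (S r) \<le> integral {\<alpha>..\<beta>} (\<lambda>t. K * (r * norm (G (of_real r * cis t))))"
      unfolding S_def
    proof (rule Henstock_Kurzweil_Integration.integral_norm_bound_integral)
      show "norm ((\<i> * of_real r * cis t) \<cdot> G (of_real r * cis t)) \<le> K * (r * norm (G (of_real r * cis t)))" for t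
        using K(2)[of "\<i> * of_real r * cis t" "G (of_real r * cis t)"] that
        by (simp add: norm_mult mult_ac)
    qed (intro integrable_continuous_interval continuous_on continuous_intros c)+
    then show ?thesis by simp
  qed
  define I where "I t = integral {0<..} (\<lambda>r. cis t \<cdot> G (of_real r * cis t))" for t
  have conv: "(\<lambda>r. norm (G (of_real r * cis t))) integrable_on {0<..}"
    "continuous_on {0<..} (\<lambda>r. cis t \<cdot> G (of_real r * cis t))" if "t \<in> {\<alpha>..\<beta>}" for t
    using int[OF that] that
    by (auto intro!: continuous_on continuous_intros continuous_on_compose2[OF contG])
  have nb: "norm (cis t \<cdot> G (of_real r * cis t)) \<le> norm (G (of_real r * cis t)) * K" for r t
    using K(2)[of "cis t" "G (of_real r * cis t)"] by simp
  have Ilim: "(\<lambda>n. integral {a n..b n} (\<lambda>r. cis t \<cdot> G (of_real r * cis t))) \<longlonglongrightarrow> 0"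
    if t: "t \<in> {\<alpha>..\<beta>}" and "\<And>n. 0 < a n"
      and lim: "(\<lambda>n. integral {a n..b n} (\<lambda>r. norm (G (of_real r * cis t)))) \<longlonglongrightarrow> 0" for t and a b :: "nat \<Rightarrow> real"
  proof (rule Lim_null_comparison)
    show "\<forall>\<^sub>F n in sequentially. norm (integral {a n..b n} (\<lambda>r. cis t \<cdot> G (of_real r * cis t)))
       \<le> integral {a n..b n} (\<lambda>r. norm (G (of_real r * cis t))) * K"
    proof (intro always_eventually allI)
      fix n
      have sub: "{a n..b n} \<subseteq> {0<..}" using that(2)[of n] by auto
      have "norm (integral {a n..b n} (\<lambda>r. cis t \<cdot> G (of_real r * cis t)))
         \<le> integral {a n..b n} (\<lambda>r. norm (G (of_real r * cis t)) * K)"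
        by (intro Henstock_Kurzweil_Integration.integral_norm_bound_integral nb
            integrable_continuous_interval continuous_on_subset[OF conv(2)[OF t] sub]
            integrable_on_mult_left integrable_on_subinterval[OF conv(1)[OF t] sub])
      then show "norm (integral {a n..b n} (\<lambda>r. cis t \<cdot> G (of_real r * cis t)))
         \<le> integral {a n..b n} (\<lambda>r. norm (G (of_real r * cis t))) * K" by simp
    qed
    show "(\<lambda>n. integral {a n..b n} (\<lambda>r. norm (G (of_real r * cis t))) * K) \<longlonglongrightarrow> 0"
      by (rule tendsto_mult_left_zero[OF lim])
  qed
  text \<open>The vertical sides need not tend to 0 pointwise, but their logarithmic averages over
    dyadic intervals do, by dominated convergence in the angle.\<close>
  have average: "\<exists>x. (\<forall>n. x n \<in> {a n..2 * a n}) \<and> (\<lambda>n. S (x n)) \<longlonglongrightarrow> 0"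
    if a0: "\<And>n. 0 < a n" and lim: "\<And>t. t \<in> {\<alpha>..\<beta>} \<Longrightarrow>
        (\<lambda>n. integral {a n..2 * a n} (\<lambda>r. norm (G (of_real r * cis t)))) \<longlonglongrightarrow> 0" for a :: "nat \<Rightarrow> real"
  proof -
    define V where "V r = integral {\<alpha>..\<beta>} (\<lambda>t. r * norm (G (of_real r * cis t)))" for r
    define W where "W n = integral {\<alpha>..\<beta>} (\<lambda>t. integral {a n..2 * a n} (\<lambda>r. norm (G (of_real r * cis t))))" for n
    have cpn: "continuous_on ({a n..2 * a n} \<times> {\<alpha>..\<beta>}) (\<lambda>p. norm (G (of_real (fst p) * cis (snd p))))" for n
      by (rule continuous_on_subset[OF continuous_on_norm[OF cpol[OF contG]]])
        (use a0[of n] in \<open>auto intro: less_le_trans\<close>)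
    have cW: "continuous_on {\<alpha>..\<beta>} (\<lambda>t. integral {a n..2 * a n} (\<lambda>r. norm (G (of_real r * cis t))))" for n
    proof -
      have c: "continuous_on ({\<alpha>..\<beta>} \<times> {a n..2 * a n}) (\<lambda>p. (snd p, fst p) :: real \<times> real)"
        by (intro continuous_intros)
      have "(\<lambda>p. (snd p, fst p)) ` ({\<alpha>..\<beta>} \<times> {a n..2 * a n}) \<subseteq> {a n..2 * a n} \<times> {\<alpha>..\<beta>}" by auto
      from continuous_on_compose2[OF cpn c this]
      have "continuous_on ({\<alpha>..\<beta>} \<times> cbox (a n) (2 * a n)) (\<lambda>(t, r). norm (G (of_real r * cis t)))"
        by (simp add: case_prod_beta)
      from integral_continuous_on_param[OF this] show ?thesis by simp
    qed
    have W0: "W \<longlonglongrightarrow> 0"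
    proof -
      have b: "norm (integral {a n..2 * a n} (\<lambda>r. norm (G (of_real r * cis t)))) \<le> \<bar>M\<bar> * ln 2"
        if t: "t \<in> {\<alpha>..\<beta>}" for n t
      proof -
        have i: "(\<lambda>r. norm (G (of_real r * cis t))) integrable_on {a n..2 * a n}"
          using int[OF t] by (rule integrable_on_subinterval) (use a0[of n] in auto)
        have "norm (integral {a n..2 * a n} (\<lambda>r. norm (G (of_real r * cis t)))) \<le> integral {a n..2 * a n} (\<lambda>r. \<bar>M\<bar> * (1 / r))"
        proof (rule Henstock_Kurzweil_Integration.integral_norm_bound_integral[OF i])
          show "(\<lambda>r. \<bar>M\<bar> * (1 / r)) integrable_on {a n..2 * a n}"
            using integrable_on_cmult_left[OF has_integral_integrable[OF integral_inverse_dyadic[OF a0[of n]]], of "\<bar>M\<bar>"]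
            by simp
          fix r assume "r \<in> {a n..2 * a n}"
          then have r: "r > 0" using a0[of n] by auto
          have "r * norm (G (of_real r * cis t)) \<le> \<bar>M\<bar>"
            using bdd[OF inW[OF r t]] r by (simp add: norm_mult)
          then show "norm (norm (G (of_real r * cis t))) \<le> \<bar>M\<bar> * (1 / r)"
            using r by (simp add: field_simps)
        qed
        also have "\<dots> = \<bar>M\<bar> * ln 2"
          by (rule integral_unique[OF has_integral_mult_right[OF integral_inverse_dyadic[OF a0[of n]]]])
        finally show ?thesis .
      qed
      have "(\<lambda>n. integral {\<alpha>..\<beta>} (\<lambda>t. integral {a n..2 * a n} (\<lambda>r. norm (G (of_real r * cis t))))) \<longlonglongrightarrow> integral {\<alpha>..\<beta>} (\<lambda>t. 0 :: real)"
        by (rule dominated_convergence(2)[OF integrable_continuous_interval[OF cW] integrable_const_ivl[of "\<bar>M\<bar> * ln 2"]])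
            (use b lim in auto)
      then show ?thesis by (simp add: W_def[abs_def])
    qed
    have cV: "continuous_on {a n..2 * a n} V" for n
    proof -
      have "continuous_on ({a n..2 * a n} \<times> cbox \<alpha> \<beta>) (\<lambda>(r, t). r * norm (G (of_real r * cis t)))"
        using continuous_on_mult[OF continuous_on_fst[OF continuous_on_id] cpn[of n]] by (simp add: case_prod_beta)
      from integral_continuous_on_param[OF this] show ?thesis by (simp add: V_def[abs_def])
    qed
    have WV: "W n = integral {a n..2 * a n} (\<lambda>r. V r * (1 / r))" for n
    proof -
      have "continuous_on (cbox (a n, \<alpha>) (2 * a n, \<beta>)) (\<lambda>(r, t). norm (G (of_real r * cis t)))"
        using cpn[of n] by (simp add: case_prod_beta cbox_Pair_eq)
      from integral_swap_continuous[OF this]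
      have "W n = integral {a n..2 * a n} (\<lambda>r. integral {\<alpha>..\<beta>} (\<lambda>t. norm (G (of_real r * cis t))))"
        by (simp add: W_def)
      also have "\<dots> = integral {a n..2 * a n} (\<lambda>r. V r * (1 / r))"
        using a0[of n] by (intro integral_cong) (auto simp: V_def)
      finally show ?thesis .
    qed
    \<comment> \<open>\<open>W n\<close> is the integral of \<open>V\<close> against
      \<open>dr / r\<close>, a measure of total mass \<open>ln 2\<close> on the block, so
      \<open>V\<close> cannot exceed \<open>W n / ln 2\<close> at every radius.\<close>
    have "\<exists>x\<in>{a n..2 * a n}. V x * ln 2 \<le> W n" for n
    proof (rule ccontr)
      assume "\<not> ?thesis"
      then have gt: "V x > W n / ln 2" if "x \<in> {a n..2 * a n}" for x
        using that by (force simp: field_simps not_le)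
      obtain x where x: "x \<in> {a n..2 * a n}" "\<And>y. y \<in> {a n..2 * a n} \<Longrightarrow> V x \<le> V y"
        using continuous_attains_inf[OF compact_Icc _ cV[of n]] a0[of n] by auto
      have "V x * ln 2 = integral {a n..2 * a n} (\<lambda>r. V x * (1 / r))"
        by (rule integral_unique[OF has_integral_mult_right[OF integral_inverse_dyadic[OF a0[of n]]], symmetric])
      also have "\<dots> \<le> integral {a n..2 * a n} (\<lambda>r. V r * (1 / r))"
        using a0[of n] x
        by (intro integral_le integrable_continuous_interval continuous_intros cV mult_right_mono) auto
      finally have "V x \<le> W n / ln 2" using WV[of n] by (simp add: field_simps)
      then show False using gt[OF x(1)] by simp
    qed
    then obtain x where x: "\<And>n. x n \<in> {a n..2 * a n}" "\<And>n. V (x n) * ln 2 \<le> W n" by metis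
    have x0: "x n > 0" for n using x(1)[of n] a0[of n] by auto
    have "(\<lambda>n. S (x n)) \<longlonglongrightarrow> 0"
    proof (rule Lim_null_comparison)
      show "\<forall>\<^sub>F n in sequentially. norm (S (x n)) \<le> K * (W n / ln 2)"
      proof (intro always_eventually allI)
        fix n
        have "V (x n) \<le> W n / ln 2" using x(2)[of n] by (simp add: field_simps)
        then show "norm (S (x n)) \<le> K * (W n / ln 2)"
          using Sbound[OF x0[of n]] K(1) unfolding V_def[symmetric] 
          by (meson mult_left_mono order.strict_implies_order order_trans)
      qed
      show "(\<lambda>n. K * (W n / ln 2)) \<longlonglongrightarrow> 0"
        using tendsto_mult_right_zero[OF tendsto_divide_zero[OF W0, of "ln 2"], of K] by simp
    qed
    then show ?thesis using x(1) by blast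
  qed
  obtain x where x: "\<And>n. x n \<in> {real (Suc n)..2 * real (Suc n)}" "(\<lambda>n. S (x n)) \<longlonglongrightarrow> 0"
    using average[of "\<lambda>n. real (Suc n)"] dyadic_tendsto_0(1)[OF int] by auto
  obtain y where y: "\<And>n. y n \<in> {1 / (2 * real (Suc n))..1 / real (Suc n)}" "(\<lambda>n. S (y n)) \<longlonglongrightarrow> 0"
  proof -
    have e: "2 * (1 / (2 * real (Suc n))) = 1 / real (Suc n)" for n by (simp add: field_simps)
    show ?thesis
      using average[of "\<lambda>n. 1 / (2 * real (Suc n))", unfolded e, OF _ dyadic_tendsto_0(2)[OF int]] that by force
  qed
  have y0: "0 < y n" for n using y(1)[of n] by (auto intro: less_le_trans[of 0 "1 / (2 * real (Suc n))"])
  have yx: "y n \<le> x n" for n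
  proof -
    have "1 / real (Suc n) \<le> 1" "1 \<le> real (Suc n)" by simp_all
    then show ?thesis using x(1)[of n] y(1)[of n] unfolding atLeastAtMost_iff by linarith
  qed
  \<comment> \<open>The radii \<open>y n\<close> and \<open>x n\<close> lie in the dyadic blocks
    adjacent to the ends of \<open>exhaust n\<close>. Hence the truncated integral differs from the
    one over \<open>exhaust n\<close> by integrals over parts of these blocks, which tend to
    0.\<close>
  have main: "(\<lambda>n. integral {y n..x n} (\<lambda>r. cis t \<cdot> G (of_real r * cis t))) \<longlonglongrightarrow> I t" if t: "t \<in> {\<alpha>..\<beta>}" for t
  proof -
    have s: "integral {y n..x n} (\<lambda>r. cis t \<cdot> G (of_real r * cis t))
      = integral (exhaust n) (\<lambda>r. cis t \<cdot> G (of_real r * cis t))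
        + integral {y n..1 / real (Suc n)} (\<lambda>r. cis t \<cdot> G (of_real r * cis t))
        + integral {real (Suc n)..x n} (\<lambda>r. cis t \<cdot> G (of_real r * cis t))" for n
    proof -
      have i: "(\<lambda>r. cis t \<cdot> G (of_real r * cis t)) integrable_on {y n..c}" for c
        by (rule integrable_continuous_interval[OF continuous_on_subset[OF conv(2)[OF t]]]) (use y0[of n] in auto)
      have o: "y n \<le> 1 / real (Suc n)" "1 / real (Suc n) \<le> real (Suc n)" "real (Suc n) \<le> x n"
      proof -
        have "1 / real (Suc n) \<le> 1" "1 \<le> real (Suc n)" by simp_all
        then show "y n \<le> 1 / real (Suc n)" "1 / real (Suc n) \<le> real (Suc n)" "real (Suc n) \<le> x n"
          using x(1)[of n] y(1)[of n] unfolding atLeastAtMost_iff by linarith+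
      qed
      have "integral {y n..1 / real (Suc n)} (\<lambda>r. cis t \<cdot> G (of_real r * cis t)) + integral {1 / real (Suc n)..real (Suc n)} (\<lambda>r. cis t \<cdot> G (of_real r * cis t))
         = integral {y n..real (Suc n)} (\<lambda>r. cis t \<cdot> G (of_real r * cis t))"
        by (rule Henstock_Kurzweil_Integration.integral_combine[OF o(1,2) i])
      moreover have "integral {y n..real (Suc n)} (\<lambda>r. cis t \<cdot> G (of_real r * cis t)) + integral {real (Suc n)..x n} (\<lambda>r. cis t \<cdot> G (of_real r * cis t))
         = integral {y n..x n} (\<lambda>r. cis t \<cdot> G (of_real r * cis t))"
        by (rule Henstock_Kurzweil_Integration.integral_combine[OF order_trans[OF o(1,2)] o(3) i])
      ultimately show ?thesis unfolding exhaust_def by (metis add.commute)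
    qed
    have small: "(\<lambda>n. integral {c n..d n} (\<lambda>r. norm (G (of_real r * cis t)))) \<longlonglongrightarrow> 0"
      if sub: "\<And>n. {c n..d n} \<subseteq> {c' n..d' n}" "\<And>n. 0 < c' n"
        and l: "(\<lambda>n. integral {c' n..d' n} (\<lambda>r. norm (G (of_real r * cis t)))) \<longlonglongrightarrow> 0" for c d c' d' :: "nat \<Rightarrow> real"
    proof (rule tendsto_sandwich[OF _ _ tendsto_const l]; intro always_eventually allI)
      fix n
      have i: "(\<lambda>r. norm (G (of_real r * cis t))) integrable_on {c' n..d' n}"
        using int[OF t] by (rule integrable_on_subinterval) (use sub(2)[of n] in auto)
      have j: "(\<lambda>r. norm (G (of_real r * cis t))) integrable_on {c n..d n}"
        using i sub(1)[of n] by (rule integrable_on_subinterval)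
      show "0 \<le> integral {c n..d n} (\<lambda>r. norm (G (of_real r * cis t)))" by (rule integral_nonneg[OF j]) auto
      show "integral {c n..d n} (\<lambda>r. norm (G (of_real r * cis t))) \<le> integral {c' n..d' n} (\<lambda>r. norm (G (of_real r * cis t)))"
        by (rule integral_subset_le[OF sub(1) j i]) auto
    qed
    have l1: "(\<lambda>n. integral (exhaust n) (\<lambda>r. cis t \<cdot> G (of_real r * cis t))) \<longlonglongrightarrow> I t"
      unfolding I_def
      by (rule dominated_integrable_Ioi(2)[OF conv(2)[OF t] integrable_on_mult_left[OF conv(1)[OF t]] nb])
    have l2: "(\<lambda>n. integral {y n..1 / real (Suc n)} (\<lambda>r. cis t \<cdot> G (of_real r * cis t))) \<longlonglongrightarrow> 0"
      by (rule Ilim[OF t y0 small[OF _ _ dyadic_tendsto_0(2)[OF int[OF t]]]]) (use y(1) in auto)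
    have l3: "(\<lambda>n. integral {real (Suc n)..x n} (\<lambda>r. cis t \<cdot> G (of_real r * cis t))) \<longlonglongrightarrow> 0"
      by (rule Ilim[OF t _ small[OF _ _ dyadic_tendsto_0(1)[OF int[OF t]]]]) (use x(1) in auto)
    show ?thesis unfolding s using tendsto_add[OF tendsto_add[OF l1 l2] l3] by simp
  qed
  have "I \<beta> - I \<alpha> = 0 - 0"
  proof (rule LIMSEQ_unique)
    show "(\<lambda>n. integral {y n..x n} (\<lambda>r. cis \<beta> \<cdot> G (of_real r * cis \<beta>)) - integral {y n..x n} (\<lambda>r. cis \<alpha> \<cdot> G (of_real r * cis \<alpha>))) \<longlonglongrightarrow> I \<beta> - I \<alpha>"
      by (intro tendsto_diff main) (use assms(1) in auto)
    show "(\<lambda>n. integral {y n..x n} (\<lambda>r. cis \<beta> \<cdot> G (of_real r * cis \<beta>)) - integral {y n..x n} (\<lambda>r. cis \<alpha> \<cdot> G (of_real r * cis \<alpha>))) \<longlonglongrightarrow> 0 - 0"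
      unfolding green[OF y0 yx] by (intro tendsto_diff x y)
  qed
  moreover have "I t = ray (cis t) G" if t: "t \<in> {\<alpha>..\<beta>}" for t
  proof -
    have "(\<lambda>r. G (of_real r * cis t)) integrable_on {0<..}"
      using t by (intro dominated_integrable_Ioi(1)[OF _ int[OF t]] continuous_on_compose2[OF contG] continuous_intros) auto
    from integral_linear[OF this bounded_linear_right[of "cis t"]]
    show ?thesis by (simp add: I_def ray_def o_def)
  qed
  ultimately show ?thesis using assms(1) by simp
qed

end


section \<open>Integrals over the boundary of the double sector\<close>

context complex_action
begin

definition ray_integrable :: "complex \<Rightarrow> (complex \<Rightarrow> 'a) \<Rightarrow> bool" where
  "ray_integrable d G \<longleftrightarrow> (\<lambda>r. G (of_real r * d)) integrable_on {0<..}"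

lemma ray_add: "ray_integrable d G \<Longrightarrow> ray_integrable d H \<Longrightarrow> ray d (\<lambda>z. G z + H z) = ray d G + ray d H"
  unfolding ray_integrable_def ray_def by (simp add: integral_add add_right)

lemma ray_diff: "ray_integrable d G \<Longrightarrow> ray_integrable d H \<Longrightarrow> ray d (\<lambda>z. G z - H z) = ray d G - ray d H"
  unfolding ray_integrable_def ray_def by (simp add: integral_diff diff_right)

lemma ray_linear:
  assumes "ray_integrable d G" "bounded_linear L" "\<And>c v. L (c \<cdot> v) = c \<cdot> L v"
  shows "ray_integrable d (\<lambda>z. L (G z))" "ray d (\<lambda>z. L (G z)) = L (ray d G)"
  using integral_linear[of "\<lambda>r. G (of_real r * d)" "{0<..}" L] integrable_linear[of "\<lambda>r. G (of_real r * d)" "{0<..}" L] assms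
  unfolding ray_integrable_def ray_def by (simp_all add: o_def)

lemma ray_cong: "(\<And>r. r > 0 \<Longrightarrow> G (of_real r * d) = H (of_real r * d)) \<Longrightarrow> ray d G = ray d H"
  unfolding ray_def by (rule arg_cong[where f = "\<lambda>x. d \<cdot> x"], rule integral_cong) auto

lemma ray_integrable_cong:
  "(\<And>r. r > 0 \<Longrightarrow> G (of_real r * d) = H (of_real r * d)) \<Longrightarrow> ray_integrable d G \<longleftrightarrow> ray_integrable d H"
  unfolding ray_integrable_def by (rule integrable_cong) auto

lemma ray_minus: "ray d (\<lambda>z. G (- z)) = - ray (- d) G"
  unfolding ray_def by (simp add: minus_left)

text \<open>The integrals over the positively oriented boundaries of the right half of the double sector of
  half-angle \<open>\<phi>\<close> and of the whole double sector.\<close>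

definition sec :: "real \<Rightarrow> (complex \<Rightarrow> 'a) \<Rightarrow> 'a" where
  "sec \<phi> G = ray (cis (- \<phi>)) G - ray (cis \<phi>) G"

definition ring :: "real \<Rightarrow> (complex \<Rightarrow> 'a) \<Rightarrow> 'a" where
  "ring \<phi> G = ray (cis (- \<phi>)) G - ray (cis \<phi>) G + ray (- cis (- \<phi>)) G - ray (- cis \<phi>) G"

definition dirs :: "real \<Rightarrow> complex set" where
  "dirs \<phi> = {cis (- \<phi>), cis \<phi>, - cis (- \<phi>), - cis \<phi>}"

text \<open>The rotation z -> -z carries the right half to the left half and keeps the orientation;
  the minus sign comes from dz. Most facts about the double sector are reduced to its right half in
  this way.\<close>

lemma ring_sec: "ring \<phi> G = sec \<phi> G - sec \<phi> (\<lambda>z. G (- z))"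
  unfolding ring_def sec_def ray_minus by simp

lemma ring_minus: "ring \<phi> (\<lambda>z. G (- z)) = - ring \<phi> G"
  by (simp add: ring_sec)

lemma ring_cong:
  assumes "\<And>r d. r > 0 \<Longrightarrow> d \<in> dirs \<phi> \<Longrightarrow> G (of_real r * d) = H (of_real r * d)"
  shows "ring \<phi> G = ring \<phi> H"
  unfolding ring_def
  by (intro arg_cong2[where f = "(-)"] arg_cong2[where f = "(+)"] ray_cong assms) (auto simp: dirs_def)

lemma ring_add: "(\<And>d. d \<in> dirs \<phi> \<Longrightarrow> ray_integrable d G) \<Longrightarrow> (\<And>d. d \<in> dirs \<phi> \<Longrightarrow> ray_integrable d H) \<Longrightarrow>
    ring \<phi> (\<lambda>z. G z + H z) = ring \<phi> G + ring \<phi> H"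
  unfolding ring_def dirs_def by (simp add: ray_add)

lemma ring_diff: "(\<And>d. d \<in> dirs \<phi> \<Longrightarrow> ray_integrable d G) \<Longrightarrow> (\<And>d. d \<in> dirs \<phi> \<Longrightarrow> ray_integrable d H) \<Longrightarrow>
    ring \<phi> (\<lambda>z. G z - H z) = ring \<phi> G - ring \<phi> H"
  unfolding ring_def dirs_def by (simp add: ray_diff)

lemma ring_linear:
  assumes "\<And>d. d \<in> dirs \<phi> \<Longrightarrow> ray_integrable d G" "bounded_linear L" "\<And>c v. L (c \<cdot> v) = c \<cdot> L v"
  shows "ring \<phi> (\<lambda>z. L (G z)) = L (ring \<phi> G)"
proof -
  interpret L: bounded_linear L by fact
  show ?thesis
    unfolding ring_def using assms(1) ray_linear(2)[OF _ assms(2,3)]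
    by (simp add: L.add L.diff dirs_def)
qed

lemma ring_cs:
  assumes "\<And>d. d \<in> dirs \<phi> \<Longrightarrow> ray_integrable d G"
  shows "ring \<phi> (\<lambda>z. c \<cdot> G z) = c \<cdot> ring \<phi> G"
  by (rule ring_linear[OF assms bounded_linear_right cs_commute])

end

interpretation C: complex_action "(*) :: complex \<Rightarrow> complex \<Rightarrow> complex"
  by (rule complex_action.intro) (auto intro: bounded_bilinear_mult)

lemma (in complex_action) ray_scalar:
  assumes "C.ray_integrable d H"
  shows "ray_integrable d (\<lambda>z. H z \<cdot> v)" "ray d (\<lambda>z. H z \<cdot> v) = C.ray d H \<cdot> v"
proof -
  have b: "bounded_linear (\<lambda>c. c \<cdot> v)" by (rule bounded_linear_left)
  show "ray_integrable d (\<lambda>z. H z \<cdot> v)" "ray d (\<lambda>z. H z \<cdot> v) = C.ray d H \<cdot> v"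
    using assms integral_linear[OF _ b, of "\<lambda>r. H (of_real r * d)"] integrable_linear[OF _ b, of "\<lambda>r. H (of_real r * d)"]
    unfolding C.ray_integrable_def ray_integrable_def C.ray_def ray_def by (simp_all add: o_def cs_assoc)
qed

lemma (in complex_action) ring_scalar:
  assumes "\<And>d. d \<in> dirs \<phi> \<Longrightarrow> C.ray_integrable d H"
  shows "ring \<phi> (\<lambda>z. H z \<cdot> v) = C.ring \<phi> H \<cdot> v"
  using assms ray_scalar(2) by (simp add: ring_def C.ring_def dirs_def add_left diff_left)

section \<open>Explicit scalar integrals along a ray\<close>

lemma integrable_inverse_1_plus_square: "(\<lambda>r :: real. 1 / (1 + r\<^sup>2)) integrable_on {0<..}"
proof -
  have d: "((\<lambda>r :: real. 1 / (1 + r\<^sup>2)) has_integral (arctan (real (Suc n)) - arctan (1 / real (Suc n)))) (exhaust n)" for n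
    unfolding exhaust_def
    by (rule fundamental_theorem_of_calculus)
      (auto intro!: derivative_eq_intros simp: has_real_derivative_iff_has_vector_derivative[symmetric] inverse_eq_divide order_trans[of _ 1])
  let ?F = "\<lambda>n r. if r \<in> exhaust n then 1 / (1 + r\<^sup>2) else 0 :: real"
  have i: "(?F n has_integral (arctan (real (Suc n)) - arctan (1 / real (Suc n)))) {0<..}" for n
    using d[of n] exhaust_subset[of n]
    by (subst has_integral_restrict_Int) (simp add: Int_absorb2)
  have "(\<lambda>r :: real. 1 / (1 + r\<^sup>2)) integrable_on {0<..} \<and>
    (\<lambda>n. integral {0<..} (?F n)) \<longlonglongrightarrow> integral {0<..} (\<lambda>r :: real. 1 / (1 + r\<^sup>2))"
  proof (rule monotone_convergence_increasing)
    show "?F n integrable_on {0<..}" for n using i by blast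
    show "?F n r \<le> ?F (Suc n) r" for n r
    proof -
      have "exhaust n \<subseteq> exhaust (Suc n)" by (auto simp: exhaust_def field_simps intro: order_trans)
      then show ?thesis by (auto simp: add_nonneg_nonneg)
    qed
    show "(\<lambda>n. ?F n r) \<longlonglongrightarrow> 1 / (1 + r\<^sup>2)" if "r \<in> {0<..}" for r
      using that by (intro tendsto_eventually eventually_mono[OF eventually_in_exhaust[of r]]) auto
    have "\<bar>arctan (real (Suc n)) - arctan (1 / real (Suc n))\<bar> \<le> pi" for n
      using arctan_bounded[of "real (Suc n)"] arctan_bounded[of "1 / real (Suc n)"] by linarith
    then show "bounded (range (\<lambda>n. integral {0<..} (?F n)))"
      unfolding integral_unique[OF i] bounded_iff by auto
  qed
  then show ?thesis by blast
qed

text \<open>The triangle inequality gives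
  \<open>1 + norm w \<le> norm (w - z) + (norm z + 1)\<close>, and the constant is absorbed because
  \<open>norm (w - z) / \<delta>\<close> is at least 1. Off a disc around a pole, its distance is
  thus comparable with \<open>1 + norm w\<close>.\<close>

lemma one_plus_norm_le:
  fixes w z :: complex
  assumes "\<delta> > 0" "\<delta> \<le> norm (w - z)"
  shows "1 + norm w \<le> (1 + (norm z + 1) / \<delta>) * norm (w - z)"
proof -
  have "1 + norm w \<le> norm (w - z) + (norm z + 1)" using norm_triangle_sub[of w z] by simp
  also have "norm z + 1 \<le> (norm z + 1) / \<delta> * norm (w - z)"
  proof -
    have "(norm z + 1) / \<delta> * \<delta> \<le> (norm z + 1) / \<delta> * norm (w - z)"
      by (rule mult_left_mono[OF assms(2)]) (use assms(1) in auto)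
    then show ?thesis using assms(1) by simp
  qed
  finally show ?thesis by (simp add: algebra_simps)
qed

lemma one_plus_square_le:
  fixes w z :: complex
  assumes "\<delta> > 0" "\<delta> \<le> norm (w - z)" "\<delta> \<le> norm (w + z)"
  shows "1 + (norm w)\<^sup>2 \<le> (1 + (norm z + 1) / \<delta>)\<^sup>2 * norm (w\<^sup>2 - z\<^sup>2)"
proof -
  let ?K = "1 + (norm z + 1) / \<delta>"
  have "1 + (norm w)\<^sup>2 \<le> (1 + norm w) * (1 + norm w)" by (simp add: power2_eq_square algebra_simps)
  also have "\<dots> \<le> (?K * norm (w - z)) * (?K * norm (w - (- z)))"
    using one_plus_norm_le[OF assms(1,2)] one_plus_norm_le[of \<delta> w "- z"] assms
    by (intro mult_mono) (auto intro!: mult_nonneg_nonneg add_nonneg_nonneg)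
  also have "\<dots> = ?K\<^sup>2 * norm (w\<^sup>2 - z\<^sup>2)"
  proof -
    have "w\<^sup>2 - z\<^sup>2 = (w - z) * (w + z)" by (simp add: power2_eq_square algebra_simps)
    then show ?thesis by (simp add: norm_mult power2_eq_square)
  qed
  finally show ?thesis .
qed

text \<open>The integrand is the derivative of the logarithm of (w - z)/(w + z). Along the ray this
  quotient stays in the upper half plane, by the sign condition on \<open>d\<close> and
  \<open>z\<close>. The factor - \<i> turns it into the right half plane, away from the branch cut,
  where it runs from \<i> at 0 to - \<i> at infinity. This supplies the residue in Cauchy's formula
  without a closed contour.\<close>

lemma ray_log:
  assumes d: "norm d = 1" and im: "Im (d * cnj z) > 0"
  shows "C.ray_integrable d (\<lambda>w. 2 * z / (w\<^sup>2 - z\<^sup>2))" and "C.ray d (\<lambda>w. 2 * z / (w\<^sup>2 - z\<^sup>2)) = - \<i> * pi"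
proof -
  \<comment> \<open>Since \<open>d\<close> is a unit vector, \<delta> is the distance of
    \<open>z\<close>, and of \<open>- z\<close>, from the line spanned by \<open>d\<close>.\<close>
  define \<delta> where "\<delta> = Im (d * cnj z)"
  have \<delta>: "\<delta> > 0" using im by (simp add: \<delta>_def)
  have dd: "d * cnj d = 1" using complex_norm_square[of d] d by simp
  have z0: "z \<noteq> 0" and d0: "d \<noteq> 0" using im by auto
  have ge: "\<delta> \<le> norm (of_real r * d - z)" "\<delta> \<le> norm (of_real r * d + z)" for r
  proof -
    have *: "Im ((of_real r * d - c * z) * cnj d) = c * \<delta>" for c :: real
      using dd by (simp add: \<delta>_def algebra_simps complex_eq_iff)
    have "\<bar>c * \<delta>\<bar> \<le> norm (of_real r * d - c * z)" for c :: real
      using abs_Im_le_cmod[of "(of_real r * d - c * z) * cnj d"] d unfolding * by (simp add: norm_mult)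
    from this[of 1] this[of "-1"] \<delta> show "\<delta> \<le> norm (of_real r * d - z)" "\<delta> \<le> norm (of_real r * d + z)" by auto
  qed
  let ?G = "\<lambda>r. 2 * z / ((of_real r * d)\<^sup>2 - z\<^sup>2)"
  have ne: "of_real r * d - z \<noteq> 0" "of_real r * d + z \<noteq> 0" for r using ge[of r] \<delta> by auto
  have ne2: "(of_real r * d)\<^sup>2 - z\<^sup>2 \<noteq> 0" for r
  proof -
    have "(of_real r * d)\<^sup>2 - z\<^sup>2 = (of_real r * d - z) * (of_real r * d + z)" by (simp add: power2_eq_square algebra_simps)
    then show ?thesis using ne[of r] by simp
  qed
  define K where "K = (1 + (norm z + 1) / \<delta>)\<^sup>2"
  have K0: "K \<ge> 0" by (simp add: K_def)
  have bound: "norm (?G r) \<le> (2 * norm z * K) * (1 / (1 + r\<^sup>2))" for r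
  proof -
    have "1 + r\<^sup>2 \<le> K * norm ((of_real r * d)\<^sup>2 - z\<^sup>2)"
      using one_plus_square_le[OF \<delta> ge[of r]] d by (simp add: K_def norm_mult power_mult_distrib)
    then have "(1 + r\<^sup>2) * norm z \<le> K * norm ((of_real r * d)\<^sup>2 - z\<^sup>2) * norm z" by (intro mult_right_mono) auto
    then show ?thesis using ne2[of r]
      by (simp add: norm_divide norm_mult field_simps add_nonneg_eq_0_iff add_pos_nonneg)
  qed
  have cont: "continuous_on {0<..} ?G" using ne2 by (intro continuous_intros) auto
  have dom: "(\<lambda>r. (2 * norm z * K) * (1 / (1 + r\<^sup>2))) integrable_on {0<..}"
    using integrable_on_cmult_left[OF integrable_inverse_1_plus_square, of "2 * norm z * K"] by simp
  have I: "?G integrable_on {0<..}" and lim: "(\<lambda>n. integral (exhaust n) ?G) \<longlonglongrightarrow> integral {0<..} ?G"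
    using dominated_integrable_Ioi[OF cont dom bound] by auto
  show "C.ray_integrable d (\<lambda>w. 2 * z / (w\<^sup>2 - z\<^sup>2))" using I by (simp add: C.ray_integrable_def)
  define g where "g r = Ln (- \<i> * ((of_real r * d - z) / (of_real r * d + z)))" for r
  have pos: "Re (- \<i> * ((of_real r * d - z) / (of_real r * d + z))) > 0" if "r > 0" for r
  proof -
    have "Im ((of_real r * d - z) * cnj (of_real r * d + z)) = 2 * r * \<delta>"
      by (simp add: \<delta>_def algebra_simps)
    then have "Im ((of_real r * d - z) / (of_real r * d + z)) > 0"
      using that \<delta> ne(2)[of r] unfolding complex_div_cnj[of _ "of_real r * d + z"]
      by (simp del: complex_cnj_add complex_cnj_mult add: Im_divide_of_real)
    moreover have "Re (- \<i> * x) = Im x" for x by simp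
    ultimately show ?thesis by metis
  qed
  have der: "(g has_vector_derivative d * ?G r) (at r)" if "r > 0" for r
  proof -
    have "((\<lambda>w. Ln (- \<i> * ((w - z) / (w + z)))) has_field_derivative ?G r) (at (of_real r * d))"
    proof -
      have "- \<i> * ((of_real r * d - z) / (of_real r * d + z)) \<notin> \<real>\<^sub>\<le>\<^sub>0"
        using pos[OF that] by (auto simp: complex_nonpos_Reals_iff)
      moreover have "((\<lambda>w. - \<i> * ((w - z) / (w + z))) has_field_derivative - \<i> * (((of_real r * d + z) - (of_real r * d - z)) / ((of_real r * d + z) * (of_real r * d + z)))) (at (of_real r * d))"
        by (rule DERIV_cmult) (use ne[of r] in \<open>auto intro!: derivative_eq_intros\<close>)
      ultimately have D: "((\<lambda>w. Ln (- \<i> * ((w - z) / (w + z)))) has_field_derivative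
          inverse (- \<i> * ((of_real r * d - z) / (of_real r * d + z))) * (- \<i> * (((of_real r * d + z) - (of_real r * d - z)) / ((of_real r * d + z) * (of_real r * d + z))))) (at (of_real r * d))"
        by (rule DERIV_chain2[OF has_field_derivative_Ln])
      have I: "inverse (- \<i> * (a / b)) * (- \<i> * ((b - a) / (b * b))) = (b - a) / (a * b)"
        if "a \<noteq> 0" "b \<noteq> 0" for a b :: complex
        using that by (simp add: field_simps)
      have e: "(of_real r * d + z) - (of_real r * d - z) = 2 * z"
        "(of_real r * d - z) * (of_real r * d + z) = (of_real r * d)\<^sup>2 - z\<^sup>2"
        by (simp_all add: power2_eq_square algebra_simps)
      have "inverse (- \<i> * ((of_real r * d - z) / (of_real r * d + z))) * (- \<i> * (((of_real r * d + z) - (of_real r * d - z)) / ((of_real r * d + z) * (of_real r * d + z)))) = ?G r"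
        unfolding I[OF ne[of r]] unfolding e ..
      with D show ?thesis by (simp only:)
    qed
    moreover have "((\<lambda>r. of_real r * d) has_vector_derivative d) (at r)"
      unfolding has_vector_derivative_def scaleR_conv_of_real by (auto intro!: derivative_eq_intros)
    ultimately have "((\<lambda>w. Ln (- \<i> * ((w - z) / (w + z)))) \<circ> (\<lambda>r. of_real r * d) has_vector_derivative d * ?G r) (at r)"
      by (rule field_vector_diff_chain_at[rotated])
    then show ?thesis by (simp add: o_def g_def[abs_def])
  qed
  have int: "integral (exhaust n) (\<lambda>r. d * ?G r) = g (real (Suc n)) - g (1 / real (Suc n))" for n
    unfolding exhaust_def
  proof (rule integral_unique, rule fundamental_theorem_of_calculus)
    have "1 / real (Suc n) \<le> 1" "1 \<le> real (Suc n)" by simp_all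
    then show "1 / real (Suc n) \<le> real (Suc n)" by linarith
    fix x assume "x \<in> {1 / real (Suc n)..real (Suc n)}"
    then have "x > 0" using exhaust_subset[of n] by (auto simp: exhaust_def)
    then show "(g has_vector_derivative d * ?G x) (at x within {1 / real (Suc n)..real (Suc n)})"
      by (rule has_vector_derivative_at_within[OF der])
  qed
  have Lni: "isCont Ln \<i>" "isCont Ln (- \<i>)" by (auto intro!: continuous_at_Ln simp: complex_nonpos_Reals_iff)
  have "(\<lambda>n. - \<i> * ((of_real (1 / real (Suc n)) * d - z) / (of_real (1 / real (Suc n)) * d + z))) \<longlonglongrightarrow> - \<i> * ((of_real 0 * d - z) / (of_real 0 * d + z))"
    using z0 LIMSEQ_inverse_real_of_nat by (intro tendsto_intros) (auto simp: inverse_eq_divide simp del: of_nat_Suc)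
  then have "(\<lambda>n. - \<i> * ((of_real (1 / real (Suc n)) * d - z) / (of_real (1 / real (Suc n)) * d + z))) \<longlonglongrightarrow> \<i>"
    using z0 by (simp add: divide_minus_left)
  from isCont_tendsto_compose[OF Lni(1) this]
  have l1: "(\<lambda>n. g (1 / real (Suc n))) \<longlonglongrightarrow> \<i> * pi / 2" by (simp add: g_def del: of_nat_Suc)
  \<comment> \<open>For the limit at infinity, numerator and denominator are divided by the
    radius.\<close>
  have "(\<lambda>n. - \<i> * ((d - of_real (1 / real (Suc n)) * z) / (d + of_real (1 / real (Suc n)) * z))) \<longlonglongrightarrow> - \<i> * ((d - of_real 0 * z) / (d + of_real 0 * z))"
    using d0 LIMSEQ_inverse_real_of_nat by (intro tendsto_intros) (auto simp: inverse_eq_divide simp del: of_nat_Suc)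
  then have "(\<lambda>n. - \<i> * ((d - of_real (1 / real (Suc n)) * z) / (d + of_real (1 / real (Suc n)) * z))) \<longlonglongrightarrow> - \<i>"
    using d0 by simp
  moreover have "(d - of_real (1 / real (Suc n)) * z) / (d + of_real (1 / real (Suc n)) * z)
      = (of_real (real (Suc n)) * d - z) / (of_real (real (Suc n)) * d + z)" for n
  proof -
    have "of_real (real (Suc n)) * (d - of_real (1 / real (Suc n)) * z) = of_real (real (Suc n)) * d - z"
      "of_real (real (Suc n)) * (d + of_real (1 / real (Suc n)) * z) = of_real (real (Suc n)) * d + z"
      by (simp_all add: algebra_simps del: of_nat_Suc)
    then show ?thesis
      using mult_divide_mult_cancel_left[of "of_real (real (Suc n)) :: complex" "d - of_real (1 / real (Suc n)) * z" "d + of_real (1 / real (Suc n)) * z"]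
      by (simp del: of_nat_Suc)
  qed
  ultimately have "(\<lambda>n. - \<i> * ((of_real (real (Suc n)) * d - z) / (of_real (real (Suc n)) * d + z))) \<longlonglongrightarrow> - \<i>" by (simp only:)
  from isCont_tendsto_compose[OF Lni(2) this]
  have l2: "(\<lambda>n. g (real (Suc n))) \<longlonglongrightarrow> - (\<i> * pi / 2)" by (simp add: g_def del: of_nat_Suc)
  have "(\<lambda>n. integral (exhaust n) (\<lambda>r. d * ?G r)) \<longlonglongrightarrow> - (\<i> * pi / 2) - \<i> * pi / 2"
    unfolding int by (intro tendsto_diff l1 l2)
  moreover have "(\<lambda>n. integral (exhaust n) (\<lambda>r. d * ?G r)) \<longlonglongrightarrow> d * integral {0<..} ?G"
    using tendsto_mult_left[OF lim, of d] by (simp only: integral_mult_right)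
  ultimately have "d * integral {0<..} ?G = - (\<i> * pi / 2) - \<i> * pi / 2" by (rule LIMSEQ_unique[rotated])
  then show "C.ray d (\<lambda>w. 2 * z / (w\<^sup>2 - z\<^sup>2)) = - \<i> * pi" by (simp add: C.ray_def)
qed

section \<open>Decaying holomorphic functions on sectors, Cauchy's theorem and formula\<close>

text \<open>The condition \<open>\<bar>Im z\<bar> < tan \<theta> * \<bar>Re z\<bar>\<close> without
  the division, so that it also makes sense for \<theta> = pi/2, where it excludes exactly the
  imaginary axis. The strict inequality keeps 0 out.\<close>

definition sector :: "real \<Rightarrow> complex set" where
  "sector \<theta> = {z. \<bar>Im z\<bar> * cos \<theta> < sin \<theta> * \<bar>Re z\<bar>}"

definition rsector :: "real \<Rightarrow> complex set" where
  "rsector \<theta> = {z. \<bar>Im z\<bar> * cos \<theta> < sin \<theta> * Re z}"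

text \<open>Holomorphic functions with the decay that is required in the class
  \<open>\<S>\<H>\<^sub>L\<^sup>0\<close>, on a cone \<open>S\<close>.\<close>

definition decays :: "complex set \<Rightarrow> (complex \<Rightarrow> complex) \<Rightarrow> bool" where
  "decays S F \<longleftrightarrow> F holomorphic_on S \<and> (\<exists>M. \<forall>z\<in>S. norm (F z) \<le> M) \<and>
     (\<forall>d\<in>S. norm d = 1 \<longrightarrow> (\<lambda>r. norm (F (of_real r * d)) / r) integrable_on {0<..})"

lemma open_sector: "open (sector \<theta>)" and open_rsector: "open (rsector \<theta>)"
  unfolding sector_def rsector_def by (auto intro!: open_Collect_less continuous_intros)

lemma sector_scale: "r > 0 \<Longrightarrow> of_real r * z \<in> sector \<theta> \<longleftrightarrow> z \<in> sector \<theta>"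
  and rsector_scale: "r > 0 \<Longrightarrow> of_real r * z \<in> rsector \<theta> \<longleftrightarrow> z \<in> rsector \<theta>"
  by (auto simp: sector_def rsector_def abs_mult mult.assoc mult.left_commute[of _ r])

lemma sector_iff_rsector:
  assumes "0 < \<theta>" "\<theta> < pi / 2"
  shows "z \<in> sector \<theta> \<longleftrightarrow> z \<in> rsector \<theta> \<or> - z \<in> rsector \<theta>"
proof -
  have "sin \<theta> > 0" using assms by (auto intro!: sin_gt_zero)
  then have "sin \<theta> * \<bar>Re z\<bar> = \<bar>sin \<theta> * Re z\<bar>" by (simp add: abs_mult)
  moreover have "a < \<bar>y\<bar> \<longleftrightarrow> a < y \<or> a < - y" for a y :: real by linarith
  ultimately show ?thesis by (simp add: sector_def rsector_def)
qed

lemma cis_in_rsector: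
  assumes "\<bar>t\<bar> < \<theta>" "\<theta> < pi / 2"
  shows "cis t \<in> rsector \<theta>"
proof -
  have "0 < sin (\<theta> - \<bar>t\<bar>)" using assms by (intro sin_gt_zero) auto
  moreover have "\<bar>sin t\<bar> = sin \<bar>t\<bar>" using assms by (cases "t \<ge> 0") (use sin_ge_zero[of t] sin_ge_zero[of "- t"] in auto)
  moreover have "cos \<bar>t\<bar> = cos t" by (cases "t \<ge> 0") auto
  ultimately show ?thesis by (simp add: rsector_def sin_diff mult.commute)
qed


text \<open>Two closed cones that meet only in 0 have a distance that grows like the norms.
  Combining the two cone inequalities yields \<open>sin (\<phi>2 - \<phi>1) * \<bar>Re w\<bar> \<le>
  2 * \<delta>\<close> with \<delta> = \<open>norm (w - z)\<close>, and this controls the other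
  coordinates. The case \<phi>2 = pi/2 separates a sector from the points \<plusminus>\<i>.\<close>

lemma cones_separated:
  assumes "0 \<le> \<phi>1" "\<phi>1 < \<phi>2" "\<phi>2 \<le> pi / 2"
  shows "\<exists>c>0. \<forall>z w. \<bar>Im z\<bar> * cos \<phi>1 \<le> sin \<phi>1 * \<bar>Re z\<bar> \<longrightarrow> w \<notin> sector \<phi>2 \<longrightarrow> c * (norm z + norm w) \<le> norm (w - z)"
proof -
  define \<kappa> where "\<kappa> = sin (\<phi>2 - \<phi>1)"
  have \<kappa>: "\<kappa> > 0" unfolding \<kappa>_def using assms by (intro sin_gt_zero) auto
  have c1: "cos \<phi>1 > 0" using assms by (intro cos_gt_zero_pi) auto
  have nn: "0 \<le> cos \<phi>2" "0 \<le> sin \<phi>1" "cos \<phi>1 \<le> 1" "cos \<phi>2 \<le> 1" "sin \<phi>1 \<le> 1"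
    using assms by (auto intro!: cos_ge_zero sin_ge_zero)
  define K where "K = (1 + 1 / cos \<phi>1) * (1 + 2 / \<kappa>)"
  have K: "K > 0" unfolding K_def using c1 \<kappa> by (intro mult_pos_pos add_pos_pos) auto
  have le: "norm z + norm w \<le> (2 * K + 1) * norm (w - z)"
    if z: "\<bar>Im z\<bar> * cos \<phi>1 \<le> sin \<phi>1 * \<bar>Re z\<bar>" and w: "w \<notin> sector \<phi>2" for z w
  proof -
    define \<delta> where "\<delta> = norm (w - z)"
    have \<delta>0: "0 \<le> \<delta>" by (simp add: \<delta>_def)
    have re: "\<bar>Re w - Re z\<bar> \<le> \<delta>" and im: "\<bar>Im w - Im z\<bar> \<le> \<delta>"
      using abs_Re_le_cmod[of "w - z"] abs_Im_le_cmod[of "w - z"] by (simp_all add: \<delta>_def)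
    have w': "sin \<phi>2 * \<bar>Re w\<bar> \<le> cos \<phi>2 * \<bar>Im w\<bar>" using w by (simp add: sector_def mult.commute)
    have "cos \<phi>1 * (sin \<phi>2 * \<bar>Re w\<bar>) \<le> cos \<phi>1 * (cos \<phi>2 * \<bar>Im w\<bar>)"
      using w' c1 by (intro mult_left_mono) auto
    also have "\<dots> \<le> cos \<phi>1 * (cos \<phi>2 * (\<bar>Im z\<bar> + \<delta>))"
      using im nn c1 by (intro mult_left_mono) auto
    also have "\<dots> = cos \<phi>2 * (\<bar>Im z\<bar> * cos \<phi>1 + cos \<phi>1 * \<delta>)" by (simp add: algebra_simps)
    also have "\<dots> \<le> cos \<phi>2 * (sin \<phi>1 * (\<bar>Re w\<bar> + \<delta>) + cos \<phi>1 * \<delta>)"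
    proof -
      have "sin \<phi>1 * \<bar>Re z\<bar> \<le> sin \<phi>1 * (\<bar>Re w\<bar> + \<delta>)" using re nn by (intro mult_left_mono) auto
      then show ?thesis using z nn by (intro mult_left_mono) auto
    qed
    finally have "\<kappa> * \<bar>Re w\<bar> \<le> cos \<phi>2 * ((sin \<phi>1 + cos \<phi>1) * \<delta>)"
      by (simp add: \<kappa>_def sin_diff algebra_simps)
    also have "\<dots> \<le> 1 * (2 * \<delta>)"
    proof -
      have "sin \<phi>1 + cos \<phi>1 \<le> 2" using sin_le_one[of \<phi>1] cos_le_one[of \<phi>1] by linarith
      from mult_right_mono[OF this \<delta>0] have le2: "(sin \<phi>1 + cos \<phi>1) * \<delta> \<le> 2 * \<delta>" .
      then show ?thesis using nn c1 \<delta>0 by (intro mult_mono[OF nn(4) le2]) auto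
    qed
    finally have "\<bar>Re w\<bar> \<le> 2 / \<kappa> * \<delta>" using \<kappa> by (simp add: field_simps)
    then have rz: "\<bar>Re z\<bar> \<le> (1 + 2 / \<kappa>) * \<delta>" using re by (simp add: algebra_simps)
    have "\<bar>Im z\<bar> * cos \<phi>1 \<le> 1 * \<bar>Re z\<bar>"
      using z nn mult_right_mono[of "sin \<phi>1" 1 "\<bar>Re z\<bar>"] by linarith
    then have "\<bar>Im z\<bar> \<le> 1 / cos \<phi>1 * \<bar>Re z\<bar>" using c1 by (simp add: field_simps)
    then have "norm z \<le> (1 + 1 / cos \<phi>1) * \<bar>Re z\<bar>"
      using cmod_le[of z] by (simp add: algebra_simps)
    also have "\<dots> \<le> K * \<delta>"
      unfolding K_def mult.assoc using rz c1 by (intro mult_left_mono) auto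
    finally have "norm z \<le> K * \<delta>" .
    moreover have "norm w \<le> norm z + \<delta>" using norm_triangle_sub[of w z] by (simp add: \<delta>_def)
    ultimately show ?thesis by (simp add: \<delta>_def[symmetric] algebra_simps)
  qed
  have "(1 / (2 * K + 1)) * (norm z + norm w) \<le> norm (w - z)"
    if "\<bar>Im z\<bar> * cos \<phi>1 \<le> sin \<phi>1 * \<bar>Re z\<bar>" "w \<notin> sector \<phi>2" for z w
    using le[OF that] K by (simp add: field_simps)
  moreover have "1 / (2 * K + 1) > 0" using K by simp
  ultimately show ?thesis by blast
qed

definition conical :: "complex set \<Rightarrow> bool" where
  "conical S \<longleftrightarrow> (\<forall>z\<in>S. \<forall>r>0. of_real r * z \<in> S)"

lemma conical_sector [simp]: "conical (sector \<theta>)" and conical_rsector [simp]: "conical (rsector \<theta>)"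
  unfolding conical_def using sector_scale rsector_scale by blast+

lemma decays_continuous:
  assumes "conical S" "continuous_on S F" "d \<in> S"
  shows "continuous_on {0<..} (\<lambda>r. F (of_real r * d))"
  using assms by (intro continuous_on_compose2[OF assms(2)] continuous_intros) (auto simp: conical_def)

text \<open>Two majorants are allowed since the remainder in Cauchy's formula is bounded by a
  multiple of the given function plus a multiple of z/(1+z^2).\<close>

lemma decays_dominated:
  assumes S: "conical S" and F: "F holomorphic_on S" and k: "decays S k" and l: "decays S l"
    and le: "\<And>z. z \<in> S \<Longrightarrow> norm (F z) \<le> A * norm (k z) + B * norm (l z)"
  shows "decays S F"
  unfolding decays_def
proof (intro conjI ballI impI F)
  obtain M where M: "\<And>z. z \<in> S \<Longrightarrow> norm (k z) \<le> M" using k by (auto simp: decays_def)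
  obtain N where N: "\<And>z. z \<in> S \<Longrightarrow> norm (l z) \<le> N" using l by (auto simp: decays_def)
  have "norm (F z) \<le> \<bar>A\<bar> * M + \<bar>B\<bar> * N" if z: "z \<in> S" for z
  proof -
    have "A * norm (k z) \<le> \<bar>A\<bar> * M" "B * norm (l z) \<le> \<bar>B\<bar> * N"
      using M[OF z] N[OF z] by (auto intro!: mult_mono)
    with le[OF z] show ?thesis by linarith
  qed
  then show "\<exists>M. \<forall>z\<in>S. norm (F z) \<le> M" by blast
  fix d assume d: "d \<in> S" "norm d = 1"
  have g: "(\<lambda>r. A * (norm (k (of_real r * d)) / r) + B * (norm (l (of_real r * d)) / r)) integrable_on {0<..}"
    using k l d integrable_on_cmult_left[of "\<lambda>r. norm (k (of_real r * d)) / r" "{0<..}" A]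
     integrable_on_cmult_left[of "\<lambda>r. norm (l (of_real r * d)) / r" "{0<..}" B]
    by (intro integrable_add) (auto simp: decays_def)
  show "(\<lambda>r. norm (F (of_real r * d)) / r) integrable_on {0<..}"
  proof (rule dominated_integrable_Ioi(1)[OF _ g])
    show "continuous_on {0<..} (\<lambda>r. norm (F (of_real r * d)) / r)"
      by (intro continuous_intros decays_continuous[OF S holomorphic_on_imp_continuous_on[OF F] d(1)]) auto
    fix r :: real assume r: "r > 0"
    then have "of_real r * d \<in> S" using S d(1) by (auto simp: conical_def)
    from le[OF this] r
    show "norm (norm (F (of_real r * d)) / r) \<le> A * (norm (k (of_real r * d)) / r) + B * (norm (l (of_real r * d)) / r)"
      by (simp add: divide_right_mono add_divide_distrib[symmetric])
  qed
qed

lemma decays_mult_bounded: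
  assumes "conical S" "decays S F" "b holomorphic_on S" "\<And>z. z \<in> S \<Longrightarrow> norm (b z) \<le> B"
  shows "decays S (\<lambda>z. b z * F z)"
proof (rule decays_dominated[OF assms(1) _ assms(2,2), of _ B 0])
  show "(\<lambda>z. b z * F z) holomorphic_on S"
    using assms by (auto simp: decays_def intro!: holomorphic_intros)
qed (use assms(4) in \<open>auto simp: norm_mult intro!: mult_right_mono\<close>)

lemma decays_cmult: "conical S \<Longrightarrow> decays S F \<Longrightarrow> decays S (\<lambda>z. c * F z)"
  by (rule decays_mult_bounded[of _ _ "\<lambda>_. c"]) auto

lemma decays_mult: "conical S \<Longrightarrow> decays S F \<Longrightarrow> decays S G \<Longrightarrow> decays S (\<lambda>z. F z * G z)"
  using decays_mult_bounded[of S G F] unfolding decays_def by blast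

lemma decays_add:
  assumes "conical S" "decays S F" "decays S G" shows "decays S (\<lambda>z. F z + G z)"
  by (rule decays_dominated[OF assms(1) _ assms(2,3), of _ 1 1])
    (use assms in \<open>auto simp: decays_def norm_triangle_ineq intro!: holomorphic_intros\<close>)

lemma decays_subset: "decays S F \<Longrightarrow> T \<subseteq> S \<Longrightarrow> decays T F"
  unfolding decays_def by (blast intro: holomorphic_on_subset)

lemma decays_cong:
  assumes "conical S" "decays S F" "\<And>z. z \<in> S \<Longrightarrow> F z = G z" shows "decays S G"
proof (rule decays_dominated[OF assms(1) _ assms(2,2), of _ 1 0])
  show "G holomorphic_on S" using assms(2,3) by (auto simp: decays_def cong: holomorphic_cong)
qed (use assms(3) in auto)

lemma decays_rsector:
  assumes "0 < \<theta>" "\<theta> < pi / 2" "decays (sector \<theta>) F"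
  shows "decays (rsector \<theta>) F" and "decays (rsector \<theta>) (\<lambda>z. F (- z))"
proof -
  note iff = sector_iff_rsector[OF assms(1,2)]
  have sub: "rsector \<theta> \<subseteq> sector \<theta>" "uminus ` rsector \<theta> \<subseteq> sector \<theta>"
    using iff by (blast, metis iff image_subsetI minus_minus)
  show "decays (rsector \<theta>) F" by (rule decays_subset[OF assms(3) sub(1)])
  have "(F \<circ> uminus) holomorphic_on rsector \<theta>"
    by (rule holomorphic_on_compose_gen[OF _ _ sub(2)])
      (use assms(3) in \<open>auto simp: decays_def intro!: holomorphic_intros\<close>)
  then show "decays (rsector \<theta>) (\<lambda>z. F (- z))"
    unfolding decays_def
  proof (intro conjI ballI impI)
    show "(\<lambda>z. F (- z)) holomorphic_on rsector \<theta>" if "(F \<circ> uminus) holomorphic_on rsector \<theta>"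
      using that by (simp add: o_def)
    show "\<exists>M. \<forall>z\<in>rsector \<theta>. norm (F (- z)) \<le> M"
      using assms(3) sub(2) unfolding decays_def by blast
    fix d assume "d \<in> rsector \<theta>" "norm d = 1"
    then have "- d \<in> sector \<theta>" "norm (- d) = 1" using sub(2) by auto
    then have "(\<lambda>r. norm (F (of_real r * - d)) / r) integrable_on {0<..}"
      using assms(3) unfolding decays_def by blast
    then show "(\<lambda>r. norm (F (- (of_real r * d))) / r) integrable_on {0<..}" by simp
  qed
qed

lemma decays_ray_integrable:
  assumes "conical S" "decays S F" "d \<in> S" "norm d = 1"
  shows "C.ray_integrable d (\<lambda>z. F z / z)"
  unfolding C.ray_integrable_def
proof (rule dominated_integrable_Ioi(1))
  show "(\<lambda>r. norm (F (of_real r * d)) / r) integrable_on {0<..}" using assms by (auto simp: decays_def)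
  show "continuous_on {0<..} (\<lambda>r. F (of_real r * d) / (of_real r * d))"
    using assms by (intro continuous_intros decays_continuous) (auto simp: decays_def holomorphic_on_imp_continuous_on)
qed (use assms(4) in \<open>auto simp: norm_divide norm_mult\<close>)

text \<open>The lower boundary ray is rotated into the upper one inside the sector. The form
  \<open>F z / z\<close> fits \<open>ray_rotate\<close>: decay of \<open>F\<close> is its
  integrability along rays, and boundedness of \<open>F\<close> is the bound on
  \<open>norm z\<close> times its norm.\<close>

lemma sec_zero:
  assumes F: "decays (rsector \<theta>) F" and \<phi>: "0 < \<phi>" "\<phi> < \<theta>" "\<theta> < pi / 2"
  shows "C.sec \<phi> (\<lambda>z. F z / z) = 0"
proof -
  have W: "C.wedge (- \<phi>) \<phi> \<subseteq> rsector \<theta>"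
  proof
    fix z assume "z \<in> C.wedge (- \<phi>) \<phi>"
    then obtain r t where z: "z = of_real r * cis t" "r > 0" "t \<in> {- \<phi>..\<phi>}" by (auto simp: C.wedge_def)
    then have "cis t \<in> rsector \<theta>" using \<phi> by (intro cis_in_rsector) auto
    then show "z \<in> rsector \<theta>" unfolding z(1) using rsector_scale[OF z(2)] by blast
  qed
  have n0: "z \<noteq> 0" if "z \<in> rsector \<theta>" for z using that by (auto simp: rsector_def)
  have h: "(\<lambda>z. F z / z) holomorphic_on rsector \<theta>"
    using F n0 by (auto simp: decays_def intro!: holomorphic_intros)
  have W0: "z \<noteq> 0" if "z \<in> C.wedge (- \<phi>) \<phi>" for z using that W n0 by blast
  obtain M where M: "\<And>z. z \<in> rsector \<theta> \<Longrightarrow> norm (F z) \<le> M" using F by (auto simp: decays_def)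
  have "C.ray (cis (- \<phi>)) (\<lambda>z. F z / z) = C.ray (cis \<phi>) (\<lambda>z. F z / z)"
  proof (rule C.ray_rotate[where G' = "deriv (\<lambda>z. F z / z)" and M = M])
    show "((\<lambda>z. F z / z) has_derivative (\<lambda>h. h * deriv (\<lambda>z. F z / z) z)) (at z)" if "z \<in> C.wedge (- \<phi>) \<phi>" for z
      using holomorphic_derivI[OF h open_rsector, of z UNIV] that W
      unfolding has_field_derivative_def by (auto simp: mult.commute[of _ "deriv _ _"])
    show "continuous_on (C.wedge (- \<phi>) \<phi>) (deriv (\<lambda>z. F z / z))"
      by (rule continuous_on_subset[OF holomorphic_on_imp_continuous_on[OF holomorphic_deriv[OF h open_rsector]] W])
    show "(\<lambda>r. norm (F (of_real r * cis t) / (of_real r * cis t))) integrable_on {0<..}" if "t \<in> {- \<phi>..\<phi>}" for t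
    proof -
      have "cis t \<in> rsector \<theta>" using that \<phi> by (intro cis_in_rsector) auto
      then have "(\<lambda>r. norm (F (of_real r * cis t)) / r) integrable_on {0<..}" using F by (auto simp: decays_def)
      then show ?thesis
        by (rule integrable_eq) (auto simp: norm_divide norm_mult)
    qed
    show "norm z * norm (F z / z) \<le> M" if "z \<in> C.wedge (- \<phi>) \<phi>" for z
      using M[of z] that W W0[OF that] by (auto simp: norm_divide)
  qed (use \<phi> in auto)
  then show ?thesis by (simp add: C.sec_def)
qed

lemma ring_zero:
  assumes "decays (sector \<theta>) F" "0 < \<phi>" "\<phi> < \<theta>" "\<theta> < pi / 2"
  shows "C.ring \<phi> (\<lambda>z. F z / z) = 0"
proof -
  have \<theta>: "0 < \<theta>" using assms by simp
  note d = decays_rsector[OF \<theta> assms(4,1)]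
  have "C.sec \<phi> (\<lambda>z. (- 1 * F (- z)) / z) = 0"
    by (rule sec_zero[OF decays_cmult[OF conical_rsector d(2)] assms(2-4)])
  then show ?thesis
    using sec_zero[OF d(1) assms(2-4)] by (simp add: C.ring_sec)
qed

text \<open>The poles \<plusminus>\<i> are separated from the sector, so the modulus of
  \<open>1 + z\<^sup>2\<close> is comparable with \<open>1 + (norm z)\<^sup>2\<close>.\<close>

lemma decays_z_div_1_plus_square:
  assumes "0 < \<theta>" "\<theta> < pi / 2"
  shows "decays (sector \<theta>) (\<lambda>z. z / (1 + z\<^sup>2))"
    and "\<exists>c>0. \<forall>z\<in>sector \<theta>. c * (1 + (norm z)\<^sup>2) \<le> norm (1 + z\<^sup>2)"
proof -
  obtain c where c: "c > 0" "\<And>z w. \<bar>Im z\<bar> * cos \<theta> \<le> sin \<theta> * \<bar>Re z\<bar> \<Longrightarrow> w \<notin> sector (pi / 2) \<Longrightarrow> c * (norm z + norm w) \<le> norm (w - z)"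
    using cones_separated[of \<theta> "pi / 2"] assms by auto
  have i: "\<i> \<notin> sector (pi / 2)" "- \<i> \<notin> sector (pi / 2)" by (auto simp: sector_def)
  have ge: "c \<le> norm (z - \<i>)" "c \<le> norm (z + \<i>)" if "z \<in> sector \<theta>" for z
  proof -
    have z: "\<bar>Im z\<bar> * cos \<theta> \<le> sin \<theta> * \<bar>Re z\<bar>" using that by (simp add: sector_def)
    have "c * 1 \<le> c * (norm z + 1)" using c(1) by (intro mult_left_mono) auto
    then show "c \<le> norm (z - \<i>)" "c \<le> norm (z + \<i>)"
      using c(2)[OF z i(1)] c(2)[OF z i(2)] norm_minus_commute[of \<i> z] norm_minus_commute[of "- \<i>" z] by auto
  qed
  define K where "K = (1 + (norm \<i> + 1) / c)\<^sup>2"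
  have "1 + (norm \<i> + 1) / c > 0" by (rule add_pos_pos) (use c(1) in auto)
  then have K: "K > 0" unfolding K_def by (rule zero_less_power)
  have le: "1 + (norm z)\<^sup>2 \<le> K * norm (1 + z\<^sup>2)" if "z \<in> sector \<theta>" for z
    using one_plus_square_le[OF c(1) ge[OF that]] by (simp add: K_def add.commute)
  then show "\<exists>c>0. \<forall>z\<in>sector \<theta>. c * (1 + (norm z)\<^sup>2) \<le> norm (1 + z\<^sup>2)"
    using K by (intro exI[of _ "1 / K"]) (auto simp: field_simps)
  have n0: "1 + z\<^sup>2 \<noteq> 0" if "z \<in> sector \<theta>" for z
  proof
    assume "1 + z\<^sup>2 = 0"
    then have "1 + (norm z)\<^sup>2 \<le> 0" using le[OF that] by simp
    moreover have "0 \<le> (norm z)\<^sup>2" by simp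
    ultimately show False by linarith
  qed
  have bound: "norm (z / (1 + z\<^sup>2)) \<le> K * (norm z / (1 + (norm z)\<^sup>2))" if "z \<in> sector \<theta>" for z
  proof -
    have "norm z * (1 + (norm z)\<^sup>2) \<le> norm z * (K * norm (1 + z\<^sup>2))"
      using le[OF that] by (intro mult_left_mono) auto
    then show ?thesis using n0[OF that] by (simp add: norm_divide field_simps add_pos_nonneg)
  qed
  have sm: "x / (1 + x\<^sup>2) \<le> 1" for x :: real
    using sum_squares_bound[of x 1] by (simp add: divide_le_eq add_pos_nonneg) (smt (verit) zero_le_power2)
  show "decays (sector \<theta>) (\<lambda>z. z / (1 + z\<^sup>2))"
    unfolding decays_def
  proof (intro conjI ballI impI)
    show "(\<lambda>z. z / (1 + z\<^sup>2)) holomorphic_on sector \<theta>" using n0 by (intro holomorphic_intros)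
    have "norm (z / (1 + z\<^sup>2)) \<le> K * 1" if "z \<in> sector \<theta>" for z
      using order_trans[OF bound[OF that] mult_left_mono[OF sm[of "norm z"], of K]] K by simp
    then show "\<exists>M. \<forall>z\<in>sector \<theta>. norm (z / (1 + z\<^sup>2)) \<le> M" by blast
    fix d assume d: "d \<in> sector \<theta>" "norm d = 1"
    have s: "of_real r * d \<in> sector \<theta>" if "r > 0" for r using d(1) sector_scale[OF that] by simp
    show "(\<lambda>r. norm (of_real r * d / (1 + (of_real r * d)\<^sup>2)) / r) integrable_on {0<..}"
    proof (rule dominated_integrable_Ioi(1))
      show "(\<lambda>r. K * (1 / (1 + r\<^sup>2))) integrable_on {0<..}"
        using integrable_on_cmult_left[OF integrable_inverse_1_plus_square, of K] by simp
      show "continuous_on {0<..} (\<lambda>r. norm (of_real r * d / (1 + (of_real r * d)\<^sup>2)) / r)"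
        using n0[OF s] by (intro continuous_intros) auto
      fix r :: real assume r: "r > 0"
      have "norm (of_real r * d / (1 + (of_real r * d)\<^sup>2)) / r \<le> K * (r / (1 + r\<^sup>2)) / r"
        using bound[OF s[OF r]] r d(2) by (intro divide_right_mono) (auto simp: norm_mult)
      then show "norm (norm (of_real r * d / (1 + (of_real r * d)\<^sup>2)) / r) \<le> K * (1 / (1 + r\<^sup>2))"
        using r by simp
    qed
  qed
qed

lemma Im_cis_cnj:
  assumes "z \<in> rsector \<phi>" "0 \<le> cos \<phi>"
  shows "Im (cis \<phi> * cnj z) > 0" "Im (cis (- \<phi>) * cnj (- z)) > 0"
proof -
  have "\<bar>Im z * cos \<phi>\<bar> < sin \<phi> * Re z" using assms by (simp add: rsector_def abs_mult)
  then show "Im (cis \<phi> * cnj z) > 0" "Im (cis (- \<phi>) * cnj (- z)) > 0"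
    by (simp_all add: abs_less_iff mult.commute)
qed

lemma rsector_mono:
  assumes "0 < \<phi>" "\<phi> < \<theta>" "\<theta> < pi / 2"
  shows "rsector \<phi> \<subseteq> rsector \<theta>"
proof
  fix z assume z: "z \<in> rsector \<phi>"
  have p: "sin \<phi> > 0" "cos \<phi> > 0" "cos \<theta> > 0" "sin (\<theta> - \<phi>) > 0"
    using assms by (auto intro!: sin_gt_zero cos_gt_zero_pi)
  have "0 \<le> \<bar>Im z\<bar> * cos \<phi>" using p by simp
  then have "0 < sin \<phi> * Re z" using z by (auto simp: rsector_def)
  then have r: "Re z > 0" using p by (simp add: zero_less_mult_iff)
  have "cos \<phi> * (\<bar>Im z\<bar> * cos \<theta>) < cos \<theta> * (sin \<phi> * Re z)"
    using z p by (simp add: rsector_def mult.assoc mult.left_commute mult.commute)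
  also have "\<dots> < cos \<phi> * (sin \<theta> * Re z)"
    using mult_pos_pos[OF p(4) r] by (simp add: sin_diff algebra_simps)
  finally show "z \<in> rsector \<theta>" using p by (simp add: rsector_def)
qed

lemma sector_mono:
  assumes "0 < \<phi>" "\<phi> < \<theta>" "\<theta> < pi / 2"
  shows "sector \<phi> \<subseteq> sector \<theta>"
  using rsector_mono[OF assms] sector_iff_rsector[of \<phi>] sector_iff_rsector[of \<theta>] assms by auto

lemma rsector_Re_pos:
  assumes "0 < \<phi>" "\<phi> < pi / 2" "z \<in> rsector \<phi>" shows "Re z > 0"
proof -
  have p: "sin \<phi> > 0" "cos \<phi> > 0" using assms by (auto intro!: sin_gt_zero cos_gt_zero_pi)
  have "0 \<le> \<bar>Im z\<bar> * cos \<phi>" using p by simp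
  then have "0 < sin \<phi> * Re z" using assms(3) by (auto simp: rsector_def)
  then show ?thesis using p by (simp add: zero_less_mult_iff)
qed

text \<open>What is split off is not k(z)/(w - z), whose ray integral diverges at infinity, but k(z)
  * 2z/(w^2 - z^2). It has the same residue at \<open>z\<close>, no pole at 0, its second pole
  outside the sector, and quadratic decay; \<open>ray_log\<close> evaluates it. The remainder
  \<open>N\<close> is holomorphic in the sector and \<open>w * N w\<close> decays, so its integral
  vanishes by \<open>sec_zero\<close>.\<close>

lemma Cauchy_formula_rsector:
  assumes k: "decays (rsector \<theta>) k" and \<phi>: "0 < \<phi>" "\<phi> < \<theta>" "\<theta> < pi / 2" and z: "z \<in> rsector \<phi>"
  shows "C.sec \<phi> (\<lambda>w. k w / (w - z)) = 2 * pi * \<i> * k z"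
proof -
  have \<theta>0: "0 < \<theta>" using \<phi> by simp
  have z\<theta>: "z \<in> rsector \<theta>" using z rsector_mono[OF \<phi>] by blast
  have rez: "Re z > 0" using rsector_Re_pos[OF \<phi>(1) _ z] \<phi> by simp
  have cos\<phi>: "0 \<le> cos \<phi>" using \<phi> by (intro cos_ge_zero) auto
  have hk: "k holomorphic_on rsector \<theta>" using k by (simp add: decays_def)
  \<comment> \<open>Multiplying by \<open>w + z\<close> gives \<open>f z = 2 * z * k z\<close>. So
    the difference quotient of \<open>f\<close> at \<open>z\<close>, divided by
    \<open>w + z\<close>, is k(w)/(w - z) minus the term split off, with the singularity
    removed.\<close>
  define f where "f w = k w * (w + z)" for w
  have hf: "f holomorphic_on rsector \<theta>" unfolding f_def by (intro holomorphic_intros hk)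
  define h where "h w = (if w = z then deriv f z else (f w - f z) / (w - z))" for w
  have hh: "h holomorphic_on rsector \<theta>" unfolding h_def by (rule pole_lemma_open[OF hf open_rsector])
  have plus: "Re z \<le> norm (w + z)" if "w \<in> rsector \<theta>" for w
    using rsector_Re_pos[OF \<theta>0 \<phi>(3) that] complex_Re_le_cmod[of "w + z"] by simp
  have wz: "w + z \<noteq> 0" if "w \<in> rsector \<theta>" for w using plus[OF that] rez by auto
  define N where "N w = h w / (w + z)" for w
  have hN: "N holomorphic_on rsector \<theta>" unfolding N_def by (intro holomorphic_intros hh) (use wz in auto)
  have w0: "w \<noteq> 0" if "w \<in> rsector \<theta>" for w using rsector_Re_pos[OF \<theta>0 \<phi>(3) that] by auto
  obtain \<epsilon> where \<epsilon>: "\<epsilon> > 0" "cball z \<epsilon> \<subseteq> rsector \<theta>"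
    using open_contains_cball[of "rsector \<theta>"] open_rsector z\<theta> by blast
  \<comment> \<open>Near \<open>z\<close> the remainder is only known as a difference quotient and
    is bounded by compactness; away from \<open>z\<close> its explicit formula is estimated.\<close>
  have "compact ((\<lambda>w. N w * (1 + (norm w)\<^sup>2)) ` cball z \<epsilon>)"
    by (intro compact_continuous_image continuous_intros
        holomorphic_on_imp_continuous_on[OF holomorphic_on_subset[OF hN \<epsilon>(2)]] compact_cball)
  then obtain m where m: "\<And>w. w \<in> cball z \<epsilon> \<Longrightarrow> norm (N w * (1 + (norm w)\<^sup>2)) \<le> m"
    unfolding bounded_iff[symmetric] by (meson bounded_iff compact_imp_bounded imageI)
  \<comment> \<open>Off the ball the distance to \<open>z\<close> is at least \<epsilon>; the
    distance to \<open>- z\<close> is at least \<open>Re z\<close> in the whole right half.\<close>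
  define \<delta> where "\<delta> = min \<epsilon> (Re z)"
  have \<delta>: "\<delta> > 0" using \<epsilon>(1) rez by (simp add: \<delta>_def)
  define K where "K = 1 + (norm z + 1) / \<delta>"
  have K: "K \<ge> 1" using \<delta> by (simp add: K_def)
  let ?s = "\<lambda>w. norm w / (1 + (norm w)\<^sup>2)"
  have m0: "m \<ge> 0" using m[of z] \<epsilon>(1) by (meson centre_in_cball less_imp_le norm_ge_zero order_trans)
  have bound: "norm (w * N w) \<le> K * norm (k w) + (m + 2 * norm z * norm (k z) * K\<^sup>2) * ?s w"
    if w: "w \<in> rsector \<theta>" for w
  proof (cases "w \<in> cball z \<epsilon>")
    case True
    have p: "1 + (norm w)\<^sup>2 > 0" by (simp add: add_pos_nonneg)
    have "norm (N w * (1 + (norm w)\<^sup>2)) = norm (N w) * (1 + (norm w)\<^sup>2)"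
      using p by (metis abs_of_pos norm_mult norm_of_real of_real_1 of_real_add of_real_power)
    then have "norm (N w) \<le> m / (1 + (norm w)\<^sup>2)" using m[OF True] p by (simp add: field_simps)
    then have "norm (w * N w) \<le> norm w * (m / (1 + (norm w)\<^sup>2))"
      unfolding norm_mult by (intro mult_left_mono) auto
    also have "\<dots> = m * ?s w" by simp
    also have "\<dots> \<le> K * norm (k w) + (m + 2 * norm z * norm (k z) * K\<^sup>2) * ?s w"
    proof -
      have "0 \<le> K * norm (k w)" "0 \<le> 2 * norm z * norm (k z) * K\<^sup>2 * ?s w" using K p by auto
      then show ?thesis by (simp add: algebra_simps)
    qed
    finally show ?thesis .
  next
    case False
    then have d: "\<delta> \<le> norm (w - z)" "\<delta> \<le> norm (w + z)"
      using plus[OF w] by (auto simp: \<delta>_def dist_norm norm_minus_commute)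
    have ne: "w \<noteq> z" using d(1) \<delta> by auto
    have p: "1 + (norm w)\<^sup>2 > 0" by (simp add: add_pos_nonneg)
    have n2: "w\<^sup>2 - z\<^sup>2 \<noteq> 0"
    proof -
      have "w\<^sup>2 - z\<^sup>2 = (w - z) * (w + z)" by (simp add: power2_eq_square algebra_simps)
      then show ?thesis using ne wz[OF w] by simp
    qed
    have "N w = k w / (w - z) - 2 * z * k z / (w\<^sup>2 - z\<^sup>2)"
      using ne wz[OF w] n2 by (simp add: N_def h_def f_def divide_simps) (simp add: power2_eq_square algebra_simps)
    then have "norm (w * N w) \<le> norm (w * (k w / (w - z))) + norm (w * (2 * z * k z / (w\<^sup>2 - z\<^sup>2)))"
      by (metis norm_triangle_ineq4 right_diff_distrib)
    also have "norm (w * (k w / (w - z))) \<le> K * norm (k w)"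
    proof -
      have "norm w \<le> K * norm (w - z)" using one_plus_norm_le[OF \<delta> d(1)] by (simp add: K_def)
      then have "norm w * norm (k w) \<le> K * norm (w - z) * norm (k w)" by (intro mult_right_mono) auto
      then show ?thesis using ne by (simp add: norm_mult norm_divide field_simps)
    qed
    also have "norm (w * (2 * z * k z / (w\<^sup>2 - z\<^sup>2))) \<le> 2 * norm z * norm (k z) * K\<^sup>2 * ?s w"
    proof -
      have "1 + (norm w)\<^sup>2 \<le> K\<^sup>2 * norm (w\<^sup>2 - z\<^sup>2)" using one_plus_square_le[OF \<delta> d] by (simp add: K_def)
      then have "1 / norm (w\<^sup>2 - z\<^sup>2) \<le> K\<^sup>2 / (1 + (norm w)\<^sup>2)" using n2 p by (simp add: field_simps)
      then have "(norm w * (2 * norm z * norm (k z))) * (1 / norm (w\<^sup>2 - z\<^sup>2)) \<le> (norm w * (2 * norm z * norm (k z))) * (K\<^sup>2 / (1 + (norm w)\<^sup>2))"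
        by (intro mult_left_mono) auto
      then show ?thesis by (simp add: norm_mult norm_divide mult_ac)
    qed
    also have "K * norm (k w) + 2 * norm z * norm (k z) * K\<^sup>2 * ?s w \<le> K * norm (k w) + (m + 2 * norm z * norm (k z) * K\<^sup>2) * ?s w"
    proof -
      have "0 \<le> m * ?s w" using m0 p by simp
      then show ?thesis unfolding distrib_right by linarith
    qed
    finally show ?thesis by simp
  qed
  have dq: "decays (rsector \<theta>) (\<lambda>z. z / (1 + z\<^sup>2))"
    by (rule decays_rsector(1)[OF \<theta>0 \<phi>(3) decays_z_div_1_plus_square(1)[OF \<theta>0 \<phi>(3)]])
  have sle: "?s w \<le> norm (w / (1 + w\<^sup>2))" if w: "w \<in> rsector \<theta>" for w
  proof -
    obtain c where "c > 0" "c * (1 + (norm w)\<^sup>2) \<le> norm (1 + w\<^sup>2)"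
      using decays_z_div_1_plus_square(2)[OF \<theta>0 \<phi>(3)] w sector_iff_rsector[OF \<theta>0 \<phi>(3)] by blast
    then have "norm (1 + w\<^sup>2) > 0" by (meson add_pos_nonneg less_le_trans mult_pos_pos zero_le_power2 zero_less_one)
    moreover have "norm (1 + w\<^sup>2) \<le> 1 + (norm w)\<^sup>2" using norm_triangle_ineq[of 1 "w\<^sup>2"] by (simp add: norm_power)
    ultimately show ?thesis unfolding norm_divide by (intro divide_left_mono mult_pos_pos) (auto intro!: add_pos_nonneg)
  qed
  have dN: "decays (rsector \<theta>) (\<lambda>w. w * N w)"
  proof (rule decays_dominated[OF conical_rsector _ k dq])
    show "(\<lambda>w. w * N w) holomorphic_on rsector \<theta>" by (intro holomorphic_intros hN)
    fix w assume w: "w \<in> rsector \<theta>"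
    have "0 \<le> m + 2 * norm z * norm (k z) * K\<^sup>2" using m0 by simp
    from mult_left_mono[OF sle[OF w] this] bound[OF w]
    show "norm (w * N w) \<le> K * norm (k w) + (m + 2 * norm z * norm (k z) * K\<^sup>2) * norm (w / (1 + w\<^sup>2))" by linarith
  qed
  have cis: "cis \<phi> \<in> rsector \<theta>" "cis (- \<phi>) \<in> rsector \<theta>" using \<phi> by (auto intro!: cis_in_rsector)
  have split: "C.ray d (\<lambda>w. k w / (w - z)) = C.ray d (\<lambda>w. (w * N w) / w) + k z * C.ray d (\<lambda>w. 2 * z / (w\<^sup>2 - z\<^sup>2))"
    if d: "d \<in> rsector \<theta>" "norm d = 1" and ri: "C.ray_integrable d (\<lambda>w. 2 * z / (w\<^sup>2 - z\<^sup>2))"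
      and nd: "\<And>r. r > 0 \<Longrightarrow> of_real r * d \<noteq> z" for d
  proof -
    have lin: "C.ray_integrable d (\<lambda>w. k z * (2 * z / (w\<^sup>2 - z\<^sup>2)))"
      "C.ray d (\<lambda>w. k z * (2 * z / (w\<^sup>2 - z\<^sup>2))) = k z * C.ray d (\<lambda>w. 2 * z / (w\<^sup>2 - z\<^sup>2))"
      by (rule C.ray_linear[OF ri bounded_linear_mult_right], simp add: mult_ac)+
    have "C.ray d (\<lambda>w. k w / (w - z)) = C.ray d (\<lambda>w. (w * N w) / w + k z * (2 * z / (w\<^sup>2 - z\<^sup>2)))"
    proof (rule C.ray_cong)
      fix r :: real assume r: "r > 0"
      define w where "w = of_real r * d"
      have w: "w \<in> rsector \<theta>" using d(1) rsector_scale[OF r] by (simp add: w_def)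
      have ne: "w \<noteq> z" using nd[OF r] by (simp add: w_def)
      have n2: "w\<^sup>2 - z\<^sup>2 = (w - z) * (w + z)" by (simp add: power2_eq_square algebra_simps)
      have "k w / (w - z) = (w * N w) / w + k z * (2 * z / (w\<^sup>2 - z\<^sup>2))"
        unfolding n2 using ne wz[OF w] w0[OF w] by (simp add: N_def h_def f_def divide_simps)
      then show "k (of_real r * d) / (of_real r * d - z) = (of_real r * d * N (of_real r * d)) / (of_real r * d) + k z * (2 * z / ((of_real r * d)\<^sup>2 - z\<^sup>2))"
        by (simp add: w_def)
    qed
    also have "\<dots> = C.ray d (\<lambda>w. (w * N w) / w) + C.ray d (\<lambda>w. k z * (2 * z / (w\<^sup>2 - z\<^sup>2)))"
      by (rule C.ray_add[OF decays_ray_integrable[OF conical_rsector dN d] lin(1)])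
    finally show ?thesis using lin(2) by simp
  qed
  have not_in: "of_real r * cis \<phi> \<noteq> z" "of_real r * cis (- \<phi>) \<noteq> z" if "r > 0" for r
  proof -
    have "cis \<phi> \<notin> rsector \<phi>" "cis (- \<phi>) \<notin> rsector \<phi>"
      using mult_right_mono[OF abs_ge_self[of "sin \<phi>"] cos\<phi>] by (auto simp: rsector_def)
    then show "of_real r * cis \<phi> \<noteq> z" "of_real r * cis (- \<phi>) \<noteq> z"
      using z rsector_scale[OF that] by blast+
  qed
  have l1: "C.ray_integrable (cis \<phi>) (\<lambda>w. 2 * z / (w\<^sup>2 - z\<^sup>2))" "C.ray (cis \<phi>) (\<lambda>w. 2 * z / (w\<^sup>2 - z\<^sup>2)) = - \<i> * pi"
    by (rule ray_log; use Im_cis_cnj[OF z] cos\<phi> in simp)+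
  \<comment> \<open>On the lower ray the sign condition of \<open>ray_log\<close> holds for
    \<open>- z\<close>. The integrand is odd in \<open>z\<close>, so the value is the negative of
    that on the upper ray.\<close>
  have l2: "C.ray_integrable (cis (- \<phi>)) (\<lambda>w. 2 * z / (w\<^sup>2 - z\<^sup>2))" "C.ray (cis (- \<phi>)) (\<lambda>w. 2 * z / (w\<^sup>2 - z\<^sup>2)) = \<i> * pi"
  proof -
    have a: "C.ray_integrable (cis (- \<phi>)) (\<lambda>w. 2 * (- z) / (w\<^sup>2 - (- z)\<^sup>2))" "C.ray (cis (- \<phi>)) (\<lambda>w. 2 * (- z) / (w\<^sup>2 - (- z)\<^sup>2)) = - \<i> * pi"
      by (rule ray_log; use Im_cis_cnj[OF z] cos\<phi> in simp)+
    have e: "(\<lambda>w. - 1 * (2 * (- z) / (w\<^sup>2 - (- z)\<^sup>2))) = (\<lambda>w. 2 * z / (w\<^sup>2 - z\<^sup>2))" by (simp add: fun_eq_iff)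
    show "C.ray_integrable (cis (- \<phi>)) (\<lambda>w. 2 * z / (w\<^sup>2 - z\<^sup>2))" "C.ray (cis (- \<phi>)) (\<lambda>w. 2 * z / (w\<^sup>2 - z\<^sup>2)) = \<i> * pi"
      using C.ray_linear[OF a(1) bounded_linear_mult_right[of "- 1"]] a(2) unfolding e by simp_all
  qed
  have alg: "(A + c * (\<i> * pi)) - (B + c * (- \<i> * pi)) = 2 * pi * \<i> * c" if "A - B = 0" for A B c :: complex
    using that by (simp add: algebra_simps)
  have "C.ray (cis \<phi>) (\<lambda>w. k w / (w - z)) = C.ray (cis \<phi>) (\<lambda>w. (w * N w) / w) + k z * (- \<i> * pi)"
    by (subst l1(2)[symmetric], rule split[OF cis(1) norm_cis l1(1)], rule not_in(1))
  moreover have "C.ray (cis (- \<phi>)) (\<lambda>w. k w / (w - z)) = C.ray (cis (- \<phi>)) (\<lambda>w. (w * N w) / w) + k z * (\<i> * pi)"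
    by (subst l2(2)[symmetric], rule split[OF cis(2) norm_cis l2(1)], rule not_in(2))
  ultimately show ?thesis
    unfolding C.sec_def by (simp only: alg[OF sec_zero[OF dN \<phi>, unfolded C.sec_def]])
qed

text \<open>If \<open>z\<close> is in the right half, the integrand has no pole in the left half,
  which therefore contributes 0. The other case follows by the substitution w -> -w.\<close>

lemma Cauchy_formula_sector:
  assumes k: "decays (sector \<theta>) k" and \<phi>: "0 < \<phi>" "\<phi> < \<theta>" "\<theta> < pi / 2" and z: "z \<in> sector \<phi>"
  shows "C.ring \<phi> (\<lambda>w. k w / (w - z)) = 2 * pi * \<i> * k z"
proof -
  have \<theta>0: "0 < \<theta>" and \<phi>2: "\<phi> < pi / 2" using \<phi> by auto
  have right: "C.ring \<phi> (\<lambda>w. l w / (w - z)) = 2 * pi * \<i> * l z"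
    if l: "decays (rsector \<theta>) l" "decays (rsector \<theta>) (\<lambda>z. l (- z))" and z: "z \<in> rsector \<phi>" for l z
  proof -
    have rez: "Re z > 0" by (rule rsector_Re_pos[OF \<phi>(1) \<phi>2 z])
    have plus: "Re z \<le> norm (w - (- z))" if "w \<in> rsector \<theta>" for w
      using rsector_Re_pos[OF \<theta>0 \<phi>(3) that] complex_Re_le_cmod[of "w + z"] by simp
    have wz: "w + z \<noteq> 0" if "w \<in> rsector \<theta>" for w using plus[OF that] rez by auto
    have b: "norm (- w / (w + z)) \<le> 1 + (norm (- z) + 1) / Re z" if "w \<in> rsector \<theta>" for w
      using one_plus_norm_le[OF rez plus[OF that]] wz[OF that] by (simp add: norm_divide divide_le_eq)
    have "decays (rsector \<theta>) (\<lambda>w. (- w / (w + z)) * l (- w))"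
      by (rule decays_mult_bounded[OF conical_rsector l(2) _ b]) (use wz in \<open>auto intro!: holomorphic_intros\<close>)
    from sec_zero[OF this \<phi>]
    have "C.sec \<phi> (\<lambda>w. (- w / (w + z)) * l (- w) / w) = 0" .
    moreover have "C.sec \<phi> (\<lambda>w. (- w / (w + z)) * l (- w) / w) = C.sec \<phi> (\<lambda>w. l (- w) / (- w - z))"
    proof -
      have "C.ray d (\<lambda>w. (- w / (w + z)) * l (- w) / w) = C.ray d (\<lambda>w. l (- w) / (- w - z))" if "d \<in> rsector \<theta>" for d
      proof (rule C.ray_cong)
        fix r :: real assume r: "r > 0"
        define w where "w = of_real r * d"
        have w: "w \<in> rsector \<theta>" using that rsector_scale[OF r] by (simp add: w_def)
        have "w \<noteq> 0" using rsector_Re_pos[OF \<theta>0 \<phi>(3) w] by auto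
        moreover have "- w - z \<noteq> 0" using wz[OF w] by (metis add.inverse_inverse minus_add_distrib neg_equal_0_iff_equal uminus_add_conv_diff add.commute)
        ultimately have "(- w / (w + z)) * l (- w) / w = l (- w) / (- w - z)"
          using wz[OF w] by (simp add: divide_simps) (simp add: algebra_simps)
        then show "(- (of_real r * d) / (of_real r * d + z)) * l (- (of_real r * d)) / (of_real r * d) = l (- (of_real r * d)) / (- (of_real r * d) - z)"
          by (simp add: w_def)
      qed
      moreover have "cis \<phi> \<in> rsector \<theta>" "cis (- \<phi>) \<in> rsector \<theta>" using \<phi> by (auto intro!: cis_in_rsector)
      ultimately show ?thesis by (simp add: C.sec_def)
    qed
    ultimately show ?thesis
      using Cauchy_formula_rsector[OF l(1) \<phi> z] by (simp add: C.ring_sec)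
  qed
  note d = decays_rsector[OF \<theta>0 \<phi>(3) k]
  show ?thesis
  proof (cases "z \<in> rsector \<phi>")
    case True
    then show ?thesis using right[OF d] by simp
  next
    case False
    then have z': "- z \<in> rsector \<phi>" using sector_iff_rsector[OF \<phi>(1) \<phi>2] z by auto
    have "C.ring \<phi> (\<lambda>w. k (- w) / (w - (- z))) = 2 * pi * \<i> * k (- (- z))"
      by (rule right[OF d(2) _ z']) (use d(1) in simp)
    moreover have "C.ring \<phi> (\<lambda>w. k (- w) / (w - (- z))) = C.ring \<phi> (\<lambda>w. - (k (- w) / (- w - z)))"
      by (rule arg_cong[where f = "C.ring \<phi>"]) (auto simp: fun_eq_iff minus_divide_right)
    moreover have "C.ring \<phi> (\<lambda>w. - (k (- w) / (- w - z))) = - C.ring \<phi> (\<lambda>w. - (k w / (w - z)))"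
      by (rule C.ring_minus)
    moreover have "C.ring \<phi> (\<lambda>w. - (k w / (w - z))) = - C.ring \<phi> (\<lambda>w. k w / (w - z))"
      by (simp add: C.ring_def C.ray_def)
    ultimately show ?thesis by simp
  qed
qed


section \<open>The Riesz-Dunford calculus of an abstract bisectorial resolvent\<close>

lemma uminus_sector [simp]: "- z \<in> sector \<theta> \<longleftrightarrow> z \<in> sector \<theta>"
  by (simp add: sector_def)

lemma cis_notin_sector:
  assumes "0 < \<phi>" "\<phi> < pi / 2" "\<phi> \<le> t" "t \<le> pi - \<phi>"
  shows "cis t \<notin> sector \<phi>"
proof -
  have "0 \<le> sin (t - \<phi>)" "0 \<le> sin (t + \<phi>)" "0 \<le> sin t" using assms by (auto intro!: sin_ge_zero)
  then show ?thesis by (auto simp: sector_def sin_diff sin_add abs_if mult.commute not_less)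
qed

lemma cis_in_sector:
  assumes "0 < \<phi>" "\<phi> < \<theta>" "\<theta> < pi / 2"
  shows "cis \<phi> \<in> sector \<theta>" "cis (- \<phi>) \<in> sector \<theta>"
  using assms sector_iff_rsector[of \<theta>] cis_in_rsector[of \<phi> \<theta>] cis_in_rsector[of "- \<phi>" \<theta>] by auto

lemma cnj_sector: "cis (- t) \<in> sector \<phi> \<longleftrightarrow> cis t \<in> sector \<phi>"
  by (simp add: sector_def)

lemma sector_minus_cis: "cis (pi + t) = - cis t" "cis (pi - t) = - cis (- t)"
  by (auto simp: complex_eq_iff)

text \<open>It contains the boundary rays of the sector of angle \<phi>, so that the resolvent
  estimate for \<phi> applies to integrals over exactly these rays.\<close>

definition outside :: "real \<Rightarrow> complex set" where
  "outside \<phi> = {z. z \<noteq> 0 \<and> z \<notin> sector \<phi>}"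

lemma outside_mono:
  assumes "0 < \<phi>" "\<phi> < \<theta>" "\<theta> < pi / 2" shows "outside \<theta> \<subseteq> outside \<phi>"
  using sector_mono[OF assms] by (auto simp: outside_def)

lemma outside_scale: "r > 0 \<Longrightarrow> of_real r * z \<in> outside \<phi> \<longleftrightarrow> z \<in> outside \<phi>"
  by (auto simp: outside_def sector_scale simp flip: scaleR_conv_of_real)
     (metis sector_scale scaleR_conv_of_real)+

lemma outside_strict:
  assumes "0 < \<phi>" "\<phi> < \<theta>" "\<theta> < pi / 2" "z \<in> outside \<theta>"
  shows "sin \<phi> * \<bar>Re z\<bar> < \<bar>Im z\<bar> * cos \<phi>"
proof -
  have p: "sin \<phi> > 0" "cos \<phi> > 0" "sin \<theta> > 0" "cos \<theta> > 0" "sin (\<theta> - \<phi>) > 0"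
    using assms by (auto intro!: sin_gt_zero cos_gt_zero_pi)
  have le: "sin \<theta> * \<bar>Re z\<bar> \<le> \<bar>Im z\<bar> * cos \<theta>" and z0: "z \<noteq> 0"
    using assms(4) by (auto simp: outside_def sector_def)
  have "cos \<theta> * (sin \<phi> * \<bar>Re z\<bar>) < cos \<theta> * (\<bar>Im z\<bar> * cos \<phi>)"
  proof (cases "Re z = 0")
    case True
    then have "Im z \<noteq> 0" using z0 by (simp add: complex_eq_iff)
    then show ?thesis using True p by simp
  next
    case False
    then have "0 < sin (\<theta> - \<phi>) * \<bar>Re z\<bar>" using p by simp
    then have "cos \<theta> * (sin \<phi> * \<bar>Re z\<bar>) < cos \<phi> * (sin \<theta> * \<bar>Re z\<bar>)"
      by (simp add: sin_diff algebra_simps)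
    also have "\<dots> \<le> cos \<phi> * (\<bar>Im z\<bar> * cos \<theta>)" using le p by (intro mult_left_mono) auto
    finally show ?thesis by (simp add: mult_ac)
  qed
  then show ?thesis using p by simp
qed

text \<open>Allows the resolvent to be differentiated at every point of
  \<open>outside \<theta>\<close>, boundary points included, by means of the estimate for a smaller
  angle.\<close>

lemma outside_interior:
  assumes "0 < \<phi>" "\<phi> < \<theta>" "\<theta> < pi / 2"
  shows "outside \<theta> \<subseteq> interior (outside \<phi>)"
proof -
  let ?U = "{z. sin \<phi> * \<bar>Re z\<bar> < \<bar>Im z\<bar> * cos \<phi>}"
  have "open ?U" by (intro open_Collect_less continuous_intros)
  moreover have "?U \<subseteq> outside \<phi>" by (auto simp: outside_def sector_def)
  moreover have "outside \<theta> \<subseteq> ?U" using outside_strict[OF assms] by auto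
  ultimately show ?thesis by (meson interior_maximal order_trans)
qed

lemma dirs_props:
  assumes "0 < \<phi>" "\<phi> < \<theta>" "\<theta> < pi / 2" "d \<in> complex_action.dirs \<phi>"
  shows "d \<in> sector \<theta>" "d \<in> outside \<phi>" "norm d = 1"
proof -
  have "cis \<phi> \<notin> sector \<phi>" using assms by (intro cis_notin_sector) auto
  then show "d \<in> sector \<theta>" "d \<in> outside \<phi>" "norm d = 1"
    using assms(4) cis_in_sector[OF assms(1-3)] cnj_sector[of \<phi> \<phi>]
    by (auto simp: C.dirs_def outside_def)
qed

text \<open>\<open>R z\<close> stands for (z - T)^{-1}, but the operator itself does not occur:
  commutation with complex scalars, the resolvent identity and the bound C / |z| on each
  \<open>outside \<phi>\<close> carry the whole calculus.\<close>

locale sectorial_resolvent = complex_action cs for cs :: "complex \<Rightarrow> 'a::banach \<Rightarrow> 'a" (infixr "\<cdot>" 75) +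
  fixes R :: "complex \<Rightarrow> 'a \<Rightarrow>\<^sub>L 'a" and \<omega> :: real
  assumes \<omega>: "0 < \<omega>" "\<omega> < pi / 2"
    and R_cs: "\<lbrakk>\<omega> < \<phi>; \<phi> < pi / 2; z \<in> outside \<phi>\<rbrakk> \<Longrightarrow> R z (c \<cdot> v) = c \<cdot> R z v"
    and R_id: "\<lbrakk>\<omega> < \<phi>; \<phi> < pi / 2; z \<in> outside \<phi>; w \<in> outside \<phi>\<rbrakk> \<Longrightarrow> R z v - R w v = (w - z) \<cdot> R z (R w v)"
    and R_bound: "\<lbrakk>\<omega> < \<phi>; \<phi> < pi / 2\<rbrakk> \<Longrightarrow> \<exists>C. \<forall>z\<in>outside \<phi>. norm (R z) \<le> C / norm z"
begin

lemma R_bound_apply: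
  assumes "\<omega> < \<phi>" "\<phi> < pi / 2"
  shows "\<exists>C\<ge>0. \<forall>z\<in>outside \<phi>. \<forall>v. norm (R z v) \<le> C / norm z * norm v"
proof -
  obtain C where C: "\<And>z. z \<in> outside \<phi> \<Longrightarrow> norm (R z) \<le> C / norm z" using R_bound[OF assms] by blast
  have b: "norm (R z) \<le> \<bar>C\<bar> / norm z" if "z \<in> outside \<phi>" for z
    by (rule order_trans[OF C[OF that] divide_right_mono]) auto
  have "norm (R z v) \<le> \<bar>C\<bar> / norm z * norm v" if "z \<in> outside \<phi>" for z v
    by (rule order_trans[OF norm_blinfun mult_right_mono[OF b[OF that] norm_ge_zero]])
  then show ?thesis using abs_ge_zero by blast
qed

lemma R_commute:
  assumes "\<omega> < \<phi>" "\<phi> < pi / 2" "z \<in> outside \<phi>" "w \<in> outside \<phi>"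
  shows "R z (R w v) = R w (R z v)"
proof (cases "z = w")
  case False
  have "(w - z) \<cdot> R z (R w v) = - ((z - w) \<cdot> R w (R z v))"
    using R_id[OF assms, of v] R_id[OF assms(1,2,4,3), of v] by (metis minus_diff_eq)
  then have "(w - z) \<cdot> R z (R w v) = (w - z) \<cdot> R w (R z v)" by (metis minus_diff_eq minus_left)
  then have "(1 / (w - z)) \<cdot> (w - z) \<cdot> R z (R w v) = (1 / (w - z)) \<cdot> (w - z) \<cdot> R w (R z v)" by simp
  then show ?thesis using False by (simp flip: cs_assoc)
qed simp

lemma R_product:
  assumes "\<omega> < \<phi>" "\<phi> < pi / 2" "z \<in> outside \<phi>" "w \<in> outside \<phi>" "z \<noteq> w"
  shows "R z (R w v) = (1 / (w - z)) \<cdot> (R z v - R w v)"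
  unfolding R_id[OF assms(1-4)] using assms(5) by (simp flip: cs_assoc)

lemma R_continuous:
  assumes \<phi>: "\<omega> < \<phi>" "\<phi> < pi / 2"
  shows "continuous_on (outside \<phi>) R"
proof -
  obtain C where C: "C \<ge> 0" and Cv: "\<And>z v. z \<in> outside \<phi> \<Longrightarrow> norm (R z v) \<le> C / norm z * norm v"
    using R_bound_apply[OF \<phi>] by blast
  obtain K where K: "K > 0" "\<And>c v. norm (c \<cdot> v) \<le> norm c * norm v * K" using norm_cs by blast
  have le: "norm (R w - R z) \<le> norm (w - z) * (C / norm w * (C / norm z)) * K"
    if zw: "z \<in> outside \<phi>" "w \<in> outside \<phi>" for z w
  proof (rule norm_blinfun_bound)
    show "0 \<le> norm (w - z) * (C / norm w * (C / norm z)) * K" using C K(1) by simp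
    fix v
    have "norm ((R w - R z) v) = norm ((z - w) \<cdot> R w (R z v))"
      using R_id[OF \<phi> zw(2,1)] by (simp add: blinfun.diff_left)
    also have "\<dots> \<le> norm (z - w) * norm (R w (R z v)) * K" by (rule K(2))
    also have "norm (R w (R z v)) \<le> C / norm w * (C / norm z * norm v)"
      using Cv[OF zw(2), of "R z v"] mult_left_mono[OF Cv[OF zw(1), of v], of "C / norm w"] C by simp
    finally show "norm ((R w - R z) v) \<le> norm (w - z) * (C / norm w * (C / norm z)) * K * norm v"
      using K(1) by (simp add: norm_minus_commute[of z w] mult_left_mono mult_right_mono mult_ac)
  qed
  show ?thesis
    unfolding continuous_on_def
  proof
    fix z assume z: "z \<in> outside \<phi>"
    have z0: "z \<noteq> 0" using z by (simp add: outside_def)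
    have "((\<lambda>w. norm (w - z) * (C / norm w * (C / norm z)) * K) \<longlongrightarrow> norm (z - z) * (C / norm z * (C / norm z)) * K) (at z within outside \<phi>)"
      using z0 by (intro tendsto_intros) auto
    then have l: "((\<lambda>w. norm (w - z) * (C / norm w * (C / norm z)) * K) \<longlongrightarrow> 0) (at z within outside \<phi>)" by simp
    have "\<forall>\<^sub>F w in at z within outside \<phi>. norm (R w - R z) \<le> norm (w - z) * (C / norm w * (C / norm z)) * K"
      using le[OF z] by (auto simp: eventually_at_filter)
    from Lim_null_comparison[OF this l] show "(R \<longlongrightarrow> R z) (at z within outside \<phi>)"
      by (rule Lim_null[THEN iffD2])
  qed
qed

lemma R_has_derivative:
  assumes \<phi>: "\<omega> < \<phi>" "\<phi> < pi / 2" and z: "z \<in> outside \<phi>"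
  shows "((\<lambda>z. R z v) has_derivative (\<lambda>h. h \<cdot> (- R z (R z v)))) (at z)"
proof -
  \<comment> \<open>An angle strictly between \<omega> and \<phi>, for which \<open>z\<close> is an
    interior point of the domain of continuity.\<close>
  define \<psi> where "\<psi> = (\<omega> + \<phi>) / 2"
  have \<psi>: "\<omega> < \<psi>" "\<psi> < \<phi>" "\<psi> < pi / 2" "0 < \<psi>" using \<phi> \<omega> by (auto simp: \<psi>_def)
  have int: "z \<in> interior (outside \<psi>)" using outside_interior[OF \<psi>(4,2) \<phi>(2)] z by blast
  have z': "z \<in> outside \<psi>" using int interior_subset by blast
  obtain K where K: "K > 0" "\<And>c v. norm (c \<cdot> v) \<le> norm c * norm v * K" using norm_cs by blast
  have cont: "isCont R z" using R_continuous[OF \<psi>(1,3)] int by (metis continuous_on_interior)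
  have "((\<lambda>w. norm (R w v - R z v - (w - z) \<cdot> (- R z (R z v))) / norm (w - z)) \<longlongrightarrow> 0) (at z)"
  proof (rule Lim_null_comparison)
    show "\<forall>\<^sub>F w in at z. norm (norm (R w v - R z v - (w - z) \<cdot> (- R z (R z v))) / norm (w - z)) \<le> norm (R z - R w) * norm (R z v) * K"
    proof -
      have "\<forall>\<^sub>F w in at z. w \<in> interior (outside \<psi>) \<and> w \<noteq> z"
        using eventually_at_in_open[OF open_interior int] by (simp add: eventually_conj_iff)
      then show ?thesis
      proof eventually_elim
        case (elim w)
        then have w: "w \<in> outside \<psi>" "w \<noteq> z" using interior_subset by blast+
        have "R w v - R z v - (w - z) \<cdot> (- R z (R z v)) = (w - z) \<cdot> (R z - R w) (R z v)"
          unfolding R_id[OF \<psi>(1,3) w(1) z'] using minus_left[of "w - z"]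
          by (simp add: blinfun.diff_left diff_right minus_right)
        then have "norm (R w v - R z v - (w - z) \<cdot> (- R z (R z v))) \<le> norm (w - z) * norm ((R z - R w) (R z v)) * K"
          using K(2) by simp
        also have "\<dots> \<le> norm (w - z) * (norm (R z - R w) * norm (R z v)) * K"
          using K(1) by (intro mult_right_mono mult_left_mono norm_blinfun) auto
        finally show ?case using w(2) by (simp add: divide_le_eq mult_ac)
      qed
    qed
    have "((\<lambda>w. norm (R z - R w) * norm (R z v) * K) \<longlongrightarrow> norm (R z - R z) * norm (R z v) * K) (at z)"
      using cont by (intro tendsto_intros) (simp add: isCont_def)
    then show "((\<lambda>w. norm (R z - R w) * norm (R z v) * K) \<longlongrightarrow> 0) (at z)" by simp
  qed
  moreover have "bounded_linear (\<lambda>h. h \<cdot> (- R z (R z v)))" by (rule bounded_linear_left)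
  ultimately show ?thesis unfolding has_derivative_iff_norm by simp
qed

text \<open>The term with \<open>H\<close> is the trace of a principal part that is subtracted when
  a ray crosses \<i> or - \<i>; for a change of angle alone \<open>H\<close> is 0.\<close>

lemma ray_rotate_resolvent:
  assumes ab: "\<alpha> \<le> \<beta>" and \<phi>: "\<omega> < \<phi>" "\<phi> < pi / 2"
    and S: "open S" "F holomorphic_on S" "H holomorphic_on S"
    and W: "\<And>r t. r > 0 \<Longrightarrow> t \<in> {\<alpha>..\<beta>} \<Longrightarrow> of_real r * cis t \<in> S \<and> cis t \<in> outside \<phi>"
    and int: "\<And>t. t \<in> {\<alpha>..\<beta>} \<Longrightarrow>
      (\<lambda>r. norm (F (of_real r * cis t) \<cdot> R (of_real r * cis t) u + H (of_real r * cis t) \<cdot> v)) integrable_on {0<..}"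
    and bdd: "\<And>z. z \<in> wedge \<alpha> \<beta> \<Longrightarrow> norm z * norm (F z \<cdot> R z u + H z \<cdot> v) \<le> M"
  shows "ray (cis \<alpha>) (\<lambda>z. F z \<cdot> R z u + H z \<cdot> v) = ray (cis \<beta>) (\<lambda>z. F z \<cdot> R z u + H z \<cdot> v)"
proof -
  have W': "wedge \<alpha> \<beta> \<subseteq> S" "wedge \<alpha> \<beta> \<subseteq> outside \<phi>"
    using W outside_scale by (auto simp: wedge_def)
  define G' where "G' z = deriv F z \<cdot> R z u + F z \<cdot> (- R z (R z u)) + deriv H z \<cdot> v" for z
  show ?thesis
  proof (rule ray_rotate[OF ab _ _ int bdd])
    fix z assume "z \<in> wedge \<alpha> \<beta>"
    then have z: "z \<in> S" "z \<in> outside \<phi>" using W' by auto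
    have f: "(F has_derivative (\<lambda>h. deriv F z * h)) (at z)" "(H has_derivative (\<lambda>h. deriv H z * h)) (at z)"
      using holomorphic_derivI[OF S(2,1) z(1), of UNIV] holomorphic_derivI[OF S(3,1) z(1), of UNIV]
      by (simp_all add: has_field_derivative_def)
    have e: "(\<lambda>h. (F z \<cdot> (h \<cdot> (- R z (R z u))) + (deriv F z * h) \<cdot> R z u) + (deriv H z * h) \<cdot> v) = (\<lambda>h. h \<cdot> G' z)"
      by (simp add: fun_eq_iff G'_def add_right cs_assoc[symmetric] mult_ac)
    show "((\<lambda>z. F z \<cdot> R z u + H z \<cdot> v) has_derivative (\<lambda>h. h \<cdot> G' z)) (at z)"
      using has_derivative_add[OF FDERIV[OF f(1) R_has_derivative[OF \<phi> z(2), of u]]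
          bounded_linear.has_derivative[OF bounded_linear_left[of v] f(2)]] unfolding e .
  next
    have "continuous_on (wedge \<alpha> \<beta>) R" by (rule continuous_on_subset[OF R_continuous[OF \<phi>] W'(2)])
    moreover have "continuous_on (wedge \<alpha> \<beta>) (deriv F)" "continuous_on (wedge \<alpha> \<beta>) (deriv H)" "continuous_on (wedge \<alpha> \<beta>) F"
      by (rule continuous_on_subset[OF holomorphic_on_imp_continuous_on W'(1)], intro holomorphic_deriv S)+
    ultimately show "continuous_on (wedge \<alpha> \<beta>) G'"
      unfolding G'_def
      by (intro continuous_on_add continuous_on continuous_on_minus continuous_intros blinfun.continuous_on)
  qed
qed

definition \<Phi> :: "real \<Rightarrow> (complex \<Rightarrow> complex) \<Rightarrow> 'a \<Rightarrow> 'a" where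
  "\<Phi> \<phi> F v = (1 / (2 * of_real pi * \<i>)) \<cdot> ring \<phi> (\<lambda>z. F z \<cdot> R z v)"

text \<open>The resolvent bound supplies the factor 1 / r in the decay condition. Together with the
  boundedness of \<open>F\<close> it also yields the bound that \<open>ray_rotate\<close> asks
  for.\<close>

lemma resolvent_bounds:
  assumes F: "decays (sector \<theta>) F" and \<phi>: "\<omega> < \<phi>" "\<phi> < pi / 2"
  shows "\<And>d. d \<in> sector \<theta> \<Longrightarrow> d \<in> outside \<phi> \<Longrightarrow> norm d = 1 \<Longrightarrow> (\<lambda>r. norm (F (of_real r * d) \<cdot> R (of_real r * d) v)) integrable_on {0<..}"
    and "\<And>d. d \<in> sector \<theta> \<Longrightarrow> d \<in> outside \<phi> \<Longrightarrow> norm d = 1 \<Longrightarrow> ray_integrable d (\<lambda>z. F z \<cdot> R z v)"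
    and "\<exists>M. \<forall>z \<in> sector \<theta> \<inter> outside \<phi>. norm z * norm (F z \<cdot> R z v) \<le> M"
proof -
  obtain C where C: "C \<ge> 0" "\<And>z v. z \<in> outside \<phi> \<Longrightarrow> norm (R z v) \<le> C / norm z * norm v"
    using R_bound_apply[OF \<phi>] by blast
  obtain K where K: "K > 0" "\<And>c v. norm (c \<cdot> v) \<le> norm c * norm v * K" using norm_cs by blast
  have bound: "norm (F z \<cdot> R z v) \<le> (C * norm v * K) * (norm (F z) / norm z)" if "z \<in> outside \<phi>" for z
  proof -
    have "norm (F z \<cdot> R z v) \<le> norm (F z) * norm (R z v) * K" by (rule K(2))
    also have "\<dots> \<le> norm (F z) * (C / norm z * norm v) * K"
      using C(2)[OF that] K(1) by (intro mult_right_mono mult_left_mono) auto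
    finally show ?thesis by (simp add: mult_ac)
  qed
  have hF: "continuous_on (sector \<theta>) F" using F by (auto simp: decays_def holomorphic_on_imp_continuous_on)
  fix d assume d: "d \<in> sector \<theta>" "d \<in> outside \<phi>" "norm d = 1"
  have rd: "of_real r * d \<in> sector \<theta>" "of_real r * d \<in> outside \<phi>" if "r > 0" for r
    using d that sector_scale outside_scale by blast+
  have c: "continuous_on {0<..} (\<lambda>r. F (of_real r * d) \<cdot> R (of_real r * d) v)"
    by (intro continuous_on blinfun.continuous_on continuous_on_const
        continuous_on_compose2[OF hF] continuous_on_compose2[OF R_continuous[OF \<phi>]] continuous_intros)
      (use rd in auto)
  have i: "(\<lambda>r. (C * norm v * K) * (norm (F (of_real r * d)) / r)) integrable_on {0<..}"
    using F d integrable_on_cmult_left[of "\<lambda>r. norm (F (of_real r * d)) / r" "{0<..}" "C * norm v * K"]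
    by (auto simp: decays_def)
  have le: "norm (F (of_real r * d) \<cdot> R (of_real r * d) v) \<le> (C * norm v * K) * (norm (F (of_real r * d)) / r)" if "r > 0" for r
    using bound[OF rd(2)[OF that]] that d(3) by (simp add: norm_mult)
  show "(\<lambda>r. norm (F (of_real r * d) \<cdot> R (of_real r * d) v)) integrable_on {0<..}"
    by (rule dominated_integrable_Ioi(1)[OF continuous_on_norm[OF c] i]) (use le in simp)
  show "ray_integrable d (\<lambda>z. F z \<cdot> R z v)"
    unfolding ray_integrable_def by (rule dominated_integrable_Ioi(1)[OF c i le])
next
  obtain C where C: "C \<ge> 0" "\<And>z v. z \<in> outside \<phi> \<Longrightarrow> norm (R z v) \<le> C / norm z * norm v"
    using R_bound_apply[OF \<phi>] by blast
  obtain K where K: "K > 0" "\<And>c v. norm (c \<cdot> v) \<le> norm c * norm v * K" using norm_cs by blast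
  obtain M where M: "\<And>z. z \<in> sector \<theta> \<Longrightarrow> norm (F z) \<le> M" using F by (auto simp: decays_def)
  have "norm z * norm (F z \<cdot> R z v) \<le> M * (C * norm v) * K" if z: "z \<in> sector \<theta> \<inter> outside \<phi>" for z
  proof -
    have z0: "norm z > 0" using z by (auto simp: outside_def)
    have M0: "M \<ge> 0" using M[of z] z norm_ge_zero order_trans by blast
    have "norm z * norm (F z \<cdot> R z v) \<le> norm z * (norm (F z) * norm (R z v) * K)"
      using K(2) by (intro mult_left_mono) auto
    also have "\<dots> = norm (F z) * (norm z * norm (R z v)) * K" by simp
    also have "\<dots> \<le> M * (C * norm v) * K"
    proof -
      have "norm z * norm (R z v) \<le> C * norm v" using C(2)[of z v] z z0 by (simp add: field_simps)
      then show ?thesis using M[of z] z K(1) M0 by (intro mult_right_mono mult_mono[of "norm (F z)" M "norm z * norm (R z v)"]) auto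
    qed
    finally show ?thesis .
  qed
  then show "\<exists>M. \<forall>z \<in> sector \<theta> \<inter> outside \<phi>. norm z * norm (F z \<cdot> R z v) \<le> M" by blast
qed

lemma dirs_integrable:
  assumes "decays (sector \<theta>) F" "\<omega> < \<phi>" "\<phi> < \<theta>" "\<theta> < pi / 2" "d \<in> dirs \<phi>"
  shows "ray_integrable d (\<lambda>z. F z \<cdot> R z v)"
  using resolvent_bounds(2)[OF assms(1,2), of d v] dirs_props[of \<phi> \<theta> d] assms \<omega> by (auto simp: C.dirs_def dirs_def)

text \<open>Each of the four boundary rays is rotated by itself through the region between the two
  angles. There \<open>F\<close> is holomorphic, and the resolvent estimate for the smaller angle
  holds throughout.\<close>

lemma \<Phi>_angle_le:
  assumes F: "decays (sector \<theta>) F" and \<phi>: "\<omega> < \<phi>1" "\<phi>1 \<le> \<phi>2" "\<phi>2 < \<theta>" "\<theta> < pi / 2"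
  shows "\<Phi> \<phi>1 F v = \<Phi> \<phi>2 F v"
proof -
  have p: "0 < \<phi>1" "\<phi>1 < pi / 2" "\<phi>1 < \<theta>" "0 < \<theta>" using \<phi> \<omega> by auto
  obtain M where M: "\<And>z. z \<in> sector \<theta> \<inter> outside \<phi>1 \<Longrightarrow> norm z * norm (F z \<cdot> R z v) \<le> M"
    using resolvent_bounds(3)[OF F \<phi>(1) p(2)] by blast
  have rot: "ray (cis \<alpha>) (\<lambda>z. F z \<cdot> R z v) = ray (cis \<beta>) (\<lambda>z. F z \<cdot> R z v)"
    if ab: "\<alpha> \<le> \<beta>" and t: "\<And>t. t \<in> {\<alpha>..\<beta>} \<Longrightarrow> cis t \<in> sector \<theta> \<inter> outside \<phi>1" for \<alpha> \<beta>
  proof -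
    have W: "wedge \<alpha> \<beta> \<subseteq> sector \<theta> \<inter> outside \<phi>1"
    proof
      fix z assume "z \<in> wedge \<alpha> \<beta>"
      then obtain r s where z: "z = of_real r * cis s" "r > 0" "s \<in> {\<alpha>..\<beta>}" by (auto simp: wedge_def)
      then show "z \<in> sector \<theta> \<inter> outside \<phi>1" using t[OF z(3)] sector_scale outside_scale by blast
    qed
    have "ray (cis \<alpha>) (\<lambda>z. F z \<cdot> R z v + 0 \<cdot> v) = ray (cis \<beta>) (\<lambda>z. F z \<cdot> R z v + 0 \<cdot> v)"
    proof (rule ray_rotate_resolvent[OF ab \<phi>(1) p(2) open_sector[of \<theta>], where F = F and H = "\<lambda>_. 0" and u = v and v = v and M = M])
      show "F holomorphic_on sector \<theta>" using F by (simp add: decays_def)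
      show "of_real r * cis s \<in> sector \<theta> \<and> cis s \<in> outside \<phi>1" if "r > 0" "s \<in> {\<alpha>..\<beta>}" for r s
        using t[OF that(2)] sector_scale[OF that(1)] by blast
      show "(\<lambda>r. norm (F (of_real r * cis s) \<cdot> R (of_real r * cis s) v + 0 \<cdot> v)) integrable_on {0<..}" if "s \<in> {\<alpha>..\<beta>}" for s
        using resolvent_bounds(1)[OF F \<phi>(1) p(2), of "cis s" v] t[OF that] by (simp add: zero_left)
      show "norm z * norm (F z \<cdot> R z v + 0 \<cdot> v) \<le> M" if "z \<in> wedge \<alpha> \<beta>" for z
        using M[of z] W that by (auto simp: zero_left)
    qed auto
    then show ?thesis by (simp add: zero_left)
  qed
  have in1: "cis t \<in> sector \<theta>" "cis t \<in> outside \<phi>1" "cis (- t) \<in> sector \<theta>" "cis (- t) \<in> outside \<phi>1" if "\<phi>1 \<le> t" "t \<le> \<phi>2" for t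
    using cis_in_sector[of t \<theta>] cis_notin_sector[of \<phi>1 t] that \<phi> p cnj_sector[of t \<phi>1] by (auto simp: outside_def)
  have "ray (cis \<phi>1) (\<lambda>z. F z \<cdot> R z v) = ray (cis \<phi>2) (\<lambda>z. F z \<cdot> R z v)"
    using in1 by (intro rot \<phi>) auto
  moreover have "ray (cis (- \<phi>2)) (\<lambda>z. F z \<cdot> R z v) = ray (cis (- \<phi>1)) (\<lambda>z. F z \<cdot> R z v)"
  proof (rule rot)
    fix t assume "t \<in> {- \<phi>2..- \<phi>1}"
    then show "cis t \<in> sector \<theta> \<inter> outside \<phi>1" using in1(3,4)[of "- t"] by simp
  qed (use \<phi> in simp)
  moreover have "ray (- cis \<phi>1) (\<lambda>z. F z \<cdot> R z v) = ray (- cis \<phi>2) (\<lambda>z. F z \<cdot> R z v)"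
    unfolding sector_minus_cis[symmetric]
  proof (rule rot)
    fix t assume "t \<in> {pi + \<phi>1..pi + \<phi>2}"
    then show "cis t \<in> sector \<theta> \<inter> outside \<phi>1"
      using in1(1,2)[of "t - pi"] sector_minus_cis(1)[of "t - pi"] by (simp add: outside_def)
  qed (use \<phi> in simp)
  moreover have "ray (- cis (- \<phi>2)) (\<lambda>z. F z \<cdot> R z v) = ray (- cis (- \<phi>1)) (\<lambda>z. F z \<cdot> R z v)"
    unfolding sector_minus_cis(2)[symmetric]
  proof (rule rot)
    fix t assume "t \<in> {pi - \<phi>2..pi - \<phi>1}"
    then show "cis t \<in> sector \<theta> \<inter> outside \<phi>1"
      using in1(3,4)[of "pi - t"] sector_minus_cis(1)[of "t - pi"] by (simp add: outside_def)
  qed (use \<phi> in simp)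
  ultimately show ?thesis by (simp add: \<Phi>_def ring_def)
qed

lemma \<Phi>_cong:
  assumes "\<omega> < \<phi>" "\<phi> < \<theta>" "\<theta> < pi / 2" "\<And>z. z \<in> sector \<theta> \<Longrightarrow> F z = G z"
  shows "\<Phi> \<phi> F v = \<Phi> \<phi> G v"
proof -
  have "F (of_real r * d) = G (of_real r * d)" if "r > 0" "d \<in> dirs \<phi>" for r d
    using assms(4)[of "of_real r * d"] dirs_props(1)[of \<phi> \<theta> d] that assms \<omega> sector_scale[OF that(1)]
    by (auto simp: dirs_def C.dirs_def)
  then show ?thesis unfolding \<Phi>_def by (intro arg_cong[where f = "cs _"] ring_cong) simp
qed

lemma \<Phi>_linear:
  assumes F: "decays (sector \<theta>) F" and \<phi>: "\<omega> < \<phi>" "\<phi> < \<theta>" "\<theta> < pi / 2"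
  shows "\<And>c. \<Phi> \<phi> (\<lambda>z. c * F z) v = c \<cdot> \<Phi> \<phi> F v"
    and "\<And>G. decays (sector \<theta>) G \<Longrightarrow> \<Phi> \<phi> (\<lambda>z. F z + G z) v = \<Phi> \<phi> F v + \<Phi> \<phi> G v"
    and "\<And>u. \<Phi> \<phi> F (u + v) = \<Phi> \<phi> F u + \<Phi> \<phi> F v"
    and "\<And>c. \<Phi> \<phi> F (c \<cdot> v) = c \<cdot> \<Phi> \<phi> F v"
    and "\<And>w \<psi>. \<omega> < \<psi> \<Longrightarrow> \<psi> < pi / 2 \<Longrightarrow> w \<in> outside \<psi> \<Longrightarrow> R w (\<Phi> \<phi> F v) = (1 / (2 * of_real pi * \<i>)) \<cdot> ring \<phi> (\<lambda>z. F z \<cdot> R w (R z v))"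
proof -
  note int = dirs_integrable[OF F \<phi>]
  have out: "of_real r * d \<in> outside \<phi>" if "r > 0" "d \<in> dirs \<phi>" for r d
    using dirs_props(2)[of \<phi> \<theta> d] that \<phi> \<omega> outside_scale[OF that(1)] by (auto simp: dirs_def C.dirs_def)
  show "\<Phi> \<phi> (\<lambda>z. c * F z) v = c \<cdot> \<Phi> \<phi> F v" for c
    unfolding \<Phi>_def cs_assoc by (subst ring_cs[OF int]) (auto intro: cs_commute)
  show "\<Phi> \<phi> (\<lambda>z. F z + G z) v = \<Phi> \<phi> F v + \<Phi> \<phi> G v" if G: "decays (sector \<theta>) G" for G
    unfolding \<Phi>_def add_left by (subst ring_add[OF int dirs_integrable[OF G \<phi>]]) (auto simp: add_right)
  show "\<Phi> \<phi> F (u + v) = \<Phi> \<phi> F u + \<Phi> \<phi> F v" for u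
    unfolding \<Phi>_def blinfun.add_right add_right by (subst ring_add[OF int int]) (auto simp: add_right)
  show "\<Phi> \<phi> F (c \<cdot> v) = c \<cdot> \<Phi> \<phi> F v" for c
  proof -
    have "ring \<phi> (\<lambda>z. F z \<cdot> R z (c \<cdot> v)) = ring \<phi> (\<lambda>z. c \<cdot> (F z \<cdot> R z v))"
      using R_cs[OF \<phi>(1) _ out] \<phi> by (intro ring_cong) (auto intro: cs_commute)
    also have "\<dots> = c \<cdot> ring \<phi> (\<lambda>z. F z \<cdot> R z v)" by (rule ring_cs) (rule int)
    finally show ?thesis unfolding \<Phi>_def by (simp only: cs_commute[of c])
  qed
  show "R w (\<Phi> \<phi> F v) = (1 / (2 * of_real pi * \<i>)) \<cdot> ring \<phi> (\<lambda>z. F z \<cdot> R w (R z v))"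
    if "\<omega> < \<psi>" "\<psi> < pi / 2" "w \<in> outside \<psi>" for w \<psi>
  proof -
    have "ring \<phi> (\<lambda>z. F z \<cdot> R w (R z v)) = ring \<phi> (\<lambda>z. R w (F z \<cdot> R z v))" by (simp add: R_cs[OF that])
    also have "\<dots> = R w (ring \<phi> (\<lambda>z. F z \<cdot> R z v))"
      by (rule ring_linear[OF _ blinfun.bounded_linear_right R_cs[OF that]]) (rule int)
    finally show ?thesis by (simp add: \<Phi>_def R_cs[OF that])
  qed
qed

end


section \<open>Fubini's theorem for contours and the multiplicativity of
  \<open>\<Phi>\<close>\<close>

context complex_action
begin

lemma ray_integrable_add: "ray_integrable d G \<Longrightarrow> ray_integrable d H \<Longrightarrow> ray_integrable d (\<lambda>z. G z + H z)"
  and ray_integrable_diff: "ray_integrable d G \<Longrightarrow> ray_integrable d H \<Longrightarrow> ray_integrable d (\<lambda>z. G z - H z)"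
  unfolding ray_integrable_def by (auto intro: integrable_add integrable_diff)

lemma ring_0 [simp]: "ring \<phi> (\<lambda>_. 0) = 0"
  by (simp add: ring_def ray_def zero_right)

lemma ray_swap:
  assumes f: "continuous_on ({0<..} \<times> {0<..}) (\<lambda>(r, s). f (of_real r * d) (of_real s * d'))"
    and a: "a integrable_on {0<..}" and b: "b integrable_on {0<..}"
    and a0: "\<And>r. r > 0 \<Longrightarrow> 0 \<le> a r" and b0: "\<And>r. r > 0 \<Longrightarrow> 0 \<le> b r"
    and le: "\<And>r s. r > 0 \<Longrightarrow> s > 0 \<Longrightarrow> norm (f (of_real r * d) (of_real s * d')) \<le> a r * b s"
  shows "ray_integrable d (\<lambda>z. ray d' (f z))" and "ray_integrable d' (\<lambda>w. ray d (\<lambda>z. f z w))"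
    and "ray d (\<lambda>z. ray d' (f z)) = ray d' (\<lambda>w. ray d (\<lambda>z. f z w))"
proof -
  let ?f = "\<lambda>r s. f (of_real r * d) (of_real s * d')"
  have f': "continuous_on ({0<..} \<times> {0<..}) (\<lambda>(s, r). ?f r s)"
  proof -
    have c: "continuous_on ({0<..} \<times> {0<..}) (\<lambda>x. (snd x, fst x) :: real \<times> real)"
      by (intro continuous_intros)
    have "(\<lambda>x. (snd x, fst x)) ` ({0<..} \<times> {0<..}) \<subseteq> {0<..} \<times> {0 :: real <..}"
      by auto
    from continuous_on_compose2[OF f c this] show ?thesis by (simp add: case_prod_beta)
  qed
  have le': "norm (?f r s) \<le> b s * a r" if "s > 0" "r > 0" for r s
    using le[OF that(2,1)] by (simp add: mult.commute)
  have i1: "(\<lambda>r. integral {0<..} (\<lambda>s. ?f r s)) integrable_on {0<..}"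
    by (rule iterated_integral_Ioi(1)[OF f a b a0 b0 le])
  have i2: "(\<lambda>s. integral {0<..} (\<lambda>r. ?f r s)) integrable_on {0<..}"
    by (rule iterated_integral_Ioi(1)[OF f' b a b0 a0 le'])
  show "ray_integrable d (\<lambda>z. ray d' (f z))"
    using integrable_linear[OF i1 bounded_linear_right[of d']] by (simp add: ray_integrable_def ray_def o_def)
  show "ray_integrable d' (\<lambda>w. ray d (\<lambda>z. f z w))"
    using integrable_linear[OF i2 bounded_linear_right[of d]] by (simp add: ray_integrable_def ray_def o_def)
  have "ray d (\<lambda>z. ray d' (f z)) = d \<cdot> d' \<cdot> integral {0<..} (\<lambda>r. integral {0<..} (\<lambda>s. ?f r s))"
    using integral_linear[OF i1 bounded_linear_right[of d']] by (simp add: ray_def o_def)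
  also have "\<dots> = d' \<cdot> d \<cdot> integral {0<..} (\<lambda>s. integral {0<..} (\<lambda>r. ?f r s))"
  proof -
    have "integral {0<..} (\<lambda>r. integral {0<..} (\<lambda>s. ?f r s)) = integral {0<..} (\<lambda>s. integral {0<..} (\<lambda>r. ?f r s))"
      by (rule integral_swap_Ioi[OF f a b a0 b0 le])
    then show ?thesis using cs_commute by simp
  qed
  also have "\<dots> = ray d' (\<lambda>w. ray d (\<lambda>z. f z w))"
    using integral_linear[OF i2 bounded_linear_right[of d]] by (simp add: ray_def o_def)
  finally show "ray d (\<lambda>z. ray d' (f z)) = ray d' (\<lambda>w. ray d (\<lambda>z. f z w))" .
qed

lemma ring_swap:
  assumes i: "\<And>d d'. d \<in> dirs \<phi> \<Longrightarrow> d' \<in> dirs \<phi>' \<Longrightarrow> ray_integrable d (\<lambda>z. ray d' (f z))"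
    and i': "\<And>d d'. d \<in> dirs \<phi> \<Longrightarrow> d' \<in> dirs \<phi>' \<Longrightarrow> ray_integrable d' (\<lambda>w. ray d (\<lambda>z. f z w))"
    and eq: "\<And>d d'. d \<in> dirs \<phi> \<Longrightarrow> d' \<in> dirs \<phi>' \<Longrightarrow> ray d (\<lambda>z. ray d' (f z)) = ray d' (\<lambda>w. ray d (\<lambda>z. f z w))"
  shows "ring \<phi> (\<lambda>z. ring \<phi>' (f z)) = ring \<phi>' (\<lambda>w. ring \<phi> (\<lambda>z. f z w))"
proof -
  have ray4: "ray d (\<lambda>z. A z - B z + C z - D z) = ray d A - ray d B + ray d C - ray d D"
    if "ray_integrable d A" "ray_integrable d B" "ray_integrable d C" "ray_integrable d D" for d A B C D
    using that by (simp add: ray_add ray_diff ray_integrable_add ray_integrable_diff)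
  have d: "d \<in> dirs \<psi> \<longleftrightarrow> d = cis (- \<psi>) \<or> d = cis \<psi> \<or> d = - cis (- \<psi>) \<or> d = - cis \<psi>" for d \<psi>
    by (auto simp: dirs_def)
  have l: "ray d (\<lambda>z. ring \<phi>' (f z)) = ring \<phi>' (\<lambda>w. ray d (\<lambda>z. f z w))" if "d \<in> dirs \<phi>" for d
    unfolding ring_def using that by (subst ray4) (auto simp: d intro!: i simp: eq)
  have j: "ray_integrable d' (\<lambda>w. ring \<phi> (\<lambda>z. f z w))" if "d' \<in> dirs \<phi>'" for d'
    unfolding ring_def using that by (intro ray_integrable_add ray_integrable_diff i') (auto simp: d)
  have r: "ray d' (\<lambda>w. ring \<phi> (\<lambda>z. f z w))
      = ray d' (\<lambda>w. ray (cis (- \<phi>)) (\<lambda>z. f z w)) - ray d' (\<lambda>w. ray (cis \<phi>) (\<lambda>z. f z w))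
        + ray d' (\<lambda>w. ray (- cis (- \<phi>)) (\<lambda>z. f z w)) - ray d' (\<lambda>w. ray (- cis \<phi>) (\<lambda>z. f z w))"
    if "d' \<in> dirs \<phi>'" for d'
    unfolding ring_def using that by (intro ray4 i') (auto simp: d)
  show ?thesis
    unfolding ring_def[of \<phi> "\<lambda>z. ring \<phi>' (f z)"]
    by (subst (1 2 3 4) l) (auto simp: d ring_def[of \<phi>'] r algebra_simps)
qed

end

lemma decays_div:
  assumes F: "decays (sector \<theta>) F" and \<theta>: "0 < \<theta>" "\<theta> < \<psi>" "\<psi> < pi / 2" and w: "w \<in> outside \<psi>"
  shows "decays (sector \<theta>) (\<lambda>z. F z / (w - z))" and "decays (sector \<theta>) (\<lambda>z. z * F z / (w - z))"
proof -
  obtain c where c: "c > 0" "\<And>z w. \<bar>Im z\<bar> * cos \<theta> \<le> sin \<theta> * \<bar>Re z\<bar> \<Longrightarrow> w \<notin> sector \<psi> \<Longrightarrow> c * (norm z + norm w) \<le> norm (w - z)"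
    using cones_separated[of \<theta> \<psi>] \<theta> by auto
  have w0: "norm w > 0" using w by (simp add: outside_def)
  have le: "c * (norm z + norm w) \<le> norm (w - z)" if "z \<in> sector \<theta>" for z
    using c(2)[of z w] that w by (simp add: outside_def sector_def)
  have ge: "c * norm z \<le> norm (w - z)" "c * norm w \<le> norm (w - z)" if "z \<in> sector \<theta>" for z
  proof -
    have "0 \<le> c * norm z" "0 \<le> c * norm w" using c(1) by auto
    then show "c * norm z \<le> norm (w - z)" "c * norm w \<le> norm (w - z)"
      using le[OF that] unfolding distrib_left by linarith+
  qed
  have ne: "w - z \<noteq> 0" if "z \<in> sector \<theta>" for z
    using ge(2)[OF that] mult_pos_pos[OF c(1) w0] by auto
  have "decays (sector \<theta>) (\<lambda>z. (1 / (w - z)) * F z)"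
  proof (rule decays_mult_bounded[OF conical_sector F, of _ "1 / (c * norm w)"])
    show "(\<lambda>z. 1 / (w - z)) holomorphic_on sector \<theta>" by (intro holomorphic_intros) (use ne in auto)
    show "norm (1 / (w - z)) \<le> 1 / (c * norm w)" if "z \<in> sector \<theta>" for z
      unfolding norm_divide norm_one using ge(2)[OF that] ne[OF that] c(1) w0 by (intro divide_left_mono) auto
  qed
  then show "decays (sector \<theta>) (\<lambda>z. F z / (w - z))" by simp
  have "decays (sector \<theta>) (\<lambda>z. (z / (w - z)) * F z)"
  proof (rule decays_mult_bounded[OF conical_sector F, of _ "1 / c"])
    show "(\<lambda>z. z / (w - z)) holomorphic_on sector \<theta>" by (intro holomorphic_intros) (use ne in auto)
    show "norm (z / (w - z)) \<le> 1 / c" if "z \<in> sector \<theta>" for z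
      using ge(1)[OF that] ne[OF that] c(1) by (simp add: norm_divide field_simps)
  qed
  then show "decays (sector \<theta>) (\<lambda>z. z * F z / (w - z))" by simp
qed

text \<open>The pole \<open>w\<close> is outside, so this is Cauchy's theorem once the integrand is
  written as \<open>(z * F z / (w - z)) / z\<close>, the form required by
  \<open>ring_zero\<close>.\<close>

lemma ring_kernel_zero:
  assumes F: "decays (sector \<theta>) F" and \<phi>: "0 < \<phi>" "\<phi> < \<theta>" "\<theta> < pi / 2" "\<phi> < \<psi>" "\<psi> < pi / 2" and w: "w \<in> outside \<psi>"
  shows "\<And>d. d \<in> C.dirs \<phi> \<Longrightarrow> C.ray_integrable d (\<lambda>z. F z / (w - z))" and "C.ring \<phi> (\<lambda>z. F z / (w - z)) = 0"
proof -
  \<comment> \<open>Above \<phi>, but below both \<theta> and \<psi>: \<open>F\<close> still decays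
    on this sector and \<open>w\<close> keeps its distance from it.\<close>
  define \<theta>' where "\<theta>' = (\<phi> + min \<theta> \<psi>) / 2"
  have \<theta>': "0 < \<theta>'" "\<theta>' < \<psi>" "\<theta>' < \<theta>" "\<phi> < \<theta>'" "\<theta>' < pi / 2" using \<phi> by (auto simp: \<theta>'_def min_def)
  have F': "decays (sector \<theta>') F" by (rule decays_subset[OF F sector_mono[OF \<theta>'(1,3) \<phi>(3)]])
  note D = decays_div(2)[OF F' \<theta>'(1,2) \<phi>(5) w]
  have e: "F (of_real r * d) / (w - of_real r * d) = ((of_real r * d) * F (of_real r * d) / (w - of_real r * d)) / (of_real r * d)"
    if "r > 0" "d \<in> C.dirs \<phi>" for r d
  proof -
    have "a / c = (z * a / c) / z" if "z \<noteq> 0" for z a c :: complex using that by simp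
    moreover have "of_real r * d \<noteq> 0" using dirs_props(3)[OF \<phi>(1) \<theta>'(4,5) that(2)] that(1) by auto
    ultimately show ?thesis by blast
  qed
  show "C.ray_integrable d (\<lambda>z. F z / (w - z))" if d: "d \<in> C.dirs \<phi>" for d
  proof -
    have "C.ray_integrable d (\<lambda>z. (z * F z / (w - z)) / z)"
      using decays_ray_integrable[OF conical_sector D] dirs_props[OF \<phi>(1) \<theta>'(4,5) d] by blast
    then show ?thesis using C.ray_integrable_cong[of "\<lambda>z. F z / (w - z)" d "\<lambda>z. (z * F z / (w - z)) / z"] e d by blast
  qed
  have "C.ring \<phi> (\<lambda>z. F z / (w - z)) = C.ring \<phi> (\<lambda>z. (z * F z / (w - z)) / z)"
    by (rule C.ring_cong) (rule e)
  then show "C.ring \<phi> (\<lambda>z. F z / (w - z)) = 0" using ring_zero[OF D \<phi>(1) \<theta>'(4,5)] by simp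
qed

text \<open>The case \<open>z\<^sup>2 = - 1\<close> of \<open>ray_log\<close>; the sign of
  \<open>Re d\<close> decides whether \<open>z\<close> is - \<i> or \<i>.\<close>

lemma ray_arctan:
  assumes "norm d = 1"
  shows "Re d > 0 \<Longrightarrow> C.ray_integrable d (\<lambda>w. 1 / (1 + w\<^sup>2)) \<and> C.ray d (\<lambda>w. 1 / (1 + w\<^sup>2)) = pi / 2"
    and "Re d < 0 \<Longrightarrow> C.ray_integrable d (\<lambda>w. 1 / (1 + w\<^sup>2)) \<and> C.ray d (\<lambda>w. 1 / (1 + w\<^sup>2)) = - pi / 2"
proof -
  have *: "C.ray_integrable d (\<lambda>w. 1 / (1 + w\<^sup>2)) \<and> C.ray d (\<lambda>w. 1 / (1 + w\<^sup>2)) = (1 / (2 * z)) * (- \<i> * pi)"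
    if "Im (d * cnj z) > 0" and z: "z\<^sup>2 = - 1" for z
  proof -
    have z0: "z \<noteq> 0" using z by auto
    have e: "(\<lambda>w. (1 / (2 * z)) * (2 * z / (w\<^sup>2 - z\<^sup>2))) = (\<lambda>w. 1 / (1 + w\<^sup>2))"
      using z0 by (simp add: fun_eq_iff z add.commute)
    show ?thesis
      using C.ray_linear[OF ray_log(1)[OF assms that(1)] bounded_linear_mult_right[of "1 / (2 * z)"]]
        ray_log(2)[OF assms that(1)]
      unfolding e by simp
  qed
  show "C.ray_integrable d (\<lambda>w. 1 / (1 + w\<^sup>2)) \<and> C.ray d (\<lambda>w. 1 / (1 + w\<^sup>2)) = pi / 2" if "Re d > 0"
    using *[of "- \<i>"] that by simp
  show "C.ray_integrable d (\<lambda>w. 1 / (1 + w\<^sup>2)) \<and> C.ray d (\<lambda>w. 1 / (1 + w\<^sup>2)) = - pi / 2" if "Re d < 0"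
    using *[of "\<i>"] that by simp
qed

context sectorial_resolvent
begin

text \<open>The inner operator is placed on the wider contour. Then each \<open>z\<close> on the
  contour of \<open>h\<close> lies inside that of \<open>k\<close>, where Cauchy's formula in
  \<open>w\<close> gives \<open>k z\<close>. Conversely each \<open>w\<close> lies outside the
  contour of \<open>h\<close>, so that after Fubini the integral in \<open>z\<close>
  vanishes.\<close>

lemma \<Phi>_product_lt:
  assumes h: "decays (sector \<theta>) h" and k: "decays (sector \<theta>) k"
    and \<phi>: "\<omega> < \<phi>" "\<phi> < \<phi>'" "\<phi>' < \<theta>" "\<theta> < pi / 2"
  shows "\<Phi> \<phi> h (\<Phi> \<phi>' k v) = \<Phi> \<phi> (\<lambda>z. h z * k z) v"
proof -
  have p: "0 < \<phi>" "0 < \<phi>'" "\<phi>' < pi / 2" "\<phi> < \<theta>" "\<phi> < pi / 2" "\<omega> < \<phi>'" using \<phi> \<omega> by auto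
  note D = dirs_props[OF p(1) \<phi>(2) p(3)]
  note D' = dirs_props[OF p(2) \<phi>(3,4)]
  note D\<theta> = dirs_props[OF p(1) p(4) \<phi>(4)]
  let ?c = "2 * of_real pi * \<i>"
  define u where "u = \<Phi> \<phi>' k v"
  obtain c where c: "c > 0" "\<And>z w. \<bar>Im z\<bar> * cos \<phi> \<le> sin \<phi> * \<bar>Re z\<bar> \<Longrightarrow> w \<notin> sector \<phi>' \<Longrightarrow> c * (norm z + norm w) \<le> norm (w - z)"
    using cones_separated[of \<phi> \<phi>'] \<phi> p by auto
  have sep: "c * (r + s) \<le> norm (of_real s * d' - of_real r * d)" if "r > 0" "s > 0" "d \<in> dirs \<phi>" "d' \<in> dirs \<phi>'" for r s d d'
  proof -
    have s0: "sin \<phi> > 0" "cos \<phi> > 0" using p by (auto intro!: sin_gt_zero cos_gt_zero_pi)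
    have "\<bar>Im d\<bar> * cos \<phi> \<le> sin \<phi> * \<bar>Re d\<bar>" using that(3) s0 by (auto simp: dirs_def)
    then have "\<bar>Im (of_real r * d)\<bar> * cos \<phi> \<le> sin \<phi> * \<bar>Re (of_real r * d)\<bar>"
      using that(1) by (simp add: abs_mult mult.assoc mult.left_commute[of _ r])
    moreover have "of_real s * d' \<notin> sector \<phi>'" using D'(2)[OF that(4)] sector_scale[OF that(2)] by (auto simp: outside_def)
    ultimately show ?thesis using c(2) D(3)[OF that(3)] D'(3)[OF that(4)] that(1,2) by (fastforce simp: norm_mult)
  qed
  have sep': "c * r \<le> norm (of_real s * d' - of_real r * d)" "c * s \<le> norm (of_real s * d' - of_real r * d)" "of_real s * d' - of_real r * d \<noteq> 0"
    if "r > 0" "s > 0" "d \<in> dirs \<phi>" "d' \<in> dirs \<phi>'" for r s d d'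
  proof -
    have "0 < c * r" "0 < c * s" using c(1) that by auto
    then show "c * r \<le> norm (of_real s * d' - of_real r * d)" "c * s \<le> norm (of_real s * d' - of_real r * d)" "of_real s * d' - of_real r * d \<noteq> 0"
      using sep[OF that] unfolding distrib_left by (linarith, linarith, force)
  qed
  have hc: "continuous_on (sector \<theta>) h" "continuous_on (sector \<theta>) k"
    using h k by (auto simp: decays_def holomorphic_on_imp_continuous_on)
  have s\<theta>: "of_real r * d \<in> sector \<theta>" if "r > 0" "d \<in> dirs \<phi>" for r d using D\<theta>(1)[OF that(2)] sector_scale[OF that(1)] by blast
  have s\<theta>': "of_real r * d \<in> sector \<theta>" if "r > 0" "d \<in> dirs \<phi>'" for r d using D'(1)[OF that(2)] sector_scale[OF that(1)] by blast
  have o: "of_real r * d \<in> outside \<phi>" if "r > 0" "d \<in> dirs \<phi>" for r d using D(2)[OF that(2)] outside_scale[OF that(1)] by blast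
  have o': "of_real r * d \<in> outside \<phi>'" if "r > 0" "d \<in> dirs \<phi>'" for r d using D'(2)[OF that(2)] outside_scale[OF that(1)] by blast
  have oo: "outside \<phi>' \<subseteq> outside \<phi>" by (rule outside_mono[OF p(1) \<phi>(2) p(3)])
  have ki: "C.ray_integrable d' (\<lambda>w. k w / (w - of_real r * d))" if rd: "r > 0" "d \<in> dirs \<phi>" and d': "d' \<in> dirs \<phi>'" for r d d'
    unfolding C.ray_integrable_def
  proof (rule dominated_integrable_Ioi(1))
    show "(\<lambda>s. (1 / c) * (norm (k (of_real s * d')) / s)) integrable_on {0<..}"
      using k D'[OF d'] integrable_on_cmult_left[of "\<lambda>s. norm (k (of_real s * d')) / s" "{0<..}" "1 / c"]
      by (auto simp: decays_def)
    show "continuous_on {0<..} (\<lambda>s. k (of_real s * d') / (of_real s * d' - of_real r * d))"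
      by (intro continuous_intros continuous_on_compose2[OF hc(2)]) (use s\<theta>' sep'(3) rd d' in auto)
    fix s :: real assume s: "s > 0"
    have "norm (k (of_real s * d')) / norm (of_real s * d' - of_real r * d) \<le> norm (k (of_real s * d')) / (c * s)"
      using sep'(2)[OF rd(1) s rd(2) d'] c(1) s sep'(3)[OF rd(1) s rd(2) d'] by (intro divide_left_mono mult_pos_pos) auto
    then show "norm (k (of_real s * d') / (of_real s * d' - of_real r * d)) \<le> (1 / c) * (norm (k (of_real s * d')) / s)"
      by (simp add: norm_divide)
  qed
  \<comment> \<open>The part of the double integral that carries \<open>R w v\<close> after the
    resolvent identity; integrated against \<open>h\<close> it turns out to be 0.\<close>
  define X where "X z = ring \<phi>' (\<lambda>w. (k w / (w - z)) \<cdot> R w v)" for z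
  have key: "k w \<cdot> R z (R w v) = (k w / (w - z)) \<cdot> R z v - (k w / (w - z)) \<cdot> R w v"
    if "z \<in> outside \<phi>" "w \<in> outside \<phi>" "w - z \<noteq> 0" for z w
    using R_product[OF \<phi>(1) p(5) that(1,2), of v] that(3) by (auto simp: diff_right simp flip: cs_assoc)
  \<comment> \<open>Obtained as the difference of the two other terms of \<open>key\<close>, both of
    which are already known to be integrable.\<close>
  have Xi: "ray_integrable d' (\<lambda>w. (k w / (w - of_real r * d)) \<cdot> R w v)" if rd: "r > 0" "d \<in> dirs \<phi>" and d': "d' \<in> dirs \<phi>'" for r d d'
  proof -
    let ?z = "of_real r * d"
    have 1: "ray_integrable d' (\<lambda>w. (k w / (w - ?z)) \<cdot> R ?z v)" by (rule ray_scalar(1)[OF ki[OF that]])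
    have 2: "ray_integrable d' (\<lambda>w. R ?z (k w \<cdot> R w v))"
      by (rule ray_linear(1)[OF dirs_integrable[OF k p(6) \<phi>(3,4) d'] blinfun.bounded_linear_right R_cs[OF \<phi>(1) p(5) o[OF rd]]])
    have "ray_integrable d' (\<lambda>w. (k w / (w - ?z)) \<cdot> R ?z v - R ?z (k w \<cdot> R w v))"
      by (rule ray_integrable_diff[OF 1 2])
    moreover have "(k w / (w - ?z)) \<cdot> R ?z v - R ?z (k w \<cdot> R w v) = (k w / (w - ?z)) \<cdot> R w v" if s: "w = of_real s * d'" "s > 0" for w s
      using key[OF o[OF rd], of w] oo o'[OF s(2) d'] sep'(3)[OF rd(1) s(2) rd(2) d'] R_cs[OF \<phi>(1) p(5) o[OF rd], of "k w" "R w v"] s(1) by auto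
    ultimately show ?thesis
      using ray_integrable_cong[of "\<lambda>w. (k w / (w - ?z)) \<cdot> R ?z v - R ?z (k w \<cdot> R w v)" d' "\<lambda>w. (k w / (w - ?z)) \<cdot> R w v"] by blast
  qed
  have X: "X z = ?c \<cdot> (k z \<cdot> R z v - R z u)" if z: "z = of_real r * d" and rd: "r > 0" "d \<in> dirs \<phi>" for z r d
  proof -
    have "R z u = (1 / ?c) \<cdot> ring \<phi>' (\<lambda>w. k w \<cdot> R z (R w v))"
      unfolding u_def by (rule \<Phi>_linear(5)[OF k p(6) \<phi>(3,4) \<phi>(1) p(5)]) (use o[OF rd] z in simp)
    also have "ring \<phi>' (\<lambda>w. k w \<cdot> R z (R w v)) = ring \<phi>' (\<lambda>w. (k w / (w - z)) \<cdot> R z v - (k w / (w - z)) \<cdot> R w v)"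
    proof (rule ring_cong)
      fix s :: real and d' assume sd: "s > 0" "d' \<in> dirs \<phi>'"
      show "k (of_real s * d') \<cdot> R z (R (of_real s * d') v) = (k (of_real s * d') / (of_real s * d' - z)) \<cdot> R z v - (k (of_real s * d') / (of_real s * d' - z)) \<cdot> R (of_real s * d') v"
        by (rule key) (use o[OF rd] z oo o'[OF sd] sep'(3)[OF rd(1) sd(1) rd(2) sd(2)] in auto)
    qed
    also have "\<dots> = ring \<phi>' (\<lambda>w. (k w / (w - z)) \<cdot> R z v) - X z"
      unfolding X_def z by (rule ring_diff) (use ray_scalar(1)[OF ki[OF rd]] Xi[OF rd] in auto)
    also have "ring \<phi>' (\<lambda>w. (k w / (w - z)) \<cdot> R z v) = C.ring \<phi>' (\<lambda>w. k w / (w - z)) \<cdot> R z v"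
      unfolding z by (rule ring_scalar) (rule ki[OF rd])
    also have "C.ring \<phi>' (\<lambda>w. k w / (w - z)) = ?c * k z"
      using Cauchy_formula_sector[OF k p(2) \<phi>(3,4), of z] D(1)[OF rd(2)] sector_scale[OF rd(1)] z by (simp add: mult_ac)
    finally have "?c \<cdot> R z u = (?c * k z) \<cdot> R z v - X z" by (simp flip: cs_assoc)
    then show ?thesis by (simp add: diff_right cs_assoc)
  qed
  have "ring \<phi> (\<lambda>z. h z \<cdot> X z) = ring \<phi> (\<lambda>z. ring \<phi>' (\<lambda>w. (h z * (k w / (w - z))) \<cdot> R w v))"
  proof (rule ring_cong)
    fix r :: real and d assume rd: "r > 0" "d \<in> dirs \<phi>"
    show "h (of_real r * d) \<cdot> X (of_real r * d) = ring \<phi>' (\<lambda>w. (h (of_real r * d) * (k w / (w - of_real r * d))) \<cdot> R w v)"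
      unfolding X_def cs_assoc by (rule ring_cs[symmetric]) (rule Xi[OF rd])
  qed
  also have "\<dots> = ring \<phi>' (\<lambda>w. ring \<phi> (\<lambda>z. (h z * (k w / (w - z))) \<cdot> R w v))"
  proof -
    obtain C where C: "C \<ge> 0" "\<And>z v. z \<in> outside \<phi>' \<Longrightarrow> norm (R z v) \<le> C / norm z * norm v"
      using R_bound_apply[OF p(6,3)] by blast
    obtain K where K: "K > 0" "\<And>c v. norm (c \<cdot> v) \<le> norm c * norm v * K" using norm_cs by blast
    define B where "B = C * norm v * K / c"
    have B0: "B \<ge> 0" using C(1) K(1) c(1) by (simp add: B_def)
    have f: "continuous_on ({0<..} \<times> {0<..}) (\<lambda>(r, s). (h (of_real r * d) * (k (of_real s * d') / (of_real s * d' - of_real r * d))) \<cdot> R (of_real s * d') v)"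
      if d: "d \<in> dirs \<phi>" "d' \<in> dirs \<phi>'" for d d'
      unfolding case_prod_beta
      by (intro continuous_on blinfun.continuous_on continuous_on_const continuous_on_mult continuous_on_divide continuous_on_diff
          continuous_on_compose2[OF hc(1)] continuous_on_compose2[OF hc(2)] continuous_on_compose2[OF R_continuous[OF p(6,3)]]
          continuous_on_of_real continuous_on_fst continuous_on_snd continuous_on_id)
        (use s\<theta> s\<theta>' o' sep'(3) d in auto)
    have a: "(\<lambda>r. norm (h (of_real r * d)) / r) integrable_on {0<..}" if "d \<in> dirs \<phi>" for d
      using h D\<theta>[OF that] by (auto simp: decays_def)
    have b: "(\<lambda>s. B * (norm (k (of_real s * d')) / s)) integrable_on {0<..}" if "d' \<in> dirs \<phi>'" for d'
      using k D'[OF that] integrable_on_cmult_left[of "\<lambda>s. norm (k (of_real s * d')) / s" "{0<..}" B]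
      by (auto simp: decays_def)
    \<comment> \<open>The majorant for Fubini is a product: the separation of the contours is used
      as \<open>1 / (c * r)\<close>, and the factor \<open>1 / s\<close> comes from the
      resolvent.\<close>
    have le: "norm ((h (of_real r * d) * (k (of_real s * d') / (of_real s * d' - of_real r * d))) \<cdot> R (of_real s * d') v)
        \<le> norm (h (of_real r * d)) / r * (B * (norm (k (of_real s * d')) / s))"
      if d: "d \<in> dirs \<phi>" "d' \<in> dirs \<phi>'" and rs: "r > 0" "s > 0" for r s d d'
    proof -
      have "norm ((h (of_real r * d) * (k (of_real s * d') / (of_real s * d' - of_real r * d))) \<cdot> R (of_real s * d') v)
          \<le> norm (h (of_real r * d)) * norm (k (of_real s * d')) / norm (of_real s * d' - of_real r * d) * norm (R (of_real s * d') v) * K"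
        using K(2)[of "h (of_real r * d) * (k (of_real s * d') / (of_real s * d' - of_real r * d))" "R (of_real s * d') v"]
        by (simp add: norm_mult norm_divide)
      also have "\<dots> \<le> norm (h (of_real r * d)) * norm (k (of_real s * d')) / (c * r) * (C / s * norm v) * K"
      proof (intro mult_right_mono mult_mono)
        show "norm (h (of_real r * d)) * norm (k (of_real s * d')) / norm (of_real s * d' - of_real r * d) \<le> norm (h (of_real r * d)) * norm (k (of_real s * d')) / (c * r)"
          using sep'(1,3)[OF rs d] c(1) rs by (intro divide_left_mono mult_pos_pos) auto
        show "norm (R (of_real s * d') v) \<le> C / s * norm v"
          using C(2)[OF o'[OF rs(2) d(2)], of v] D'(3)[OF d(2)] rs by (simp add: norm_mult)
      qed (use c(1) rs K(1) in auto)
      also have "\<dots> = norm (h (of_real r * d)) / r * (B * (norm (k (of_real s * d')) / s))"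
        using rs c(1) by (simp add: B_def field_simps)
      finally show ?thesis .
    qed
    show ?thesis
      by (rule ring_swap; rule ray_swap[OF f a b _ _ le]) (use B0 in auto)
  qed
  also have "\<dots> = ring \<phi>' (\<lambda>w. 0)"
  proof (rule ring_cong)
    fix s :: real and d' assume sd: "s > 0" "d' \<in> dirs \<phi>'"
    let ?w = "of_real s * d'"
    note kz = ring_kernel_zero[OF h p(1,4) \<phi>(4,2) p(3) o'[OF sd]]
    have e: "(\<lambda>z. k ?w * (h z / (?w - z))) = (\<lambda>z. h z * (k ?w / (?w - z)))" by (simp add: fun_eq_iff mult_ac)
    have i: "C.ray_integrable d (\<lambda>z. h z * (k ?w / (?w - z)))" if "d \<in> dirs \<phi>" for d
      using C.ray_linear(1)[OF kz(1)[OF that] bounded_linear_mult_right[of "k ?w"]] unfolding e by simp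
    have "ring \<phi> (\<lambda>z. (h z * (k ?w / (?w - z))) \<cdot> R ?w v) = C.ring \<phi> (\<lambda>z. h z * (k ?w / (?w - z))) \<cdot> R ?w v"
      by (rule ring_scalar) (rule i)
    also have "C.ring \<phi> (\<lambda>z. h z * (k ?w / (?w - z))) = k ?w * C.ring \<phi> (\<lambda>z. h z / (?w - z))"
      unfolding e[symmetric] by (rule C.ring_cs) (use kz(1) in auto)
    finally show "ring \<phi> (\<lambda>z. (h z * (k ?w / (?w - z))) \<cdot> R ?w v) = 0" using kz(2) by (simp add: zero_left)
  qed
  finally have zero: "ring \<phi> (\<lambda>z. h z \<cdot> X z) = 0" by simp
  have hk: "decays (sector \<theta>) (\<lambda>z. h z * k z)" by (rule decays_mult[OF conical_sector h k])
  have "ring \<phi> (\<lambda>z. h z \<cdot> X z) = ring \<phi> (\<lambda>z. ?c \<cdot> ((h z * k z) \<cdot> R z v - h z \<cdot> R z u))"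
  proof (rule ring_cong)
    fix r :: real and d assume rd: "r > 0" "d \<in> dirs \<phi>"
    show "h (of_real r * d) \<cdot> X (of_real r * d)
      = ?c \<cdot> ((h (of_real r * d) * k (of_real r * d)) \<cdot> R (of_real r * d) v - h (of_real r * d) \<cdot> R (of_real r * d) u)"
      unfolding X[OF refl rd] cs_commute[of "h (of_real r * d)" ?c] by (simp only: diff_right cs_assoc)
  qed
  also have "\<dots> = ?c \<cdot> ring \<phi> (\<lambda>z. (h z * k z) \<cdot> R z v - h z \<cdot> R z u)"
    by (rule ring_cs, rule ray_integrable_diff) (use dirs_integrable[OF hk \<phi>(1) p(4) \<phi>(4)] dirs_integrable[OF h \<phi>(1) p(4) \<phi>(4)] in auto)
  also have "ring \<phi> (\<lambda>z. (h z * k z) \<cdot> R z v - h z \<cdot> R z u) = ring \<phi> (\<lambda>z. (h z * k z) \<cdot> R z v) - ring \<phi> (\<lambda>z. h z \<cdot> R z u)"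
    by (rule ring_diff) (use dirs_integrable[OF hk \<phi>(1) p(4) \<phi>(4)] dirs_integrable[OF h \<phi>(1) p(4) \<phi>(4)] in auto)
  finally have "?c \<cdot> (ring \<phi> (\<lambda>z. (h z * k z) \<cdot> R z v) - ring \<phi> (\<lambda>z. h z \<cdot> R z u)) = 0" using zero by simp
  \<comment> \<open>One factor cancels \<open>?c\<close>; the other is the normalization in
    \<open>\<Phi>\<close>.\<close>
  then have "(1 / ?c) \<cdot> (1 / ?c) \<cdot> ?c \<cdot> (ring \<phi> (\<lambda>z. (h z * k z) \<cdot> R z v) - ring \<phi> (\<lambda>z. h z \<cdot> R z u)) = 0" by (simp only: zero_right)
  then have "(1 / ?c) \<cdot> ring \<phi> (\<lambda>z. (h z * k z) \<cdot> R z v) = (1 / ?c) \<cdot> ring \<phi> (\<lambda>z. h z \<cdot> R z u)"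
    by (simp add: diff_right flip: cs_assoc)
  then show ?thesis by (simp add: \<Phi>_def u_def)
qed

theorem \<Phi>_product:
  assumes h: "decays (sector \<theta>) h" and k: "decays (sector \<theta>) k" and \<phi>: "\<omega> < \<phi>" "\<phi> < \<theta>" "\<theta> < pi / 2"
  shows "\<Phi> \<phi> h (\<Phi> \<phi> k v) = \<Phi> \<phi> (\<lambda>z. h z * k z) v"
proof -
  define \<phi>' where "\<phi>' = (\<phi> + \<theta>) / 2"
  have \<phi>': "\<phi> < \<phi>'" "\<phi>' < \<theta>" using \<phi> by (auto simp: \<phi>'_def)
  have "\<Phi> \<phi> k v = \<Phi> \<phi>' k v" using \<phi> \<phi>' by (intro \<Phi>_angle_le[OF k]) auto
  then show ?thesis using \<Phi>_product_lt[OF h k \<phi>(1) \<phi>' \<phi>(3)] by simp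
qed

end


section \<open>The inverse of 1 + T^2 and the product rule of the extended calculus\<close>

lemma imaginary_unit_outside:
  assumes "\<phi> < pi / 2" "0 < \<phi>" shows "\<i> \<in> outside \<phi>" "- \<i> \<in> outside \<phi>"
  using cos_gt_zero_pi[of \<phi>] assms by (auto simp: outside_def sector_def)

context sectorial_resolvent
begin

text \<open>The resolvent identity splits \<open>R w (R z v)\<close>, and the part with
  \<open>R w v\<close> is a multiple of the scalar integral in \<open>ring_kernel_zero\<close>,
  hence 0.\<close>

lemma R_\<Phi>:
  assumes F: "decays (sector \<theta>) F" and \<phi>: "\<omega> < \<phi>" "\<phi> < \<theta>" "\<theta> < \<psi>" "\<psi> < pi / 2" and w: "w \<in> outside \<psi>"
  shows "R w (\<Phi> \<phi> F v) = \<Phi> \<phi> (\<lambda>z. F z / (w - z)) v"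
proof -
  have p: "0 < \<phi>" "0 < \<theta>" "\<theta> < pi / 2" "\<phi> < \<psi>" "\<phi> < pi / 2" "\<omega> < \<psi>" using \<phi> \<omega> by auto
  have wo: "w \<in> outside \<phi>" using outside_mono[OF p(1,4) \<phi>(4)] w by blast
  note D = decays_div(1)[OF F p(2) \<phi>(3,4) w]
  note kz = ring_kernel_zero[OF F p(1) \<phi>(2) p(3,4) \<phi>(4) w]
  have "R w (\<Phi> \<phi> F v) = (1 / (2 * of_real pi * \<i>)) \<cdot> ring \<phi> (\<lambda>z. F z \<cdot> R w (R z v))"
    by (rule \<Phi>_linear(5)[OF F \<phi>(1,2) p(3) p(6) \<phi>(4) w])
  also have "ring \<phi> (\<lambda>z. F z \<cdot> R w (R z v)) = ring \<phi> (\<lambda>z. (F z / (w - z)) \<cdot> R z v - (F z / (w - z)) \<cdot> R w v)"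
  proof (rule ring_cong)
    fix r :: real and d assume rd: "r > 0" "d \<in> dirs \<phi>"
    define z where "z = of_real r * d"
    have zo: "z \<in> outside \<phi>" "z \<in> sector \<psi>"
      using dirs_props[OF p(1,4) \<phi>(4) rd(2)] sector_scale[OF rd(1)] outside_scale[OF rd(1)] by (auto simp: z_def)
    have ne: "z \<noteq> w" using zo(2) w by (auto simp: outside_def)
    have e: "1 / (z - w) = - (1 / (w - z))" by (metis minus_diff_eq minus_divide_right)
    have "R w (R z v) = (1 / (w - z)) \<cdot> (R z v - R w v)"
      unfolding R_product[OF \<phi>(1) p(5) wo zo(1) ne[symmetric]] e by (simp add: minus_left diff_right)
    then show "F z \<cdot> R w (R z v) = (F z / (w - z)) \<cdot> R z v - (F z / (w - z)) \<cdot> R w v"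
      by (simp add: diff_right flip: cs_assoc)
  qed
  also have "\<dots> = ring \<phi> (\<lambda>z. (F z / (w - z)) \<cdot> R z v) - ring \<phi> (\<lambda>z. (F z / (w - z)) \<cdot> R w v)"
    by (rule ring_diff) (use dirs_integrable[OF D \<phi>(1,2) p(3)] ray_scalar(1)[OF kz(1)] in auto)
  also have "ring \<phi> (\<lambda>z. (F z / (w - z)) \<cdot> R w v) = C.ring \<phi> (\<lambda>z. F z / (w - z)) \<cdot> R w v"
    by (rule ring_scalar) (rule kz(1))
  finally show ?thesis using kz(2) by (simp add: \<Phi>_def zero_left)
qed

text \<open>Subtracting from \<open>z / (1 + z\<^sup>2) R(z)\<close> its principal part at \<open>\<sigma> = \<plusminus>\<i>\<close> leaves a function that is
  holomorphic across \<open>\<sigma>\<close>.\<close>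

lemma ray_rotate_across:
  assumes \<sigma>: "\<sigma> = \<i> \<or> \<sigma> = - \<i>" and \<phi>: "\<omega> < \<phi>" "\<phi> < pi / 2" and ab: "\<alpha> \<le> \<beta>"
    and t: "\<And>t. t \<in> {\<alpha>..\<beta>} \<Longrightarrow> cis t \<in> outside \<phi> \<and> Im (cis t) * Im \<sigma> > 0"
    and G: "\<And>d. d \<in> {cis \<alpha>, cis \<beta>} \<Longrightarrow> Re d \<noteq> 0 \<and> ray_integrable d (\<lambda>z. (z / (1 + z\<^sup>2)) \<cdot> R z v)"
  shows "ray (cis \<alpha>) (\<lambda>z. (z / (1 + z\<^sup>2)) \<cdot> R z v) - (\<sigma> * C.ray (cis \<alpha>) (\<lambda>z. 1 / (1 + z\<^sup>2))) \<cdot> R \<sigma> v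
       = ray (cis \<beta>) (\<lambda>z. (z / (1 + z\<^sup>2)) \<cdot> R z v) - (\<sigma> * C.ray (cis \<beta>) (\<lambda>z. 1 / (1 + z\<^sup>2))) \<cdot> R \<sigma> v"
proof -
  have \<sigma>2: "\<sigma> * \<sigma> = - 1" using \<sigma> by auto
  have \<phi>0: "0 < \<phi>" using \<phi> \<omega> by simp
  have \<sigma>o: "\<sigma> \<in> outside \<phi>" using \<sigma> imaginary_unit_outside[OF \<phi>(2) \<phi>0] by auto
  define u where "u = R \<sigma> v"
  define S where "S = {z. Im z * Im \<sigma> > 0}"
  \<comment> \<open>Inserting \<open>R z v = u + (\<sigma> - z) \<cdot> R z u\<close> cancels the
    factor \<open>z - \<sigma>\<close> of \<open>1 + z\<^sup>2\<close>; \<open>F\<close> and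
    \<open>H\<close> are the coefficients that remain.\<close>
  define F where "F z = - (z / (z + \<sigma>))" for z
  define H where "H z = 1 / (z + \<sigma>)" for z
  define N where "N z = F z \<cdot> R z u + H z \<cdot> u" for z
  have oS: "open S" unfolding S_def by (intro open_Collect_less continuous_intros)
  have ge1: "1 \<le> norm (z + \<sigma>)" if "z \<in> S" for z
  proof -
    have "1 \<le> \<bar>Im (z + \<sigma>)\<bar>" using that \<sigma> by (auto simp: S_def)
    then show ?thesis using abs_Im_le_cmod[of "z + \<sigma>"] by simp
  qed
  have ne: "z + \<sigma> \<noteq> 0" if "z \<in> S" for z using ge1[OF that] by auto
  have hol: "F holomorphic_on S" "H holomorphic_on S"
    unfolding F_def H_def by (intro holomorphic_intros; use ne in auto)+
  have W: "of_real r * cis s \<in> S \<and> cis s \<in> outside \<phi>" "of_real r * cis s \<in> outside \<phi>" if "r > 0" "s \<in> {\<alpha>..\<beta>}" for r s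
    using t[OF that(2)] that(1) outside_scale[OF that(1)] by (auto simp: S_def mult.assoc)
  have split: "N z = (z / (1 + z\<^sup>2)) \<cdot> R z v - (\<sigma> / (1 + z\<^sup>2)) \<cdot> u" if z: "z \<in> S" "z \<in> outside \<phi>" "z \<noteq> \<sigma>" for z
  proof -
    have q: "1 + z\<^sup>2 = (z + \<sigma>) * (z - \<sigma>)" using \<sigma>2 by (simp add: power2_eq_square algebra_simps)
    have n: "z + \<sigma> \<noteq> 0" "z - \<sigma> \<noteq> 0" "\<sigma> - z \<noteq> 0" using ne[OF z(1)] z(3) by auto
    have Ru: "R z u = (1 / (\<sigma> - z)) \<cdot> (R z v - u)"
      unfolding u_def by (rule R_product[OF \<phi> z(2) \<sigma>o z(3)])
    have "N z = (F z / (\<sigma> - z)) \<cdot> R z v + (H z - F z / (\<sigma> - z)) \<cdot> u"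
      unfolding N_def Ru by (simp add: diff_right diff_left flip: cs_assoc)
    moreover have "F z / (\<sigma> - z) = z / (1 + z\<^sup>2)"
    proof -
      have "- (z / x) / - y = z / (x * y)" for x y by simp
      from this[of "z + \<sigma>" "z - \<sigma>"] show ?thesis by (simp only: F_def q minus_diff_eq)
    qed
    moreover have "H z - z / (1 + z\<^sup>2) = - (\<sigma> / (1 + z\<^sup>2))"
    proof -
      have "1 / x - z / (x * y) = (y - z) / (x * y)" if "x \<noteq> 0" "y \<noteq> 0" for x y
        using that by (simp add: diff_divide_distrib)
      from this[OF n(1,2)] show ?thesis by (simp add: H_def q)
    qed
    ultimately show ?thesis by (simp add: minus_left)
  qed
  obtain C where C: "C \<ge> 0" "\<And>z v. z \<in> outside \<phi> \<Longrightarrow> norm (R z v) \<le> C / norm z * norm v"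
    using R_bound_apply[OF \<phi>] by blast
  obtain K where K: "K > 0" "\<And>c v. norm (c \<cdot> v) \<le> norm c * norm v * K" using norm_cs by blast
  define A where "A = C * norm u * K + norm u * K"
  define B where "B = C * norm v * K + norm u * K"
  have AB: "A \<ge> 0" "B \<ge> 0" using C(1) K(1) by (auto simp: A_def B_def)
  \<comment> \<open>For \<open>(norm z)\<^sup>2 \<le> 2\<close>, a region that contains \<sigma>,
    the pole-free form of \<open>N\<close> is estimated. Beyond it both terms of
    \<open>split\<close> decay quadratically. The factor 3 serves both sides:
    \<open>1 + (norm z)\<^sup>2\<close> is at most 3 there, and at most three times the modulus of
    \<open>1 + z\<^sup>2\<close> here.\<close>
  have bound: "norm (N z) \<le> 3 * (A + B) * (1 / (1 + (norm z)\<^sup>2))" if z: "z \<in> S" "z \<in> outside \<phi>" for z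
  proof -
    have z0: "norm z > 0" using z(2) by (simp add: outside_def)
    have pos: "1 + (norm z)\<^sup>2 > 0" by (simp add: add_pos_nonneg)
    show ?thesis
    proof (cases "(norm z)\<^sup>2 \<le> 2")
      case True
      have "norm (F z) \<le> norm z" "norm (H z) \<le> 1"
        using ge1[OF z(1)] by (auto simp: F_def H_def norm_divide divide_le_eq mult_le_cancel_left1)
      then have "norm (F z) * norm (R z u) * K \<le> norm z * (C / norm z * norm u) * K" "norm (H z) * norm u * K \<le> 1 * norm u * K"
        using C(2)[OF z(2), of u] K(1) by (intro mult_right_mono mult_mono; simp)+
      then have "norm (N z) \<le> A"
        unfolding N_def A_def using norm_triangle_ineq[of "F z \<cdot> R z u" "H z \<cdot> u"] K(2)[of "F z" "R z u"] K(2)[of "H z" u] z0 by simp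
      also have "A \<le> (A + B) * (3 / (1 + (norm z)\<^sup>2))"
      proof -
        have "1 \<le> 3 / (1 + (norm z)\<^sup>2)" using True pos by (simp add: field_simps)
        then have "(A + B) * 1 \<le> (A + B) * (3 / (1 + (norm z)\<^sup>2))" using AB by (intro mult_left_mono) auto
        moreover have "A \<le> (A + B) * 1" using AB by simp
        ultimately show ?thesis by (rule order_trans[rotated])
      qed
      finally show ?thesis by (simp only: times_divide_eq_right mult_1_right mult.commute[of "A + B" 3])
    next
      case False
      have zn: "z \<noteq> \<sigma>" using False \<sigma> by auto
      have q: "(1 + (norm z)\<^sup>2) / 3 \<le> norm (1 + z\<^sup>2)"
        using False norm_triangle_ineq2[of "z\<^sup>2" "- 1"] by (simp add: norm_power add.commute)
      have qpos: "norm (1 + z\<^sup>2) > 0" by (rule less_le_trans[OF _ q]) (use pos in simp)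
      have "norm ((z / (1 + z\<^sup>2)) \<cdot> R z v) \<le> norm z / norm (1 + z\<^sup>2) * (C / norm z * norm v) * K"
      proof -
        have "norm z / norm (1 + z\<^sup>2) * norm (R z v) * K \<le> norm z / norm (1 + z\<^sup>2) * (C / norm z * norm v) * K"
          using C(2)[OF z(2), of v] K(1) by (intro mult_right_mono mult_left_mono) auto
        then show ?thesis using K(2)[of "z / (1 + z\<^sup>2)" "R z v"] unfolding norm_divide by linarith
      qed
      moreover have "norm ((\<sigma> / (1 + z\<^sup>2)) \<cdot> u) \<le> 1 / norm (1 + z\<^sup>2) * norm u * K"
        using K(2)[of "\<sigma> / (1 + z\<^sup>2)" u] \<sigma> by (auto simp: norm_divide)
      ultimately have "norm (N z) \<le> B / norm (1 + z\<^sup>2)"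
        unfolding split[OF z zn] B_def using norm_triangle_ineq4[of "(z / (1 + z\<^sup>2)) \<cdot> R z v" "(\<sigma> / (1 + z\<^sup>2)) \<cdot> u"] z0
        by (simp add: add_divide_distrib mult_ac)
      also have "\<dots> \<le> (A + B) / ((1 + (norm z)\<^sup>2) / 3)"
        using AB q pos qpos by (intro frac_le) auto
      also have "\<dots> = 3 * (A + B) * (1 / (1 + (norm z)\<^sup>2))"
        using divide_divide_eq_right[of "A + B" "1 + (norm z)\<^sup>2" 3] mult.commute[of "A + B" 3]
        by (simp only: times_divide_eq_right mult_1_right)
      finally show ?thesis .
    qed
  qed
  have Ncont: "continuous_on {0<..} (\<lambda>r. N (of_real r * cis s))" if s: "s \<in> {\<alpha>..\<beta>}" for s
    unfolding N_def
    by (intro continuous_on_add continuous_on blinfun.continuous_on continuous_on_const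
        continuous_on_compose2[OF holomorphic_on_imp_continuous_on[OF hol(1)]]
        continuous_on_compose2[OF holomorphic_on_imp_continuous_on[OF hol(2)]]
        continuous_on_compose2[OF R_continuous[OF \<phi>]] continuous_intros)
      (use W s in auto)
  have dom: "(\<lambda>r. 3 * (A + B) * (1 / (1 + r\<^sup>2))) integrable_on {0<..}"
    using integrable_on_cmult_left[OF integrable_inverse_1_plus_square, of "3 * (A + B)"] by simp
  have Nle: "norm (N (of_real r * cis s)) \<le> 3 * (A + B) * (1 / (1 + r\<^sup>2))" if "s \<in> {\<alpha>..\<beta>}" "r > 0" for r s
    using bound[of "of_real r * cis s"] W[OF that(2,1)] by (simp add: norm_mult)
  have rot: "ray (cis \<alpha>) N = ray (cis \<beta>) N"
    unfolding N_def
  proof (rule ray_rotate_resolvent[OF ab \<phi> oS hol])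
    show "of_real r * cis s \<in> S \<and> cis s \<in> outside \<phi>" if "r > 0" "s \<in> {\<alpha>..\<beta>}" for r s using W[OF that] by blast
    show "(\<lambda>r. norm (F (of_real r * cis s) \<cdot> R (of_real r * cis s) u + H (of_real r * cis s) \<cdot> u)) integrable_on {0<..}" if s: "s \<in> {\<alpha>..\<beta>}" for s
      unfolding N_def[symmetric]
      by (rule dominated_integrable_Ioi(1)[OF continuous_on_norm[OF Ncont[OF s]] dom]) (use Nle[OF s] in simp)
    show "norm z * norm (F z \<cdot> R z u + H z \<cdot> u) \<le> 3 * (A + B)" if "z \<in> wedge \<alpha> \<beta>" for z
    proof -
      have z: "z \<in> S" "z \<in> outside \<phi>" using that W by (auto simp: wedge_def)
      have pos: "1 + (norm z)\<^sup>2 > 0" by (simp add: add_pos_nonneg)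
      have "norm z * 1 \<le> 1 + (norm z)\<^sup>2"
      proof -
        have "2 * norm z \<le> (norm z)\<^sup>2 + 1" using sum_squares_bound[of "norm z" 1] by simp
        then show ?thesis using norm_ge_zero[of z] by linarith
      qed
      then have "norm z * (1 / (1 + (norm z)\<^sup>2)) \<le> 1" using pos by (simp add: divide_le_eq)
      then have "3 * (A + B) * (norm z * (1 / (1 + (norm z)\<^sup>2))) \<le> 3 * (A + B) * 1" using AB by (intro mult_left_mono) auto
      moreover have "norm z * norm (N z) \<le> norm z * (3 * (A + B) * (1 / (1 + (norm z)\<^sup>2)))"
        by (intro mult_left_mono bound z) auto
      ultimately show ?thesis unfolding N_def[symmetric] by (simp add: mult_ac)
    qed
  qed
  have ray: "ray d N = ray d (\<lambda>z. (z / (1 + z\<^sup>2)) \<cdot> R z v) - (\<sigma> * C.ray d (\<lambda>z. 1 / (1 + z\<^sup>2))) \<cdot> u"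
    if d: "d = cis s" "s \<in> {\<alpha>..\<beta>}" "d \<in> {cis \<alpha>, cis \<beta>}" for d s
  proof -
    have re: "Re d \<noteq> 0" and gi: "ray_integrable d (\<lambda>z. (z / (1 + z\<^sup>2)) \<cdot> R z v)" using G[OF d(3)] by auto
    have qi: "C.ray_integrable d (\<lambda>w. 1 / (1 + w\<^sup>2))"
      using ray_arctan[of d] re d(1) by (cases "Re d > 0") auto
    have qs: "C.ray_integrable d (\<lambda>w. \<sigma> * (1 / (1 + w\<^sup>2)))" "C.ray d (\<lambda>w. \<sigma> * (1 / (1 + w\<^sup>2))) = \<sigma> * C.ray d (\<lambda>z. 1 / (1 + z\<^sup>2))"
      by (rule C.ray_linear[OF qi bounded_linear_mult_right], simp add: mult_ac)+
    have "ray d N = ray d (\<lambda>z. (z / (1 + z\<^sup>2)) \<cdot> R z v - (\<sigma> * (1 / (1 + z\<^sup>2))) \<cdot> u)"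
    proof (rule ray_cong)
      fix r :: real assume r: "r > 0"
      have "Re (of_real r * d) \<noteq> Re \<sigma>" using re r \<sigma> by auto
      then have "of_real r * d \<noteq> \<sigma>" by metis
      then show "N (of_real r * d) = (of_real r * d / (1 + (of_real r * d)\<^sup>2)) \<cdot> R (of_real r * d) v - (\<sigma> * (1 / (1 + (of_real r * d)\<^sup>2))) \<cdot> u"
        using split[of "of_real r * d"] W[OF r d(2)] d(1) by simp
    qed
    also have "\<dots> = ray d (\<lambda>z. (z / (1 + z\<^sup>2)) \<cdot> R z v) - ray d (\<lambda>z. (\<sigma> * (1 / (1 + z\<^sup>2))) \<cdot> u)"
      by (rule ray_diff[OF gi ray_scalar(1)[OF qs(1)]])
    finally show ?thesis using ray_scalar(2)[OF qs(1), of u] qs(2) by simp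
  qed
  show ?thesis
    using rot ray[OF refl, of \<alpha>] ray[OF refl, of \<beta>] ab by (simp add: u_def)
qed

text \<open>\<open>P\<close> and \<open>TP\<close> are (1+T^2)^{-1} and T(1+T^2)^{-1}, written by
  partial fractions with the poles \<i> and - \<i>.\<close>

definition P :: "'a \<Rightarrow> 'a" where "P v = (1 / (2 * \<i>)) \<cdot> (R (- \<i>) v - R \<i> v)"

definition TP :: "'a \<Rightarrow> 'a" where "TP v = (- 1 / 2) \<cdot> (R \<i> v + R (- \<i>) v)"

text \<open>The two upper rays are rotated into each other across \<i> and the two lower ones across
  - \<i>, so that only the principal parts are left. Their scalar integrals are \<plusminus> pi/2 by
  \<open>ray_arctan\<close>.\<close>

lemma \<Phi>_z_div_1_plus_square:
  assumes \<phi>: "\<omega> < \<phi>" "\<phi> < \<theta>" "\<theta> < pi / 2"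
  shows "\<Phi> \<phi> (\<lambda>z. z / (1 + z\<^sup>2)) v = TP v"
proof -
  have p: "0 < \<theta>" "0 < \<phi>" "\<phi> < pi / 2" using \<phi> \<omega> by auto
  let ?G = "\<lambda>z. (z / (1 + z\<^sup>2)) \<cdot> R z v"
  note gi = dirs_integrable[OF decays_z_div_1_plus_square(1)[OF p(1) \<phi>(3)] \<phi>, of _ v]
  have c: "cos \<phi> > 0" using p by (intro cos_gt_zero_pi) auto
  have q: "C.ray (cis \<phi>) (\<lambda>z. 1 / (1 + z\<^sup>2)) = pi / 2" "C.ray (cis (- \<phi>)) (\<lambda>z. 1 / (1 + z\<^sup>2)) = pi / 2"
    "C.ray (- cis \<phi>) (\<lambda>z. 1 / (1 + z\<^sup>2)) = - pi / 2" "C.ray (- cis (- \<phi>)) (\<lambda>z. 1 / (1 + z\<^sup>2)) = - pi / 2"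
    using c ray_arctan(1)[of "cis \<phi>"] ray_arctan(1)[of "cis (- \<phi>)"]
      ray_arctan(2)[of "- cis \<phi>"] ray_arctan(2)[of "- cis (- \<phi>)"] by simp_all
  have in1: "cis t \<in> outside \<phi> \<and> Im (cis t) > 0" if "t \<in> {\<phi>..pi - \<phi>}" for t
    using cis_notin_sector[of \<phi> t] that p sin_gt_zero[of t] by (auto simp: outside_def)
  have e: "cis (\<phi> - pi) = - cis \<phi>" by (auto simp: complex_eq_iff)
  have up: "ray (cis \<phi>) ?G - (\<i> * C.ray (cis \<phi>) (\<lambda>z. 1 / (1 + z\<^sup>2))) \<cdot> R \<i> v
      = ray (cis (pi - \<phi>)) ?G - (\<i> * C.ray (cis (pi - \<phi>)) (\<lambda>z. 1 / (1 + z\<^sup>2))) \<cdot> R \<i> v"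
  proof (rule ray_rotate_across[OF _ \<phi>(1) p(3)])
    show "cis t \<in> outside \<phi> \<and> Im (cis t) * Im \<i> > 0" if "t \<in> {\<phi>..pi - \<phi>}" for t using in1[OF that] by simp
    show "Re d \<noteq> 0 \<and> ray_integrable d ?G" if "d \<in> {cis \<phi>, cis (pi - \<phi>)}" for d
      using that c gi[of d] by (auto simp: dirs_def sector_minus_cis(2))
  qed (use p in auto)
  have low: "ray (cis (\<phi> - pi)) ?G - (- \<i> * C.ray (cis (\<phi> - pi)) (\<lambda>z. 1 / (1 + z\<^sup>2))) \<cdot> R (- \<i>) v
      = ray (cis (- \<phi>)) ?G - (- \<i> * C.ray (cis (- \<phi>)) (\<lambda>z. 1 / (1 + z\<^sup>2))) \<cdot> R (- \<i>) v"
  proof (rule ray_rotate_across[OF _ \<phi>(1) p(3)])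
    show "cis t \<in> outside \<phi> \<and> Im (cis t) * Im (- \<i>) > 0" if "t \<in> {\<phi> - pi..- \<phi>}" for t
      using in1[of "- t"] that cnj_sector[of t \<phi>] by (auto simp: outside_def)
    show "Re d \<noteq> 0 \<and> ray_integrable d ?G" if "d \<in> {cis (\<phi> - pi), cis (- \<phi>)}" for d
      using that c gi[of d] by (auto simp: dirs_def e)
  qed (use p in auto)
  have up': "ray (- cis (- \<phi>)) ?G = ray (cis \<phi>) ?G - (\<i> * pi) \<cdot> R \<i> v"
  proof -
    have "(\<i> * (pi / 2)) \<cdot> R \<i> v - (\<i> * (- pi / 2)) \<cdot> R \<i> v = (\<i> * pi) \<cdot> R \<i> v"
      by (simp flip: diff_left)
    then show ?thesis using up unfolding sector_minus_cis(2) q by (simp add: algebra_simps)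
  qed
  have low': "ray (- cis \<phi>) ?G = ray (cis (- \<phi>)) ?G + (\<i> * pi) \<cdot> R (- \<i>) v"
  proof -
    have "(- \<i> * (- pi / 2)) \<cdot> R (- \<i>) v - (- \<i> * (pi / 2)) \<cdot> R (- \<i>) v = (\<i> * pi) \<cdot> R (- \<i>) v"
      by (simp flip: diff_left)
    then show ?thesis using low unfolding e q by (simp add: algebra_simps)
  qed
  have "ring \<phi> ?G = (- (\<i> * pi)) \<cdot> (R \<i> v + R (- \<i>) v)"
    unfolding ring_def up' low' by (simp add: add_right minus_left)
  moreover have "1 / (2 * of_real pi * \<i>) * (- (\<i> * of_real pi)) = - 1 / 2" by simp
  ultimately show ?thesis unfolding \<Phi>_def TP_def by (metis cs_assoc)
qed

lemma R_imaginary_units: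
  "R \<i> (x + y) = R \<i> x + R \<i> y" "R (- \<i>) (c \<cdot> x) = c \<cdot> R (- \<i>) x" "R \<i> (c \<cdot> x) = c \<cdot> R \<i> x"
  "R \<i> (R (- \<i>) v) = P v" "R (- \<i>) (R \<i> v) = P v"
proof -
  define \<phi> where "\<phi> = (\<omega> + pi / 2) / 2"
  have \<phi>: "\<omega> < \<phi>" "\<phi> < pi / 2" "0 < \<phi>" using \<omega> by (auto simp: \<phi>_def)
  note o = imaginary_unit_outside[OF \<phi>(2,3)]
  show "R \<i> (x + y) = R \<i> x + R \<i> y" by (rule blinfun.add_right)
  show "R (- \<i>) (c \<cdot> x) = c \<cdot> R (- \<i>) x" "R \<i> (c \<cdot> x) = c \<cdot> R \<i> x" by (rule R_cs[OF \<phi>(1,2)]; fact o)+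
  have e: "1 / (- \<i> - \<i>) = - (1 / (2 * \<i>))" by (simp add: complex_eq_iff)
  have "R \<i> (R (- \<i>) v) = (1 / (- \<i> - \<i>)) \<cdot> (R \<i> v - R (- \<i>) v)"
    by (rule R_product[OF \<phi>(1,2) o]) (simp add: complex_eq_iff)
  then show "R \<i> (R (- \<i>) v) = P v" unfolding e P_def by (simp add: minus_left diff_right)
  then show "R (- \<i>) (R \<i> v) = P v" using R_commute[OF \<phi>(1,2) o] by simp
qed

lemma P_linear: "P (u + v) = P u + P v" "P (c \<cdot> v) = c \<cdot> P v"
  by (simp_all add: P_def R_imaginary_units blinfun.add_right diff_right add_right cs_commute[of c] algebra_simps)

text \<open>The operator form of q^2 = q - (z q)^2 for q = 1/(1+z^2). It rewrites the square of
  \<open>P\<close> as \<open>P\<close> plus a value of \<open>\<Phi>\<close>.\<close>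

lemma P_P: "P (P v) = P v - TP (TP v)"
proof -
  have q: "c \<cdot> x = x'" if "(2::complex) * c = 1" "x = x' + x'" for c x x'
    using that by (metis cs_one mult.commute add_left cs_assoc mult_2 one_add_one distrib_right)
  have "P (P v) + TP (TP v) = P v"
  proof -
    define a where "a = R \<i> (R \<i> v)"
    define b where "b = R (- \<i>) (R (- \<i>) v)"
    define p where "p = P v"
    have Rd: "R w (x - y) = R w x - R w y" "R w (x + y) = R w x + R w y" for w x y by (rule blinfun.diff_right blinfun.add_right)+
    have 1: "P (P v) = (- 1 / 4) \<cdot> ((b - p) - (p - a))"
    proof -
      have "P (P v) = (1 / (2 * \<i>)) \<cdot> (R (- \<i>) ((1 / (2 * \<i>)) \<cdot> (R (- \<i>) v - R \<i> v)) - R \<i> ((1 / (2 * \<i>)) \<cdot> (R (- \<i>) v - R \<i> v)))"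
        by (simp only: P_def)
      also have "\<dots> = (1 / (2 * \<i>)) \<cdot> ((1 / (2 * \<i>)) \<cdot> (b - p) - (1 / (2 * \<i>)) \<cdot> (p - a))"
        by (simp only: R_imaginary_units(2-5) Rd a_def b_def p_def)
      also have "\<dots> = (1 / (2 * \<i>) * (1 / (2 * \<i>))) \<cdot> ((b - p) - (p - a))"
        by (simp only: diff_right cs_assoc)
      also have "1 / (2 * \<i>) * (1 / (2 * \<i>)) = - 1 / 4" by (simp add: complex_eq_iff)
      finally show ?thesis .
    qed
    have 2: "TP (TP v) = (1 / 4) \<cdot> ((a + p) + (p + b))"
    proof -
      have "TP (TP v) = (- 1 / 2) \<cdot> (R \<i> ((- 1 / 2) \<cdot> (R \<i> v + R (- \<i>) v)) + R (- \<i>) ((- 1 / 2) \<cdot> (R \<i> v + R (- \<i>) v)))"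
        by (simp only: TP_def)
      also have "\<dots> = (- 1 / 2) \<cdot> ((- 1 / 2) \<cdot> (a + p) + (- 1 / 2) \<cdot> (p + b))"
        by (simp only: R_imaginary_units(2-5) Rd a_def b_def p_def)
      also have "\<dots> = ((- 1 / 2) * (- 1 / 2)) \<cdot> ((a + p) + (p + b))"
        by (simp only: add_right cs_assoc)
      finally show ?thesis by simp
    qed
    have "(- 1 / 4) \<cdot> x = - ((1 / 4) \<cdot> x)" for x using minus_left[of "1 / 4" x] by simp
    then have "P (P v) + TP (TP v) = (1 / 4) \<cdot> (((a + p) + (p + b)) - ((b - p) - (p - a)))"
      unfolding 1 2 by (simp only: diff_right) simp
    also have "((a + p) + (p + b)) - ((b - p) - (p - a)) = 4 *\<^sub>R p"
    proof -
      have "4 *\<^sub>R p = p + p + p + p" using scaleR_left_distrib[of 2 2 p] scaleR_2[of p] by simp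
      then show ?thesis by simp
    qed
    also have "(1 / 4) \<cdot> (4 *\<^sub>R p) = p" using cs_of_real[of 4 p] cs_assoc[of "1 / 4" 4 p] by simp
    finally show ?thesis by (simp add: p_def)
  qed
  then show ?thesis by (simp add: algebra_simps)
qed

text \<open>Partial fractions reduce \<open>P\<close> to the resolvents at \<i> and - \<i>, to which
  \<open>R_\<Phi>\<close> applies.\<close>

lemma P_\<Phi>:
  assumes F: "decays (sector \<theta>) F" and \<phi>: "\<omega> < \<phi>" "\<phi> < \<theta>" "\<theta> < pi / 2"
  shows "P (\<Phi> \<phi> F v) = \<Phi> \<phi> (\<lambda>z. 1 / (1 + z\<^sup>2) * F z) v" and "\<Phi> \<phi> F (P v) = P (\<Phi> \<phi> F v)"
    and "decays (sector \<theta>) (\<lambda>z. 1 / (1 + z\<^sup>2) * F z)"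
proof -
  define \<psi> where "\<psi> = (\<theta> + pi / 2) / 2"
  have \<psi>: "\<theta> < \<psi>" "\<psi> < pi / 2" "0 < \<psi>" "0 < \<theta>" "\<omega> < \<psi>" using \<phi> \<omega> by (auto simp: \<psi>_def)
  note o = imaginary_unit_outside[OF \<psi>(2,3)]
  let ?a = "\<lambda>z. F z / (- \<i> - z)" and ?b = "\<lambda>z. F z / (\<i> - z)"
  have d: "decays (sector \<theta>) ?a" "decays (sector \<theta>) ?b"
    by (rule decays_div(1)[OF F \<psi>(4,1,2)]; fact o)+
  have dm: "decays (sector \<theta>) (\<lambda>z. - 1 * ?b z)" by (rule decays_cmult[OF conical_sector d(2)])
  have dab: "decays (sector \<theta>) (\<lambda>z. ?a z + - 1 * ?b z)" by (rule decays_add[OF conical_sector d(1) dm])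
  have eq: "1 / (2 * \<i>) * (?a z + - 1 * ?b z) = 1 / (1 + z\<^sup>2) * F z" if "z \<in> sector \<theta>" for z
  proof -
    have "z \<noteq> \<i>" "z \<noteq> - \<i>" using that imaginary_unit_outside[OF \<phi>(3) \<psi>(4)] by (auto simp: outside_def)
    then have n: "\<i> - z \<noteq> 0" "- \<i> - z \<noteq> 0" by (auto simp: algebra_simps)
    have "1 + z\<^sup>2 = (\<i> - z) * (- \<i> - z)" by (simp add: power2_eq_square algebra_simps)
    moreover have "f / y + - 1 * (f / x) = (x - y) * f / (x * y)" if "x \<noteq> 0" "y \<noteq> 0" for x y f :: complex
      using that by (simp add: field_simps)
    from this[OF n] have "?a z + - 1 * ?b z = (2 * \<i>) * F z / ((\<i> - z) * (- \<i> - z))" by simp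
    ultimately show ?thesis by simp
  qed
  show "decays (sector \<theta>) (\<lambda>z. 1 / (1 + z\<^sup>2) * F z)"
    by (rule decays_cong[OF conical_sector decays_cmult[OF conical_sector dab, of "1 / (2 * \<i>)"] eq])
  have "P (\<Phi> \<phi> F v) = (1 / (2 * \<i>)) \<cdot> (\<Phi> \<phi> ?a v - \<Phi> \<phi> ?b v)"
    unfolding P_def R_\<Phi>[OF F \<phi>(1,2) \<psi>(1,2) o(1)] R_\<Phi>[OF F \<phi>(1,2) \<psi>(1,2) o(2)] ..
  also have "\<dots> = (1 / (2 * \<i>)) \<cdot> \<Phi> \<phi> (\<lambda>z. ?a z + - 1 * ?b z) v"
    unfolding \<Phi>_linear(2)[OF d(1) \<phi> dm] \<Phi>_linear(1)[OF d(2) \<phi>] by (simp add: minus_left)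
  also have "\<dots> = \<Phi> \<phi> (\<lambda>z. 1 / (2 * \<i>) * (?a z + - 1 * ?b z)) v"
    by (rule \<Phi>_linear(1)[OF dab \<phi>, symmetric])
  also have "\<dots> = \<Phi> \<phi> (\<lambda>z. 1 / (1 + z\<^sup>2) * F z) v"
    by (rule \<Phi>_cong[OF \<phi>]) (rule eq)
  finally show "P (\<Phi> \<phi> F v) = \<Phi> \<phi> (\<lambda>z. 1 / (1 + z\<^sup>2) * F z) v" .
  have Rc: "R w (\<Phi> \<phi> F v) = \<Phi> \<phi> F (R w v)" if w: "w \<in> outside \<psi>" for w v
  proof -
    have "R w (\<Phi> \<phi> F v) = (1 / (2 * of_real pi * \<i>)) \<cdot> ring \<phi> (\<lambda>z. F z \<cdot> R w (R z v))"
      by (rule \<Phi>_linear(5)[OF F \<phi> \<psi>(5,2) w])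
    also have "ring \<phi> (\<lambda>z. F z \<cdot> R w (R z v)) = ring \<phi> (\<lambda>z. F z \<cdot> R z (R w v))"
    proof (rule ring_cong)
      have p: "0 < \<phi>" "\<phi> < pi / 2" "\<phi> < \<psi>" using \<phi> \<omega> \<psi> by auto
      fix r :: real and d assume "r > 0" "d \<in> dirs \<phi>"
      then have "of_real r * d \<in> outside \<phi>" using dirs_props[OF p(1) \<phi>(2,3)] outside_scale by blast
      moreover have "w \<in> outside \<phi>" using w outside_mono[OF p(1,3) \<psi>(2)] by blast
      ultimately show "F (of_real r * d) \<cdot> R w (R (of_real r * d) v) = F (of_real r * d) \<cdot> R (of_real r * d) (R w v)"
        using R_commute[OF \<phi>(1) p(2)] by simp
    qed
    finally show ?thesis by (simp add: \<Phi>_def)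
  qed
  have m: "\<Phi> \<phi> F (x - y) = \<Phi> \<phi> F x - \<Phi> \<phi> F y" for x y
    using \<Phi>_linear(3)[OF F \<phi>, of y "x - y"] by simp
  show "\<Phi> \<phi> F (P v) = P (\<Phi> \<phi> F v)"
    unfolding P_def \<Phi>_linear(4)[OF F \<phi>] m Rc[OF o(1)] Rc[OF o(2)] ..
qed

text \<open>\<open>a\<close> is the value at infinity and \<open>b\<close> the value at 0 of the
  function to which the calculus is applied.\<close>

definition \<Psi> :: "real \<Rightarrow> complex \<Rightarrow> complex \<Rightarrow> (complex \<Rightarrow> complex) \<Rightarrow> 'a \<Rightarrow> 'a" where
  "\<Psi> \<phi> a b H v = a \<cdot> v + (b - a) \<cdot> P v + \<Phi> \<phi> H v"

text \<open>With q = 1/(1+z^2), this is the decaying part of (a + (b-a) q + F)(a' + (b'-a') q + F')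
  after a a' + (b b' - a a') q has been taken out. The last summand is what replacing q^2 by q - (z
  q)^2 leaves behind.\<close>

definition \<Psi>_rest :: "complex \<Rightarrow> complex \<Rightarrow> (complex \<Rightarrow> complex) \<Rightarrow> complex \<Rightarrow> complex \<Rightarrow> (complex \<Rightarrow> complex) \<Rightarrow> complex \<Rightarrow> complex" where
  "\<Psi>_rest a b F a' b' F' z = a * F' z + ((b - a) * (1 / (1 + z\<^sup>2) * F' z) + (a' * F z + ((b' - a') * (1 / (1 + z\<^sup>2) * F z)
     + (F z * F' z + (- ((b - a) * (b' - a'))) * (z / (1 + z\<^sup>2) * (z / (1 + z\<^sup>2)))))))"

text \<open>Both sides are expanded into the same terms: \<open>\<Phi>_product\<close> deals with
  \<open>F\<close> and \<open>F'\<close>, \<open>P_\<Phi>\<close> with the mixed terms, and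
  \<open>P_P\<close> with the square of \<open>P\<close>, where \<open>TP\<close> is a value of
  \<open>\<Phi>\<close>.\<close>

lemma \<Psi>_product:
  assumes F: "decays (sector \<theta>) F" and F': "decays (sector \<theta>) F'" and \<phi>: "\<omega> < \<phi>" "\<phi> < \<theta>" "\<theta> < pi / 2"
  shows "\<Psi> \<phi> a b F (\<Psi> \<phi> a' b' F' v) = \<Psi> \<phi> (a * a') (b * b') (\<Psi>_rest a b F a' b' F') v"
    and "decays (sector \<theta>) (\<Psi>_rest a b F a' b' F')"
proof -
  have p: "0 < \<theta>" using \<phi> \<omega> by auto
  let ?q = "\<lambda>z. z / (1 + z\<^sup>2) :: complex"
  note zq = decays_z_div_1_plus_square(1)[OF p \<phi>(3)]
  note S = conical_sector[of \<theta>]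
  note zq2 = decays_mult[OF S zq zq]
  note FF = decays_mult[OF S F F']
  note qF = P_\<Phi>(3)[OF F \<phi>] and qF' = P_\<Phi>(3)[OF F' \<phi>]
  note d6 = decays_cmult[OF S zq2, of "- ((b - a) * (b' - a'))"]
  note d5 = decays_add[OF S FF d6]
  note c4 = decays_cmult[OF S qF, of "b' - a'"]
  note d4 = decays_add[OF S c4 d5]
  note c3 = decays_cmult[OF S F, of a']
  note d3 = decays_add[OF S c3 d4]
  note c2 = decays_cmult[OF S qF', of "b - a"]
  note d2 = decays_add[OF S c2 d3]
  note c1 = decays_cmult[OF S F', of a]
  show rest: "decays (sector \<theta>) (\<Psi>_rest a b F a' b' F')"
    using decays_add[OF S c1 d2] by (simp add: \<Psi>_rest_def[abs_def])
  have R: "\<Phi> \<phi> (\<Psi>_rest a b F a' b' F') v = a \<cdot> \<Phi> \<phi> F' v + ((b - a) \<cdot> P (\<Phi> \<phi> F' v) + (a' \<cdot> \<Phi> \<phi> F v + ((b' - a') \<cdot> P (\<Phi> \<phi> F v)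
     + (\<Phi> \<phi> F (\<Phi> \<phi> F' v) + (- ((b - a) * (b' - a'))) \<cdot> TP (TP v)))))"
    unfolding \<Psi>_rest_def[abs_def] \<Phi>_linear(2)[OF c1 \<phi> d2] \<Phi>_linear(2)[OF c2 \<phi> d3] \<Phi>_linear(2)[OF c3 \<phi> d4]
      \<Phi>_linear(2)[OF c4 \<phi> d5] \<Phi>_linear(2)[OF FF \<phi> d6] \<Phi>_linear(1)[OF F' \<phi>] \<Phi>_linear(1)[OF qF' \<phi>]
      \<Phi>_linear(1)[OF F \<phi>] \<Phi>_linear(1)[OF qF \<phi>] \<Phi>_linear(1)[OF zq2 \<phi>]
      P_\<Phi>(1)[OF F \<phi>] P_\<Phi>(1)[OF F' \<phi>] \<Phi>_product[OF F F' \<phi>]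
      \<Phi>_product[OF zq zq \<phi>, symmetric] \<Phi>_z_div_1_plus_square[OF \<phi>] ..
  have L: "\<Psi> \<phi> a b F (\<Psi> \<phi> a' b' F' v) =
      a \<cdot> (a' \<cdot> v + (b' - a') \<cdot> P v + \<Phi> \<phi> F' v)
      + (b - a) \<cdot> (a' \<cdot> P v + (b' - a') \<cdot> (P v - TP (TP v)) + P (\<Phi> \<phi> F' v))
      + (a' \<cdot> \<Phi> \<phi> F v + (b' - a') \<cdot> P (\<Phi> \<phi> F v) + \<Phi> \<phi> F (\<Phi> \<phi> F' v))"
    unfolding \<Psi>_def P_linear \<Phi>_linear(3)[OF F \<phi>] \<Phi>_linear(4)[OF F \<phi>] P_\<Phi>(2)[OF F \<phi>] P_P ..
  show "\<Psi> \<phi> a b F (\<Psi> \<phi> a' b' F' v) = \<Psi> \<phi> (a * a') (b * b') (\<Psi>_rest a b F a' b' F') v"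
    unfolding L unfolding \<Psi>_def R
    by (simp add: add_right diff_right add_left diff_left minus_left algebra_simps flip: cs_assoc)
qed

end


section \<open>The Clifford module as a complex Banach space, and slices as copies of the complex
  plane\<close>

lemma norm_vec_le_sum: "norm (v :: ('v::real_normed_vector, 'k::finite) vec) \<le> (\<Sum>k\<in>UNIV. norm (v $ k))"
  unfolding norm_vec_def by (rule L2_set_le_sum) auto

lemma norm_axis_le: "norm (axis k x :: ('v::real_normed_vector, 'k::finite) vec) \<le> norm x"
proof -
  have "(\<Sum>j\<in>UNIV. norm ((axis k x :: ('v, 'k) vec) $ j)) = (\<Sum>j\<in>UNIV. if j = k then norm x else 0)"
    by (rule sum.cong) (auto simp: axis_def)
  then show ?thesis using norm_vec_le_sum[of "axis k x :: ('v, 'k) vec"] by simp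
qed

lemma cl_sign_square [simp]: "cl_sign A B * cl_sign A B = 1"
  unfolding cl_sign_def by (auto simp: prod.distrib[symmetric] intro!: prod.neutral)

lemma abs_cl_sign [simp]: "\<bar>cl_sign A B\<bar> = 1"
  using cl_sign_square[of A B] by (metis abs_mult_self_eq abs_square_eq_1 power2_eq_square)

lemma bounded_bilinear_cl_mult:
  "bounded_bilinear (cl_mult :: 'n::{finite,linorder} clifford \<Rightarrow> ('v::real_normed_vector, 'n) cmodule \<Rightarrow> ('v, 'n) cmodule)"
proof
  fix a b :: "'n clifford" and v w :: "('v, 'n) cmodule" and r :: real
  show "(a + b) \<odot> v = a \<odot> v + b \<odot> v" "a \<odot> (v + w) = a \<odot> v + a \<odot> w"
    "(r *\<^sub>R a) \<odot> v = r *\<^sub>R (a \<odot> v)" "a \<odot> (r *\<^sub>R v) = r *\<^sub>R (a \<odot> v)"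
    by (simp_all add: vec_eq_iff cl_mult_nth sum.distrib scaleR_add_left distrib_left distrib_right
        scaleR_add_right scaleR_sum_right mult_ac)
  show "\<exists>K. \<forall>(a :: 'n clifford) (v :: ('v, 'n) cmodule). norm (a \<odot> v) \<le> norm a * norm v * K"
  proof (intro exI allI)
    fix a :: "'n clifford" and v :: "('v, 'n) cmodule"
    have "norm (a \<odot> v) \<le> (\<Sum>A\<in>(UNIV :: 'n set set). \<Sum>B\<in>(UNIV :: 'n set set). norm a * norm v)"
      unfolding cl_mult_def
    proof (intro sum_norm_le)
      fix A B :: "'n set"
      have "norm (axis (sym_diff A B) ((cl_sign A B * a $ A) *\<^sub>R v $ B) :: ('v, 'n) cmodule) \<le> \<bar>a $ A\<bar> * norm (v $ B)"
        using norm_axis_le[of "sym_diff A B" "(cl_sign A B * a $ A) *\<^sub>R v $ B"] by (simp add: abs_mult)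
      also have "\<dots> \<le> norm a * norm v"
        using component_le_norm_cart[of a A] Finite_Cartesian_Product.norm_nth_le[of v B] by (intro mult_mono) auto
      finally show "norm (axis (sym_diff A B) ((cl_sign A B * a $ A) *\<^sub>R v $ B) :: ('v, 'n) cmodule) \<le> norm a * norm v" .
    qed
    then show "norm (a \<odot> v) \<le> norm a * norm v * real (CARD('n set) * CARD('n set))"
      by (simp add: mult_ac)
  qed
qed

interpretation cl_mult: bounded_bilinear "cl_mult :: 'n::{finite,linorder} clifford \<Rightarrow> ('v::real_normed_vector, 'n) cmodule \<Rightarrow> ('v, 'n) cmodule"
  by (rule bounded_bilinear_cl_mult)

lemma cl_rmult_basis_nth:
  "((v :: ('v::real_vector, 'n::{finite,linorder}) cmodule) \<odot>\<^sub>r cl_basis B) $ C = cl_sign (sym_diff B C) B *\<^sub>R v $ sym_diff B C"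
proof -
  have "(v \<odot>\<^sub>r cl_basis B) $ C
     = (\<Sum>B'\<in>UNIV. if B' = B then cl_sign (sym_diff B C) B *\<^sub>R v $ sym_diff B C else 0)"
    unfolding cl_rmult_nth by (rule sum.cong) (auto simp: cl_basis_def axis_def)
  then show ?thesis by simp
qed

text \<open>Right multiplication by a generator is a complex structure on the module. It commutes with
  all right-linear operators, so that the left module structure does not matter for the calculus of
  intrinsic functions.\<close>

definition imult :: "('v::real_vector, 'n::{finite,linorder}) cmodule \<Rightarrow> ('v, 'n) cmodule" where
  "imult v = v \<odot>\<^sub>r cl_basis {Min UNIV}"

definition cmult :: "complex \<Rightarrow> ('v::real_vector, 'n::{finite,linorder}) cmodule \<Rightarrow> ('v, 'n) cmodule" where
  "cmult c v = Re c *\<^sub>R v + Im c *\<^sub>R imult v"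

lemma sym_diff_cancel: "sym_diff B (sym_diff B C) = C" by auto

lemma imult_nth: "imult v $ C = cl_sign (sym_diff {Min UNIV} C) {Min UNIV} *\<^sub>R v $ sym_diff {Min UNIV} C"
  unfolding imult_def by (rule cl_rmult_basis_nth)

lemma imult_imult: "imult (imult v) = - (v :: ('v::real_vector, 'n::{finite,linorder}) cmodule)"
proof -
  have "imult (imult v) $ C = - v $ C" for C
  proof -
    let ?B = "{Min UNIV} :: 'n set"
    have s: "cl_sign ?B ?B = - 1" by (simp add: cl_sign_def)
    have "imult (imult v) $ C = (cl_sign (sym_diff ?B C) ?B * cl_sign C ?B) *\<^sub>R v $ C"
      by (simp only: imult_nth sym_diff_cancel scaleR_scaleR)
    also have "cl_sign (sym_diff ?B C) ?B * cl_sign C ?B = - 1"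
      unfolding cl_sign_sym_diff(1) s by (simp add: mult.assoc)
    finally show ?thesis by simp
  qed
  then show ?thesis by (simp add: vec_eq_iff)
qed

lemma imult_linear: "imult (v + w) = imult v + imult w" "imult (r *\<^sub>R v) = r *\<^sub>R imult v"
  by (simp_all add: vec_eq_iff imult_nth scaleR_add_right)

lemma cl_mult_imult:
  fixes v :: "('v::real_vector, 'n::{finite,linorder}) cmodule"
  shows "a \<odot> imult v = imult (a \<odot> v)"
proof -
  have "(a \<odot> imult v) $ C = imult (a \<odot> v) $ C" for C
  proof -
    let ?B = "{Min UNIV} :: 'n set"
    have sd: "sym_diff ?B (sym_diff A C) = sym_diff A (sym_diff ?B C)" for A by auto
    have "(a \<odot> imult v) $ C = (\<Sum>A\<in>UNIV. (cl_sign A (sym_diff A C) * a $ A) *\<^sub>R cl_sign (sym_diff ?B (sym_diff A C)) ?B *\<^sub>R v $ sym_diff ?B (sym_diff A C))"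
      by (simp only: cl_mult_nth imult_nth)
    also have "\<dots> = (\<Sum>A\<in>UNIV. cl_sign (sym_diff ?B C) ?B *\<^sub>R (cl_sign A (sym_diff A (sym_diff ?B C)) * a $ A) *\<^sub>R v $ sym_diff A (sym_diff ?B C))"
      by (rule sum.cong[OF refl]) (simp only: sd cl_sign_sym_diff scaleR_scaleR mult_ac)
    also have "\<dots> = imult (a \<odot> v) $ C"
      by (simp only: cl_mult_nth imult_nth scaleR_sum_right)
    finally show ?thesis .
  qed
  then show ?thesis by (simp add: vec_eq_iff)
qed

lemma bounded_linear_imult: "bounded_linear (imult :: ('v::real_normed_vector, 'n::{finite,linorder}) cmodule \<Rightarrow> _)"
proof (rule bounded_linear_intro)
  fix v :: "('v, 'n) cmodule"
  have "norm (imult v) \<le> (\<Sum>k\<in>(UNIV :: 'n set set). norm v)"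
    by (rule order_trans[OF norm_vec_le_sum sum_mono]) (simp add: imult_nth Finite_Cartesian_Product.norm_nth_le)
  then show "norm (imult v) \<le> norm v * real CARD('n set)" by (simp add: mult.commute)
qed (rule imult_linear)+

interpretation cmult: complex_action "cmult :: complex \<Rightarrow> ('v::banach, 'n::{finite,linorder}) cmodule \<Rightarrow> _"
proof
  interpret im: bounded_linear "imult :: ('v, 'n) cmodule \<Rightarrow> _" by (rule bounded_linear_imult)
  obtain K where K: "K > 0" "\<And>v :: ('v, 'n) cmodule. norm (imult v) \<le> norm v * K" using im.pos_bounded by blast
  fix a b c :: complex and v w :: "('v, 'n) cmodule" and r :: real
  show "cmult (a + b) v = cmult a v + cmult b v" "cmult c (v + w) = cmult c v + cmult c w"
    "cmult (r *\<^sub>R c) v = r *\<^sub>R cmult c v" "cmult c (r *\<^sub>R v) = r *\<^sub>R cmult c v" "cmult 1 v = v"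
    by (simp_all add: cmult_def imult_linear algebra_simps)
  show "cmult (a * b) v = cmult a (cmult b v)"
    by (simp add: cmult_def imult_linear imult_imult algebra_simps)
  show "\<exists>K. \<forall>c (v :: ('v, 'n) cmodule). norm (cmult c v) \<le> norm c * norm v * K"
  proof (intro exI allI)
    fix c and v :: "('v, 'n) cmodule"
    have "norm (cmult c v) \<le> \<bar>Re c\<bar> * norm v + \<bar>Im c\<bar> * norm (imult v)"
      unfolding cmult_def by (rule order_trans[OF norm_triangle_ineq]) simp
    also have "\<dots> \<le> norm c * norm v + norm c * (norm v * K)"
      using abs_Re_le_cmod[of c] abs_Im_le_cmod[of c] K by (intro add_mono mult_mono) auto
    finally show "norm (cmult c v) \<le> norm c * norm v * (1 + K)" by (simp add: algebra_simps)
  qed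
qed

lemma norm_vec_square: "(norm (s :: 'n::finite clifford))\<^sup>2 = (\<Sum>A\<in>UNIV. (s $ A)\<^sup>2)"
  by (simp add: norm_vec_def L2_set_def sum_nonneg)

lemma cl_of_real_nth: "cl_of_real x $ A = (if A = {} then x else 0)"
  by (simp add: cl_of_real_def cl_basis_def axis_def)

lemma imag_units_nth: "J \<in> imag_units \<Longrightarrow> \<not> (\<exists>i. A = {i}) \<Longrightarrow> J $ A = 0"
proof -
  assume J: "J \<in> imag_units" and A: "\<not> (\<exists>i. A = {i})"
  have "A = {} \<or> card A \<ge> 2"
  proof (rule ccontr)
    assume "\<not> ?thesis"
    then have "card A = 1" using card_gt_0_iff[of A] by auto
    then show False using A card_1_singletonE by blast
  qed
  then show "J $ A = 0" using J by (auto simp: imag_units_def paravectors_def)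
qed

text \<open>Products of distinct generators cancel in pairs, and the squares add up to
  \<open>- (norm J)\<^sup>2\<close>. To see this, the sum over \<open>A\<close> is added to its copy
  reindexed by \<open>sym_diff C\<close>, which exchanges the two factors.\<close>

lemma imag_unit_square:
  assumes J: "J \<in> imag_units" shows "J \<odot> J = cl_of_real (- 1)"
proof -
  have "(J \<odot> J) $ C = cl_of_real (- 1) $ C" for C
  proof -
    let ?t = "\<lambda>A. cl_sign A (sym_diff A C) * J $ A * J $ sym_diff A C"
    let ?t' = "\<lambda>A. cl_sign (sym_diff A C) A * J $ A * J $ sym_diff A C"
    have "(J \<odot> J) $ C = (\<Sum>A\<in>UNIV. ?t A)" by (simp add: cl_mult_nth)
    moreover have "(\<Sum>A\<in>UNIV. ?t A) = (\<Sum>A\<in>UNIV. ?t' A)"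
    proof -
      have "?t (sym_diff C A) = ?t' A" for A
      proof -
        have e: "sym_diff (sym_diff C A) C = A" "sym_diff A C = sym_diff C A" by auto
        show ?thesis by (simp only: e mult_ac)
      qed
      then show ?thesis using sum.reindex_bij_betw[OF bij_sym_diff[of C], of ?t, symmetric] by simp
    qed
    moreover have "?t A + ?t' A = (if C = {} then - 2 * (J $ A)\<^sup>2 else 0)" for A
    proof (cases "(\<exists>i. A = {i}) \<and> (\<exists>j. sym_diff A C = {j})")
      case True
      then obtain i j where ij: "A = {i}" "sym_diff A C = {j}" by blast
      have C: "C = sym_diff A {j}" using sym_diff_cancel[of A C] ij(2) by simp
      show ?thesis
      proof (cases "i = j")
        case True
        then show ?thesis using ij C by (simp add: cl_sign_def power2_eq_square)
      next
        case False
        then have "C \<noteq> {}" using ij C by auto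
        moreover have "cl_sign {i} {j} + cl_sign {j} {i} = 0" using False by (auto simp: cl_sign_def)
        moreover have "?t A + ?t' A = (cl_sign {i} {j} + cl_sign {j} {i}) * (J $ {i} * J $ {j})"
          unfolding ij(2) unfolding ij(1) by (simp only: distrib_right mult.assoc)
        ultimately show ?thesis by (simp only: mult_zero_left if_False)
      qed
    next
      case False
      then have "J $ A = 0 \<or> J $ sym_diff A C = 0" using imag_units_nth[OF J] by blast
      moreover have "C = {} \<Longrightarrow> sym_diff A C = A" by auto
      ultimately show ?thesis by auto
    qed
    then have "(\<Sum>A\<in>UNIV. ?t A) + (\<Sum>A\<in>UNIV. ?t' A) = (if C = {} then - 2 * (norm J)\<^sup>2 else 0)"
      by (simp add: sum.distrib[symmetric] norm_vec_square sum_distrib_left)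
    ultimately show ?thesis using J by (simp add: cl_of_real_nth imag_units_def split: if_splits)
  qed
  then show ?thesis by (simp add: vec_eq_iff)
qed

text \<open>For an imaginary unit \<open>J\<close>, the isomorphism of the complex numbers onto the
  plane C_J. It preserves the norm, conjugation and inverses, which turns computations on a slice
  into complex ones.\<close>

definition slice_complex :: "'n::{finite,linorder} clifford \<Rightarrow> complex \<Rightarrow> 'n clifford" where
  "slice_complex J c = slice_point J (Re c) (Im c)"

lemma slice_point_eq: "slice_point J x y = slice_complex J (Complex x y)"
  by (simp add: slice_complex_def)

lemma slice_complex_linear:
  "slice_complex J (c + d) = slice_complex J c + slice_complex J d"
  "slice_complex J (c - d) = slice_complex J c - slice_complex J d"
  "slice_complex J (r *\<^sub>R c) = r *\<^sub>R slice_complex J c"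
  "slice_complex J (of_real x) = cl_of_real x" "slice_complex J (- c) = - slice_complex J c"
  by (simp_all add: slice_complex_def slice_point_def cl_of_real_def algebra_simps)

lemma slice_complex_act:
  "slice_complex J c \<odot> v = Re c *\<^sub>R v + Im c *\<^sub>R (J \<odot> (v :: ('v::real_normed_vector, 'n::{finite,linorder}) cmodule))"
  by (simp add: slice_complex_def slice_point_def cl_mult.add_left cl_mult.scaleR_left cl_mult_one)

lemma imag_unit_act:
  assumes "J \<in> imag_units" shows "J \<odot> (J \<odot> v) = - (v :: ('v::real_normed_vector, 'n::{finite,linorder}) cmodule)"
  unfolding cl_mult_assoc[symmetric] imag_unit_square[OF assms] cl_mult_one by simp

lemma slice_complex_mult:
  assumes "J \<in> imag_units" shows "slice_complex J c \<odot> slice_complex J d = slice_complex J (c * d)"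
proof -
  have *: "slice_complex J d = Re d *\<^sub>R cl_of_real 1 + Im d *\<^sub>R J" for d
    by (simp add: slice_complex_def slice_point_def cl_of_real_def)
  have J1: "J \<odot> cl_of_real 1 = J" using cl_rmult_one[of J 1] by (simp add: cl_rmult_eq_cl_mult)
  have JJ: "J \<odot> J = - cl_of_real 1" unfolding imag_unit_square[OF assms] by (simp add: cl_of_real_def)
  show ?thesis
    unfolding slice_complex_act[of J c] *[of d] *[of "c * d"]
    by (simp add: cl_mult.add_right cl_mult.scaleR_right J1 JJ algebra_simps)
qed

lemma slice_complex_nth:
  assumes "J \<in> imag_units" shows "slice_complex J c $ A = (if A = {} then Re c else Im c * J $ A)"
  using assms by (auto simp: slice_complex_def slice_point_def cl_of_real_nth imag_units_def)

lemma norm_slice_complex: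
  assumes J: "J \<in> imag_units" shows "norm (slice_complex J c) = norm c"
proof -
  have "(slice_complex J c $ A)\<^sup>2 = (if A = {} then (Re c)\<^sup>2 else 0) + (Im c)\<^sup>2 * (J $ A)\<^sup>2" for A
    using J by (auto simp: slice_complex_nth[OF J] power_mult_distrib imag_units_def)
  then have "(norm (slice_complex J c))\<^sup>2 = (Re c)\<^sup>2 + (Im c)\<^sup>2 * (norm J)\<^sup>2"
    by (simp add: norm_vec_square sum.distrib sum_distrib_left)
  also have "\<dots> = (norm c)\<^sup>2" using J by (simp add: imag_units_def cmod_power2)
  finally show ?thesis by simp
qed

lemma slice_complex_paravector: "J \<in> imag_units \<Longrightarrow> slice_complex J c \<in> paravectors"
  by (auto simp: paravectors_def slice_complex_nth imag_units_def)

lemma para_conj_slice_complex: "J \<in> imag_units \<Longrightarrow> para_conj (slice_complex J c) = slice_complex J (cnj c)"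
  by (simp add: vec_eq_iff para_conj_def slice_complex_nth)

lemma para_inverse_slice_complex: "J \<in> imag_units \<Longrightarrow> para_inverse (slice_complex J c) = slice_complex J (1 / c)"
proof -
  assume J: "J \<in> imag_units"
  have "(1 / (norm c)\<^sup>2) *\<^sub>R cnj c = 1 / c" by (simp add: complex_div_cnj[of 1 c] scaleR_conv_of_real)
  then show ?thesis
    by (simp only: para_inverse_def para_conj_slice_complex[OF J] norm_slice_complex[OF J] slice_complex_linear(3)[symmetric])
qed

lemma slice_exp_eq: "slice_exp J \<phi> = slice_complex J (cis \<phi>)"
  by (simp add: slice_exp_def slice_complex_def)

text \<open>A witness that imaginary units exist; it is the generator used in
  \<open>imult\<close>.\<close>

definition basis_unit :: "'n::{finite,linorder} clifford" where "basis_unit = cl_basis {Min UNIV}"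

lemma basis_unit [simp]: "basis_unit \<in> imag_units"
proof -
  have "norm (cl_basis A :: 'n clifford) = 1" for A :: "'n::{finite,linorder} set"
  proof -
    have "(norm (cl_basis A :: 'n clifford))\<^sup>2 = (\<Sum>B\<in>UNIV. if B = A then 1 else 0)"
      unfolding norm_vec_square by (rule sum.cong) (auto simp: cl_basis_def axis_def)
    then show ?thesis using power2_eq_iff_nonneg[of "norm (cl_basis A :: 'n clifford)" 1] by simp
  qed
  then show ?thesis by (auto simp: imag_units_def paravectors_def basis_unit_def cl_basis_def axis_def)
qed

lemma rsector_polar:
  assumes "0 < \<theta>" "\<theta> < pi / 2" "z \<in> rsector \<theta>"
  shows "\<exists>r t. z = of_real r * cis t \<and> r > 0 \<and> \<bar>t\<bar> < \<theta>"
proof -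
  have re: "Re z > 0" by (rule rsector_Re_pos[OF assms])
  then have z0: "z \<noteq> 0" by auto
  have z: "z = of_real (norm z) * cis (Arg z)" using rcis_cmod_Arg[of z] by (simp add: rcis_def)
  have "\<bar>Arg z\<bar> < pi / 2" using re z0 Arg_Re_pos by auto
  have "complex_of_real (norm z) * cis (Arg z) \<in> rsector \<theta>" by (metis assms(3) z)
  then have "cis (Arg z) \<in> rsector \<theta>" using z0 rsector_scale[of "norm z" "cis (Arg z)" \<theta>] by simp
  then have "\<bar>sin (Arg z)\<bar> * cos \<theta> < sin \<theta> * cos (Arg z)" by (simp add: rsector_def)
  moreover have "\<bar>sin (Arg z)\<bar> = sin \<bar>Arg z\<bar>"
    using \<open>\<bar>Arg z\<bar> < pi / 2\<close> sin_ge_zero[of "Arg z"] sin_ge_zero[of "- Arg z"] by (cases "Arg z \<ge> 0") auto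
  moreover have "cos (Arg z) = cos \<bar>Arg z\<bar>" by (cases "Arg z \<ge> 0") auto
  ultimately have "sin \<bar>Arg z\<bar> * cos \<theta> < sin \<theta> * cos \<bar>Arg z\<bar>" by (simp only:)
  then have "sin (\<theta> - \<bar>Arg z\<bar>) > 0" unfolding sin_diff by (simp only: mult.commute diff_gt_0_iff_gt)
  moreover have "sin (\<theta> - \<bar>Arg z\<bar>) \<le> 0" if "\<theta> \<le> \<bar>Arg z\<bar>"
  proof -
    have "0 \<le> sin (\<bar>Arg z\<bar> - \<theta>)" using that \<open>\<bar>Arg z\<bar> < pi / 2\<close> assms by (intro sin_ge_zero) auto
    then show ?thesis by (simp add: sin_diff mult.commute)
  qed
  ultimately have "\<bar>Arg z\<bar> < \<theta>" by (meson not_le)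
  then show ?thesis using z z0 by (intro exI[of _ "norm z"] exI[of _ "Arg z"]) auto
qed

lemma sector_polar:
  assumes \<theta>: "0 < \<theta>" "\<theta> < pi / 2" and "z \<in> sector \<theta>"
  shows "\<exists>r t. z = of_real r * cis t \<and> r > 0 \<and> t \<in> angles \<theta>"
proof -
  consider "z \<in> rsector \<theta>" | "- z \<in> rsector \<theta>" using sector_iff_rsector[OF \<theta>] assms(3) by auto
  then show ?thesis
  proof cases
    case 1
    then show ?thesis using rsector_polar[OF \<theta> 1] by (force simp: angles_def)
  next
    case 2
    then obtain r t where "- z = of_real r * cis t" "r > 0" "\<bar>t\<bar> < \<theta>" using rsector_polar[OF \<theta> 2] by blast
    moreover from this have "z = of_real r * cis (pi + t)" unfolding sector_minus_cis(1) by (simp add: minus_equation_iff[of z])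
    ultimately show ?thesis by (intro exI[of _ r] exI[of _ "pi + t"]) (auto simp: angles_def)
  qed
qed

lemma cis_angles_in_sector:
  assumes \<theta>: "0 < \<theta>" "\<theta> < pi / 2" and t: "t \<in> angles \<theta>"
  shows "cis t \<in> sector \<theta>"
proof (cases "t \<in> {-\<theta><..<\<theta>}")
  case True
  then have "cis t \<in> rsector \<theta>" using \<theta> by (intro cis_in_rsector) auto
  then show ?thesis using sector_iff_rsector[OF \<theta>] by blast
next
  case False
  then have "\<bar>t - pi\<bar> < \<theta>" using t by (auto simp: angles_def)
  then have "cis (t - pi) \<in> rsector \<theta>" using \<theta> by (intro cis_in_rsector)
  then have "cis (t - pi) \<in> sector \<theta>" using sector_iff_rsector[OF \<theta>] by blast
  moreover have "cis t = - cis (t - pi)" using sector_minus_cis(1)[of "t - pi"] by simp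
  ultimately show ?thesis by simp
qed

text \<open>A paravector determines the real part and the modulus of the imaginary part of
  \<open>z\<close>, whichever unit represents it, and membership in the sector depends on these two
  only.\<close>

lemma slice_complex_in_double_sector:
  assumes \<theta>: "0 < \<theta>" "\<theta> < pi / 2" and J: "J \<in> imag_units"
  shows "slice_complex J z \<in> double_sector \<theta> \<longleftrightarrow> z \<in> sector \<theta>"
proof
  assume "z \<in> sector \<theta>"
  then obtain r t where "z = of_real r * cis t" "r > 0" "t \<in> angles \<theta>" using sector_polar[OF \<theta>] by blast
  moreover from this have "slice_complex J z = r *\<^sub>R slice_exp J t"
    by (simp only: slice_exp_eq slice_complex_linear(3)[symmetric] scaleR_conv_of_real[of r "cis t"])
  ultimately show "slice_complex J z \<in> double_sector \<theta>"
    unfolding double_sector_def using J by blast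
next
  assume "slice_complex J z \<in> double_sector \<theta>"
  then obtain r J' t where *: "slice_complex J z = r *\<^sub>R slice_exp J' t" "r > 0" "J' \<in> imag_units" "t \<in> angles \<theta>"
    unfolding double_sector_def by blast
  define w where "w = of_real r * cis t"
  have e: "slice_complex J z = slice_complex J' w"
    using *(1) by (simp only: slice_exp_eq slice_complex_linear(3)[symmetric] w_def scaleR_conv_of_real[of r "cis t"])
  have re: "Re z = Re w" using arg_cong[OF e, of "\<lambda>s. s $ {}"] by (simp add: slice_complex_nth J *(3))
  have "norm z = norm w" using arg_cong[OF e, of norm] by (simp add: norm_slice_complex J *(3))
  then have "(Im z)\<^sup>2 = (Im w)\<^sup>2" using re cmod_power2[of z] cmod_power2[of w] by simp
  then have im: "\<bar>Im z\<bar> = \<bar>Im w\<bar>" by (metis real_sqrt_abs)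
  have "cis t \<in> sector \<theta>" by (rule cis_angles_in_sector[OF \<theta> *(4)])
  then have "w \<in> sector \<theta>" using *(2) sector_scale[OF *(2)] by (simp add: w_def)
  then show "z \<in> sector \<theta>" using re im by (simp add: sector_def)
qed

lemma double_sector_eq:
  assumes "0 < \<theta>" "\<theta> < pi / 2"
  shows "double_sector \<theta> = {slice_complex J z | J z. J \<in> imag_units \<and> z \<in> sector \<theta>}"
proof -
  have "\<exists>J z. s = slice_complex J z \<and> J \<in> imag_units \<and> z \<in> sector \<theta>" if s: "s \<in> double_sector \<theta>" for s :: "'n::{finite,linorder} clifford"
  proof -
    obtain r J t where "s = r *\<^sub>R slice_exp J t" "J \<in> imag_units" using s unfolding double_sector_def by blast
    then have "s = slice_complex J (r *\<^sub>R cis t)" by (simp add: slice_exp_eq slice_complex_linear)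
    then show ?thesis using slice_complex_in_double_sector[OF assms \<open>J \<in> imag_units\<close>] s \<open>J \<in> imag_units\<close> by blast
  qed
  then show ?thesis using slice_complex_in_double_sector[OF assms] by blast
qed


section \<open>The complex resolvent of a bisectorial operator\<close>

lemma op_inverse_eq_Some:
  assumes "op_injective A" "A w = Some v" shows "op_inverse A v = Some w"
proof -
  have "(THE u. A u = Some v) = w"
    using assms by (intro the_equality) (auto simp: op_injective_def inj_on_def dom_def)
  then show ?thesis using assms(2) by (auto simp: op_inverse_def ran_def)
qed

lemma Q_op_eq_Some:
  fixes T :: "('v::banach, 'n::{finite,linorder}) oper"
  shows "Q_op s T w = Some v \<longleftrightarrow>
     (\<exists>t t'. T w = Some t \<and> T t = Some t' \<and> v = t' - (2 * s $ {}) *\<^sub>R t + (norm s)\<^sup>2 *\<^sub>R w)"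
  by (auto simp: Q_op_def op_add_def op_of_def cl_mult_one map_comp_def dom_def algebra_simps split: option.splits)

locale bisectorial_operator =
  fixes T :: "('v::banach, 'n::{finite,linorder}) oper" and \<omega> :: real
  assumes bisectorial: "bisectorial \<omega> T" and \<omega>_pos: "0 < \<omega>" and \<omega>_less: "\<omega> < pi / 2"
begin

lemma T_right_linear: "right_linear T"
  using bisectorial by (simp add: bisectorial_def closed_ops_def)

lemma T_add: "T v = Some a \<Longrightarrow> T w = Some b \<Longrightarrow> T (v + w) = Some (a + b)"
  using T_right_linear unfolding right_linear_def by (metis domI domD option.sel)

lemma T_rmult: "T v = Some a \<Longrightarrow> T (v \<odot>\<^sub>r c) = Some (a \<odot>\<^sub>r c)"
  using T_right_linear unfolding right_linear_def by (metis domI domD option.sel)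

lemma T_scaleR: "T v = Some a \<Longrightarrow> T (x *\<^sub>R v) = Some (x *\<^sub>R a)"
  using T_rmult[of v a "cl_of_real x"] by (simp add: cl_rmult_one)

lemma T_diff: "T v = Some a \<Longrightarrow> T w = Some b \<Longrightarrow> T (v - w) = Some (a - b)"
  using T_add[OF _ T_scaleR[of w b "- 1"]] by simp

lemma T_cmult: "T v = Some a \<Longrightarrow> T (cmult c v) = Some (cmult c a)"
  unfolding cmult_def imult_def by (intro T_add T_scaleR T_rmult)

text \<open>\<open>A z\<close> is Q_z[T]^{-1} and \<open>B z\<close> below is T Q_z[T]^{-1},
  meaningful for \<open>z\<close> in \<open>res\<close>. Since Q_s[T] depends on \<open>s\<close>
  only through its real part and its norm, the unit chosen here is immaterial, and \<open>A\<close>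
  and \<open>B\<close> take the same values at \<open>z\<close> and \<open>cnj z\<close>.\<close>

definition A :: "complex \<Rightarrow> ('v, 'n) cmodule \<Rightarrow> ('v, 'n) cmodule" where
  "A z v = the (op_inverse (Q_op (slice_complex basis_unit z) T) v)"

definition B :: "complex \<Rightarrow> ('v, 'n) cmodule \<Rightarrow> ('v, 'n) cmodule" where
  "B z v = the (T (A z v))"

lemma Q_op_slice_complex:
  assumes "J \<in> imag_units" "J' \<in> imag_units" "Re z = Re w" "norm z = norm w"
  shows "Q_op (slice_complex J z) T = Q_op (slice_complex J' w) T"
  by (simp add: Q_op_def slice_complex_nth norm_slice_complex assms)

definition res :: "complex set" where "res = {z. \<exists>\<phi>. \<omega> < \<phi> \<and> \<phi> < pi / 2 \<and> z \<in> outside \<phi>}"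

lemma outside_res: "\<omega> < \<phi> \<Longrightarrow> \<phi> < pi / 2 \<Longrightarrow> z \<in> outside \<phi> \<Longrightarrow> z \<in> res"
  by (auto simp: res_def)

lemma cnj_res [simp]: "cnj z \<in> res \<longleftrightarrow> z \<in> res"
  by (simp add: res_def outside_def sector_def)

lemma slice_complex_resolvent_set:
  assumes z: "z \<in> res" and J: "J \<in> imag_units"
  shows "slice_complex J z \<in> S_resolvent_set T"
proof -
  obtain \<phi> where \<phi>: "\<omega> < \<phi>" "\<phi> < pi / 2" "z \<in> outside \<phi>" using z by (auto simp: res_def)
  \<comment> \<open>A closed cone of angle \<omega> written without reference to a unit: on each
    slice the norm in it is the modulus of the imaginary part. It contains the closure of the double
    sector, and points of \<open>res\<close> miss it strictly.\<close>
  let ?C = "{s :: 'n clifford. norm (s - cl_of_real (s $ {})) * cos \<omega> \<le> sin \<omega> * \<bar>s $ {}\<bar>}"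
  have n: "norm (slice_complex J w - cl_of_real (slice_complex J w $ {})) = \<bar>Im w\<bar>" if "J \<in> imag_units" for J w
    using that by (simp add: slice_complex_nth) (simp add: slice_complex_def slice_point_def imag_units_def)
  have "closed ?C"
    unfolding cl_of_real_def by (intro closed_Collect_le continuous_intros)
  moreover have "double_sector \<omega> \<subseteq> ?C"
  proof
    fix s :: "'n clifford" assume "s \<in> double_sector \<omega>"
    then obtain J w where "s = slice_complex J w" "J \<in> imag_units" "w \<in> sector \<omega>"
      unfolding double_sector_eq[OF \<omega>_pos \<omega>_less] by blast
    then show "s \<in> ?C" using n[of J w] by (simp add: slice_complex_nth sector_def)
  qed
  ultimately have "closure (double_sector \<omega>) \<subseteq> ?C" by (rule closure_minimal[rotated])
  moreover have "slice_complex J z \<notin> ?C"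
    using outside_strict[OF \<omega>_pos \<phi>] n[OF J, of z] by (simp add: slice_complex_nth[OF J])
  moreover have "S_spectrum T \<subseteq> closure (double_sector \<omega>)" using bisectorial by (simp add: bisectorial_def)
  ultimately show ?thesis using slice_complex_paravector[OF J, of z] unfolding S_spectrum_def by blast
qed

lemma op_inverse_Q:
  assumes z: "z \<in> res" and J: "J \<in> imag_units"
  shows "op_inverse (Q_op (slice_complex J z) T) v = Some (A z v)"
proof -
  have "op_inverse (Q_op (slice_complex basis_unit z) T) \<in> bounded_ops"
    using slice_complex_resolvent_set[OF z basis_unit] by (simp add: S_resolvent_set_def)
  then have "v \<in> dom (op_inverse (Q_op (slice_complex basis_unit z) T))" by (simp add: bounded_ops_def)
  then show ?thesis unfolding Q_op_slice_complex[OF J basis_unit refl refl, of z] A_def by auto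
qed

lemma A_unique:
  assumes z: "z \<in> res" and "T w = Some t" "T t = Some t'"
  shows "A z (t' - (2 * Re z) *\<^sub>R t + (norm z)\<^sup>2 *\<^sub>R w) = w"
proof -
  have "Q_op (slice_complex basis_unit z) T w = Some (t' - (2 * Re z) *\<^sub>R t + (norm z)\<^sup>2 *\<^sub>R w)"
    unfolding Q_op_eq_Some using assms(2,3) by (auto simp: slice_complex_nth norm_slice_complex)
  moreover have "op_injective (Q_op (slice_complex basis_unit z) T)"
    using slice_complex_resolvent_set[OF z basis_unit] by (simp add: S_resolvent_set_def)
  ultimately show ?thesis using op_inverse_eq_Some by (fastforce simp: A_def)
qed

lemma T_A:
  assumes z: "z \<in> res"
  shows "T (A z v) = Some (B z v)" and "T (B z v) = Some (v + (2 * Re z) *\<^sub>R B z v - (norm z)\<^sup>2 *\<^sub>R A z v)"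
proof -
  let ?Q = "Q_op (slice_complex basis_unit z) T"
  have inj: "op_injective ?Q"
    using slice_complex_resolvent_set[OF z basis_unit] by (simp add: S_resolvent_set_def)
  have "op_inverse ?Q v = Some (A z v)" by (rule op_inverse_Q[OF z basis_unit])
  then have "v \<in> ran ?Q" by (simp add: op_inverse_def split: if_splits)
  then obtain w where w: "?Q w = Some v" by (auto simp: ran_def)
  then have "A z v = w" using op_inverse_eq_Some[OF inj w] by (simp add: A_def)
  with w obtain t t' where t: "T (A z v) = Some t" "T t = Some t'" "v = t' - (2 * Re z) *\<^sub>R t + (norm z)\<^sup>2 *\<^sub>R A z v"
    unfolding Q_op_eq_Some by (auto simp: slice_complex_nth norm_slice_complex)
  show 1: "T (A z v) = Some (B z v)" using t(1) by (simp add: B_def)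
  show "T (B z v) = Some (v + (2 * Re z) *\<^sub>R B z v - (norm z)\<^sup>2 *\<^sub>R A z v)"
    using t 1 by (simp add: algebra_simps)
qed

lemma A_right_linear:
  assumes z: "z \<in> res"
  shows "A z (v + w) = A z v + A z w" "A z (v \<odot>\<^sub>r a) = A z v \<odot>\<^sub>r a" "bounded_linear (A z)"
    "A z (cmult c v) = cmult c (A z v)"
proof -
  have b: "op_inverse (Q_op (slice_complex basis_unit z) T) \<in> bounded_ops"
    using slice_complex_resolvent_set[OF z basis_unit] by (simp add: S_resolvent_set_def)
  show add: "A z (v + w) = A z v + A z w" for v w
    using b unfolding bounded_ops_def right_linear_def A_def by auto
  show r: "A z (v \<odot>\<^sub>r a) = A z v \<odot>\<^sub>r a" for v a
    using b unfolding bounded_ops_def right_linear_def A_def by auto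
  have s: "A z (x *\<^sub>R v) = x *\<^sub>R A z v" for x v using r[of v "cl_of_real x"] by (simp add: cl_rmult_one)
  obtain C where "\<And>v. norm (A z v) \<le> C * norm v" using b by (auto simp: bounded_ops_def A_def)
  then show "bounded_linear (A z)" by (intro bounded_linear_intro[of _ C]) (auto simp: add s mult.commute)
  show "A z (cmult c v) = cmult c (A z v)" by (simp add: cmult_def imult_def add s r)
qed

lemma B_right_linear:
  assumes z: "z \<in> res"
  shows "B z (v + w) = B z v + B z w" "B z (x *\<^sub>R v) = x *\<^sub>R B z v" "B z (cmult c v) = cmult c (B z v)"
proof -
  have "T (A z (v + w)) = Some (B z v + B z w)" unfolding A_right_linear(1)[OF z] by (intro T_add T_A z)
  then show "B z (v + w) = B z v + B z w" by (simp add: B_def)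
  have "A z (x *\<^sub>R v) = x *\<^sub>R A z v" by (rule linear_simps(5)[OF A_right_linear(3)[OF z]])
  then have "T (A z (x *\<^sub>R v)) = Some (x *\<^sub>R B z v)" using T_scaleR[OF T_A(1)[OF z]] by simp
  then show "B z (x *\<^sub>R v) = x *\<^sub>R B z v" by (simp add: B_def)
  have "T (A z (cmult c v)) = Some (cmult c (B z v))" unfolding A_right_linear(4)[OF z] by (intro T_cmult T_A z)
  then show "B z (cmult c v) = cmult c (B z v)" by (simp add: B_def)
qed

lemma cnj_A: "z \<in> res \<Longrightarrow> A (cnj z) v = A z v" and cnj_B: "z \<in> res \<Longrightarrow> B (cnj z) v = B z v"
proof -
  show "A (cnj z) v = A z v" by (simp add: A_def Q_op_slice_complex[of basis_unit basis_unit "cnj z" z])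
  then show "B (cnj z) v = B z v" by (simp add: B_def)
qed

lemma S_resolvent_eq:
  assumes z: "z \<in> res" and J: "J \<in> imag_units"
  shows "S_resolvent (slice_complex J z) T v = Some (A z (slice_complex J (cnj z) \<odot> v) - B z v)"
  unfolding S_resolvent_def op_add_def
  by (simp add: op_of_def dom_def map_comp_def op_inverse_Q[OF z J] T_A[OF z] para_conj_slice_complex[OF J] cl_mult_one)

text \<open>The hypothesis bounds only the combination of both operators in the S-resolvent. The
  S-resolvents at \<open>z\<close> and \<open>cnj z\<close> share \<open>A z\<close> and
  \<open>B z\<close>, so their difference isolates \<open>A z\<close> with the factor
  \<open>2 * Im z\<close>, and off the sector \<open>\<bar>Im z\<bar>\<close> is at least
  \<open>sin \<phi> * norm z\<close>. The bound for \<open>B z\<close> then follows by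
  subtraction.\<close>

lemma bounds:
  assumes \<phi>: "\<omega> < \<phi>" "\<phi> < pi / 2"
  shows "\<exists>C\<ge>0. \<forall>z\<in>outside \<phi>. \<forall>v. norm (A z v) \<le> C / (norm z)\<^sup>2 * norm v \<and> norm (B z v) \<le> C / norm z * norm v"
proof -
  have \<phi>0: "0 < \<phi>" and s0: "sin \<phi> > 0" and c0: "cos \<phi> > 0"
    using \<phi> \<omega>_pos by (auto intro!: sin_gt_zero cos_gt_zero_pi)
  obtain C where C: "C \<ge> 0" "\<And>s v. s \<in> paravectors - (double_sector \<phi> \<union> {0}) \<Longrightarrow> norm (the (S_resolvent s T v)) \<le> C / norm s * norm v"
    using bisectorial \<phi> unfolding bisectorial_def by force
  obtain K where K: "K > 0" "\<And>a (v :: ('v, 'n) cmodule). norm (a \<odot> v) \<le> norm a * norm v * K"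
    using cl_mult.pos_bounded by blast
  let ?J = "basis_unit :: 'n clifford"
  have S: "norm (A z (slice_complex ?J (cnj z) \<odot> v) - B z v) \<le> C / norm z * norm v" if z: "z \<in> outside \<phi>" for z v
  proof -
    have "norm (slice_complex ?J z) \<noteq> 0" using z by (simp add: norm_slice_complex outside_def)
    then have "slice_complex ?J z \<noteq> 0" by (metis norm_zero)
    then have "slice_complex ?J z \<in> paravectors - (double_sector \<phi> \<union> {0})"
      using z slice_complex_in_double_sector[OF \<phi>0 \<phi>(2) basis_unit] slice_complex_paravector[OF basis_unit] by (auto simp: outside_def)
    from C(2)[OF this, of v] show ?thesis
      using S_resolvent_eq[OF outside_res[OF \<phi> z] basis_unit] by (simp add: norm_slice_complex)
  qed
  define D where "D = C * K / sin \<phi>"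
  have D0: "D \<ge> 0" using C(1) K(1) s0 by (simp add: D_def)
  have A: "norm (A z w) \<le> D / (norm z)\<^sup>2 * norm w" if z: "z \<in> outside \<phi>" for z w
  proof -
    have zr: "z \<in> res" by (rule outside_res[OF \<phi> z])
    have z': "cnj z \<in> outside \<phi>" using z by (auto simp: outside_def sector_def)
    have z0: "norm z > 0" using z by (simp add: outside_def)
    interpret bl: bounded_linear "A z" by (rule A_right_linear(3)[OF zr])
    have im: "sin \<phi> * norm z \<le> \<bar>Im z\<bar>"
    proof -
      have "sin \<phi> * \<bar>Re z\<bar> \<le> \<bar>Im z\<bar> * cos \<phi>" using z by (simp add: outside_def sector_def)
      then have "(sin \<phi> * \<bar>Re z\<bar>)\<^sup>2 \<le> (\<bar>Im z\<bar> * cos \<phi>)\<^sup>2" using s0 by (intro power_mono) auto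
      then have "(sin \<phi>)\<^sup>2 * (Re z)\<^sup>2 \<le> (Im z)\<^sup>2 * (cos \<phi>)\<^sup>2" by (simp add: power_mult_distrib)
      then have "(sin \<phi>)\<^sup>2 * ((Re z)\<^sup>2 + (Im z)\<^sup>2) \<le> (Im z)\<^sup>2 * ((cos \<phi>)\<^sup>2 + (sin \<phi>)\<^sup>2)"
        using mult.commute[of "(sin \<phi>)\<^sup>2" "(Im z)\<^sup>2"] unfolding distrib_left by linarith
      then have "(sin \<phi> * norm z)\<^sup>2 \<le> \<bar>Im z\<bar>\<^sup>2" by (simp add: power_mult_distrib cmod_power2)
      then show ?thesis by (rule power2_le_imp_le) simp
    qed
    \<comment> \<open>Chosen so that the unit times \<open>u\<close> is \<open>- w\<close>: the
      difference of the two S-resolvents, applied to \<open>u\<close>, becomes \<open>A z w\<close>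
      with a real factor.\<close>
    define u where "u = ?J \<odot> w"
    have "?J \<in> imag_units" by (rule basis_unit)
    then have "norm ?J = 1" by (simp only: imag_units_def mem_Collect_eq)
    then have u: "norm u \<le> norm w * K" using K(2)[of ?J w] by (simp add: u_def)
    have "A z (slice_complex ?J (cnj z) \<odot> u) - B z u - (A z (slice_complex ?J z \<odot> u) - B z u) = (2 * Im z) *\<^sub>R A z w"
    proof -
      have "slice_complex ?J (cnj z) \<odot> u - slice_complex ?J z \<odot> u = (- (2 * Im z)) *\<^sub>R (?J \<odot> u)"
        unfolding cl_mult.diff_left[symmetric] slice_complex_linear(2)[symmetric] slice_complex_act
        using scaleR_left_distrib[of "Im z" "Im z" "?J \<odot> u"] by simp
      also have "?J \<odot> u = - w" unfolding u_def by (rule imag_unit_act[OF basis_unit])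
      finally have "slice_complex ?J (cnj z) \<odot> u - slice_complex ?J z \<odot> u = (2 * Im z) *\<^sub>R w" by simp
      then have "A z (slice_complex ?J (cnj z) \<odot> u) - A z (slice_complex ?J z \<odot> u) = (2 * Im z) *\<^sub>R A z w"
        by (simp flip: bl.diff add: bl.scaleR)
      then show ?thesis by simp
    qed
    then have "norm ((2 * Im z) *\<^sub>R A z w) \<le> C / norm z * norm u + C / norm z * norm u"
      using norm_triangle_ineq4[of "A z (slice_complex ?J (cnj z) \<odot> u) - B z u" "A z (slice_complex ?J z \<odot> u) - B z u"]
        S[OF z, of u] S[OF z', of u] by (simp add: cnj_A[OF zr] cnj_B[OF zr])
    then have "\<bar>Im z\<bar> * norm (A z w) \<le> C / norm z * norm u" by simp
    also have "\<dots> \<le> C / norm z * (norm w * K)" using u C(1) by (intro mult_left_mono) auto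
    finally have "sin \<phi> * norm z * norm (A z w) \<le> C / norm z * (norm w * K)"
      using mult_right_mono[OF im norm_ge_zero[of "A z w"]] by linarith
    then show ?thesis using z0 s0 by (simp add: D_def field_simps power2_eq_square)
  qed
  have B: "norm (B z v) \<le> (D * K + C) / norm z * norm v" if z: "z \<in> outside \<phi>" for z v
  proof -
    have z0: "norm z > 0" using z by (simp add: outside_def)
    let ?a = "A z (slice_complex ?J (cnj z) \<odot> v)"
    have "norm (B z v) \<le> norm ?a + norm (?a - B z v)" using norm_triangle_ineq4[of ?a "?a - B z v"] by simp
    also have "norm ?a \<le> D / (norm z)\<^sup>2 * (norm z * norm v * K)"
      using order_trans[OF A[OF z] mult_left_mono[OF K(2)[of "slice_complex ?J (cnj z)" v]]] D0
      by (simp add: norm_slice_complex)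
    also have "norm (?a - B z v) \<le> C / norm z * norm v" by (rule S[OF z])
    also have "D / (norm z)\<^sup>2 * (norm z * norm v * K) + C / norm z * norm v = (D * K + C) / norm z * norm v"
      using z0 by (simp add: field_simps power2_eq_square)
    finally show ?thesis by simp
  qed
  show ?thesis
  proof (intro exI[of _ "D + (D * K + C)"] conjI ballI allI)
    show "0 \<le> D + (D * K + C)" using D0 C(1) K(1) by simp
    fix z v assume z: "z \<in> outside \<phi>"
    have "D \<le> D + (D * K + C)" "D * K + C \<le> D + (D * K + C)" using D0 C(1) K(1) by simp_all
    then show "norm (A z v) \<le> (D + (D * K + C)) / (norm z)\<^sup>2 * norm v" "norm (B z v) \<le> (D + (D * K + C)) / norm z * norm v"
      by (auto intro!: order_trans[OF A[OF z]] order_trans[OF B[OF z]] mult_right_mono divide_right_mono)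
  qed
qed

lemma bounded_linear_B:
  assumes "\<omega> < \<phi>" "\<phi> < pi / 2" "z \<in> outside \<phi>" shows "bounded_linear (B z)"
proof -
  obtain C where "\<And>v. norm (B z v) \<le> C / norm z * norm v" using bounds[OF assms(1,2)] assms(3) by blast
  then show ?thesis
    by (intro bounded_linear_intro[of _ "C / norm z"]) (simp_all add: B_right_linear[OF outside_res[OF assms]] mult.commute)
qed

definition resolvent :: "complex \<Rightarrow> ('v, 'n) cmodule \<Rightarrow>\<^sub>L ('v, 'n) cmodule" where
  "resolvent z = Blinfun (\<lambda>v. A z (cmult (cnj z) v) - B z v)"

lemma resolvent_apply:
  assumes "\<omega> < \<phi>" "\<phi> < pi / 2" "z \<in> outside \<phi>"
  shows "blinfun_apply (resolvent z) v = cmult (cnj z) (A z v) - B z v"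
proof -
  have "bounded_linear (\<lambda>v. A z (cmult (cnj z) v) - B z v)"
    by (intro bounded_linear_sub bounded_linear_B[OF assms] bounded_linear_compose[OF A_right_linear(3)[OF outside_res[OF assms]]]
        cmult.bounded_linear_right)
  then show ?thesis
    unfolding resolvent_def by (simp add: bounded_linear_Blinfun_apply A_right_linear(4)[OF outside_res[OF assms]])
qed

text \<open>T commutes with the complex structure, so Q_z[T] factors as (T - z)(T - cnj z), and
  \<open>resolvent z\<close> is (cnj z - T) Q_z[T]^{-1}.\<close>

lemma T_resolvent:
  assumes "\<omega> < \<phi>" "\<phi> < pi / 2" "z \<in> outside \<phi>"
  shows "T (resolvent z v) = Some (cmult z (resolvent z v) - v)"
proof -
  note z = outside_res[OF assms]
  have "T (resolvent z v) = Some (cmult (cnj z) (B z v) - (v + (2 * Re z) *\<^sub>R B z v - (norm z)\<^sup>2 *\<^sub>R A z v))"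
    unfolding resolvent_apply[OF assms] by (intro T_diff T_cmult T_A z)
  also have "cmult (cnj z) (B z v) - (v + (2 * Re z) *\<^sub>R B z v - (norm z)\<^sup>2 *\<^sub>R A z v) = cmult z (resolvent z v) - v"
  proof -
    have "cmult z (cmult (cnj z) (A z v)) = (norm z)\<^sup>2 *\<^sub>R A z v"
      unfolding cmult.cs_assoc[symmetric] complex_norm_square[symmetric] by (simp flip: of_real_power)
    moreover have "cmult (cnj z) (B z v) - (2 * Re z) *\<^sub>R B z v = - cmult z (B z v)"
      by (simp add: cmult_def algebra_simps) (metis mult_2_right scaleR_left_distrib)
    ultimately show ?thesis
      unfolding resolvent_apply[OF assms] cmult.diff_right by (simp add: algebra_simps)
  qed
  finally show ?thesis .
qed

text \<open>As \<open>z\<close> is a root of the polynomial of Q_z, an eigenvector would lie in the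
  kernel of the injective operator Q_z[T]. This injectivity of z - T is what proves the resolvent
  identity.\<close>

lemma T_eigen_zero:
  assumes z: "z \<in> res" and u: "T u = Some (cmult z u)" shows "u = 0"
proof -
  have "A z (cmult z (cmult z u) - (2 * Re z) *\<^sub>R cmult z u + (norm z)\<^sup>2 *\<^sub>R u) = u"
    by (rule A_unique[OF z u T_cmult[OF u]])
  moreover have "cmult z (cmult z u) - (2 * Re z) *\<^sub>R cmult z u + (norm z)\<^sup>2 *\<^sub>R u = 0"
  proof -
    have "z * z - of_real (2 * Re z) * z + of_real ((norm z)\<^sup>2) = 0"
      by (simp add: complex_eq_iff cmod_power2) (simp add: power2_eq_square)
    then have "cmult (z * z - of_real (2 * Re z) * z + of_real ((norm z)\<^sup>2)) u = 0" by (simp only: cmult.zero_left)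
    then show ?thesis by (simp only: cmult.add_left cmult.diff_left cmult.cs_assoc cmult.cs_of_real)
  qed
  moreover have "A z 0 = 0" by (rule linear_simps(3)[OF A_right_linear(3)[OF z]])
  ultimately show ?thesis by simp
qed

sublocale sectorial_resolvent cmult resolvent \<omega>
proof
  show "0 < \<omega>" "\<omega> < pi / 2" by (rule \<omega>_pos \<omega>_less)+
  fix \<phi> assume \<phi>: "\<omega> < \<phi>" "\<phi> < pi / 2"
  show "resolvent z (cmult c v) = cmult c (resolvent z v)" if z: "z \<in> outside \<phi>" for z c v
    unfolding resolvent_apply[OF \<phi> z]
    by (simp add: A_right_linear(4)[OF outside_res[OF \<phi> z]] B_right_linear(3)[OF outside_res[OF \<phi> z]] cmult.diff_right cmult.cs_commute[of c])
  show "resolvent z v - resolvent w v = cmult (w - z) (resolvent z (resolvent w v))" if z: "z \<in> outside \<phi>" "w \<in> outside \<phi>" for z w v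
  proof -
    let ?r = "resolvent w v"
    \<comment> \<open>The defect of the resolvent identity satisfies T u = z u and is therefore
      0.\<close>
    define u where "u = resolvent z v - ?r - cmult (w - z) (resolvent z ?r)"
    have "T u = Some ((cmult z (resolvent z v) - v) - (cmult w ?r - v) - cmult (w - z) (cmult z (resolvent z ?r) - ?r))"
      unfolding u_def by (intro T_diff T_cmult T_resolvent[OF \<phi>] z)
    also have "(cmult z (resolvent z v) - v) - (cmult w ?r - v) - cmult (w - z) (cmult z (resolvent z ?r) - ?r) = cmult z u"
      unfolding u_def by (simp add: cmult.diff_right cmult.diff_left cmult.cs_commute[of z w])
    finally have "u = 0" by (rule T_eigen_zero[OF outside_res[OF \<phi> z(1)]])
    then show ?thesis by (simp add: u_def)
  qed
  obtain C where C: "C \<ge> 0" "\<And>z v. z \<in> outside \<phi> \<Longrightarrow> norm (A z v) \<le> C / (norm z)\<^sup>2 * norm v"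
    "\<And>z v. z \<in> outside \<phi> \<Longrightarrow> norm (B z v) \<le> C / norm z * norm v"
    using bounds[OF \<phi>] by blast
  obtain K where K: "K > 0" "\<And>c (v :: ('v, 'n) cmodule). norm (cmult c v) \<le> norm c * norm v * K" using cmult.norm_cs by blast
  have "norm (resolvent z) \<le> (C * K + C) / norm z" if z: "z \<in> outside \<phi>" for z
  proof (rule norm_blinfun_bound)
    show "0 \<le> (C * K + C) / norm z" using C(1) K(1) by simp
    fix v
    have z0: "norm z > 0" using z by (simp add: outside_def)
    have "norm (resolvent z v) \<le> norm (cmult (cnj z) (A z v)) + norm (B z v)"
      unfolding resolvent_apply[OF \<phi> z] by (rule norm_triangle_ineq4)
    also have "norm (cmult (cnj z) (A z v)) \<le> norm z * (C / (norm z)\<^sup>2 * norm v) * K"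
      using K(2)[of "cnj z" "A z v"] mult_right_mono[OF mult_left_mono[OF C(2)[OF z, of v], of "norm z"], of K] K(1) by simp
    also have "norm (B z v) \<le> C / norm z * norm v" by (rule C(3)[OF z])
    also have "norm z * (C / (norm z)\<^sup>2 * norm v) * K + C / norm z * norm v = (C * K + C) / norm z * norm v"
      using z0 by (simp add: field_simps power2_eq_square)
    finally show "norm (resolvent z v) \<le> (C * K + C) / norm z * norm v" by simp
  qed
  then show "\<exists>C. \<forall>z\<in>outside \<phi>. norm (resolvent z) \<le> C / norm z" by blast
qed

text \<open>Q_s[T] at the unit is T^2 + 1, and the terms with \<open>B\<close> cancel in
  \<open>P\<close>. So the abstract \<open>P\<close> is the inverse that occurs in
  \<open>bnd_calculus\<close>.\<close>

lemma P_eq_A: "P v = A \<i> v"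
proof -
  define \<phi> where "\<phi> = (\<omega> + pi / 2) / 2"
  have \<phi>: "\<omega> < \<phi>" "\<phi> < pi / 2" "0 < \<phi>" using \<omega>_pos \<omega>_less by (auto simp: \<phi>_def)
  note o = imaginary_unit_outside[OF \<phi>(2,3)]
  have "A (- \<i>) v = A \<i> v" "B (- \<i>) v = B \<i> v"
    using cnj_A[OF outside_res[OF \<phi>(1,2) o(1)], of v] cnj_B[OF outside_res[OF \<phi>(1,2) o(1)], of v] by simp_all
  then have "resolvent (- \<i>) v - resolvent \<i> v = cmult (2 * \<i>) (A \<i> v)"
    unfolding resolvent_apply[OF \<phi>(1,2) o(1)] resolvent_apply[OF \<phi>(1,2) o(2)]
    by (simp flip: cmult.diff_left)
  then show ?thesis unfolding P_def by (simp flip: cmult.cs_assoc)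
qed

lemma op_inverse_1_plus_square:
  "op_inverse (op_of (cl_of_real 1) \<oplus> (T \<circ>\<^sub>m T)) v = Some (P v)"
proof -
  define \<phi> where "\<phi> = (\<omega> + pi / 2) / 2"
  have \<phi>: "\<omega> < \<phi>" "\<phi> < pi / 2" "0 < \<phi>" using \<omega>_pos \<omega>_less by (auto simp: \<phi>_def)
  note r = outside_res[OF \<phi>(1,2) imaginary_unit_outside(1)[OF \<phi>(2,3)]]
  have "op_of (cl_of_real 1) \<oplus> (T \<circ>\<^sub>m T) = Q_op (slice_complex basis_unit \<i>) T"
  proof
    fix w
    have "(op_of (cl_of_real 1) \<oplus> (T \<circ>\<^sub>m T)) w = Some u \<longleftrightarrow> Q_op (slice_complex basis_unit \<i>) T w = Some u" for u
      unfolding Q_op_eq_Some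
      by (auto simp: op_add_def op_of_def map_comp_def dom_def cl_mult_one slice_complex_nth norm_slice_complex algebra_simps split: option.splits)
    then show "(op_of (cl_of_real 1) \<oplus> (T \<circ>\<^sub>m T)) w = Q_op (slice_complex basis_unit \<i>) T w"
      by (metis option.exhaust)
  qed
  then show ?thesis using op_inverse_Q[OF r basis_unit] by (simp add: P_eq_A)
qed

end


section \<open>Slice hyperholomorphic functions as families of holomorphic functions\<close>

lemma slice_domain_sector:
  assumes "0 < \<theta>" "\<theta> < pi / 2"
  shows "(x, y) \<in> slice_domain (double_sector \<theta> :: 'n::{finite,linorder} clifford set) \<longleftrightarrow> Complex x y \<in> sector \<theta>"
proof -
  have "(basis_unit :: 'n clifford) \<in> imag_units" by (rule basis_unit)
  then show ?thesis
    using slice_complex_in_double_sector[OF assms, where ?'a = 'n]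
    unfolding slice_domain_def slice_point_eq by blast
qed

text \<open>The complex number \<open>F A z\<close> packs the coefficients at e_A of both components
  f_0 and f_1; \<open>Re_vec\<close> and \<open>Im_vec\<close> recover the two components.\<close>

definition Re_vec :: "('k \<Rightarrow> complex \<Rightarrow> complex) \<Rightarrow> complex \<Rightarrow> (real, 'k::finite) vec" where
  "Re_vec F z = (\<chi> A. Re (F A z))"

definition Im_vec :: "('k \<Rightarrow> complex \<Rightarrow> complex) \<Rightarrow> complex \<Rightarrow> (real, 'k::finite) vec" where
  "Im_vec F z = (\<chi> A. Im (F A z))"

text \<open>A slice hyperholomorphic function is a family of holomorphic functions, one for each basis element
  of the Clifford algebra, that are compatible with conjugation.\<close>

definition slice_rep ::
    "real \<Rightarrow> ('n::{finite,linorder} clifford \<Rightarrow> 'n clifford) \<Rightarrow> ('n set \<Rightarrow> complex \<Rightarrow> complex) \<Rightarrow> bool" where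
  "slice_rep \<theta> f F \<longleftrightarrow> (\<forall>A. F A holomorphic_on sector \<theta>) \<and> (\<forall>A. \<forall>z\<in>sector \<theta>. F A (cnj z) = cnj (F A z)) \<and>
     (\<forall>z\<in>sector \<theta>. \<forall>J\<in>imag_units. f (slice_complex J z) = Re_vec F z + J \<odot> Im_vec F z)"

lemma cnj_in_sector [simp]: "cnj z \<in> sector \<theta> \<longleftrightarrow> z \<in> sector \<theta>"
  by (simp add: sector_def)

text \<open>For each coefficient the differential equations for f_0 and f_1 are the Cauchy-Riemann
  equations, and the parity in \<open>y\<close> is compatibility with conjugation.\<close>

lemma slice_components_rep:
  fixes f :: "'n::{finite,linorder} clifford \<Rightarrow> 'n clifford"
  assumes \<theta>: "0 < \<theta>" "\<theta> < pi / 2" and f: "slice_components (double_sector \<theta>) f f0 f1"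
  shows "slice_rep \<theta> f (\<lambda>A z. Complex (f0 (Re z, Im z) $ A) (f1 (Re z, Im z) $ A))"
proof -
  note dom = slice_domain_sector[OF \<theta>, where 'n = 'n]
  have inD: "(Re z, Im z) \<in> slice_domain (double_sector \<theta> :: 'n clifford set)" if "z \<in> sector \<theta>" for z
    using dom[of "Re z" "Im z"] that by simp
  from f[unfolded slice_components_def, THEN conjunct2, THEN conjunct2] obtain f0x f0y f1x f1y where
    0: "has_continuous_partials f0 f0x f0y (slice_domain (double_sector \<theta> :: 'n clifford set))" and
    1: "has_continuous_partials f1 f1x f1y (slice_domain (double_sector \<theta> :: 'n clifford set))" and
    cr: "\<forall>p\<in>slice_domain (double_sector \<theta> :: 'n clifford set). f0x p = f1y p \<and> f0y p = - f1x p"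
    by (elim exE conjE) blast
  have "(\<lambda>z. Complex (f0 (Re z, Im z) $ A) (f1 (Re z, Im z) $ A)) holomorphic_on sector \<theta>" for A
    unfolding holomorphic_on_def
  proof
    fix z assume z: "z \<in> sector \<theta>"
    define p where "p = (Re z, Im z)"
    have p: "p \<in> slice_domain (double_sector \<theta> :: 'n clifford set)" using inD[OF z] by (simp add: p_def)
    have d0: "(f0 has_derivative (\<lambda>(h, k). h *\<^sub>R f0x p + k *\<^sub>R f0y p)) (at p)"
      and d1: "(f1 has_derivative (\<lambda>(h, k). h *\<^sub>R f1x p + k *\<^sub>R f1y p)) (at p)"
      using 0 1 p unfolding has_continuous_partials_def by blast+
    have L: "((\<lambda>z. (Re z, Im z)) has_derivative (\<lambda>h. (Re h, Im h))) (at z)"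
      by (intro derivative_intros bounded_linear_imp_has_derivative bounded_linear_Re bounded_linear_Im)
    have nthb: "bounded_linear (\<lambda>v :: 'n clifford. v $ A)" by (rule bounded_linear_vec_nth)
    have c0: "((\<lambda>z. f0 (Re z, Im z) $ A) has_derivative (\<lambda>h. (Re h *\<^sub>R f0x p + Im h *\<^sub>R f0y p) $ A)) (at z)"
      using bounded_linear.has_derivative[OF nthb has_derivative_compose[OF L d0[unfolded p_def]]] by (simp add: p_def)
    have c1: "((\<lambda>z. f1 (Re z, Im z) $ A) has_derivative (\<lambda>h. (Re h *\<^sub>R f1x p + Im h *\<^sub>R f1y p) $ A)) (at z)"
      using bounded_linear.has_derivative[OF nthb has_derivative_compose[OF L d1[unfolded p_def]]] by (simp add: p_def)
    define D where "D = Complex (f0x p $ A) (f1x p $ A)"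
    have "((\<lambda>z. of_real (f0 (Re z, Im z) $ A) + \<i> * of_real (f1 (Re z, Im z) $ A)) has_derivative
        (\<lambda>h. of_real ((Re h *\<^sub>R f0x p + Im h *\<^sub>R f0y p) $ A) + \<i> * of_real ((Re h *\<^sub>R f1x p + Im h *\<^sub>R f1y p) $ A))) (at z)"
      by (intro derivative_intros bounded_linear.has_derivative[OF bounded_linear_of_real c0]
          bounded_linear.has_derivative[OF bounded_linear_of_real c1])
    moreover have "(\<lambda>h. of_real ((Re h *\<^sub>R f0x p + Im h *\<^sub>R f0y p) $ A) + \<i> * of_real ((Re h *\<^sub>R f1x p + Im h *\<^sub>R f1y p) $ A)) = (\<lambda>h. D * h)"
      using bspec[OF cr p] by (auto simp: fun_eq_iff D_def complex_eq_iff algebra_simps)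
    ultimately have "((\<lambda>z. Complex (f0 (Re z, Im z) $ A) (f1 (Re z, Im z) $ A)) has_field_derivative D) (at z)"
      unfolding has_field_derivative_def Complex_eq by simp
    then show "(\<lambda>z. Complex (f0 (Re z, Im z) $ A) (f1 (Re z, Im z) $ A)) field_differentiable at z within sector \<theta>"
      by (meson field_differentiable_at_within field_differentiable_def)
  qed
  moreover have "f0 (Re z, - Im z) = f0 (Re z, Im z) \<and> f1 (Re z, - Im z) = - f1 (Re z, Im z)" if "z \<in> sector \<theta>" for z
    using bspec[OF f[unfolded slice_components_def, THEN conjunct2, THEN conjunct1] inD[OF that]] by simp
  moreover have "f (slice_complex J z) = f0 (Re z, Im z) + J \<odot> f1 (Re z, Im z)" if "z \<in> sector \<theta>" "J \<in> imag_units" for z J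
    using bspec[OF f[unfolded slice_components_def, THEN conjunct1] inD[OF that(1)]] that(2) by (simp add: slice_complex_def)
  ultimately show ?thesis
    by (simp add: slice_rep_def Re_vec_def Im_vec_def complex_eq_iff)
qed

lemma slice_rep_components:
  fixes f :: "'n::{finite,linorder} clifford \<Rightarrow> 'n clifford"
  assumes \<theta>: "0 < \<theta>" "\<theta> < pi / 2" and f: "slice_rep \<theta> f F"
  shows "slice_components (double_sector \<theta>) f (\<lambda>p. Re_vec F (Complex (fst p) (snd p))) (\<lambda>p. Im_vec F (Complex (fst p) (snd p)))"
proof -
  note dom = slice_domain_sector[OF \<theta>, where 'n = 'n]
  have hol: "F A holomorphic_on sector \<theta>" for A using f by (simp add: slice_rep_def)
  let ?c = "\<lambda>p. Complex (fst p) (snd p)"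
  define f0 where "f0 p = Re_vec F (?c p)" for p
  define f1 where "f1 p = Im_vec F (?c p)" for p
  define D where "D A p = deriv (F A) (?c p)" for A p
  have c_eq: "?c = (\<lambda>p. of_real (fst p) + \<i> * of_real (snd p))" by (simp add: fun_eq_iff Complex_eq)
  have cc: "continuous_on S ?c" for S unfolding c_eq by (intro continuous_intros)
  have sub: "?c ` slice_domain (double_sector \<theta> :: 'n clifford set) \<subseteq> sector \<theta>"
    using dom by (auto simp: image_def)
  have contD: "continuous_on (slice_domain (double_sector \<theta> :: 'n clifford set)) (D A)" for A
    unfolding D_def
    by (rule continuous_on_compose2[OF holomorphic_on_imp_continuous_on[OF holomorphic_deriv[OF hol open_sector]] cc sub])
  have der: "((\<lambda>p. F A (?c p)) has_derivative (\<lambda>h. D A p * (of_real (fst h) + \<i> * of_real (snd h)))) (at p)"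
    if p: "p \<in> slice_domain (double_sector \<theta> :: 'n clifford set)" for A p
  proof -
    have "(?c has_derivative (\<lambda>h. of_real (fst h) + \<i> * of_real (snd h))) (at p)"
      unfolding c_eq by (intro derivative_intros)
    moreover have "(F A has_derivative (\<lambda>h. D A p * h)) (at (?c p))"
      using holomorphic_derivI[OF hol open_sector, of "?c p" A UNIV] sub p
      unfolding has_field_derivative_def D_def by auto
    ultimately show ?thesis by (rule has_derivative_compose)
  qed
  have vec: "((\<lambda>p. \<chi> A. g A p) has_derivative (\<lambda>h. \<chi> A. g' A h)) (at p)"
    if "\<And>A. (g A has_derivative g' A) (at p)" for g :: "'n set \<Rightarrow> real \<times> real \<Rightarrow> real" and g' p
    using that unfolding has_derivative_componentwise_within[of "\<lambda>p. \<chi> A. g A p"]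
    by (auto simp: Basis_vec_def inner_axis)
  have "has_continuous_partials f0 (\<lambda>p. \<chi> A. Re (D A p)) (\<lambda>p. \<chi> A. - Im (D A p)) (slice_domain (double_sector \<theta> :: 'n clifford set))"
    unfolding has_continuous_partials_def
  proof (intro conjI ballI)
    fix p assume p: "p \<in> slice_domain (double_sector \<theta> :: 'n clifford set)"
    have "(f0 has_derivative (\<lambda>h. \<chi> A. Re (D A p * (of_real (fst h) + \<i> * of_real (snd h))))) (at p)"
      unfolding f0_def Re_vec_def by (intro vec bounded_linear.has_derivative[OF bounded_linear_Re der[OF p]])
    also have "(\<lambda>h. \<chi> A. Re (D A p * (of_real (fst h) + \<i> * of_real (snd h)))) = (\<lambda>(h, k). h *\<^sub>R (\<chi> A. Re (D A p)) + k *\<^sub>R (\<chi> A. - Im (D A p)))"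
      by (auto simp: fun_eq_iff vec_eq_iff algebra_simps)
    finally show "(f0 has_derivative (\<lambda>(h, k). h *\<^sub>R (\<chi> A. Re (D A p)) + k *\<^sub>R (\<chi> A. - Im (D A p)))) (at p)" .
  qed (intro continuous_intros contD)+
  moreover have "has_continuous_partials f1 (\<lambda>p. \<chi> A. Im (D A p)) (\<lambda>p. \<chi> A. Re (D A p)) (slice_domain (double_sector \<theta> :: 'n clifford set))"
    unfolding has_continuous_partials_def
  proof (intro conjI ballI)
    fix p assume p: "p \<in> slice_domain (double_sector \<theta> :: 'n clifford set)"
    have "(f1 has_derivative (\<lambda>h. \<chi> A. Im (D A p * (of_real (fst h) + \<i> * of_real (snd h))))) (at p)"
      unfolding f1_def Im_vec_def by (intro vec bounded_linear.has_derivative[OF bounded_linear_Im der[OF p]])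
    also have "(\<lambda>h. \<chi> A. Im (D A p * (of_real (fst h) + \<i> * of_real (snd h)))) = (\<lambda>(h, k). h *\<^sub>R (\<chi> A. Im (D A p)) + k *\<^sub>R (\<chi> A. Re (D A p)))"
      by (auto simp: fun_eq_iff vec_eq_iff algebra_simps)
    finally show "(f1 has_derivative (\<lambda>(h, k). h *\<^sub>R (\<chi> A. Im (D A p)) + k *\<^sub>R (\<chi> A. Re (D A p)))) (at p)" .
  qed (intro continuous_intros contD)+
  moreover have "f (slice_point J x y) = f0 (x, y) + J \<odot> f1 (x, y)" if "Complex x y \<in> sector \<theta>" "J \<in> imag_units" for x y J
    using f that by (simp add: slice_rep_def f0_def f1_def slice_point_eq)
  moreover have "f0 (x, - y) = f0 (x, y) \<and> f1 (x, - y) = - f1 (x, y)" if "Complex x y \<in> sector \<theta>" for x y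
  proof -
    have "F A (cnj (Complex x y)) = cnj (F A (Complex x y))" for A using f that unfolding slice_rep_def by blast
    moreover have "cnj (Complex x y) = Complex x (- y)" by (simp add: complex_eq_iff)
    ultimately show ?thesis by (simp add: f0_def f1_def Re_vec_def Im_vec_def vec_eq_iff)
  qed
  moreover have "(\<chi> A. - Im (D A p)) = - (\<chi> A. Im (D A p))" for p by (simp add: vec_eq_iff)
  ultimately have "slice_components (double_sector \<theta>) f f0 f1"
    unfolding slice_components_def using dom by blast
  then show ?thesis unfolding f0_def[abs_def] f1_def[abs_def] .
qed

lemma slice_rep_SH_L:
  assumes "0 < \<theta>" "\<theta> < pi / 2" "slice_rep \<theta> f F"
  shows "f \<in> SH_L (double_sector \<theta>)"
  using slice_rep_components[OF assms] unfolding SH_L_def by blast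

text \<open>Half the sum and half the difference of the values at \<open>z\<close> and
  \<open>cnj z\<close> are f_0 and J f_1, and J is undone by another J. The constant depends on the
  algebra only, hence one \<open>K\<close> for all functions, units and points.\<close>

lemma slice_rep_norms:
  fixes f :: "'n::{finite,linorder} clifford \<Rightarrow> 'n clifford"
  shows "\<exists>K>0. \<forall>f F \<theta> J z. slice_rep \<theta> f F \<longrightarrow> J \<in> imag_units \<longrightarrow> z \<in> sector \<theta> \<longrightarrow>
     (\<forall>A. norm (F A z) \<le> K * (norm (f (slice_complex J z)) + norm (f (slice_complex J (cnj z))))) \<and>
     norm (f (slice_complex J z :: 'n clifford)) \<le> K * (\<Sum>A\<in>UNIV. norm (F A z))"
proof -
  obtain K where K: "K > 0" "\<And>(a :: 'n clifford) (v :: 'n clifford). norm (a \<odot> v) \<le> norm a * norm v * K"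
    using cl_mult.pos_bounded by blast
  have "(\<forall>A. norm (F A z) \<le> (1 + K) * (norm (f (slice_complex J z)) + norm (f (slice_complex J (cnj z))))) \<and>
     norm (f (slice_complex J z)) \<le> (1 + K) * (\<Sum>A\<in>UNIV. norm (F A z))"
    if r: "slice_rep \<theta> f F" and J: "J \<in> imag_units" and z: "z \<in> sector \<theta>"
    for f :: "'n clifford \<Rightarrow> 'n clifford" and F \<theta> J z
  proof -
    define c where "c = Re_vec F z"
    define s where "s = Im_vec F z"
    have JK: "norm (J \<odot> v) \<le> norm v * K" for v :: "'n clifford" using K(2)[of J v] J by (simp add: imag_units_def)
    have 1: "f (slice_complex J z) = c + J \<odot> s" using r J z by (simp add: slice_rep_def c_def s_def)
    have "F A (cnj z) = cnj (F A z)" for A using r z by (simp add: slice_rep_def)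
    then have "Re_vec F (cnj z) = c" "Im_vec F (cnj z) = - s"
      by (simp_all add: c_def s_def Re_vec_def Im_vec_def vec_eq_iff)
    then have 2: "f (slice_complex J (cnj z)) = c - J \<odot> s"
      using r J z by (simp add: slice_rep_def cl_mult.minus_right)
    let ?n = "norm (f (slice_complex J z)) + norm (f (slice_complex J (cnj z)))"
    have "2 *\<^sub>R c = f (slice_complex J z) + f (slice_complex J (cnj z))" unfolding 1 2 by (simp add: scaleR_2)
    then have "2 * norm c \<le> ?n" using norm_triangle_ineq[of "f (slice_complex J z)" "f (slice_complex J (cnj z))"]
      by (metis abs_numeral norm_scaleR)
    then have c: "norm c \<le> ?n" using norm_ge_zero[of c] by linarith
    have "2 *\<^sub>R (J \<odot> s) = f (slice_complex J z) - f (slice_complex J (cnj z))" unfolding 1 2 by (simp add: scaleR_2)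
    then have "2 * norm (J \<odot> s) \<le> ?n" using norm_triangle_ineq4[of "f (slice_complex J z)" "f (slice_complex J (cnj z))"]
      by (metis abs_numeral norm_scaleR)
    then have Js: "norm (J \<odot> s) \<le> ?n" using norm_ge_zero[of "J \<odot> s"] by linarith
    have "s = - (J \<odot> (J \<odot> s))" using imag_unit_act[OF J, of s] by simp
    then have "norm s = norm (J \<odot> (J \<odot> s))" by (metis norm_minus_cancel)
    also have "\<dots> \<le> norm (J \<odot> s) * K" by (rule JK)
    also have "\<dots> \<le> ?n * K" using Js K(1) by (intro mult_right_mono) auto
    finally have s: "norm s \<le> K * ?n" by (simp add: mult.commute)
    have "norm (F A z) \<le> (1 + K) * ?n" for A
    proof -
      have "norm (F A z) \<le> \<bar>c $ A\<bar> + \<bar>s $ A\<bar>" using cmod_le[of "F A z"] by (simp add: c_def s_def Re_vec_def Im_vec_def)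
      also have "\<dots> \<le> norm c + norm s" by (intro add_mono component_le_norm_cart)
      also have "\<dots> \<le> (1 + K) * ?n" using c s by (simp add: algebra_simps)
      finally show ?thesis .
    qed
    moreover have "norm (f (slice_complex J z)) \<le> (1 + K) * (\<Sum>A\<in>UNIV. norm (F A z))"
    proof -
      have "norm c \<le> (\<Sum>A\<in>UNIV. norm (F A z))" "norm s \<le> (\<Sum>A\<in>UNIV. norm (F A z))"
        by (rule order_trans[OF norm_vec_le_sum sum_mono]; simp add: c_def s_def Re_vec_def Im_vec_def abs_Re_le_cmod abs_Im_le_cmod)+
      then have "norm c + norm s * K \<le> (\<Sum>A\<in>UNIV. norm (F A z)) + (\<Sum>A\<in>UNIV. norm (F A z)) * K"
        using K(1) by (intro add_mono mult_right_mono) auto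
      moreover have "norm (c + J \<odot> s) \<le> norm c + norm s * K"
        using norm_triangle_ineq[of c "J \<odot> s"] JK[of s] by linarith
      ultimately show ?thesis unfolding 1 by (simp add: algebra_simps)
    qed
    ultimately show ?thesis by blast
  qed
  moreover have "1 + K > 0" using K(1) by simp
  ultimately show ?thesis by blast
qed

text \<open>The bridge between the Lebesgue integral in the definition of \<open>SH0\<close> and the
  integrals used for \<open>decays\<close>.\<close>

lemma nn_integral_Ioi_finite_iff:
  fixes g :: "real \<Rightarrow> real"
  assumes g: "continuous_on {0<..} g" and g0: "\<And>t. t > 0 \<Longrightarrow> 0 \<le> g t"
  shows "(\<integral>\<^sup>+t\<in>{0<..}. ennreal (g t) \<partial>lborel) < \<infinity> \<longleftrightarrow> g integrable_on {0<..}"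
proof -
  define h where "h t = indicator {0<..} t *\<^sub>R g t" for t
  have hm: "h \<in> borel_measurable borel" unfolding h_def by (rule borel_measurable_continuous_on_indicator[OF _ g]) simp
  have h0: "0 \<le> h t" for t using g0 by (simp add: h_def indicator_def)
  have e: "(\<integral>\<^sup>+t\<in>{0<..}. ennreal (g t) \<partial>lborel) = integral\<^sup>N lborel h"
    by (rule nn_integral_cong) (auto simp: h_def indicator_def)
  have r: "h integrable_on UNIV \<longleftrightarrow> g integrable_on {0<..}"
  proof -
    have "h = (\<lambda>t. if t \<in> {0<..} then g t else 0)" by (auto simp: h_def indicator_def)
    then show ?thesis by (simp only: integrable_restrict_UNIV)
  qed
  show ?thesis
  proof
    assume "(\<integral>\<^sup>+t\<in>{0<..}. ennreal (g t) \<partial>lborel) < \<infinity>"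
    then show "g integrable_on {0<..}" using nn_integral_integrable_on[OF hm h0] e r by simp
  next
    assume "g integrable_on {0<..}"
    then obtain I where "(h has_integral I) UNIV" using r by blast
    from nn_integral_has_integral_lborel[OF hm h0 this] show "(\<integral>\<^sup>+t\<in>{0<..}. ennreal (g t) \<partial>lborel) < \<infinity>" using e by simp
  qed
qed

lemma slice_rep_continuous:
  assumes "slice_rep \<theta> f F" "J \<in> imag_units" "d \<in> sector \<theta>"
  shows "continuous_on {0<..} (\<lambda>r. f (slice_complex J (of_real r * d)))"
proof -
  have c: "continuous_on {0<..} (\<lambda>r. F A (of_real r * d))" for A
    using assms by (intro decays_continuous[OF conical_sector] holomorphic_on_imp_continuous_on) (auto simp: slice_rep_def)
  have "continuous_on {0<..} (\<lambda>r. Re_vec F (of_real r * d) + J \<odot> Im_vec F (of_real r * d))"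
    unfolding Re_vec_def Im_vec_def by (intro continuous_intros cl_mult.continuous_on c)
  then show ?thesis
    by (rule continuous_on_eq) (use assms sector_scale in \<open>auto simp: slice_rep_def\<close>)
qed

text \<open>From \<open>f\<close> to \<open>F\<close> a single unit suffices, since the rays through
  \<open>d\<close> and \<open>cnj d\<close> together control all coefficients. Conversely the
  coefficients bound \<open>f\<close> on every slice.\<close>

lemma SH0_iff_decays:
  fixes f :: "'n::{finite,linorder} clifford \<Rightarrow> 'n clifford"
  assumes \<theta>: "0 < \<theta>" "\<theta> < pi / 2" and f: "slice_rep \<theta> f F"
  shows "f \<in> SH0 \<theta> \<longleftrightarrow> (\<forall>A. decays (sector \<theta>) (F A))"
proof -
  obtain K where K: "K > 0" "\<And>J z A. J \<in> imag_units \<Longrightarrow> z \<in> sector \<theta> \<Longrightarrow> norm (F A z) \<le> K * (norm (f (slice_complex J z)) + norm (f (slice_complex J (cnj z))))"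
    "\<And>J z. J \<in> imag_units \<Longrightarrow> z \<in> sector \<theta> \<Longrightarrow> norm (f (slice_complex J z)) \<le> K * (\<Sum>A\<in>UNIV. norm (F A z))"
    using slice_rep_norms[where 'n = 'n] f by metis
  have hol: "F A holomorphic_on sector \<theta>" for A using f by (simp add: slice_rep_def)
  have pt: "t *\<^sub>R slice_exp J \<phi> = slice_complex J (of_real t * cis \<phi>)" for t \<phi> and J :: "'n clifford"
    by (simp only: slice_exp_eq slice_complex_linear(3)[symmetric] scaleR_conv_of_real[of t "cis \<phi>"])
  have nn: "(\<integral>\<^sup>+t\<in>{0<..}. ennreal (norm (f (t *\<^sub>R slice_exp J \<phi>)) / t) \<partial>lborel) < \<infinity> \<longleftrightarrow>
      (\<lambda>t. norm (f (slice_complex J (of_real t * cis \<phi>))) / t) integrable_on {0<..}"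
    if "J \<in> imag_units" "\<phi> \<in> angles \<theta>" for J \<phi>
    unfolding pt using that cis_angles_in_sector[OF \<theta>]
    by (intro nn_integral_Ioi_finite_iff continuous_intros slice_rep_continuous[OF f]) auto
  show ?thesis
  proof
    assume S: "f \<in> SH0 \<theta>"
    then obtain M where M: "\<And>s. s \<in> double_sector \<theta> \<Longrightarrow> norm (f s) \<le> M" by (auto simp: SH0_def bounded_iff)
    have int: "(\<lambda>t. norm (f (slice_complex basis_unit (of_real t * d))) / t) integrable_on {0<..}" if d: "d \<in> sector \<theta>" "norm d = 1" for d
    proof -
      obtain r t where "d = of_real r * cis t" "r > 0" "t \<in> angles \<theta>" using sector_polar[OF \<theta> d(1)] by blast
      then have "d = cis t" "t \<in> angles \<theta>" using d(2) by (auto simp: norm_mult)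
      then show ?thesis using nn[OF basis_unit, of t] S by (auto simp: SH0_def)
    qed
    show "\<forall>A. decays (sector \<theta>) (F A)"
      unfolding decays_def
    proof (intro allI conjI ballI impI hol)
      fix A
      have "norm (F A z) \<le> K * (M + M)" if z: "z \<in> sector \<theta>" for z
      proof -
        have "norm (f (slice_complex basis_unit z)) \<le> M" "norm (f (slice_complex basis_unit (cnj z))) \<le> M"
          using M[of "slice_complex basis_unit z"] M[of "slice_complex basis_unit (cnj z)"] z
          by (simp_all add: slice_complex_in_double_sector[OF \<theta> basis_unit])
        then show ?thesis by (intro order_trans[OF K(2)[OF basis_unit z] mult_left_mono] add_mono) (use K(1) in auto)
      qed
      then show "\<exists>M. \<forall>z\<in>sector \<theta>. norm (F A z) \<le> M" by blast
      fix d assume d: "d \<in> sector \<theta>" "norm d = 1"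
      let ?g = "\<lambda>d t. norm (f (slice_complex basis_unit (of_real t * d))) / t"
      have g: "(\<lambda>t. K * (?g d t + ?g (cnj d) t)) integrable_on {0<..}"
        using integrable_on_cmult_left[OF integrable_add[OF int[OF d] int[of "cnj d"]], of K] d by simp
      show "(\<lambda>r. norm (F A (of_real r * d)) / r) integrable_on {0<..}"
      proof (rule dominated_integrable_Ioi(1)[OF _ g])
        show "continuous_on {0<..} (\<lambda>r. norm (F A (of_real r * d)) / r)"
          by (intro continuous_intros decays_continuous[OF conical_sector holomorphic_on_imp_continuous_on[OF hol] d(1)]) auto
        fix r :: real assume r: "r > 0"
        have "norm (F A (of_real r * d)) \<le> K * (norm (f (slice_complex basis_unit (of_real r * d))) + norm (f (slice_complex basis_unit (of_real r * cnj d))))"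
          using K(2)[OF basis_unit, of "of_real r * d" A] d(1) sector_scale[OF r] by auto
        then show "norm (norm (F A (of_real r * d)) / r) \<le> K * (?g d r + ?g (cnj d) r)"
          using r by (simp add: divide_right_mono add_divide_distrib[symmetric])
      qed
    qed
  next
    assume d: "\<forall>A. decays (sector \<theta>) (F A)"
    obtain M where M: "\<And>A z. z \<in> sector \<theta> \<Longrightarrow> norm (F A z) \<le> M A" using d unfolding decays_def by metis
    have "bounded (f ` double_sector \<theta>)"
    proof -
      have "norm (f s) \<le> K * (\<Sum>A\<in>UNIV. M A)" if s: "s \<in> double_sector \<theta>" for s
      proof -
        obtain J z where z: "s = slice_complex J z" "J \<in> imag_units" "z \<in> sector \<theta>" using s unfolding double_sector_eq[OF \<theta>] by blast
        have "K * (\<Sum>A\<in>UNIV. norm (F A z)) \<le> K * (\<Sum>A\<in>UNIV. M A)"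
          using K(1) M[OF z(3)] by (intro mult_left_mono sum_mono) auto
        with K(3)[OF z(2,3)] show ?thesis unfolding z(1) by linarith
      qed
      then show ?thesis unfolding bounded_iff by blast
    qed
    moreover have "(\<integral>\<^sup>+t\<in>{0<..}. ennreal (norm (f (t *\<^sub>R slice_exp J \<phi>)) / t) \<partial>lborel) < \<infinity>"
      if J: "J \<in> imag_units" and \<phi>: "\<phi> \<in> angles \<theta>" for J \<phi>
      unfolding nn[OF that]
    proof (rule dominated_integrable_Ioi(1))
      have c: "cis \<phi> \<in> sector \<theta>" by (rule cis_angles_in_sector[OF \<theta> \<phi>])
      show "continuous_on {0<..} (\<lambda>t. norm (f (slice_complex J (of_real t * cis \<phi>))) / t)"
        by (intro continuous_intros slice_rep_continuous[OF f J c]) auto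
      have "(\<lambda>t. norm (F A (of_real t * cis \<phi>)) / t) integrable_on {0<..}" for A using d c by (simp add: decays_def)
      then have "(\<lambda>t. \<Sum>A\<in>UNIV. norm (F A (of_real t * cis \<phi>)) / t) integrable_on {0<..}" by (intro integrable_sum) auto
      from integrable_on_cmult_left[OF this, of K]
      show "(\<lambda>t. K * (\<Sum>A\<in>UNIV. norm (F A (of_real t * cis \<phi>)) / t)) integrable_on {0<..}" by simp
      fix t :: real assume t: "t > 0"
      have "norm (f (slice_complex J (of_real t * cis \<phi>))) \<le> K * (\<Sum>A\<in>UNIV. norm (F A (of_real t * cis \<phi>)))"
        using K(3)[OF J] c sector_scale[OF t] by blast
      then show "norm (norm (f (slice_complex J (of_real t * cis \<phi>))) / t) \<le> K * (\<Sum>A\<in>UNIV. norm (F A (of_real t * cis \<phi>)) / t)"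
        using t by (simp add: divide_right_mono sum_divide_distrib[symmetric])
    qed
    ultimately show "f \<in> SH0 \<theta>" using slice_rep_SH_L[OF \<theta> f] by (auto simp: SH0_def)
  qed
qed


section \<open>The Clifford contour integral as a sum of complex ones\<close>

lemma has_integral_reflect_UNIV:
  fixes f :: "real \<Rightarrow> 'a::banach"
  assumes "(f has_integral i) UNIV" shows "((\<lambda>x. f (- x)) has_integral i) UNIV"
  unfolding has_integral_alt'
proof (intro conjI allI impI)
  have f: "\<And>a b. f integrable_on cbox a b" "\<And>e. e > 0 \<Longrightarrow> \<exists>B>0. \<forall>a b. ball 0 B \<subseteq> cbox a b \<longrightarrow> norm (integral (cbox a b) f - i) < e"
    using assms unfolding has_integral_alt' by auto
  show "(\<lambda>x. if x \<in> UNIV then f (- x) else 0) integrable_on cbox a b" for a b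
    using f(1)[of "- b" "- a"] Henstock_Kurzweil_Integration.integrable_reflect_real[where f = f and a = "- b" and b = "- a"] by simp
  fix e :: real assume "e > 0"
  then obtain B where B: "B > 0" "\<And>a b. ball 0 B \<subseteq> cbox a b \<Longrightarrow> norm (integral (cbox a b) f - i) < e" using f(2) by blast
  have "norm (integral (cbox a b) (\<lambda>x. f (- x)) - i) < e" if ab: "ball 0 B \<subseteq> cbox a b" for a b
  proof -
    have "ball 0 B \<subseteq> cbox (- b) (- a)"
    proof
      fix x :: real assume "x \<in> ball 0 B"
      then have "- x \<in> ball 0 B" by simp
      then have "- x \<in> cbox a b" using ab by blast
      then show "x \<in> cbox (- b) (- a)" by auto
    qed
    from B(2)[OF this] show ?thesis using Henstock_Kurzweil_Integration.integral_reflect_real[where f = f and a = "- b" and b = "- a"] by simp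
  qed
  then show "\<exists>B>0. \<forall>a b. ball 0 B \<subseteq> cbox a b \<longrightarrow> norm (integral (cbox a b) (\<lambda>x. if x \<in> UNIV then f (- x) else 0) - i) < e"
    using B(1) by auto
qed

lemma integral_UNIV_split:
  fixes f :: "real \<Rightarrow> 'a::banach"
  assumes "f integrable_on {0<..}" "(\<lambda>x. f (- x)) integrable_on {0<..}"
  shows "integral UNIV f = integral {0<..} f + integral {0<..} (\<lambda>x. f (- x))"
proof -
  have 1: "((\<lambda>x. if x \<in> {0<..} then f x else 0) has_integral integral {0<..} f) UNIV"
    using assms(1) by (simp only: has_integral_restrict_UNIV integrable_integral)
  have "((\<lambda>x. if x \<in> {0<..} then f (- x) else 0) has_integral integral {0<..} (\<lambda>x. f (- x))) UNIV"
    using assms(2) by (simp only: has_integral_restrict_UNIV integrable_integral)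
  from has_integral_add[OF 1 has_integral_reflect_UNIV[OF this]]
  have "((\<lambda>x. (if x \<in> {0<..} then f x else 0) + (if - x \<in> {0<..} then f x else 0)) has_integral
      integral {0<..} f + integral {0<..} (\<lambda>x. f (- x))) UNIV" by (simp only: minus_minus)
  then have "(f has_integral integral {0<..} f + integral {0<..} (\<lambda>x. f (- x))) UNIV"
    by (rule has_integral_spike[of "{0}", rotated 2]) auto
  then show ?thesis by (rule integral_unique)
qed

lemma slice_rep_basis:
  assumes "slice_rep \<theta> f F" "z \<in> sector \<theta>" "J \<in> imag_units"
  shows "f (slice_complex J z) \<odot> v = (\<Sum>A\<in>UNIV. slice_complex J (F A z) \<odot> (cl_basis A \<odot> (v :: ('v::banach, 'n::{finite,linorder}) cmodule)))"
proof -
  have b: "(\<chi> A. g A) = (\<Sum>A\<in>UNIV. g A *\<^sub>R cl_basis A)" for g :: "'n set \<Rightarrow> real"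
    by (simp add: vec_eq_iff cl_basis_def axis_def if_distrib cong: if_cong)
  have "f (slice_complex J z) = (\<Sum>A\<in>UNIV. Re (F A z) *\<^sub>R cl_basis A + Im (F A z) *\<^sub>R (J \<odot> cl_basis A))"
    using assms unfolding slice_rep_def Re_vec_def Im_vec_def b
    by (simp add: cl_mult.sum_right cl_mult.scaleR_right sum.distrib)
  then show ?thesis
    by (simp add: cl_mult.sum_left cl_mult.add_left cl_mult.scaleR_left slice_complex_act cl_mult_assoc)
qed

lift_definition left_mult :: "'n::{finite,linorder} clifford \<Rightarrow> ('v::banach, 'n) cmodule \<Rightarrow>\<^sub>L ('v, 'n) cmodule" is cl_mult
  by (rule cl_mult.bounded_linear_right)

lemma bounded_linear_left_mult: "bounded_linear (left_mult :: 'n::{finite,linorder} clifford \<Rightarrow> ('v::banach, 'n) cmodule \<Rightarrow>\<^sub>L ('v, 'n) cmodule)"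
proof -
  obtain K where K: "K > 0" "\<And>(a :: 'n clifford) (v :: ('v, 'n) cmodule). norm (a \<odot> v) \<le> norm a * norm v * K"
    using cl_mult.pos_bounded by blast
  have "norm (left_mult a :: ('v, 'n) cmodule \<Rightarrow>\<^sub>L ('v, 'n) cmodule) \<le> norm a * K" for a :: "'n clifford"
    by (rule norm_blinfun_bound) (use K(1) K(2)[of a] in \<open>auto simp: left_mult.rep_eq mult_ac\<close>)
  then show ?thesis
    by (intro bounded_linear_intro[of _ K] blinfun_eqI) (auto simp: left_mult.rep_eq blinfun.add_left blinfun.scaleR_left cl_mult.add_left cl_mult.scaleR_left)
qed

lift_definition imult_blinfun :: "('v::banach, 'n::{finite,linorder}) cmodule \<Rightarrow>\<^sub>L ('v, 'n) cmodule" is imult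
  by (rule bounded_linear_imult)

text \<open>For negative times the path comes in along the ray at angle \<phi>, for positive times
  it goes out along the one at - \<phi>. This accounts for the minus sign of the derivative at
  \<open>- r\<close>.\<close>

lemma sector_path_derivative:
  assumes J: "J \<in> imag_units" and r: "r > 0"
  shows "sector_path \<epsilon> \<phi> J r = slice_complex J (of_real r * (of_real \<epsilon> * cis (- \<phi>)))"
    and "sector_path \<epsilon> \<phi> J (- r) = slice_complex J (of_real r * (of_real \<epsilon> * cis \<phi>))"
    and "vector_derivative (sector_path \<epsilon> \<phi> J) (at r) = slice_complex J (of_real \<epsilon> * cis (- \<phi>))"
    and "vector_derivative (sector_path \<epsilon> \<phi> J) (at (- r)) = slice_complex J (- (of_real \<epsilon> * cis \<phi>))"
proof -
  have s: "x *\<^sub>R slice_complex J c = slice_complex J (of_real x * c)" for x c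
    by (simp only: slice_complex_linear(3)[symmetric] scaleR_conv_of_real[of x c])
  have p: "sector_path \<epsilon> \<phi> J t = t *\<^sub>R slice_complex J (of_real \<epsilon> * cis (- \<phi>))" if "t > 0" for t
    using that by (simp only: sector_path_def slice_exp_eq s sgn_pos abs_of_pos) (simp add: mult_ac)
  have n: "sector_path \<epsilon> \<phi> J t = t *\<^sub>R slice_complex J (- (of_real \<epsilon> * cis \<phi>))" if "t < 0" for t
    using that by (simp only: sector_path_def slice_exp_eq s sgn_neg abs_of_neg) (simp add: mult_ac)
  show "sector_path \<epsilon> \<phi> J r = slice_complex J (of_real r * (of_real \<epsilon> * cis (- \<phi>)))"
    unfolding p[OF r] s ..
  show "sector_path \<epsilon> \<phi> J (- r) = slice_complex J (of_real r * (of_real \<epsilon> * cis \<phi>))"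
  proof -
    have "of_real (- r) * (- (of_real \<epsilon> * cis \<phi>)) = of_real r * (of_real \<epsilon> * cis \<phi>)" by simp
    then show ?thesis using n[of "- r"] r unfolding s by simp
  qed
  have d: "((\<lambda>t. t *\<^sub>R x) has_vector_derivative x) (at t)" for x :: "'a clifford" and t
    by (auto intro!: derivative_eq_intros simp: has_vector_derivative_def)
  show "vector_derivative (sector_path \<epsilon> \<phi> J) (at r) = slice_complex J (of_real \<epsilon> * cis (- \<phi>))"
    by (rule vector_derivative_at, rule has_vector_derivative_transform_within_open[OF d, where S = "{0<..}"]) (use r p in auto)
  show "vector_derivative (sector_path \<epsilon> \<phi> J) (at (- r)) = slice_complex J (- (of_real \<epsilon> * cis \<phi>))"
    by (rule vector_derivative_at, rule has_vector_derivative_transform_within_open[OF d, where S = "{..<0}"]) (use r n in auto)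
qed

context bisectorial_operator
begin

text \<open>The resolvents at \<open>z\<close> and \<open>cnj z\<close> differ by - 2 Im z times the
  complex unit applied to \<open>A z\<close>. Solving for \<open>A z\<close> makes its continuity in
  the operator norm a consequence of \<open>R_continuous\<close>; the same holds for
  \<open>B_blinfun\<close>.\<close>

definition A_blinfun :: "complex \<Rightarrow> ('v, 'n) cmodule \<Rightarrow>\<^sub>L ('v, 'n) cmodule" where
  "A_blinfun z = (1 / (2 * Im z)) *\<^sub>R (imult_blinfun o\<^sub>L (resolvent z - resolvent (cnj z)))"

definition B_blinfun :: "complex \<Rightarrow> ('v, 'n) cmodule \<Rightarrow>\<^sub>L ('v, 'n) cmodule" where
  "B_blinfun z = Re z *\<^sub>R A_blinfun z - Im z *\<^sub>R (imult_blinfun o\<^sub>L A_blinfun z) - resolvent z"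

lemma AB_blinfun:
  assumes \<phi>: "\<omega> < \<phi>" "\<phi> < pi / 2" and z: "z \<in> outside \<phi>"
  shows "A_blinfun z v = A z v" "B_blinfun z v = B z v"
proof -
  have zr: "z \<in> res" by (rule outside_res[OF \<phi> z])
  have z': "cnj z \<in> outside \<phi>" using z by (auto simp: outside_def sector_def)
  have "0 \<le> sin \<omega> * \<bar>Re z\<bar>" using \<omega>_pos \<omega>_less by (simp add: sin_ge_zero)
  then have im: "Im z \<noteq> 0" using outside_strict[OF \<omega>_pos \<phi> z] by auto
  have "resolvent z v - resolvent (cnj z) v = (- 2 * Im z) *\<^sub>R imult (A z v)"
    unfolding resolvent_apply[OF \<phi> z] resolvent_apply[OF \<phi> z'] complex_cnj_cnj cnj_A[OF zr] cnj_B[OF zr]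
    using scaleR_left_distrib[of "Im z" "Im z" "imult (A z v)"] by (simp add: cmult_def)
  moreover have "imult (- w) = - imult w" for w :: "('v, 'n) cmodule" using imult_linear(2)[of "- 1" w] by simp
  ultimately show A: "A_blinfun z v = A z v"
    using im by (simp add: A_blinfun_def blinfun.scaleR_left blinfun.diff_left imult_blinfun.rep_eq imult_linear imult_imult)
  show "B_blinfun z v = B z v"
    unfolding B_blinfun_def by (simp add: blinfun.scaleR_left blinfun.diff_left A imult_blinfun.rep_eq resolvent_apply[OF \<phi> z] cmult_def)
qed

lemma AB_continuous:
  assumes \<phi>: "\<omega> < \<phi>" "\<phi> < pi / 2"
  shows "continuous_on (outside \<phi>) A_blinfun" "continuous_on (outside \<phi>) B_blinfun"
proof -
  have c: "continuous_on (outside \<phi>) resolvent" by (rule R_continuous[OF \<phi>])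
  have c': "continuous_on (outside \<phi>) (\<lambda>z. resolvent (cnj z))"
    by (rule continuous_on_compose2[OF c]) (auto intro!: continuous_intros simp: outside_def)
  have im: "Im z \<noteq> 0" if "z \<in> outside \<phi>" for z
  proof -
    have "0 \<le> sin \<omega> * \<bar>Re z\<bar>" using \<omega>_pos \<omega>_less by (simp add: sin_ge_zero)
    then show ?thesis using outside_strict[OF \<omega>_pos \<phi> that] by auto
  qed
  show a: "continuous_on (outside \<phi>) A_blinfun"
    unfolding A_blinfun_def using im by (intro continuous_intros bounded_bilinear.continuous_on[OF bounded_bilinear_blinfun_compose] c c') auto
  show "continuous_on (outside \<phi>) B_blinfun"
    unfolding B_blinfun_def by (intro continuous_intros bounded_bilinear.continuous_on[OF bounded_bilinear_blinfun_compose] a c)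
qed

lemma sector_integral_eq:
  assumes \<phi>: "\<omega> < \<phi>" "\<phi> < \<theta>" "\<theta> < pi / 2" and J: "J \<in> imag_units"
    and f: "slice_rep \<theta> f F" and F: "\<And>A. decays (sector \<theta>) (F A)"
  shows "blinfun_apply (sector_integral \<phi> J T f) v = (\<Sum>A\<in>UNIV. \<Phi> \<phi> (F A) (cl_basis A \<odot> v))"
proof -
  have p: "0 < \<phi>" "0 < \<theta>" "\<phi> < pi / 2" using \<phi> \<omega>_pos by auto
  note D = dirs_props[OF p(1) \<phi>(2,3)]
  have sD: "of_real r * d \<in> sector \<theta>" "of_real r * d \<in> outside \<phi>" if "r > 0" "d \<in> dirs \<phi>" for r d
    using D[OF that(2)] sector_scale[OF that(1)] outside_scale[OF that(1)] by blast+
  define I where "I \<epsilon> t = op_to_blinfun (S_resolvent (sector_path \<epsilon> \<phi> J t) T \<circ>\<^sub>m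
       op_of (vector_derivative (sector_path \<epsilon> \<phi> J) (at t) \<odot> para_inverse J \<odot> f (sector_path \<epsilon> \<phi> J t)))" for \<epsilon> t
  \<comment> \<open>The integrand at \<open>z\<close>, where \<kappa> is the derivative of the path
    divided by \<open>J\<close>, read as a complex number.\<close>
  define W where "W \<kappa> z = (A_blinfun z o\<^sub>L left_mult (slice_complex J (cnj z * \<kappa>) \<odot> f (slice_complex J z)))
      - (B_blinfun z o\<^sub>L left_mult (slice_complex J \<kappa> \<odot> f (slice_complex J z)))" for \<kappa> z
  have op: "op_to_blinfun (S_resolvent (slice_complex J z) T \<circ>\<^sub>m op_of (slice_complex J c \<odot> para_inverse J \<odot> f (slice_complex J z)))
      = W (c / \<i>) z" if z: "z \<in> outside \<phi>" for z c
  proof -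
    have zr: "z \<in> res" by (rule outside_res[OF \<phi>(1) p(3) z])
    have "J = slice_complex J \<i>" by (simp add: slice_complex_def slice_point_def cl_of_real_def)
    then have pj: "para_inverse J = slice_complex J (1 / \<i>)" using para_inverse_slice_complex[OF J, of \<i>] by simp
    have e: "slice_complex J c \<odot> para_inverse J \<odot> f (slice_complex J z) = slice_complex J (c / \<i>) \<odot> f (slice_complex J z)"
      by (simp only: pj slice_complex_mult[OF J] times_divide_eq_right mult_1_right)
    have "the ((S_resolvent (slice_complex J z) T \<circ>\<^sub>m op_of (slice_complex J (c / \<i>) \<odot> f (slice_complex J z))) v) = W (c / \<i>) z v" for v
      by (simp add: op_of_def map_comp_def S_resolvent_eq[OF zr J] W_def blinfun.diff_left AB_blinfun[OF \<phi>(1) p(3) z]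
          left_mult.rep_eq cl_mult_assoc[symmetric] slice_complex_mult[OF J])
    then have "(\<lambda>v. the ((S_resolvent (slice_complex J z) T \<circ>\<^sub>m op_of (slice_complex J (c / \<i>) \<odot> f (slice_complex J z))) v)) = blinfun_apply (W (c / \<i>) z)"
      by (rule ext)
    then show ?thesis unfolding op_to_blinfun_def e by (simp add: blinfun_apply_inverse)
  qed
  have dirs: "of_real \<epsilon> * cis (- \<phi>) \<in> dirs \<phi>" "of_real \<epsilon> * cis \<phi> \<in> dirs \<phi>" if "\<epsilon> \<in> {1, - 1}" for \<epsilon> :: real
    using that by (auto simp: dirs_def)
  have Ip: "I \<epsilon> r = W ((of_real \<epsilon> * cis (- \<phi>)) / \<i>) (of_real r * (of_real \<epsilon> * cis (- \<phi>)))" if "\<epsilon> \<in> {1, - 1}" "r > 0" for \<epsilon> r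
    unfolding I_def sector_path_derivative[OF J that(2)] by (rule op[OF sD(2)[OF that(2) dirs(1)[OF that(1)]]])
  have In: "I \<epsilon> (- r) = W (- (of_real \<epsilon> * cis \<phi>) / \<i>) (of_real r * (of_real \<epsilon> * cis \<phi>))" if "\<epsilon> \<in> {1, - 1}" "r > 0" for \<epsilon> r
    unfolding I_def sector_path_derivative[OF J that(2)] by (rule op[OF sD(2)[OF that(2) dirs(2)[OF that(1)]]])
  have Wint: "(\<lambda>r. W \<kappa> (of_real r * d)) integrable_on {0<..}" if d: "d \<in> dirs \<phi>" for \<kappa> d
  proof -
    obtain C where C: "C \<ge> 0" "\<And>z v. z \<in> outside \<phi> \<Longrightarrow> norm (A z v) \<le> C / (norm z)\<^sup>2 * norm v"
      "\<And>z v. z \<in> outside \<phi> \<Longrightarrow> norm (B z v) \<le> C / norm z * norm v"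
      using bounds[OF \<phi>(1) p(3)] by blast
    obtain K where K: "K > 0" "\<And>a (v :: ('v, 'n) cmodule). norm (a \<odot> v) \<le> norm a * norm v * K" using cl_mult.pos_bounded by blast
    obtain L where L: "L > 0" "\<And>a (v :: 'n clifford). norm (a \<odot> v) \<le> norm a * norm v * L"
      using bounded_bilinear.pos_bounded[OF bounded_bilinear_cl_mult[where ?'v = real]] by blast
    obtain N where N: "N > 0" "\<And>z. z \<in> sector \<theta> \<Longrightarrow> norm (f (slice_complex J z)) \<le> N * (\<Sum>A\<in>UNIV. norm (F A z))"
      using slice_rep_norms[where 'n = 'n] f J by metis
    \<comment> \<open>\<open>C\<close> bounds \<open>A\<close> and \<open>B\<close>, whence the
      factor 2; \<open>L\<close> belongs to the product of the algebra, \<open>K\<close> to its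
      action on the module, and \<open>N\<close> bounds \<open>f\<close> by its
      coefficients.\<close>
    define M where "M = 2 * C * norm \<kappa> * L * K * N"
    have cf: "continuous_on {0<..} (\<lambda>r. f (slice_complex J (of_real r * d)))"
      by (rule slice_rep_continuous[OF f J D(1)[OF d]])
    have cs: "continuous_on S (\<lambda>r. slice_complex J (g r))" if "continuous_on S g" for S and g :: "real \<Rightarrow> complex"
      unfolding slice_complex_def slice_point_def cl_of_real_def by (intro continuous_intros that)
    have "continuous_on {0<..} (\<lambda>r. W \<kappa> (of_real r * d))"
      unfolding W_def
      by (intro continuous_on_diff bounded_bilinear.continuous_on[OF bounded_bilinear_blinfun_compose] bounded_linear.continuous_on[OF bounded_linear_left_mult]
          cl_mult.continuous_on cf cs continuous_on_compose2[OF AB_continuous(1)[OF \<phi>(1) p(3)]]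
          continuous_on_compose2[OF AB_continuous(2)[OF \<phi>(1) p(3)]] continuous_intros) (use sD d in auto)
    moreover have "(\<lambda>r. M * (\<Sum>A\<in>UNIV. norm (F A (of_real r * d)) / r)) integrable_on {0<..}"
    proof -
      have "(\<lambda>r. norm (F A (of_real r * d)) / r) integrable_on {0<..}" for A using F[of A] D[OF d] by (simp add: decays_def)
      then have "(\<lambda>r. \<Sum>A\<in>UNIV. norm (F A (of_real r * d)) / r) integrable_on {0<..}" by (intro integrable_sum) auto
      from integrable_on_cmult_left[OF this, of M] show ?thesis by simp
    qed
    moreover have "norm (W \<kappa> (of_real r * d)) \<le> M * (\<Sum>A\<in>UNIV. norm (F A (of_real r * d)) / r)" if r: "r > 0" for r
    proof (rule norm_blinfun_bound)
      let ?z = "of_real r * d" and ?S = "\<Sum>A\<in>UNIV. norm (F A (of_real r * d)) / r"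
      have S0: "0 \<le> ?S" using r by (intro sum_nonneg) auto
      show "0 \<le> M * ?S" using S0 C(1) L(1) K(1) N(1) by (simp add: M_def)
      fix v :: "('v, 'n) cmodule"
      have nz: "norm ?z = r" using r D(3)[OF d] by (simp add: norm_mult)
      have nc: "norm (cnj ?z * \<kappa>) = r * norm \<kappa>" by (simp only: norm_mult[of "cnj ?z"] complex_mod_cnj nz)
      have nf: "norm (f (slice_complex J ?z)) \<le> N * (r * ?S)"
        using N(2)[OF sD(1)[OF r d]] r by (simp add: sum_distrib_left)
      have a: "norm (slice_complex J c \<odot> f (slice_complex J ?z) \<odot> v) \<le> norm c * (N * (r * ?S)) * L * norm v * K" for c
      proof -
        have "norm (slice_complex J c \<odot> f (slice_complex J ?z)) \<le> norm c * (N * (r * ?S)) * L"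
          using L(2)[of "slice_complex J c" "f (slice_complex J ?z)"] mult_right_mono[OF mult_left_mono[OF nf, of "norm c"], of L] L(1)
          by (simp add: norm_slice_complex[OF J])
        then have "norm (slice_complex J c \<odot> f (slice_complex J ?z)) * norm v * K \<le> norm c * (N * (r * ?S)) * L * norm v * K"
          using K(1) by (intro mult_right_mono) auto
        then show ?thesis using K(2)[of "slice_complex J c \<odot> f (slice_complex J ?z)" v] by linarith
      qed
      have "norm (A ?z (slice_complex J (cnj ?z * \<kappa>) \<odot> f (slice_complex J ?z) \<odot> v)) \<le> C / r\<^sup>2 * (r * norm \<kappa> * (N * (r * ?S)) * L * norm v * K)"
        by (rule order_trans[OF C(2)[OF sD(2)[OF r d], unfolded nz] mult_left_mono[OF a[of "cnj ?z * \<kappa>", unfolded nc]]])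
          (use C(1) in simp)
      moreover have "norm (B ?z (slice_complex J \<kappa> \<odot> f (slice_complex J ?z) \<odot> v)) \<le> C / r * (norm \<kappa> * (N * (r * ?S)) * L * norm v * K)"
        by (rule order_trans[OF C(3)[OF sD(2)[OF r d], unfolded nz] mult_left_mono[OF a[of \<kappa>]]])
          (use C(1) r in simp)
      moreover have "C / r\<^sup>2 * (r * norm \<kappa> * (N * (r * ?S)) * L * norm v * K) = C * norm \<kappa> * L * K * N * ?S * norm v"
        using r by (simp add: field_simps power2_eq_square)
      moreover have "C / r * (norm \<kappa> * (N * (r * ?S)) * L * norm v * K) = C * norm \<kappa> * L * K * N * ?S * norm v"
        using r by (simp add: field_simps)
      ultimately have "norm (W \<kappa> ?z v) \<le> C * norm \<kappa> * L * K * N * ?S * norm v + C * norm \<kappa> * L * K * N * ?S * norm v"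
        unfolding W_def blinfun.diff_left blinfun_apply_blinfun_compose AB_blinfun[OF \<phi>(1) p(3) sD(2)[OF r d]] left_mult.rep_eq
        by (intro order_trans[OF norm_triangle_ineq4]) linarith
      then show "norm (W \<kappa> ?z v) \<le> M * ?S * norm v" by (simp add: M_def mult_ac)
    qed
    ultimately show ?thesis by (rule dominated_integrable_Ioi(1))
  qed
  have ev: "blinfun_apply (integral {0<..} h) v = integral {0<..} (\<lambda>r. h r v)" "(\<lambda>r. h r v) integrable_on {0<..}"
    if "h integrable_on {0<..}" for h :: "real \<Rightarrow> ('v, 'n) cmodule \<Rightarrow>\<^sub>L ('v, 'n) cmodule"
    using integral_linear[OF that blinfun.bounded_linear_left[of v]] integrable_linear[OF that blinfun.bounded_linear_left[of v]]
    by (simp_all add: o_def)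
  define G where "G A z = cmult (F A z) (resolvent z (cl_basis A \<odot> v))" for A z
  have Gi: "ray_integrable d (G A)" if "d \<in> dirs \<phi>" for d A
    unfolding G_def by (rule dirs_integrable[OF F \<phi> that])
  have pair: "W ((of_real \<epsilon> * cis (- \<phi>)) / \<i>) (of_real r * (of_real \<epsilon> * cis (- \<phi>))) v + W (- (of_real \<epsilon> * cis \<phi>) / \<i>) (of_real r * (of_real \<epsilon> * cis \<phi>)) v
      = (\<Sum>A\<in>UNIV. cmult ((of_real \<epsilon> * cis (- \<phi>)) / \<i>) (G A (of_real r * (of_real \<epsilon> * cis (- \<phi>))))
          + cmult (- (of_real \<epsilon> * cis \<phi>) / \<i>) (G A (of_real r * (of_real \<epsilon> * cis \<phi>))))"
    if \<epsilon>: "\<epsilon> \<in> {1, - 1}" and r: "r > 0" for \<epsilon> r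
  proof -
    define z where "z = of_real r * (of_real \<epsilon> * cis (- \<phi>))"
    define \<kappa> where "\<kappa> = (of_real \<epsilon> * cis (- \<phi>)) / \<i>"
    have z': "of_real r * (of_real \<epsilon> * cis \<phi>) = cnj z" by (simp add: z_def cis_cnj)
    have \<kappa>': "- (of_real \<epsilon> * cis \<phi>) / \<i> = cnj \<kappa>" by (simp add: \<kappa>_def cis_cnj)
    have z: "z \<in> sector \<theta>" "z \<in> outside \<phi>" using sD[OF r dirs(1)[OF \<epsilon>]] by (simp_all add: z_def)
    have zc: "cnj z \<in> sector \<theta>" "cnj z \<in> outside \<phi>" using sD[OF r dirs(2)[OF \<epsilon>]] by (simp_all only: z')
    have zr: "z \<in> res" by (rule outside_res[OF \<phi>(1) p(3) z(2)])
    have zr': "cnj z \<in> res" using zr by simp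
    interpret bA: bounded_linear "A z" by (rule A_right_linear(3)[OF zr])
    interpret bB: bounded_linear "B z" by (rule bounded_linear_B[OF \<phi>(1) p(3) z(2)])
    have Fc: "F A (cnj z) = cnj (F A z)" for A using f z(1) by (simp add: slice_rep_def)
    have Wz: "W \<kappa> w v = (\<Sum>k\<in>UNIV. A z (slice_complex J (cnj w * \<kappa> * F k w) \<odot> (cl_basis k \<odot> v)) - B z (slice_complex J (\<kappa> * F k w) \<odot> (cl_basis k \<odot> v)))"
      if w: "w \<in> sector \<theta>" "w \<in> outside \<phi>" and e: "\<And>u. A w u = A z u" "\<And>u. B w u = B z u" for w \<kappa>
    proof -
      have "slice_complex J c \<odot> f (slice_complex J w) \<odot> v = (\<Sum>k\<in>UNIV. slice_complex J (c * F k w) \<odot> (cl_basis k \<odot> v))" for c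
        unfolding cl_mult_assoc slice_rep_basis[OF f w(1) J] cl_mult.sum_right
        by (simp add: cl_mult_assoc[symmetric] slice_complex_mult[OF J])
      then show ?thesis
        unfolding W_def blinfun.diff_left blinfun_apply_blinfun_compose AB_blinfun[OF \<phi>(1) p(3) w(2)] left_mult.rep_eq e
        by (simp add: bA.sum bB.sum sum_subtractf)
    qed
    \<comment> \<open>With \<open>c = \<kappa> * F k z\<close>, the coefficients at
      \<open>cnj z\<close> are the conjugates of those at \<open>z\<close>, while \<open>A\<close>
      and \<open>B\<close> agree there. Each operator thus meets \<open>a\<close> plus
      \<open>cnj a\<close>, which is \<open>2 * Re a\<close>, and it is irrelevant whether
      \<open>a\<close> acts from the left through \<open>J\<close> or by
      \<open>cmult\<close>.\<close>
    have tm: "A z (slice_complex J (cnj z * \<kappa> * F k z) \<odot> u) - B z (slice_complex J (\<kappa> * F k z) \<odot> u)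
       + (A z (slice_complex J (cnj (cnj z) * cnj \<kappa> * F k (cnj z)) \<odot> u) - B z (slice_complex J (cnj \<kappa> * F k (cnj z)) \<odot> u))
       = cmult \<kappa> (cmult (F k z) (resolvent z u)) + cmult (cnj \<kappa>) (cmult (F k (cnj z)) (resolvent (cnj z) u))" for k u
    proof -
      define c where "c = \<kappa> * F k z"
      have k: "cnj \<kappa> * F k (cnj z) = cnj c" "cnj z * \<kappa> * F k z = cnj z * c" "cnj (cnj z) * cnj \<kappa> * F k (cnj z) = cnj (cnj z * c)"
        by (simp_all add: c_def Fc)
      have sp: "slice_complex J a \<odot> u + slice_complex J (cnj a) \<odot> u = (2 * Re a) *\<^sub>R u" for a
        unfolding slice_complex_act using scaleR_left_distrib[of "Re a" "Re a" u] by simp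
      have cm: "cmult a u + cmult (cnj a) u = (2 * Re a) *\<^sub>R u" for a u
        unfolding cmult_def using scaleR_left_distrib[of "Re a" "Re a" u] by simp
      have "A z (slice_complex J (cnj z * c) \<odot> u) - B z (slice_complex J c \<odot> u) + (A z (slice_complex J (cnj (cnj z * c)) \<odot> u) - B z (slice_complex J (cnj c) \<odot> u))
        = A z (slice_complex J (cnj z * c) \<odot> u + slice_complex J (cnj (cnj z * c)) \<odot> u) - B z (slice_complex J c \<odot> u + slice_complex J (cnj c) \<odot> u)"
        by (simp add: bA.add bB.add)
      also have "\<dots> = (2 * Re (cnj z * c)) *\<^sub>R A z u - (2 * Re c) *\<^sub>R B z u"
        unfolding sp by (simp only: bA.scaleR bB.scaleR)
      also have "\<dots> = (cmult (cnj z * c) (A z u) + cmult (cnj (cnj z * c)) (A z u)) - (cmult c (B z u) + cmult (cnj c) (B z u))"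
        unfolding cm ..
      also have "\<dots> = cmult c (resolvent z u) + cmult (cnj c) (resolvent (cnj z) u)"
        unfolding resolvent_apply[OF \<phi>(1) p(3) z(2)] resolvent_apply[OF \<phi>(1) p(3) zc(2)] cnj_A[OF zr] cnj_B[OF zr]
        by (simp add: cmult.diff_right cmult.cs_assoc cmult.cs_commute[of z "cnj c"] cmult.cs_commute[of "cnj z" c])
      finally show ?thesis unfolding k cmult.cs_assoc[symmetric] by (simp only: c_def[symmetric] k)
    qed
    show ?thesis
      unfolding z' \<kappa>' z_def[symmetric] \<kappa>_def[symmetric] Wz[OF z refl refl] Wz[OF zc cnj_A[OF zr] cnj_B[OF zr]] G_def
      unfolding sum.distrib[symmetric] tm ..
  qed
  have eps: "blinfun_apply (integral UNIV (I \<epsilon>)) v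
      = (\<Sum>A\<in>UNIV. cmult (1 / \<i>) (ray (of_real \<epsilon> * cis (- \<phi>)) (G A) - ray (of_real \<epsilon> * cis \<phi>) (G A)))" if \<epsilon>: "\<epsilon> \<in> {1, - 1}" for \<epsilon>
  proof -
    let ?m = "of_real \<epsilon> * cis (- \<phi>)" and ?p = "of_real \<epsilon> * cis \<phi>"
    have i1: "(\<lambda>r. I \<epsilon> r) integrable_on {0<..}"
      by (rule integrable_eq[OF Wint[OF dirs(1)[OF \<epsilon>], of "?m / \<i>"]]) (use Ip[OF \<epsilon>] in auto)
    have i2: "(\<lambda>r. I \<epsilon> (- r)) integrable_on {0<..}"
      by (rule integrable_eq[OF Wint[OF dirs(2)[OF \<epsilon>], of "- ?p / \<i>"]]) (use In[OF \<epsilon>] in auto)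
    have gi: "(\<lambda>r. cmult c (G A (of_real r * d))) integrable_on {0<..}" "integral {0<..} (\<lambda>r. cmult c (G A (of_real r * d))) = cmult c (integral {0<..} (\<lambda>r. G A (of_real r * d)))"
      if "d \<in> dirs \<phi>" for d A c
      using integrable_linear[OF Gi[OF that, unfolded ray_integrable_def] cmult.bounded_linear_right[of c]]
        integral_linear[OF Gi[OF that, unfolded ray_integrable_def] cmult.bounded_linear_right[of c]] by (simp_all add: o_def)
    have "blinfun_apply (integral UNIV (I \<epsilon>)) v = integral {0<..} (\<lambda>r. I \<epsilon> r v) + integral {0<..} (\<lambda>r. I \<epsilon> (- r) v)"
      unfolding integral_UNIV_split[OF i1 i2] blinfun.add_left ev(1)[OF i1] ev(1)[OF i2] ..
    also have "\<dots> = integral {0<..} (\<lambda>r. I \<epsilon> r v + I \<epsilon> (- r) v)"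
      by (rule integral_add[symmetric, OF ev(2)[OF i1] ev(2)[OF i2]])
    also have "\<dots> = integral {0<..} (\<lambda>r. \<Sum>A\<in>UNIV. cmult (?m / \<i>) (G A (of_real r * ?m)) + cmult (- ?p / \<i>) (G A (of_real r * ?p)))"
      by (rule integral_cong) (use Ip[OF \<epsilon>] In[OF \<epsilon>] pair[OF \<epsilon>] in simp)
    also have "\<dots> = (\<Sum>A\<in>UNIV. integral {0<..} (\<lambda>r. cmult (?m / \<i>) (G A (of_real r * ?m)) + cmult (- ?p / \<i>) (G A (of_real r * ?p))))"
      by (rule integral_sum) (rule finite, rule integrable_add[OF gi(1)[OF dirs(1)[OF \<epsilon>]] gi(1)[OF dirs(2)[OF \<epsilon>]]])
    also have "\<dots> = (\<Sum>A\<in>UNIV. cmult (1 / \<i>) (ray ?m (G A) - ray ?p (G A)))"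
    proof (rule sum.cong[OF refl])
      fix A
      have e: "?m / \<i> = (1 / \<i>) * ?m" "- ?p / \<i> = - ((1 / \<i>) * ?p)" by simp_all
      have "integral {0<..} (\<lambda>r. cmult (?m / \<i>) (G A (of_real r * ?m)) + cmult (- ?p / \<i>) (G A (of_real r * ?p)))
        = cmult (?m / \<i>) (integral {0<..} (\<lambda>r. G A (of_real r * ?m))) + cmult (- ?p / \<i>) (integral {0<..} (\<lambda>r. G A (of_real r * ?p)))"
        by (subst integral_add[OF gi(1)[OF dirs(1)[OF \<epsilon>]] gi(1)[OF dirs(2)[OF \<epsilon>]]]) (simp only: gi(2)[OF dirs(1)[OF \<epsilon>]] gi(2)[OF dirs(2)[OF \<epsilon>]])
      then show "integral {0<..} (\<lambda>r. cmult (?m / \<i>) (G A (of_real r * ?m)) + cmult (- ?p / \<i>) (G A (of_real r * ?p)))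
        = cmult (1 / \<i>) (ray ?m (G A) - ray ?p (G A))"
        unfolding e by (simp only: ray_def cmult.diff_right cmult.minus_left cmult.cs_assoc add_uminus_conv_diff)
    qed
    finally show ?thesis .
  qed
  have "blinfun_apply (sector_integral \<phi> J T f) v = (1 / (2 * pi)) *\<^sub>R (\<Sum>\<epsilon>\<in>{1, - 1}. blinfun_apply (integral UNIV (I \<epsilon>)) v)"
    unfolding sector_integral_def I_def[symmetric] by (simp add: blinfun.scaleR_left blinfun.add_left)
  also have "(\<Sum>\<epsilon>\<in>{1, - 1}. blinfun_apply (integral UNIV (I \<epsilon>)) v) = (\<Sum>A\<in>UNIV. cmult (1 / \<i>) (ring \<phi> (G A)))"
  proof -
    have "(\<Sum>\<epsilon>\<in>{1, - 1}. blinfun_apply (integral UNIV (I \<epsilon>)) v) = blinfun_apply (integral UNIV (I 1)) v + blinfun_apply (integral UNIV (I (- 1))) v" by simp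
    also have "\<dots> = (\<Sum>A\<in>UNIV. cmult (1 / \<i>) (ring \<phi> (G A)))"
      using eps[of 1] eps[of "- 1"] by (simp add: sum.distrib[symmetric] ring_def cmult.add_right[symmetric] algebra_simps)
    finally show ?thesis .
  qed
  also have "(1 / (2 * pi)) *\<^sub>R (\<Sum>A\<in>UNIV. cmult (1 / \<i>) (ring \<phi> (G A))) = (\<Sum>A\<in>UNIV. \<Phi> \<phi> (F A) (cl_basis A \<odot> v))"
  proof -
    \<comment> \<open>The factor \<i> in the complex normalization is the division by
      \<open>J\<close> in the Clifford measure.\<close>
    have e: "(1 / (2 * pi)) *\<^sub>R (1 / \<i>) = 1 / (2 * of_real pi * \<i>)"
      by (simp only: scaleR_conv_of_real of_real_divide of_real_mult of_real_numeral of_real_1 times_divide_times_eq mult_1_left)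
    have "(1 / (2 * pi)) *\<^sub>R cmult (1 / \<i>) x = cmult (1 / (2 * of_real pi * \<i>)) x" for x :: "('v, 'n) cmodule"
      by (simp only: cmult.scaleR_left[symmetric] e)
    then show ?thesis by (simp only: scaleR_sum_right \<Phi>_def G_def[abs_def])
  qed
  finally show ?thesis .
qed

end


section \<open>The extended function classes: uniqueness of components and products\<close>

text \<open>One coefficient of an element of \<open>SH_bnd\<close>. The value \<open>a\<close> at
  infinity comes first here, whereas \<open>bnd_decomposition\<close> starts with the value at
  0.\<close>

definition bnd_fun :: "real \<Rightarrow> real \<Rightarrow> (complex \<Rightarrow> complex) \<Rightarrow> complex \<Rightarrow> complex" where
  "bnd_fun a b H z = of_real a + of_real (b - a) * (1 / (1 + z\<^sup>2)) + H z"

text \<open>A lower bound \<open>m\<close> forces at least \<open>m * ln 2\<close> on every block,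
  which contradicts the limit 0. In this way integrability against \<open>dr / r\<close> excludes
  nonzero limits at 0 and infinity.\<close>

lemma dyadic_lower_bound:
  fixes g :: "real \<Rightarrow> real"
  assumes lim: "(\<lambda>n. integral {a n..2 * a n} (\<lambda>r. g r / r)) \<longlonglongrightarrow> 0"
    and int: "\<And>n. (\<lambda>r. g r / r) integrable_on {a n..2 * a n}" and a: "\<And>n. 0 < a n" and m: "m > 0"
    and le: "\<And>n r. n \<ge> N \<Longrightarrow> r \<in> {a n..2 * a n} \<Longrightarrow> m \<le> g r"
  shows False
proof -
  have "m * ln 2 \<le> integral {a n..2 * a n} (\<lambda>r. g r / r)" if n: "n \<ge> N" for n
  proof -
    have i: "((\<lambda>r. m * (1 / r)) has_integral m * ln 2) {a n..2 * a n}"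
      by (rule has_integral_mult_right[OF integral_inverse_dyadic[OF a]])
    have "m * (1 / r) \<le> g r / r" if "r \<in> {a n..2 * a n}" for r
      using le[OF n that] that a[of n] by (simp add: divide_right_mono)
    then show ?thesis using has_integral_le[OF i integrable_integral[OF int[of n]]] by blast
  qed
  then have "m * ln 2 \<le> 0"
    by (intro tendsto_lowerbound[OF lim]) (auto intro!: exI[of _ N] simp: eventually_sequentially)
  then show False using m by (simp add: mult_le_0_iff)
qed

text \<open>On the positive axis \<open>H\<close> would be the negative of
  \<open>a + (b - a) / (1 + r\<^sup>2)\<close>, which tends to \<open>a\<close> at infinity and to
  \<open>b\<close> at 0; decay permits only the limit 0.\<close>

lemma bnd_fun_zero:
  assumes \<theta>: "0 < \<theta>" "\<theta> < pi / 2" and H: "decays (sector \<theta>) H"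
    and eq: "\<And>z. z \<in> sector \<theta> \<Longrightarrow> bnd_fun a b H z = 0"
  shows "a = 0" "b = 0"
proof -
  have 1: "1 \<in> sector \<theta>" using \<theta> by (auto simp: sector_def intro!: sin_gt_zero)
  define g where "g r = norm (H (of_real r))" for r
  have "norm (1 :: complex) = 1 \<longrightarrow> (\<lambda>r. norm (H (of_real r * 1)) / r) integrable_on {0<..}"
    using H 1 unfolding decays_def by blast
  then have int: "(\<lambda>r. g r / r) integrable_on {0<..}" by (simp add: g_def)
  have sub: "(\<lambda>r. g r / r) integrable_on {x..y}" if "0 < x" for x y
    using int by (rule integrable_on_subinterval) (use that in auto)
  have g: "g r = \<bar>a + (b - a) * (1 / (1 + r\<^sup>2))\<bar>" if "r > 0" for r
  proof -
    have "of_real r \<in> sector \<theta>" using sector_scale[OF that, of 1] 1 by simp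
    from eq[OF this] have "H (of_real r) = - of_real (a + (b - a) * (1 / (1 + r\<^sup>2)))"
      by (simp add: bnd_fun_def add_eq_0_iff)
    then show ?thesis unfolding g_def by (simp only: norm_minus_cancel norm_of_real)
  qed
  show "a = 0"
  proof (rule ccontr)
    assume a0: "a \<noteq> 0"
    \<comment> \<open>Makes the second term at most \<open>\<bar>a\<bar> / 2\<close> for
      \<open>r\<close> beyond \<open>N\<close>, since \<open>r \<le> 1 + r\<^sup>2\<close>.\<close>
    obtain N where N: "2 * \<bar>b - a\<bar> / \<bar>a\<bar> < real N" using reals_Archimedean2 by blast
    show False
    proof (rule dyadic_lower_bound[where g = g and a = "\<lambda>n. real (Suc n)" and m = "\<bar>a\<bar> / 2" and N = N])
      show "(\<lambda>n. integral {real (Suc n)..2 * real (Suc n)} (\<lambda>r. g r / r)) \<longlonglongrightarrow> 0"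
        by (rule dyadic_tendsto_0(1)[OF int]) (simp add: g_def)
      fix n r assume n: "N \<le> n" and r: "r \<in> {real (Suc n)..2 * real (Suc n)}"
      have r1: "r > 0" "real N \<le> r" "1 \<le> r" using n r by auto
      have "2 * \<bar>b - a\<bar> \<le> \<bar>a\<bar> * r" using N r1(2) a0 by (simp add: field_simps) (smt (verit) mult_left_mono abs_ge_zero mult.commute)
      moreover have "r \<le> 1 + r\<^sup>2" using self_le_power[OF r1(3), of 2] by simp
      ultimately have "2 * \<bar>b - a\<bar> \<le> \<bar>a\<bar> * (1 + r\<^sup>2)" by (meson abs_ge_zero mult_left_mono order_trans)
      then have "\<bar>b - a\<bar> * (1 / (1 + r\<^sup>2)) \<le> \<bar>a\<bar> / 2" by (simp add: field_simps add_pos_nonneg)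
      moreover have "\<bar>(b - a) * (1 / (1 + r\<^sup>2))\<bar> = \<bar>b - a\<bar> * (1 / (1 + r\<^sup>2))" by (simp add: abs_mult)
      ultimately show "\<bar>a\<bar> / 2 \<le> g r" unfolding g[OF r1(1)] by linarith
    qed (use a0 sub in auto)
  qed
  show "b = 0"
  proof (rule ccontr)
    assume b0: "b \<noteq> 0"
    \<comment> \<open>Near 0 the expression is
      \<open>b - (b - a) * (r\<^sup>2 / (1 + r\<^sup>2))\<close>; the last fraction is at most
      \<open>r\<close>, and on the blocks \<open>r\<close> is at most
      \<open>1 / real (Suc n)\<close>.\<close>
    obtain N where N: "2 * \<bar>b - a\<bar> / \<bar>b\<bar> < real N" using reals_Archimedean2 by blast
    show False
    proof (rule dyadic_lower_bound[where g = g and a = "\<lambda>n. 1 / (2 * real (Suc n))" and m = "\<bar>b\<bar> / 2" and N = N])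
      have e: "2 * (1 / (2 * real (Suc n))) = 1 / real (Suc n)" for n by (simp add: field_simps)
      show "(\<lambda>n. integral {1 / (2 * real (Suc n))..2 * (1 / (2 * real (Suc n)))} (\<lambda>r. g r / r)) \<longlonglongrightarrow> 0"
        unfolding e by (rule dyadic_tendsto_0(2)[OF int]) (simp add: g_def)
      fix n r assume n: "N \<le> n" and r: "r \<in> {1 / (2 * real (Suc n))..2 * (1 / (2 * real (Suc n)))}"
      have r0: "r > 0" using r by (auto intro: less_le_trans[of 0 "1 / (2 * real (Suc n))"])
      have r1: "r * real (Suc n) \<le> 1" using r unfolding e by (simp add: field_simps del: of_nat_Suc)
      have "r * 1 \<le> r * real (Suc n)" using r0 by (intro mult_left_mono) auto
      then have rle: "r \<le> 1" using r1 by linarith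
      have "2 * \<bar>b - a\<bar> \<le> \<bar>b\<bar> * real (Suc n)"
      proof -
        have "2 * \<bar>b - a\<bar> \<le> real N * \<bar>b\<bar>" using N b0 by (simp add: field_simps)
        also have "\<dots> \<le> real (Suc n) * \<bar>b\<bar>" using n by (intro mult_right_mono) auto
        finally show ?thesis by (simp add: mult.commute)
      qed
      then have "2 * \<bar>b - a\<bar> * r \<le> \<bar>b\<bar> * real (Suc n) * r" using r0 by (intro mult_right_mono) auto
      also have "\<dots> = \<bar>b\<bar> * (r * real (Suc n))" by simp
      also have "\<dots> \<le> \<bar>b\<bar> * 1" using r1 by (intro mult_left_mono) auto
      finally have s: "\<bar>b - a\<bar> * r \<le> \<bar>b\<bar> / 2" by simp
      have p: "1 + r\<^sup>2 > 0" by (simp add: add_pos_nonneg)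
      have "r\<^sup>2 / (1 + r\<^sup>2) \<le> r"
      proof -
        have "r * r \<le> r * 1" using r0 rle by (intro mult_left_mono) auto
        moreover have "r * 1 \<le> r * (1 + r\<^sup>2)" using r0 by (intro mult_left_mono) auto
        ultimately show ?thesis using p by (simp add: divide_le_eq power2_eq_square)
      qed
      then have t: "\<bar>b - a\<bar> * (r\<^sup>2 / (1 + r\<^sup>2)) \<le> \<bar>b\<bar> / 2" using s mult_left_mono[of "r\<^sup>2 / (1 + r\<^sup>2)" r "\<bar>b - a\<bar>"] by linarith
      have q: "1 / (1 + r\<^sup>2) = 1 - r\<^sup>2 / (1 + r\<^sup>2)" using p by (simp add: field_simps)
      have "a + (b - a) * (1 / (1 + r\<^sup>2)) = b - (b - a) * (r\<^sup>2 / (1 + r\<^sup>2))"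
        by (simp only: q right_diff_distrib mult_1_right)
      moreover have "\<bar>(b - a) * (r\<^sup>2 / (1 + r\<^sup>2))\<bar> = \<bar>b - a\<bar> * (r\<^sup>2 / (1 + r\<^sup>2))" using p by (simp add: abs_mult)
      ultimately show "\<bar>b\<bar> / 2 \<le> g r" unfolding g[OF r0] using t by linarith
    qed (use b0 sub in auto)
  qed
qed

lemma slice_rep_diff:
  assumes "slice_rep \<theta> f F" "slice_rep \<theta> g G"
  shows "slice_rep \<theta> (\<lambda>s. f s - g s) (\<lambda>A z. F A z - G A z)"
proof -
  have "Re_vec (\<lambda>A z. F A z - G A z) z = Re_vec F z - Re_vec G z" "Im_vec (\<lambda>A z. F A z - G A z) z = Im_vec F z - Im_vec G z" for z
    by (simp_all add: Re_vec_def Im_vec_def vec_eq_iff)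
  then show ?thesis
    using assms unfolding slice_rep_def by (auto intro!: holomorphic_intros simp: cl_mult.diff_right)
qed

lemma slice_rep_unique:
  assumes "slice_rep \<theta> f F" "slice_rep \<theta> f G" "z \<in> sector \<theta>" shows "F A z = G A z"
proof -
  obtain K where "norm (F A z - G A z) \<le> K * (norm (f (slice_complex basis_unit z) - f (slice_complex basis_unit z))
      + norm (f (slice_complex basis_unit (cnj z)) - f (slice_complex basis_unit (cnj z))))"
    using slice_rep_norms slice_rep_diff[OF assms(1,2)] assms(3) basis_unit by meson
  then show ?thesis by simp
qed

lemma slice_rep_cong:
  assumes \<theta>: "0 < \<theta>" "\<theta> < pi / 2" and f: "slice_rep \<theta> f F"
    and fg: "\<And>s. s \<in> double_sector \<theta> \<Longrightarrow> f s = g s" and FG: "\<And>A z. z \<in> sector \<theta> \<Longrightarrow> F A z = G A z"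
  shows "slice_rep \<theta> g G"
proof -
  have "Re_vec F z = Re_vec G z" "Im_vec F z = Im_vec G z" if "z \<in> sector \<theta>" for z
    using FG[OF that] by (simp_all add: Re_vec_def Im_vec_def)
  moreover have "G A holomorphic_on sector \<theta>" for A
    using f holomorphic_transform[of "F A" "sector \<theta>" "G A"] FG by (auto simp: slice_rep_def)
  ultimately show ?thesis
    using f FG fg[OF slice_complex_in_double_sector[OF \<theta>, THEN iffD2]] unfolding slice_rep_def
    by (metis cnj_in_sector)
qed

lemma slice_rep_bnd:
  fixes h :: "'n::{finite,linorder} clifford \<Rightarrow> 'n clifford"
  assumes \<theta>: "0 < \<theta>" "\<theta> < pi / 2" and h: "slice_rep \<theta> h H"
  shows "slice_rep \<theta> (\<lambda>s. a + para_inverse (cl_of_real 1 + s \<odot> s) \<odot> (b - a) + h s) (\<lambda>A. bnd_fun (a $ A) (b $ A) (H A))"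
  unfolding slice_rep_def
proof (intro conjI allI ballI)
  have n0: "1 + z\<^sup>2 \<noteq> 0" if z: "z \<in> sector \<theta>" for z
  proof -
    obtain c where "c > 0" "c * (1 + (norm z)\<^sup>2) \<le> norm (1 + z\<^sup>2)" using decays_z_div_1_plus_square(2)[OF \<theta>] z by blast
    moreover have "0 < c * (1 + (norm z)\<^sup>2)" using \<open>c > 0\<close> by (simp add: add_pos_nonneg)
    ultimately show ?thesis by auto
  qed
  show "bnd_fun (a $ A) (b $ A) (H A) holomorphic_on sector \<theta>" for A
    unfolding bnd_fun_def[abs_def] using n0 h by (auto simp: slice_rep_def intro!: holomorphic_intros)
  show "bnd_fun (a $ A) (b $ A) (H A) (cnj z) = cnj (bnd_fun (a $ A) (b $ A) (H A) z)" if "z \<in> sector \<theta>" for A z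
    using h that by (simp add: slice_rep_def bnd_fun_def)
  fix z J assume z: "z \<in> sector \<theta>" and J: "J \<in> (imag_units :: 'n clifford set)"
  let ?q = "1 / (1 + z\<^sup>2)"
  have r: "Re (of_real x * w) = x * Re w" "Im (of_real x * w) = x * Im w" for x w by simp_all
  have "cl_of_real 1 + slice_complex J z \<odot> slice_complex J z = slice_complex J (1 + z\<^sup>2)"
    using slice_complex_linear(4)[of J 1] by (simp add: slice_complex_mult[OF J] slice_complex_linear(1) power2_eq_square)
  then have "para_inverse (cl_of_real 1 + slice_complex J z \<odot> slice_complex J z) \<odot> (b - a) = Re ?q *\<^sub>R (b - a) + Im ?q *\<^sub>R (J \<odot> (b - a))"
    by (simp only: para_inverse_slice_complex[OF J] slice_complex_act)
  moreover have "Re_vec (\<lambda>A. bnd_fun (a $ A) (b $ A) (H A)) z = a + Re ?q *\<^sub>R (b - a) + Re_vec H z"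
    "Im_vec (\<lambda>A. bnd_fun (a $ A) (b $ A) (H A)) z = Im ?q *\<^sub>R (b - a) + Im_vec H z"
    by (simp_all only: vec_eq_iff Re_vec_def Im_vec_def bnd_fun_def vec_lambda_beta vector_add_component vector_minus_component
        vector_scaleR_component real_scaleR_def plus_complex.simps r Re_complex_of_real Im_complex_of_real add_0_left mult.commute simp_thms)
  moreover have "h (slice_complex J z) = Re_vec H z + J \<odot> Im_vec H z" using h z J by (simp add: slice_rep_def)
  ultimately show "a + para_inverse (cl_of_real 1 + slice_complex J z \<odot> slice_complex J z) \<odot> (b - a) + h (slice_complex J z)
     = Re_vec (\<lambda>A. bnd_fun (a $ A) (b $ A) (H A)) z + J \<odot> Im_vec (\<lambda>A. bnd_fun (a $ A) (b $ A) (H A)) z"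
    by (simp add: cl_mult.add_right cl_mult.scaleR_right)
qed

lemma SH0_rep:
  assumes \<theta>: "0 < \<theta>" "\<theta> < pi / 2" and h: "h \<in> SH0 \<theta>"
  obtains H where "slice_rep \<theta> h H" "\<And>A. decays (sector \<theta>) (H A)"
proof -
  obtain f0 f1 where "slice_components (double_sector \<theta>) h f0 f1" using h by (auto simp: SH0_def SH_L_def)
  from slice_components_rep[OF \<theta> this] SH0_iff_decays[OF \<theta> this[THEN slice_components_rep[OF \<theta>]]] h that show ?thesis by blast
qed

lemma bnd_rep_decomposition:
  fixes f :: "'n::{finite,linorder} clifford \<Rightarrow> 'n clifford"
  assumes \<theta>: "0 < \<theta>" "\<theta> < pi / 2" and f: "slice_rep \<theta> f (\<lambda>A. bnd_fun (a $ A) (b $ A) (H A))"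
  shows "\<exists>h. slice_rep \<theta> h H \<and> bnd_decomposition \<theta> f b a h"
proof -
  let ?k = "\<lambda>s. a + para_inverse (cl_of_real 1 + s \<odot> s) \<odot> (b - a)"
  have z: "slice_rep \<theta> (\<lambda>s :: 'n clifford. 0) (\<lambda>A z. 0)"
    by (simp add: slice_rep_def Re_vec_def Im_vec_def vec_eq_iff zero_vec_def[symmetric] cl_mult.zero_right)
  have "slice_rep \<theta> (\<lambda>s. f s - (?k s + 0)) (\<lambda>A z. bnd_fun (a $ A) (b $ A) (H A) z - bnd_fun (a $ A) (b $ A) (\<lambda>z. 0) z)"
    by (rule slice_rep_diff[OF f slice_rep_bnd[OF \<theta> z]])
  then have "slice_rep \<theta> (\<lambda>s. f s - (?k s + 0)) H"
    by (rule slice_rep_cong[OF \<theta>]) (auto simp: bnd_fun_def)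
  then show ?thesis by (intro exI[of _ "\<lambda>s. f s - (?k s + 0)"]) (auto simp: bnd_decomposition_def)
qed

lemma SH_bnd_iff:
  assumes \<theta>: "0 < \<theta>" "\<theta> < pi / 2"
  shows "f \<in> SH_bnd \<theta> \<longleftrightarrow> (\<exists>a b H. slice_rep \<theta> f (\<lambda>A. bnd_fun (a $ A) (b $ A) (H A)) \<and> (\<forall>A. decays (sector \<theta>) (H A)))"
proof
  assume "f \<in> SH_bnd \<theta>"
  then obtain b a h where h: "h \<in> SH0 \<theta>" "bnd_decomposition \<theta> f b a h" unfolding SH_bnd_def by blast
  obtain H where H: "slice_rep \<theta> h H" "\<And>A. decays (sector \<theta>) (H A)" using SH0_rep[OF \<theta> h(1)] by blast
  have "slice_rep \<theta> f (\<lambda>A. bnd_fun (a $ A) (b $ A) (H A))"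
    by (rule slice_rep_cong[OF \<theta> slice_rep_bnd[OF \<theta> H(1)]]) (use h(2) in \<open>auto simp: bnd_decomposition_def\<close>)
  then show "\<exists>a b H. slice_rep \<theta> f (\<lambda>A. bnd_fun (a $ A) (b $ A) (H A)) \<and> (\<forall>A. decays (sector \<theta>) (H A))" using H(2) by blast
next
  assume "\<exists>a b H. slice_rep \<theta> f (\<lambda>A. bnd_fun (a $ A) (b $ A) (H A)) \<and> (\<forall>A. decays (sector \<theta>) (H A))"
  then show "f \<in> SH_bnd \<theta>"
    unfolding SH_bnd_def using bnd_rep_decomposition[OF \<theta>] SH0_iff_decays[OF \<theta>] by blast
qed

text \<open>Intrinsic functions are those whose only nonzero component belongs to \<open>e\<^sub>\<emptyset> = 1\<close>.\<close>

definition scalar_family :: "(complex \<Rightarrow> complex) \<Rightarrow> 'k set \<Rightarrow> complex \<Rightarrow> complex" where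
  "scalar_family E A z = (if A = {} then E z else 0)"

lemma slice_rep_scalar:
  fixes e :: "'n::{finite,linorder} clifford \<Rightarrow> 'n clifford"
  assumes "slice_rep \<theta> e (scalar_family E)" "z \<in> sector \<theta>" "J \<in> imag_units"
  shows "e (slice_complex J z) = slice_complex J (E z)"
proof -
  have "Re_vec (scalar_family E) z = (cl_of_real (Re (E z)) :: 'n clifford)" "Im_vec (scalar_family E) z = (cl_of_real (Im (E z)) :: 'n clifford)"
    by (simp_all add: Re_vec_def Im_vec_def scalar_family_def vec_eq_iff cl_of_real_nth)
  moreover have "J \<odot> cl_of_real x = x *\<^sub>R J" for x using cl_rmult_one[of J x] by (simp add: cl_rmult_eq_cl_mult)
  ultimately show ?thesis using assms by (simp add: slice_rep_def slice_complex_def slice_point_def)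
qed

lemma intrinsic_rep:
  fixes g :: "'n::{finite,linorder} clifford \<Rightarrow> 'n clifford"
  assumes \<theta>: "0 < \<theta>" "\<theta> < pi / 2" and g: "g \<in> intrinsic (double_sector \<theta>)"
  obtains E where "slice_rep \<theta> g (scalar_family E)"
proof -
  obtain f0 f1 where c: "slice_components (double_sector \<theta>) g f0 f1"
    and r: "\<forall>p\<in>slice_domain (double_sector \<theta> :: 'n clifford set). f0 p \<in> range cl_of_real \<and> f1 p \<in> range cl_of_real"
    using g unfolding intrinsic_def by blast
  let ?F = "\<lambda>A z. Complex (f0 (Re z, Im z) $ A) (f1 (Re z, Im z) $ A)"
  have "slice_rep \<theta> g (scalar_family (?F {}))"
  proof (rule slice_rep_cong[OF \<theta> slice_components_rep[OF \<theta> c] refl])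
    fix A z assume "z \<in> sector \<theta>"
    then have "(Re z, Im z) \<in> slice_domain (double_sector \<theta> :: 'n clifford set)" by (simp add: slice_domain_sector[OF \<theta>])
    then obtain x y where "f0 (Re z, Im z) = cl_of_real x" "f1 (Re z, Im z) = cl_of_real y" using r by blast
    then show "?F A z = scalar_family (?F {}) A z" by (simp add: scalar_family_def cl_of_real_nth complex_eq_iff)
  qed
  then show ?thesis by (rule that)
qed

lemma scalar_rep_intrinsic:
  fixes e :: "'n::{finite,linorder} clifford \<Rightarrow> 'n clifford"
  assumes \<theta>: "0 < \<theta>" "\<theta> < pi / 2" and e: "slice_rep \<theta> e (scalar_family E)"
  shows "e \<in> intrinsic (double_sector \<theta>)"
proof -
  have "Re_vec (scalar_family E) z = (cl_of_real (Re (E z)) :: 'n clifford)" "Im_vec (scalar_family E) z = (cl_of_real (Im (E z)) :: 'n clifford)" for z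
    by (simp_all add: Re_vec_def Im_vec_def scalar_family_def vec_eq_iff cl_of_real_nth)
  then show ?thesis using slice_rep_components[OF \<theta> e] unfolding intrinsic_def by blast
qed

lemma scalar_family_bnd_fun:
  "scalar_family (bnd_fun \<alpha> \<beta> E) = (\<lambda>A. bnd_fun (cl_of_real \<alpha> $ A) (cl_of_real \<beta> $ A) (scalar_family E A))"
  by (auto simp: fun_eq_iff scalar_family_def bnd_fun_def cl_of_real_nth)

lemma N_bnd_iff:
  fixes e :: "'n::{finite,linorder} clifford \<Rightarrow> 'n clifford"
  assumes \<theta>: "0 < \<theta>" "\<theta> < pi / 2"
  shows "e \<in> N_bnd \<theta> \<longleftrightarrow> (\<exists>\<alpha> \<beta> E. slice_rep \<theta> e (scalar_family (bnd_fun \<alpha> \<beta> E)) \<and> decays (sector \<theta>) E)"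
proof
  assume "e \<in> N_bnd \<theta>"
  then obtain \<alpha> \<beta> h where h: "h \<in> N0 \<theta>" "bnd_decomposition \<theta> e (cl_of_real \<beta>) (cl_of_real \<alpha>) h" unfolding N_bnd_def by blast
  obtain E where E: "slice_rep \<theta> h (scalar_family E)" using intrinsic_rep[OF \<theta>] h(1) unfolding N0_def by blast
  have "decays (sector \<theta>) (scalar_family E ({} :: 'n set))" using SH0_iff_decays[OF \<theta> E] h(1) unfolding N0_def by blast
  then have "decays (sector \<theta>) E" by (simp add: scalar_family_def[abs_def])
  moreover have "slice_rep \<theta> e (scalar_family (bnd_fun \<alpha> \<beta> E))"
    unfolding scalar_family_bnd_fun
    by (rule slice_rep_cong[OF \<theta> slice_rep_bnd[OF \<theta> E]]) (use h(2) in \<open>auto simp: bnd_decomposition_def\<close>)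
  ultimately show "\<exists>\<alpha> \<beta> E. slice_rep \<theta> e (scalar_family (bnd_fun \<alpha> \<beta> E)) \<and> decays (sector \<theta>) E" by blast
next
  assume "\<exists>\<alpha> \<beta> E. slice_rep \<theta> e (scalar_family (bnd_fun \<alpha> \<beta> E)) \<and> decays (sector \<theta>) E"
  then obtain \<alpha> \<beta> E where e: "slice_rep \<theta> e (scalar_family (bnd_fun \<alpha> \<beta> E))" and E: "decays (sector \<theta>) E" by blast
  obtain h where h: "slice_rep \<theta> h (scalar_family E)" "bnd_decomposition \<theta> e (cl_of_real \<beta>) (cl_of_real \<alpha>) h"
    using bnd_rep_decomposition[OF \<theta> e[unfolded scalar_family_bnd_fun]] by blast
  have "decays (sector \<theta>) (scalar_family E A)" for A :: "'n set"
    using E decays_cmult[OF conical_sector E, of 0] by (cases "A = {}") (simp_all add: scalar_family_def[abs_def])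
  then have "h \<in> N0 \<theta>" using SH0_iff_decays[OF \<theta> h(1)] scalar_rep_intrinsic[OF \<theta> h(1)] by (simp add: N0_def)
  then show "e \<in> N_bnd \<theta>" using h(2) unfolding N_bnd_def by blast
qed

text \<open>An intrinsic function takes values in C_J on the slice of \<open>J\<close>, so
  multiplying by it from the left multiplies every coefficient function by the same
  \<open>E z\<close>.\<close>

lemma slice_rep_mult:
  fixes f :: "'n::{finite,linorder} clifford \<Rightarrow> 'n clifford"
  assumes e: "slice_rep \<theta> e (scalar_family E)" and f: "slice_rep \<theta> f F"
  shows "slice_rep \<theta> (\<lambda>s. e s \<odot> f s) (\<lambda>A z. E z * F A z)"
  unfolding slice_rep_def
proof (intro conjI allI ballI)
  have "scalar_family E ({} :: 'n set) holomorphic_on sector \<theta>" using e by (simp add: slice_rep_def)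
  then have hE: "E holomorphic_on sector \<theta>" by (simp add: scalar_family_def[abs_def])
  show "(\<lambda>z. E z * F A z) holomorphic_on sector \<theta>" for A
    using f by (intro holomorphic_intros hE) (simp add: slice_rep_def)
  have cE: "E (cnj z) = cnj (E z)" if "z \<in> sector \<theta>" for z
  proof -
    have "scalar_family E ({} :: 'n set) (cnj z) = cnj (scalar_family E ({} :: 'n set) z)" using e that unfolding slice_rep_def by blast
    then show ?thesis by (simp add: scalar_family_def)
  qed
  show "E (cnj z) * F A (cnj z) = cnj (E z * F A z)" if "z \<in> sector \<theta>" for z A
    using f cE[OF that] that by (simp add: slice_rep_def)
  fix z J assume z: "z \<in> sector \<theta>" and J: "J \<in> (imag_units :: 'n clifford set)"
  have m: "Re_vec (\<lambda>A z. E z * F A z) z = Re (E z) *\<^sub>R Re_vec F z - Im (E z) *\<^sub>R Im_vec F z"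
    "Im_vec (\<lambda>A z. E z * F A z) z = Re (E z) *\<^sub>R Im_vec F z + Im (E z) *\<^sub>R Re_vec F z"
    by (simp_all add: Re_vec_def Im_vec_def vec_eq_iff)
  have "f (slice_complex J z) = Re_vec F z + J \<odot> Im_vec F z" using f z J by (simp add: slice_rep_def)
  then show "e (slice_complex J z) \<odot> f (slice_complex J z) = Re_vec (\<lambda>A z. E z * F A z) z + J \<odot> Im_vec (\<lambda>A z. E z * F A z) z"
    unfolding slice_rep_scalar[OF e z J] slice_complex_act m
    by (simp add: cl_mult.add_right cl_mult.scaleR_right imag_unit_act[OF J] algebra_simps)
qed

text \<open>The counterpart of \<open>\<Psi>_product\<close> for functions, resting on the same
  identity q^2 = q - (z q)^2.\<close>

lemma (in sectorial_resolvent) bnd_fun_mult: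
  assumes "0 < \<theta>" "\<theta> < pi / 2" "z \<in> sector \<theta>"
  shows "bnd_fun \<alpha> \<beta> E z * bnd_fun a b H z
    = bnd_fun (\<alpha> * a) (\<beta> * b) (\<Psi>_rest (of_real \<alpha>) (of_real \<beta>) E (of_real a) (of_real b) H) z"
proof -
  obtain c where "c > 0" "c * (1 + (norm z)\<^sup>2) \<le> norm (1 + z\<^sup>2)" using decays_z_div_1_plus_square(2)[OF assms(1,2)] assms(3) by blast
  moreover have "0 < c * (1 + (norm z)\<^sup>2)" using \<open>c > 0\<close> by (simp add: add_pos_nonneg)
  ultimately have n: "1 + z\<^sup>2 \<noteq> 0" by auto
  define q where "q = 1 / (1 + z\<^sup>2)"
  have zq: "z / (1 + z\<^sup>2) * (z / (1 + z\<^sup>2)) = q - q * q" unfolding q_def using n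
    by (simp add: divide_simps) (simp add: power2_eq_square algebra_simps)
  have "(a + (b - a) * q + e) * (a' + (b' - a') * q + h) = a * a' + (b * b' - a * a') * q
      + (a * h + ((b - a) * (q * h) + (a' * e + ((b' - a') * (q * e) + (e * h + (- ((b - a) * (b' - a'))) * (q - q * q))))))"
    for a b a' b' e h :: complex by (simp add: algebra_simps)
  then show ?thesis
    unfolding bnd_fun_def \<Psi>_rest_def zq q_def[symmetric] of_real_diff of_real_mult .
qed


section \<open>Multiplicativity for the operator T, regularizers and the product rule\<close>

lemma cl_mult_expand:
  fixes a :: "'n::{finite,linorder} clifford" and v :: "('v::real_normed_vector, 'n) cmodule"
  shows "a \<odot> v = (\<Sum>A\<in>UNIV. a $ A *\<^sub>R (cl_basis A \<odot> v))"
proof -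
  have "(\<Sum>A\<in>UNIV. a $ A *\<^sub>R cl_basis A) = a"
    using basis_expansion[of a] by (simp add: scalar_mult_eq_scaleR cl_basis_def)
  from arg_cong[OF this[symmetric], of "\<lambda>x. x \<odot> v"] show ?thesis
    by (simp only: cl_mult.sum_left cl_mult.scaleR_left)
qed

lemma bnd_fun_diff:
  "bnd_fun (a - a') (b - b') (\<lambda>z. H z + - 1 * H' z) z = bnd_fun a b H z - bnd_fun a' b' H' z"
proof -
  define q where "q = 1 / (1 + z\<^sup>2)"
  show ?thesis unfolding bnd_fun_def q_def[symmetric] by (simp add: algebra_simps)
qed

text \<open>Ensures that whichever decomposition \<open>bnd_calculus\<close> selects leads to the
  same operator.\<close>

lemma bnd_fun_unique:
  fixes f :: "'n::{finite,linorder} clifford \<Rightarrow> 'n clifford"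
  assumes \<theta>: "0 < \<theta>" "\<theta> < pi / 2"
    and f: "slice_rep \<theta> f (\<lambda>A. bnd_fun (a $ A) (b $ A) (H A))" and H: "\<And>A. decays (sector \<theta>) (H A)"
    and f': "slice_rep \<theta> f (\<lambda>A. bnd_fun (a' $ A) (b' $ A) (H' A))" and H': "\<And>A. decays (sector \<theta>) (H' A)"
  shows "a = a'" "b = b'" "z \<in> sector \<theta> \<Longrightarrow> H A z = H' A z"
proof -
  have e: "bnd_fun (a $ A) (b $ A) (H A) z = bnd_fun (a' $ A) (b' $ A) (H' A) z" if "z \<in> sector \<theta>" for A z
    by (rule slice_rep_unique[OF f f' that])
  have d: "decays (sector \<theta>) (\<lambda>z. H A z + - 1 * H' A z)" for A
    by (rule decays_add[OF conical_sector H decays_cmult[OF conical_sector H']])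
  have z: "bnd_fun (a $ A - a' $ A) (b $ A - b' $ A) (\<lambda>z. H A z + - 1 * H' A z) z = 0" if "z \<in> sector \<theta>" for A z
    unfolding bnd_fun_diff e[OF that] by simp
  have "a $ A - a' $ A = 0" for A by (rule bnd_fun_zero(1)[OF \<theta> d[of A]]) (rule z)
  then show a: "a = a'" by (simp add: vec_eq_iff)
  have "b $ A - b' $ A = 0" for A by (rule bnd_fun_zero(2)[OF \<theta> d[of A]]) (rule z)
  then show b: "b = b'" by (simp add: vec_eq_iff)
  show "z \<in> sector \<theta> \<Longrightarrow> H A z = H' A z" using e[of z A] unfolding a b bnd_fun_def by simp
qed

lemma decays_scalar_family: "decays (sector \<theta>) E \<Longrightarrow> decays (sector \<theta>) (scalar_family E A)"
  using decays_cmult[OF conical_sector, of \<theta> E 0] by (cases "A = {}") (simp_all add: scalar_family_def[abs_def])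

lemma op_inverse_eq_Some_iff:
  assumes "op_injective A" shows "op_inverse A v = Some w \<longleftrightarrow> A w = Some v"
proof
  assume w: "op_inverse A v = Some w"
  then have "v \<in> ran A" by (auto simp: op_inverse_def split: if_splits)
  then obtain w' where w': "A w' = Some v" by (auto simp: ran_def)
  with op_inverse_eq_Some[OF assms w'] w show "A w = Some v" by simp
qed (rule op_inverse_eq_Some[OF assms])

text \<open>On the slice through \<open>s\<close> both functions take values in the same commutative
  field C_J.\<close>

lemma intrinsic_left_commute:
  fixes e g :: "'n::{finite,linorder} clifford \<Rightarrow> 'n clifford" and v :: "('v::real_normed_vector, 'n) cmodule"
  assumes \<theta>: "0 < \<theta>" "\<theta> < pi / 2" and e: "e \<in> intrinsic (double_sector \<theta>)" and g: "g \<in> intrinsic (double_sector \<theta>)"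
    and s: "s \<in> double_sector \<theta>"
  shows "e s \<odot> (g s \<odot> v) = g s \<odot> (e s \<odot> v)"
proof -
  obtain E where E: "slice_rep \<theta> e (scalar_family E)" using intrinsic_rep[OF \<theta> e] by blast
  obtain G where G: "slice_rep \<theta> g (scalar_family G)" using intrinsic_rep[OF \<theta> g] by blast
  obtain J z where J: "J \<in> imag_units" "z \<in> sector \<theta>" "s = slice_complex J z" using s unfolding double_sector_eq[OF \<theta>] by blast
  have "e s \<odot> g s = g s \<odot> e s"
    unfolding J(3) slice_rep_scalar[OF E J(2,1)] slice_rep_scalar[OF G J(2,1)] slice_complex_mult[OF J(1)] by (simp add: mult.commute)
  then show ?thesis by (simp add: cl_mult_assoc[symmetric])
qed

lemma N_bnd_intrinsic:
  assumes \<theta>: "0 < \<theta>" "\<theta> < pi / 2" and "e \<in> N_bnd \<theta>" shows "e \<in> intrinsic (double_sector \<theta>)"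
  using assms(3) scalar_rep_intrinsic[OF \<theta>] unfolding N_bnd_iff[OF \<theta>] by blast

lemma N_bnd_SH_bnd: "e \<in> N_bnd \<theta> \<Longrightarrow> e \<in> SH_bnd \<theta>"
  unfolding N_bnd_def SH_bnd_def N0_def by blast

lemma SH_bnd_cong:
  assumes \<theta>: "0 < \<theta>" "\<theta> < pi / 2" and "f \<in> SH_bnd \<theta>" "\<And>s. s \<in> double_sector \<theta> \<Longrightarrow> f s = g s"
  shows "g \<in> SH_bnd \<theta>"
  using assms(3,4) by (simp add: SH_bnd_def bnd_decomposition_def)

context sectorial_resolvent
begin

lemma \<Psi>_zero: "\<Psi> \<phi> 0 0 (\<lambda>z. 0) v = 0"
  by (simp add: \<Psi>_def \<Phi>_def zero_left zero_right)

lemma \<Psi>_sum: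
  assumes F: "decays (sector \<theta>) F" and \<phi>: "\<omega> < \<phi>" "\<phi> < \<theta>" "\<theta> < pi / 2"
  shows "\<Psi> \<phi> a b F (\<Sum>i\<in>I. u i) = (\<Sum>i\<in>I. \<Psi> \<phi> a b F (u i))"
proof (rule Modules.additive.sum)
  show "Modules.additive (\<Psi> \<phi> a b F)"
    unfolding Modules.additive_def \<Psi>_def P_linear(1) \<Phi>_linear(3)[OF F \<phi>] by (simp add: add_right)
qed

end

locale bisectorial_calculus = bisectorial_operator T \<omega>
  for T :: "('v::banach, 'n::{finite,linorder}) oper" and \<omega> :: real +
  fixes \<theta> :: real
  assumes \<omega>_less_\<theta>: "\<omega> < \<theta>" and \<theta>_less: "\<theta> < pi / 2"
begin

lemma \<theta>_bounds: "0 < \<theta>" "\<theta> < pi / 2"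
  using \<omega>_pos \<omega>_less_\<theta> \<theta>_less by auto

definition family_calculus :: "real \<Rightarrow> 'n clifford \<Rightarrow> 'n clifford \<Rightarrow> ('n set \<Rightarrow> complex \<Rightarrow> complex) \<Rightarrow> ('v, 'n) cmodule \<Rightarrow> ('v, 'n) cmodule" where
  "family_calculus \<phi> a b H v = (\<Sum>k\<in>UNIV. \<Psi> \<phi> (of_real (a $ k)) (of_real (b $ k)) (H k) (cl_basis k \<odot> v))"

text \<open>The selection of the contour involves \<omega> and \<theta> but not the function, so one
  contour serves all functions simultaneously.\<close>

lemma omega_calculus_eq_sector_integral:
  "\<exists>\<phi> J. \<omega> < \<phi> \<and> \<phi> < \<theta> \<and> J \<in> imag_units \<and> (\<forall>f. omega_calculus \<omega> \<theta> T f = (\<lambda>v. Some (blinfun_apply (sector_integral \<phi> J T f) v)))"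
proof -
  let ?P = "\<lambda>(\<phi>, J :: 'n clifford). \<phi> \<in> {\<omega><..<\<theta>} \<and> J \<in> imag_units"
  obtain \<phi> J where e: "(SOME x. ?P x) = (\<phi>, J)" by (rule prod.exhaust)
  have "?P ((\<omega> + \<theta>) / 2, basis_unit)" using \<omega>_less_\<theta> by simp
  then have "?P (SOME x. ?P x)" by (rule someI)
  then have "\<omega> < \<phi>" "\<phi> < \<theta>" "J \<in> imag_units" unfolding e by auto
  moreover have "omega_calculus \<omega> \<theta> T f = (\<lambda>v. Some (blinfun_apply (sector_integral \<phi> J T f) v))" for f
    unfolding omega_calculus_def e by simp
  ultimately show ?thesis by blast
qed

lemma bnd_calculus_eq_family_calculus:
  "\<exists>\<phi>. \<omega> < \<phi> \<and> \<phi> < \<theta> \<and> (\<forall>f a b H v. slice_rep \<theta> f (\<lambda>k. bnd_fun (a $ k) (b $ k) (H k)) \<longrightarrow> (\<forall>k. decays (sector \<theta>) (H k)) \<longrightarrow>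
     bnd_calculus \<omega> \<theta> T f v = Some (family_calculus \<phi> a b H v))"
proof -
  obtain \<phi> J where \<phi>: "\<omega> < \<phi>" "\<phi> < \<theta>" and J: "J \<in> imag_units"
    and om: "\<And>f. omega_calculus \<omega> \<theta> T f = (\<lambda>v. Some (blinfun_apply (sector_integral \<phi> J T f) v))"
    using omega_calculus_eq_sector_integral by blast
  have "bnd_calculus \<omega> \<theta> T f v = Some (family_calculus \<phi> a b H v)"
    if f: "slice_rep \<theta> f (\<lambda>k. bnd_fun (a $ k) (b $ k) (H k))" and H: "\<And>k. decays (sector \<theta>) (H k)" for f a b H v
  proof -
    let ?P = "\<lambda>(f\<^sub>0, f_inf, h). h \<in> SH0 \<theta> \<and> bnd_decomposition \<theta> f f\<^sub>0 f_inf h"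
    obtain b' a' h' where e: "(SOME x. ?P x) = (b', a', h')" by (rule prod_cases3)
    obtain h where h: "slice_rep \<theta> h H" "bnd_decomposition \<theta> f b a h" using bnd_rep_decomposition[OF \<theta>_bounds f] by blast
    then have "?P (b, a, h)" using SH0_iff_decays[OF \<theta>_bounds h(1)] H by simp
    then have "?P (SOME x. ?P x)" by (rule someI)
    then have h': "h' \<in> SH0 \<theta>" "bnd_decomposition \<theta> f b' a' h'" unfolding e by auto
    obtain H' where H': "slice_rep \<theta> h' H'" "\<And>k. decays (sector \<theta>) (H' k)" using SH0_rep[OF \<theta>_bounds h'(1)] by blast
    have f': "slice_rep \<theta> f (\<lambda>k. bnd_fun (a' $ k) (b' $ k) (H' k))"
      by (rule slice_rep_cong[OF \<theta>_bounds slice_rep_bnd[OF \<theta>_bounds H'(1)]]) (use h'(2) in \<open>auto simp: bnd_decomposition_def\<close>)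
    note u = bnd_fun_unique[OF \<theta>_bounds f H f' H'(2)]
    have i: "op_inverse (op_of (cl_of_real 1) \<oplus> (T \<circ>\<^sub>m T)) = (\<lambda>v. Some (P v))"
      by (rule ext) (rule op_inverse_1_plus_square)
    have "bnd_calculus \<omega> \<theta> T f v = Some (a' \<odot> v + P ((b' - a') \<odot> v) + blinfun_apply (sector_integral \<phi> J T h') v)"
      unfolding bnd_calculus_def e Let_def prod.case i om
      unfolding op_add_def op_of_def by (simp add: dom_def map_comp_def)
    also have "a' \<odot> v + P ((b' - a') \<odot> v) + blinfun_apply (sector_integral \<phi> J T h') v = family_calculus \<phi> a' b' H' v"
    proof -
      have Ps: "P (r *\<^sub>R x) = r *\<^sub>R P x" for r x using P_linear(2)[of "of_real r" x] by simp
      have "Modules.additive P" by (simp add: Modules.additive_def P_linear(1))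
      \<comment> \<open>\<open>P\<close> does not commute with left multiplication; only the real
        coefficients of \<open>b' - a'\<close> pass through it.\<close>
      then have "P ((b' - a') \<odot> v) = (\<Sum>k\<in>UNIV. (b' $ k - a' $ k) *\<^sub>R P (cl_basis k \<odot> v))"
        unfolding cl_mult_expand[of "b' - a'"] by (simp add: Modules.additive.sum Ps)
      moreover have "\<Psi> \<phi> (of_real x) (of_real y) F w = x *\<^sub>R w + (y - x) *\<^sub>R P w + \<Phi> \<phi> F w" for x y F w
        unfolding \<Psi>_def of_real_diff[symmetric] cmult.cs_of_real ..
      ultimately show ?thesis
        unfolding family_calculus_def sector_integral_eq[OF \<phi> \<theta>_bounds(2) J H'] cl_mult_expand[of a']
        by (simp add: sum.distrib)
    qed
    also have "\<dots> = family_calculus \<phi> a b H v"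
      unfolding family_calculus_def \<Psi>_def u(1,2)
      by (intro sum.cong refl arg_cong2[of _ _ _ _ "(+)"] \<Phi>_cong[OF \<phi> \<theta>_bounds(2)]) (simp add: u(3))
    finally show ?thesis .
  qed
  then show ?thesis using \<phi> by blast
qed

definition calc :: "('n clifford \<Rightarrow> 'n clifford) \<Rightarrow> ('v, 'n) cmodule \<Rightarrow> ('v, 'n) cmodule" where
  "calc f v = the (bnd_calculus \<omega> \<theta> T f v)"

lemma bnd_calculus_eq_Some:
  assumes "f \<in> SH_bnd \<theta>" shows "bnd_calculus \<omega> \<theta> T f v = Some (calc f v)"
  using assms bnd_calculus_eq_family_calculus unfolding SH_bnd_iff[OF \<theta>_bounds] calc_def by fastforce

lemma calc_cong:
  assumes f: "f \<in> SH_bnd \<theta>" and fg: "\<And>s. s \<in> double_sector \<theta> \<Longrightarrow> f s = g s"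
  shows "calc f v = calc g v"
proof -
  have "bnd_decomposition \<theta> f = bnd_decomposition \<theta> g" using fg by (auto simp: fun_eq_iff bnd_decomposition_def)
  then show ?thesis by (simp add: calc_def bnd_calculus_def)
qed

lemma family_calculus_scalar:
  "family_calculus \<phi> (cl_of_real \<alpha>) (cl_of_real \<beta>) (scalar_family E) v = \<Psi> \<phi> (of_real \<alpha>) (of_real \<beta>) E v"
proof -
  have b: "cl_basis {} \<odot> v = v" using cl_mult_one[of 1 v] by (simp add: cl_of_real_def)
  have "\<Psi> \<phi> (of_real (cl_of_real \<alpha> $ k)) (of_real (cl_of_real \<beta> $ k)) (scalar_family E k) (cl_basis k \<odot> v)
      = (if k = {} then \<Psi> \<phi> (of_real \<alpha>) (of_real \<beta>) E v else 0)" for k :: "'n set"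
    by (simp add: cl_of_real_nth scalar_family_def[abs_def] \<Psi>_zero b)
  then show ?thesis by (simp add: family_calculus_def)
qed

text \<open>By \<open>slice_rep_mult\<close> the product is taken coefficient by coefficient with
  one scalar factor. So \<open>\<Psi>_product\<close> applies to each coefficient, and the
  additivity of e(T) collects the terms.\<close>

lemma calc_mult:
  assumes e: "e \<in> N_bnd \<theta>" and f: "f \<in> SH_bnd \<theta>"
  shows "(\<lambda>s. e s \<odot> f s) \<in> SH_bnd \<theta>" and "calc (\<lambda>s. e s \<odot> f s) v = calc e (calc f v)"
proof -
  obtain \<phi> where \<phi>: "\<omega> < \<phi>" "\<phi> < \<theta>"
    and c: "\<And>f a b H v. slice_rep \<theta> f (\<lambda>k. bnd_fun (a $ k) (b $ k) (H k)) \<Longrightarrow> (\<And>k. decays (sector \<theta>) (H k)) \<Longrightarrow>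
     calc f v = family_calculus \<phi> a b H v"
    using bnd_calculus_eq_family_calculus unfolding calc_def by force
  note p = \<phi> \<theta>_bounds(2)
  obtain \<alpha> \<beta> E where e: "slice_rep \<theta> e (scalar_family (bnd_fun \<alpha> \<beta> E))" and E: "decays (sector \<theta>) E"
    using e N_bnd_iff[OF \<theta>_bounds] by blast
  obtain a b H where f: "slice_rep \<theta> f (\<lambda>k. bnd_fun (a $ k) (b $ k) (H k))" and H: "\<And>k. decays (sector \<theta>) (H k)"
    using f SH_bnd_iff[OF \<theta>_bounds] by blast
  define K where "K k = \<Psi>_rest (of_real \<alpha>) (of_real \<beta>) E (of_real (a $ k)) (of_real (b $ k)) (H k)" for k
  have K: "decays (sector \<theta>) (K k)" for k unfolding K_def by (rule \<Psi>_product(2)[OF E H p])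
  have ef: "slice_rep \<theta> (\<lambda>s. e s \<odot> f s) (\<lambda>k. bnd_fun ((\<alpha> *\<^sub>R a) $ k) ((\<beta> *\<^sub>R b) $ k) (K k))"
    by (rule slice_rep_cong[OF \<theta>_bounds slice_rep_mult[OF e f] refl]) (simp add: bnd_fun_mult[OF \<theta>_bounds] K_def)
  then show "(\<lambda>s. e s \<odot> f s) \<in> SH_bnd \<theta>" using K SH_bnd_iff[OF \<theta>_bounds] by blast
  have ce: "calc e u = \<Psi> \<phi> (of_real \<alpha>) (of_real \<beta>) E u" for u
    using c[OF e[unfolded scalar_family_bnd_fun] decays_scalar_family[OF E]] by (simp add: family_calculus_scalar)
  show "calc (\<lambda>s. e s \<odot> f s) v = calc e (calc f v)"
    unfolding ce c[OF f H] c[OF ef K] family_calculus_def \<Psi>_sum[OF E p] \<Psi>_product(1)[OF E H p] by (simp add: K_def)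
qed

lemma N_bnd_mult:
  assumes "e \<in> N_bnd \<theta>" "e' \<in> N_bnd \<theta>" shows "(\<lambda>s. e s \<odot> e' s) \<in> N_bnd \<theta>"
proof -
  obtain \<alpha> \<beta> E where e: "slice_rep \<theta> e (scalar_family (bnd_fun \<alpha> \<beta> E))" and E: "decays (sector \<theta>) E"
    using assms(1) N_bnd_iff[OF \<theta>_bounds] by blast
  obtain a b H where e': "slice_rep \<theta> e' (scalar_family (bnd_fun a b H))" and H: "decays (sector \<theta>) H"
    using assms(2) N_bnd_iff[OF \<theta>_bounds] by blast
  define K where "K = \<Psi>_rest (of_real \<alpha>) (of_real \<beta>) E (of_real a) (of_real b) H"
  have "\<omega> < (\<omega> + \<theta>) / 2" "(\<omega> + \<theta>) / 2 < \<theta>" using \<omega>_less_\<theta> by auto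
  then have "decays (sector \<theta>) K" unfolding K_def by (rule \<Psi>_product(2)[OF E H _ _ \<theta>_bounds(2)])
  moreover have "slice_rep \<theta> (\<lambda>s. e s \<odot> e' s) (scalar_family (bnd_fun (\<alpha> * a) (\<beta> * b) K))"
    by (rule slice_rep_cong[OF \<theta>_bounds slice_rep_mult[OF e e'] refl]) (simp add: bnd_fun_mult[OF \<theta>_bounds] K_def scalar_family_def)
  ultimately show ?thesis using N_bnd_iff[OF \<theta>_bounds] by blast
qed

lemma op_injective_iff:
  assumes "e \<in> SH_bnd \<theta>" shows "op_injective (bnd_calculus \<omega> \<theta> T e) \<longleftrightarrow> inj (calc e)"
proof -
  have "bnd_calculus \<omega> \<theta> T e = (\<lambda>v. Some (calc e v))" by (rule ext) (rule bnd_calculus_eq_Some[OF assms])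
  then show ?thesis by (auto simp: op_injective_def inj_on_def dom_def)
qed

lemma regularizerD:
  assumes "regularizer \<omega> \<theta> T e f"
  shows "e \<in> N_bnd \<theta>" "(\<lambda>s. e s \<odot> f s) \<in> SH_bnd \<theta>" "inj (calc e)"
  using assms op_injective_iff[OF N_bnd_SH_bnd] by (auto simp: regularizer_def)

lemma calc_commute:
  assumes "e \<in> N_bnd \<theta>" "e' \<in> N_bnd \<theta>"
  shows "calc e (calc e' v) = calc e' (calc e v)"
proof -
  note I = N_bnd_intrinsic[OF \<theta>_bounds assms(1)] N_bnd_intrinsic[OF \<theta>_bounds assms(2)]
  have one: "x \<odot> cl_basis {} = x" for x :: "'n clifford" using cl_rmult_one[of x 1] by (simp add: cl_rmult_eq_cl_mult cl_of_real_def)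
  have "e s \<odot> e' s = e' s \<odot> e s" if "s \<in> double_sector \<theta>" for s
    using intrinsic_left_commute[OF \<theta>_bounds I that, of "cl_basis {} :: 'n clifford"] by (simp only: one)
  then have "calc (\<lambda>s. e s \<odot> e' s) v = calc (\<lambda>s. e' s \<odot> e s) v"
    by (rule calc_cong[OF calc_mult(1)[OF assms(1) N_bnd_SH_bnd[OF assms(2)]]])
  then show ?thesis
    unfolding calc_mult(2)[OF assms(1) N_bnd_SH_bnd[OF assms(2)]] calc_mult(2)[OF assms(2) N_bnd_SH_bnd[OF assms(1)]] .
qed

text \<open>Both e(T)(e'f)(T) and e'(T)(ef)(T) are the operator of e e' f. Hence the relation for
  \<open>e\<close> turns into that for \<open>e'\<close> multiplied by e(T), which is cancelled by
  injectivity.\<close>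

lemma regularizer_independence:
  assumes e: "regularizer \<omega> \<theta> T e f" and e': "regularizer \<omega> \<theta> T e' f"
    and w: "calc (\<lambda>s. e s \<odot> f s) v = calc e w"
  shows "calc (\<lambda>s. e' s \<odot> f s) v = calc e' w"
proof -
  note r = regularizerD[OF e] and r' = regularizerD[OF e']
  have "calc e (calc (\<lambda>s. e' s \<odot> f s) v) = calc (\<lambda>s. e s \<odot> (e' s \<odot> f s)) v" by (rule calc_mult(2)[OF r(1) r'(2), symmetric])
  also have "\<dots> = calc (\<lambda>s. e' s \<odot> (e s \<odot> f s)) v"
    by (rule calc_cong[OF calc_mult(1)[OF r(1) r'(2)]])
      (rule intrinsic_left_commute[OF \<theta>_bounds N_bnd_intrinsic[OF \<theta>_bounds r(1)] N_bnd_intrinsic[OF \<theta>_bounds r'(1)]])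
  also have "\<dots> = calc e (calc e' w)" unfolding calc_mult(2)[OF r'(1) r(2)] w by (rule calc_commute[OF r'(1) r(1)])
  finally show ?thesis using r(3) by (simp add: inj_eq)
qed

text \<open>Membership in the graph of f(T) may be tested with any regularizer, whichever one the
  definition selects.\<close>

lemma H_calculus_eq_Some:
  assumes e: "regularizer \<omega> \<theta> T e f"
  shows "H_calculus \<omega> \<theta> T f v = Some w \<longleftrightarrow> calc (\<lambda>s. e s \<odot> f s) v = calc e w"
proof -
  define e' where "e' = (SOME e. regularizer \<omega> \<theta> T e f)"
  have e': "regularizer \<omega> \<theta> T e' f" unfolding e'_def by (rule someI[where P = "\<lambda>e. regularizer \<omega> \<theta> T e f", OF e])
  note r = regularizerD[OF e']
  have "H_calculus \<omega> \<theta> T f v = op_inverse (bnd_calculus \<omega> \<theta> T e') (calc (\<lambda>s. e' s \<odot> f s) v)"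
    unfolding H_calculus_def Let_def e'_def[symmetric] by (simp add: map_comp_def bnd_calculus_eq_Some[OF r(2)])
  moreover have "op_injective (bnd_calculus \<omega> \<theta> T e')" using e' by (simp add: regularizer_def)
  ultimately have "H_calculus \<omega> \<theta> T f v = Some w \<longleftrightarrow> calc e' w = calc (\<lambda>s. e' s \<odot> f s) v"
    by (simp add: op_inverse_eq_Some_iff bnd_calculus_eq_Some[OF N_bnd_SH_bnd[OF r(1)]])
  then show ?thesis using regularizer_independence[OF e e', of v w] regularizer_independence[OF e' e, of v w] by (auto dest: sym)
qed

text \<open>As an equality of options this contains both claims: on the domain of f(T), (gf)(T) is
  defined exactly where g(T)f(T) is, with the same value.\<close>

lemma H_calculus_product:
  assumes g: "g \<in> N_reg \<omega> \<theta> T" and f: "f \<in> SH_reg \<omega> \<theta> T" and w: "H_calculus \<omega> \<theta> T f v = Some w"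
  shows "H_calculus \<omega> \<theta> T (\<lambda>s. g s \<odot> f s) v = H_calculus \<omega> \<theta> T g w"
proof -
  obtain d where d: "d \<in> N_bnd \<theta>" "(\<lambda>s. d s \<odot> g s) \<in> N_bnd \<theta>" "op_injective (bnd_calculus \<omega> \<theta> T d)"
    and gi: "g \<in> intrinsic (double_sector \<theta>)"
    using g unfolding N_reg_def by blast
  then have rd: "regularizer \<omega> \<theta> T d g" using N_bnd_SH_bnd by (auto simp: regularizer_def)
  obtain e where re: "regularizer \<omega> \<theta> T e f" using f unfolding SH_reg_def by blast
  note D = regularizerD[OF rd] and E = regularizerD[OF re]
  \<comment> \<open>Only the intrinsic values of \<open>g\<close> and \<open>e\<close> change
    places; \<open>f\<close> is arbitrary and stays on the right.\<close>
  have eq: "d s \<odot> g s \<odot> (e s \<odot> f s) = d s \<odot> e s \<odot> (g s \<odot> f s)" if "s \<in> double_sector \<theta>" for s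
    unfolding cl_mult_assoc intrinsic_left_commute[OF \<theta>_bounds N_bnd_intrinsic[OF \<theta>_bounds E(1)] gi that] ..
  note m = calc_mult[OF d(2) E(2)] and de = calc_mult(2)[OF d(1) N_bnd_SH_bnd[OF E(1)]]
  have "calc (\<lambda>s. d s \<odot> e s) = calc d \<circ> calc e" by (rule ext) (simp only: de o_apply)
  then have "inj (calc (\<lambda>s. d s \<odot> e s))" using inj_compose[OF D(3) E(3)] by simp
  then have r: "regularizer \<omega> \<theta> T (\<lambda>s. d s \<odot> e s) (\<lambda>s. g s \<odot> f s)"
    unfolding regularizer_def using N_bnd_mult[OF d(1) E(1)] SH_bnd_cong[OF \<theta>_bounds m(1) eq] op_injective_iff[OF N_bnd_SH_bnd]
    by blast
  have cc: "calc (\<lambda>s. d s \<odot> e s \<odot> (g s \<odot> f s)) v = calc (\<lambda>s. d s \<odot> g s \<odot> (e s \<odot> f s)) v"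
    by (rule sym, rule calc_cong[OF m(1)]) (rule eq)
  have fw: "calc (\<lambda>s. e s \<odot> f s) v = calc e w" using w unfolding H_calculus_eq_Some[OF re] .
  have "H_calculus \<omega> \<theta> T (\<lambda>s. g s \<odot> f s) v = Some y \<longleftrightarrow> H_calculus \<omega> \<theta> T g w = Some y" for y
  proof -
    have "H_calculus \<omega> \<theta> T (\<lambda>s. g s \<odot> f s) v = Some y \<longleftrightarrow> calc (\<lambda>s. d s \<odot> g s) (calc e w) = calc d (calc e y)"
      unfolding H_calculus_eq_Some[OF r] cc m(2) fw de ..
    also have "\<dots> \<longleftrightarrow> calc e (calc (\<lambda>s. d s \<odot> g s) w) = calc e (calc d y)"
      unfolding calc_commute[OF d(2) E(1)] calc_commute[OF d(1) E(1)] ..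
    also have "\<dots> \<longleftrightarrow> H_calculus \<omega> \<theta> T g w = Some y"
      unfolding H_calculus_eq_Some[OF rd] using E(3) by (simp add: inj_eq)
    finally show ?thesis .
  qed
  then show ?thesis by (cases "H_calculus \<omega> \<theta> T g w") (metis not_Some_eq)+
qed

end

theorem theorem5p7:
  fixes T :: "('v::banach, 'n::{finite,linorder}) oper"
    and f g :: "'n clifford \<Rightarrow> 'n clifford"
    and \<omega> \<theta> :: real
  assumes "0 < \<omega>" and "\<omega> < pi / 2"
    and "bisectorial \<omega> T"
    and "\<omega> < \<theta>" and "\<theta> < pi / 2"
    and "g \<in> N_reg \<omega> \<theta> T"
    and "f \<in> SH_reg \<omega> \<theta> T"
  shows "H_calculus \<omega> \<theta> T g \<circ>\<^sub>m H_calculus \<omega> \<theta> T f \<subseteq>\<^sub>m H_calculus \<omega> \<theta> T (\<lambda>s. g s \<odot> f s) \<and>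
    dom (H_calculus \<omega> \<theta> T g \<circ>\<^sub>m H_calculus \<omega> \<theta> T f)
      = dom (H_calculus \<omega> \<theta> T (\<lambda>s. g s \<odot> f s)) \<inter> dom (H_calculus \<omega> \<theta> T f)"
proof -
  interpret bisectorial_calculus T \<omega> \<theta> by standard fact+
  note product = H_calculus_product[OF assms(6,7)]
  show ?thesis
  proof (intro conjI)
    show "H_calculus \<omega> \<theta> T g \<circ>\<^sub>m H_calculus \<omega> \<theta> T f \<subseteq>\<^sub>m H_calculus \<omega> \<theta> T (\<lambda>s. g s \<odot> f s)"
      unfolding map_le_def
    proof
      fix v assume "v \<in> dom (H_calculus \<omega> \<theta> T g \<circ>\<^sub>m H_calculus \<omega> \<theta> T f)"
      then obtain w where "H_calculus \<omega> \<theta> T f v = Some w" by (auto simp: map_comp_Some_iff)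
      from product[OF this] this show "(H_calculus \<omega> \<theta> T g \<circ>\<^sub>m H_calculus \<omega> \<theta> T f) v = H_calculus \<omega> \<theta> T (\<lambda>s. g s \<odot> f s) v"
        by (simp add: map_comp_def)
    qed
    show "dom (H_calculus \<omega> \<theta> T g \<circ>\<^sub>m H_calculus \<omega> \<theta> T f)
      = dom (H_calculus \<omega> \<theta> T (\<lambda>s. g s \<odot> f s)) \<inter> dom (H_calculus \<omega> \<theta> T f)" (is "?L = ?R")
    proof (rule set_eqI)
      fix v show "v \<in> ?L \<longleftrightarrow> v \<in> ?R"
        using product[of v] by (cases "H_calculus \<omega> \<theta> T f v") (simp_all add: map_comp_def dom_def)
    qed
  qed
qed

end
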